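(* Let $V$ be a finite-dimensional Euclidean space, let $G\subset \mathrm{O}(V)$ be a compact Lie subgroup acting tautologically on $V$, and let $\mathfrak{g}$ be its Lie algebra. Let $n_1\geqslant n_2\geqslant\dots\geqslant n_L$ be the dimensions of the irreducible components of the real representation of $\mathfrak{g}$ in $V$, counted with multiplicities, and put $q(V):=\sum_{i=1}^{L}\left[\frac{n_i}{2}\right]$, where $[x]$ denotes the integral part of $x$. If $\mathfrak{g}\cong\mathfrak{su}_2$ and the topological quotient space $V/G$ is a homological manifold, then $q(V)\leqslant 4$.
   Context: The group $G$ is not assumed connected; the condition $\mathfrak{g}\cong\mathfrak{su}_2$ is equivalent to the identity component $G^0$ being isomorphic to $\mathrm{SU}_2$ or $\mathrm{SO}_3$. The irreducible components of $V$ are real irreducible subrepresentations of $\mathfrak{g}$ in a direct sum decomposition of $V$. The space $V/G$ is the orbit space with the quotient topology. A homological $n$-manifold is meant in the standard sense without boundary: a (Hausdorff) topological space $X$ such that for every $x\in X$ the local homology $H_i(X,X\setminus\{x\};\mathbb{Z})$ is isomorphic to $\mathbb{Z}$ for $i=n$ and is zero for $i\ne n$; a homological manifold is a homological $n$-manifold for some $n$. *)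

theory Defs
  imports "HOL-Analysis.Analysis" "HOL-Homology.Homology"
begin

text \<open>
  Linear operators on a Euclidean space are elements of the normed space of bounded linear
  functions, so that topological notions refer to the operator norm. A compact Lie subgroup of
  the orthogonal group is the same as a compact subgroup: by Cartan's theorem a closed subgroup
  is a Lie subgroup.
\<close>

definition orthogonal_group :: "('v::euclidean_space \<Rightarrow>\<^sub>L 'v) monoid" where
  "orthogonal_group =
     \<lparr>carrier = {g. orthogonal_transformation (blinfun_apply g)},
      mult = (\<lambda>g h. g o\<^sub>L h),
      one = id_blinfun\<rparr>"

lemma group_orthogonal_group: "group (orthogonal_group :: ('v::euclidean_space \<Rightarrow>\<^sub>L 'v) monoid)"
proof (rule groupI)
  fix g :: "'v \<Rightarrow>\<^sub>L 'v" assume "g \<in> carrier orthogonal_group"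
  then have g: "orthogonal_transformation (blinfun_apply g)"
    by (simp add: orthogonal_group_def)
  define h where "h = Blinfun (inv_into UNIV (blinfun_apply g))"
  have inv: "orthogonal_transformation (inv_into UNIV (blinfun_apply g))"
    using g by (rule orthogonal_transformation_inv)
  then have h: "blinfun_apply h = inv_into UNIV (blinfun_apply g)"
    unfolding h_def
    by (intro bounded_linear_Blinfun_apply linear_conv_bounded_linear[THEN iffD1]
        orthogonal_transformation_linear)
  have "h o\<^sub>L g = id_blinfun"
    using g by (intro blinfun_eqI) (simp add: h orthogonal_transformation_inj)
  then show "\<exists>h\<in>carrier orthogonal_group. h \<otimes>\<^bsub>orthogonal_group\<^esub> g = \<one>\<^bsub>orthogonal_group\<^esub>"
    using h inv by (intro bexI[of _ h]) (simp_all add: orthogonal_group_def)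
qed (auto simp: orthogonal_group_def orthogonal_transformation_def blinfun.bounded_linear_right
    bounded_linear.linear intro!: blinfun_eqI)

definition op_exp :: "('v::euclidean_space \<Rightarrow>\<^sub>L 'v) \<Rightarrow> ('v \<Rightarrow>\<^sub>L 'v)" where
  "op_exp X = suminf (\<lambda>n. (((\<lambda>Y. X o\<^sub>L Y) ^^ n) id_blinfun) /\<^sub>R fact n)"

definition lie_algebra :: "('v::euclidean_space \<Rightarrow>\<^sub>L 'v) set \<Rightarrow> ('v \<Rightarrow>\<^sub>L 'v) set" where
  "lie_algebra G = {X. \<forall>t::real. op_exp (t *\<^sub>R X) \<in> G}"

definition op_bracket :: "('v::euclidean_space \<Rightarrow>\<^sub>L 'v) \<Rightarrow> ('v \<Rightarrow>\<^sub>L 'v) \<Rightarrow> ('v \<Rightarrow>\<^sub>L 'v)" where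
  "op_bracket X Y = (X o\<^sub>L Y) - (Y o\<^sub>L X)"

definition mat_bracket :: "complex ^ 2 ^ 2 \<Rightarrow> complex ^ 2 ^ 2 \<Rightarrow> complex ^ 2 ^ 2" where
  "mat_bracket A B = A ** B - B ** A"

definition su2 :: "(complex ^ 2 ^ 2) set" where
  "su2 = {A. (\<forall>i j. cnj (A $ j $ i) = - (A $ i $ j)) \<and> trace A = 0}"

text \<open>Isomorphism of real Lie algebras, each given by a carrier and a bracket.\<close>

definition lie_isomorphic ::
  "'a::real_vector set \<Rightarrow> ('a \<Rightarrow> 'a \<Rightarrow> 'a) \<Rightarrow> 'b::real_vector set \<Rightarrow> ('b \<Rightarrow> 'b \<Rightarrow> 'b) \<Rightarrow> bool" where
  "lie_isomorphic A brA B brB \<longleftrightarrow>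
     (\<exists>f. bij_betw f A B \<and>
          (\<forall>x\<in>A. \<forall>y\<in>A. f (x + y) = f x + f y) \<and>
          (\<forall>c. \<forall>x\<in>A. f (c *\<^sub>R x) = c *\<^sub>R f x) \<and>
          (\<forall>x\<in>A. \<forall>y\<in>A. f (brA x y) = brB (f x) (f y)))"

definition invariant_subspace :: "('v::euclidean_space \<Rightarrow>\<^sub>L 'v) set \<Rightarrow> 'v set \<Rightarrow> bool" where
  "invariant_subspace A W \<longleftrightarrow> subspace W \<and> (\<forall>X\<in>A. \<forall>w\<in>W. blinfun_apply X w \<in> W)"

definition irreducible_subrep :: "('v::euclidean_space \<Rightarrow>\<^sub>L 'v) set \<Rightarrow> 'v set \<Rightarrow> bool" where
  "irreducible_subrep A W \<longleftrightarrow>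
     invariant_subspace A W \<and> W \<noteq> {0} \<and>
     (\<forall>U. invariant_subspace A U \<longrightarrow> U \<subseteq> W \<longrightarrow> U = {0} \<or> U = W)"

definition is_direct_sum :: "nat \<Rightarrow> (nat \<Rightarrow> 'v::euclidean_space set) \<Rightarrow> bool" where
  "is_direct_sum L W \<longleftrightarrow>
     (\<forall>i<L. subspace (W i)) \<and>
     bij_betw (\<lambda>u. \<Sum>i<L. u i) (\<Pi>\<^sub>E i\<in>{..<L}. W i) UNIV"

text \<open>
  The list is determined by the operators, because the decomposition into irreducibles is unique
  up to isomorphism and order.
\<close>

definition irreducible_component_dims ::
  "('v::euclidean_space \<Rightarrow>\<^sub>L 'v) set \<Rightarrow> nat list \<Rightarrow> bool" where
  "irreducible_component_dims A ns \<longleftrightarrow>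
     sorted_wrt (\<ge>) ns \<and>
     (\<exists>W. is_direct_sum (length ns) W \<and>
          (\<forall>i<length ns. irreducible_subrep A (W i) \<and> dim (W i) = ns ! i))"

definition orbit_of :: "('v::euclidean_space \<Rightarrow>\<^sub>L 'v) set \<Rightarrow> 'v \<Rightarrow> 'v set" where
  "orbit_of G v = (\<lambda>g. blinfun_apply g v) ` G"

definition orbit_space :: "('v::euclidean_space \<Rightarrow>\<^sub>L 'v) set \<Rightarrow> 'v set topology" where
  "orbit_space G = topology (\<lambda>U. U \<subseteq> range (orbit_of G) \<and> open (orbit_of G -` U))"

lemma openin_orbit_space:
  "openin (orbit_space G) U \<longleftrightarrow> U \<subseteq> range (orbit_of G) \<and> open (orbit_of G -` U)"
proof -
  have "istopology (\<lambda>U. U \<subseteq> range (orbit_of G) \<and> open (orbit_of G -` U))"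
    unfolding istopology_def by (auto simp: vimage_Union)
  then show ?thesis
    by (simp add: orbit_space_def topology_inverse')
qed

lemma topspace_orbit_space: "topspace (orbit_space G) = range (orbit_of G)"
proof
  show "topspace (orbit_space G) \<subseteq> range (orbit_of G)"
    using openin_orbit_space openin_topspace by blast
  have "openin (orbit_space G) (range (orbit_of G))"
    by (simp add: openin_orbit_space vimage_def)
  then show "range (orbit_of G) \<subseteq> topspace (orbit_space G)"
    by (rule openin_subset)
qed

lemma quotient_map_orbit_space: "quotient_map euclidean (orbit_space G) (orbit_of G)"
  by (simp add: quotient_map_def topspace_orbit_space openin_orbit_space vimage_def)

definition homological_n_manifold :: "nat \<Rightarrow> 'a topology \<Rightarrow> bool" where
  "homological_n_manifold n X \<longleftrightarrow>
     Hausdorff_space X \<and>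
     (\<forall>x\<in>topspace X. \<forall>i::int.
        if i = int n then relative_homology_group i X (topspace X - {x}) \<cong> integer_group
        else trivial_group (relative_homology_group i X (topspace X - {x})))"

definition homological_manifold :: "'a topology \<Rightarrow> bool" where
  "homological_manifold X \<longleftrightarrow> (\<exists>n. homological_n_manifold n X)"

text \<open>For natural numbers, \<open>div\<close> rounds down, so this is the sum of the integral parts.\<close>

definition q_of_dims :: "nat list \<Rightarrow> nat" where
  "q_of_dims ns = (\<Sum>n\<leftarrow>ns. n div 2)"

end

(*
  Suppose q(V) >= 5. Identify the Lie algebra with R^3 and its cross product, and let E3 be the
  third coordinate vector. In an irreducible component of dimension n the kernel of E3 has
  dimension n mod 2, so U = ker E3 satisfies dim U + 10 <= dim V. The singular set S of points
  killed by some nonzero element of the Lie algebra is G U, and V0 = V - S is open.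

  Near a point of V0 with minimal stabilizer the orbit space X = V/G is a ball of dimension
  dim V - 3, so the homology dimension of X is n = dim V - 3. Two points of U lie in one orbit only
  if a finite group maps one to the other. Hence S/G carries dim U continuous functions with finite
  joint fibres, and X - S/G has the homology of X in degrees below n - dim U - 1, in particular in
  degree 4; this is a bisection argument using relative Mayer-Vietoris. As X is contractible,
  H_4(V0/G) = 0.

  On the other hand the unit quaternions act on V0 with finite stabilizers, and V0/G is a further
  quotient by a finite group. An orbit map from the 3-sphere to V0 is null-homotopic in V0, because
  a cone over the orbit with a generic vertex misses S. The null-homotopy projects to a 4-cycle of
  V0/G. A bounding 5-chain of it would lift, after multiplication by an integer, to chains of V0
  up to an obstruction cochain measured by degrees of 3-cycles over orbits, and that cochain takes
  a nonzero value on the 4-cycle. So H_4(V0/G) is nonzero.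
*)

theory Submission
  imports Defs "HOL-Analysis.Analysis" "HOL-Homology.Homology"
begin

section \<open>Relative homology of the complement of a closed set\<close>

text \<open>What produces the contradiction in degree 4 is the rational Euler class of V0 -> V0/G,
  whose fibres are finite unions of finite quotients of the 3-sphere. Stabilizers vary from orbit to
  orbit and G may be disconnected, so this map need not be a bundle. It is handled on chains:
  simplices of the quotient are lifted to chains that stay near the orbits they meet. Multiplying by
  integers plays the part of rational coefficients, averaging over a finite group Z that of taking
  invariants, and compact supports make the integers and the radii uniform. Z exists because all
  automorphisms of the Lie algebra are inner: every element of G is the image of a unit quaternion
  times an element of the centralizer of the Lie algebra, which is finite. As for the numbers, dim U
  + 10 <= dim V gives S/G codimension at least 7 in X, while the passage from X to X - S/G needs
  acyclicity of the pair in degree 5. A cone over an orbit meets S only if its vertex is a value of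
  a map of dim U + 7 real parameters: 3 for the rotation moving a singular point into U, 3 for the
  point of the orbit, 1 for the position on the segment.\<close>

definition rel_acyclic :: "nat => 'a topology => 'a set => bool" where
  "rel_acyclic i X S \<longleftrightarrow> (\<forall>c. singular_relcycle i X S c --> singular_relboundary i X S c)"

lemma rel_acyclicI:
  assumes "trivial_group (relative_homology_group (int i) X S)"
  shows "rel_acyclic i X S"
  unfolding rel_acyclic_def
proof (intro allI impI)
  fix c assume c: "singular_relcycle i X S c"
  have "homologous_rel_set i X S c \<in> carrier (relative_homology_group (int i) X S)"
    using c by (auto simp: carrier_relative_homology_group)
  also have "\<dots> = {singular_relboundary_set i X S}"
    using assms by (simp add: trivial_group_def)
  finally show "singular_relboundary i X S c"
    by (simp add: homologous_rel_set_eq_relboundary)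
qed

lemma singular_relcycle_superset:
  assumes "singular_relcycle i X S c" "S \<subseteq> T"
  shows "singular_relcycle i X T c"
  using assms by (auto simp: singular_relcycle intro: singular_chain_mono)

text \<open>The case of nothing removed. It starts the induction over finite sets and supplies the
  hypothesis of \<open>relative_Mayer_Vietoris\<close> when the two open sets cover the
  space.\<close>

lemma rel_acyclic_topspace: "rel_acyclic i X (topspace X)"
  by (auto simp: rel_acyclic_def singular_relcycle intro!: singular_chain_imp_relboundary)

text \<open>A sufficiently fine subdivision refines the cover by \<open>U\<close> and
  \<open>V\<close>, and its simplices are then sorted into the two sets.\<close>

lemma subdivide_into_two:
  assumes U: "openin X U" and V: "openin X V"
    and c: "singular_chain p (subtopology X (U \<union> V)) c"
  obtains n d e where "singular_chain p (subtopology X U) d" "singular_chain p (subtopology X V) e"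
    "(singular_subdivision p ^^ n) c = d + e"
proof -
  let ?Y = "subtopology X (U \<union> V)"
  obtain n where n: "\<And>m f. [|n \<le> m; f \<in> Poly_Mapping.keys ((singular_subdivision p ^^ m) c)|]
                      ==> \<exists>W \<in> {U, V}. f \<in> standard_simplex p \<rightarrow> W"
  proof (rule sufficient_iterated_singular_subdivision_exists [of "{U,V}" ?Y])
    show "openin ?Y W" if "W \<in> {U,V}" for W
      using that U V by (auto simp: openin_subtopology)
  qed (use c in auto)
  have sc: "singular_chain p ?Y ((singular_subdivision p ^^ m) c)" for m
    by (induction m) (auto simp: singular_chain_singular_subdivision c)
  have "Poly_Mapping.keys ((singular_subdivision p ^^ n) c)
      \<subseteq> singular_simplex_set p (subtopology X U) \<union> singular_simplex_set p (subtopology X V)"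
  proof
    fix f assume f: "f \<in> Poly_Mapping.keys ((singular_subdivision p ^^ n) c)"
    then have "singular_simplex p ?Y f"
      using sc[of n] by (auto simp: singular_chain_def)
    then have "singular_simplex p X f"
      by (simp add: singular_simplex_subtopology)
    with n[OF order_refl f]
    show "f \<in> singular_simplex_set p (subtopology X U) \<union> singular_simplex_set p (subtopology X V)"
      by (auto simp: singular_simplex_subtopology)
  qed
  from frag_split[OF this] show ?thesis
    using that unfolding singular_chain_def by metis
qed

text \<open>Exactness of the relative Mayer-Vietoris sequence at H_i(X, U \<inter> V), on chains.
  Two ways to push \<open>c\<close> into \<open>U\<close> and into \<open>V\<close> differ by a
  relative cycle modulo the union; as this one bounds, its remainder \<open>w\<close> can be split
  and absorbed on both sides.\<close>

lemma relative_Mayer_Vietoris: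
  assumes U: "openin X U" and V: "openin X V"
    and UV: "rel_acyclic (Suc i) X (U \<union> V)"
    and cU: "singular_relboundary i X U c" and cV: "singular_relboundary i X V c"
  shows "singular_relboundary i X (U \<inter> V) c"
proof -
  obtain d1 u1 where d1: "singular_chain (Suc i) X d1" "singular_chain i (subtopology X U) u1"
    "chain_boundary (Suc i) d1 + u1 = c"
    using cU by (auto simp: singular_relboundary)
  obtain d2 u2 where d2: "singular_chain (Suc i) X d2" "singular_chain i (subtopology X V) u2"
    "chain_boundary (Suc i) d2 + u2 = c"
    using cV by (auto simp: singular_relboundary)
  let ?W = "subtopology X (U \<union> V)"
  have u1W: "singular_chain i ?W u1" and u2W: "singular_chain i ?W u2"
    using d1 d2 by (meson singular_chain_mono Un_upper1 Un_upper2)+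
  have bd: "chain_boundary (Suc i) (d1 - d2) = u2 - u1"
    using d1(3) d2(3) by (simp add: chain_boundary_diff algebra_simps)
  have "singular_relcycle (Suc i) X (U \<union> V) (d1 - d2)"
    using d1 d2 u1W u2W by (simp add: singular_relcycle singular_chain_diff bd)
  then obtain e w where e: "singular_chain (Suc (Suc i)) X e" and w: "singular_chain (Suc i) ?W w"
    and ew: "chain_boundary (Suc (Suc i)) e + w = d1 - d2"
    using UV by (auto simp: rel_acyclic_def singular_relboundary)
  have bw: "chain_boundary (Suc i) w = u2 - u1"
    using arg_cong[OF ew, of "chain_boundary (Suc i)"] bd chain_boundary_boundary_alt[OF e]
    by (simp add: chain_boundary_add)
  obtain k w1 w2 where w12: "singular_chain (Suc i) (subtopology X U) w1"
    "singular_chain (Suc i) (subtopology X V) w2" "(singular_subdivision (Suc i) ^^ k) w = w1 + w2"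
    using subdivide_into_two[OF U V w] by metis
  obtain h where h: "\<And>p. h p 0 = (0 :: 'a chain)"
        "\<And>p c1 c2. h p (c1-c2) = h p c1 - h p c2"
        "\<And>p X c. singular_chain p X c ==> singular_chain (Suc p) X (h p c)"
        "\<And>p X c. singular_chain p X c
                 ==> chain_boundary (Suc p) (h p c) + h (p - Suc 0) (chain_boundary p c)
                   = (singular_subdivision p ^^ k) c - c"
    using chain_homotopic_iterated_singular_subdivision by metis
  have "chain_boundary (Suc (Suc i)) (h (Suc i) w) + h i (u2 - u1) = w1 + w2 - w"
    using h(4)[OF w] w12 bw by simp

  then have "chain_boundary (Suc i) (h i u2 - h i u1) = chain_boundary (Suc i) (w1 + w2 - w)"
    using chain_boundary_boundary_alt[OF h(3)[OF w]]
    by (metis (no_types) add_cancel_right_left chain_boundary_add h(2))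
  \<comment> \<open>The homotopy \<open>h\<close> keeps a chain in the subspace where it lives. So
    the left side is a chain in \<open>U\<close> and the right side a chain in \<open>V\<close>;
    being equal, it is a chain in the intersection.\<close>
  then have key: "u1 + chain_boundary (Suc i) w1 + chain_boundary (Suc i) (h i u1)
      = u2 - chain_boundary (Suc i) w2 + chain_boundary (Suc i) (h i u2)"
    using bw by (simp add: chain_boundary_diff chain_boundary_add algebra_simps)
  define u where "u = u1 + chain_boundary (Suc i) w1 + chain_boundary (Suc i) (h i u1)"
  have uU: "singular_chain i (subtopology X U) u"
    unfolding u_def using d1(2) w12(1) h(3)[OF d1(2)]
    by (intro singular_chain_add singular_chain_boundary_alt)
  have uV: "singular_chain i (subtopology X V) u"
    unfolding u_def key using d2(2) w12(2) h(3)[OF d2(2)]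
    by (intro singular_chain_add singular_chain_diff singular_chain_boundary_alt)
  have "singular_chain i (subtopology X (U \<inter> V)) u"
    using uU uV by (auto simp: singular_chain_subtopology)
  moreover have "singular_chain (Suc i) X (d1 - w1 - h i u1)"
    using d1(1) w12(1) h(3)[OF d1(2)]
    by (auto simp: singular_chain_subtopology intro!: singular_chain_diff)
  moreover have "chain_boundary (Suc i) (d1 - w1 - h i u1) + u = c"
    using d1(3) by (simp add: u_def chain_boundary_diff)
  ultimately show ?thesis
    unfolding singular_relboundary by blast
qed

lemma singular_simplex_compact_image:
  assumes "singular_simplex p X f"
  shows "compactin X (f ` standard_simplex p)"
proof -
  have "compactin (subtopology (powertop_real UNIV) (standard_simplex p)) (standard_simplex p)"
    by (simp add: compactin_subtopology compactin_standard_simplex)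
  then show ?thesis
    using assms image_compactin unfolding singular_simplex_def by blast
qed

text \<open>Simplices have compact images, so on the part of \<open>A\<close> that the finitely many
  simplices of \<open>c\<close> meet, \<open>h\<close> keeps a positive distance from the value
  \<open>x\<close>.\<close>

lemma singular_chain_avoid_slab:
  assumes X: "Hausdorff_space X" and A: "closedin X A"
    and h: "continuous_map (subtopology X A) euclideanreal h"
    and c: "singular_chain p (subtopology X (topspace X - {y \<in> A. h y = x})) c"
  obtains \<delta> where "\<delta> > 0"
    "\<And>a b. a \<le> x ==> x \<le> b ==> b - a < \<delta> ==>
       singular_chain p (subtopology X (topspace X - {y \<in> A. a \<le> h y \<and> h y \<le> b})) c"
proof -
  have "\<exists>\<delta>>0. \<forall>y \<in> A \<inter> f ` standard_simplex p. \<delta> \<le> \<bar>h y - x\<bar>" if f: "f \<in> Poly_Mapping.keys c" for f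
  proof -
    have sf: "singular_simplex p X f" and fx: "f ` standard_simplex p \<subseteq> topspace X - {y \<in> A. h y = x}"
      using c f unfolding singular_chain_subtopology by (auto simp: singular_chain_def)
    let ?K = "A \<inter> f ` standard_simplex p"
    have "compactin (subtopology X A) ?K"
      using singular_simplex_compact_image[OF sf] A
      by (simp add: compactin_subtopology closed_Int_compactin)
    then have "compact (h ` ?K)"
      using image_compactin[OF _ h] by auto
    moreover have "x \<notin> h ` ?K"
      using fx by auto
    ultimately obtain d where d: "d > 0" "\<forall>z \<in> h ` ?K. d \<le> dist x z"
      using separate_point_closed[of "h ` ?K" x] compact_imp_closed by blast
    then show ?thesis
      by (intro exI[of _ d]) (auto simp: dist_real_def abs_minus_commute)
  qed
  then obtain d where d: "\<And>f. f \<in> Poly_Mapping.keys c ==> d f > 0"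
    "\<And>f y. f \<in> Poly_Mapping.keys c ==> y \<in> A \<inter> f ` standard_simplex p ==> d f \<le> \<bar>h y - x\<bar>"
    by metis
  define \<delta> where "\<delta> = Min (insert 1 (d ` Poly_Mapping.keys c))"
  have "\<delta> > 0"
    unfolding \<delta>_def using d(1) by (subst Min_gr_iff) auto
  moreover have \<delta>: "\<delta> \<le> d f" if "f \<in> Poly_Mapping.keys c" for f
    unfolding \<delta>_def using that by (intro Min_le) auto
  moreover have "singular_chain p (subtopology X (topspace X - {y \<in> A. a \<le> h y \<and> h y \<le> b})) c"
    if ab: "a \<le> x" "x \<le> b" "b - a < \<delta>" for a b
  proof -
    have "f z \<in> topspace X - {y \<in> A. a \<le> h y \<and> h y \<le> b}"
      if f: "f \<in> Poly_Mapping.keys c" and z: "z \<in> standard_simplex p" for f z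
    proof -
      have "f z \<in> topspace X"
        using c f z by (force simp: singular_chain_subtopology)
      moreover have "\<not> (a \<le> h (f z) \<and> h (f z) \<le> b)" if "f z \<in> A"
        using d(2)[OF f, of "f z"] that z \<delta>[OF f] ab by (auto simp: abs_if split: if_splits)
      ultimately show ?thesis by auto
    qed
    then show ?thesis
      using c by (auto simp: singular_chain_subtopology)
  qed
  ultimately show ?thesis using that by blast
qed

lemma continuous_map_real_arctan:
  assumes "continuous_map X euclideanreal h"
  shows "continuous_map X euclideanreal (\<lambda>x. arctan (h x))"
proof -
  have "continuous_map euclideanreal euclideanreal arctan"
    by (simp add: continuous_at_imp_continuous_on isCont_arctan)
  then show ?thesis
    by (rule continuous_map_compose[OF assms, unfolded o_def])
qed

text \<open>Bisection along the functions \<open>hs\<close> one at a time: a class that survives on ever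
  thinner slabs would survive on a level set, because chains have compact support.\<close>

theorem rel_acyclic_complement:
  assumes X: "Hausdorff_space X"
    and loc: "\<And>x i. x \<in> topspace X ==> i < n ==> rel_acyclic i X (topspace X - {x})"
    and "closedin X A"
    and "\<And>h. h \<in> set hs ==> continuous_map (subtopology X A) euclideanreal h"
    and "\<And>x. x \<in> A ==> finite {y \<in> A. \<forall>h\<in>set hs. h y = h x}"
    and "i + length hs < n"
  shows "rel_acyclic i X (topspace X - A)"
  using assms(3-)
proof (induction hs arbitrary: A i)
  case Nil
  have "finite A"
    using Nil.prems(3) by (cases "A = {}") auto
  then have "A \<subseteq> topspace X ==> rel_acyclic i X (topspace X - A)"
  proof (induction A rule: finite_induct)
    case empty
    then show ?case by (simp add: rel_acyclic_topspace)
  next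
    case (insert a F)
    have cl: "closedin X S" if "finite S" "S \<subseteq> topspace X" for S
      using that X Hausdorff_imp_t1_space t1_space_closedin_finite by blast
    have UV: "topspace X - {a} \<union> (topspace X - F) = topspace X"
      "(topspace X - {a}) \<inter> (topspace X - F) = topspace X - insert a F"
      using insert by auto
    show ?case
      unfolding rel_acyclic_def
    proof (intro allI impI)
      fix c assume c: "singular_relcycle i X (topspace X - insert a F) c"
      have "singular_relboundary i X ((topspace X - {a}) \<inter> (topspace X - F)) c"
      proof (rule relative_Mayer_Vietoris)
        show "openin X (topspace X - {a})" "openin X (topspace X - F)"
          using cl[of "{a}"] cl[of F] insert by auto
        show "rel_acyclic (Suc i) X (topspace X - {a} \<union> (topspace X - F))"
          unfolding UV by (rule rel_acyclic_topspace)
        show "singular_relboundary i X (topspace X - {a}) c"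
          using loc[of a i] insert.prems Nil.prems singular_relcycle_superset[OF c, of "topspace X - {a}"]
          by (auto simp: rel_acyclic_def)
        show "singular_relboundary i X (topspace X - F) c"
          using insert.IH insert.prems singular_relcycle_superset[OF c, of "topspace X - F"]
          by (auto simp: rel_acyclic_def)
      qed
      then show "singular_relboundary i X (topspace X - insert a F) c"
        unfolding UV .
    qed
  qed
  then show ?case
    using Nil.prems(1) closedin_subset by blast
next
  case (Cons h hs)
  \<comment> \<open>\<open>arctan\<close> preserves level sets and confines the values to [-2, 2],
    the interval on which the bisection starts.\<close>
  define g where "g = (\<lambda>x. arctan (h x))"
  have g: "continuous_map (subtopology X A) euclideanreal g"
    unfolding g_def by (intro continuous_map_real_arctan Cons.prems(2)) auto
  have gbd: "-2 \<le> g y \<and> g y \<le> 2" for y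
    using arctan_bounded[of "h y"] pi_less_4 unfolding g_def by linarith
  define S where "S = (\<lambda>a b. {y \<in> A. a \<le> g y \<and> g y \<le> b})"
  have AX: "A \<subseteq> topspace X"
    using Cons.prems(1) closedin_subset by blast
  have cl: "closedin X (S a b)" for a b
  proof -
    have "closedin (subtopology X A) {y \<in> topspace (subtopology X A). g y \<in> {a..b}}"
      using g by (rule closedin_continuous_map_preimage) auto
    moreover have "{y \<in> topspace (subtopology X A). g y \<in> {a..b}} = S a b"
      using AX by (auto simp: S_def)
    ultimately show ?thesis
      using closedin_trans_full Cons.prems(1) by metis
  qed
  \<comment> \<open>On a level set \<open>h\<close> is constant, so the remaining functions still
    have finite joint fibres. With one function fewer the degree may be \<open>i\<close> or
    \<open>Suc i\<close>; gluing two slabs along a level uses the latter.\<close>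
  have level: "rel_acyclic j X (topspace X - S a a)" if "j + length hs < n" for j a
  proof (rule Cons.IH)
    show "closedin X (S a a)" by (rule cl)
    show "continuous_map (subtopology X (S a a)) euclideanreal h'" if "h' \<in> set hs" for h'
      using Cons.prems(2)[of h'] that continuous_map_from_subtopology_mono[of X A _ h' "S a a"]
      by (auto simp: S_def)
    show "finite {y \<in> S a a. \<forall>h\<in>set hs. h y = h x}" if "x \<in> S a a" for x
    proof (rule finite_subset)
      show "{y \<in> S a a. \<forall>h\<in>set hs. h y = h x} \<subseteq> {y \<in> A. \<forall>h'\<in>set (h # hs). h' y = h' x}"
        using that by (auto simp: S_def g_def arctan_eq_iff)
      show "finite {y \<in> A. \<forall>h'\<in>set (h # hs). h' y = h' x}"
        using that by (intro Cons.prems(3)) (auto simp: S_def)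
    qed
    show "j + length hs < n" by (rule that)
  qed
  show ?case
    unfolding rel_acyclic_def
  proof (intro allI impI)
    fix c assume c: "singular_relcycle i X (topspace X - A) c"
    have cS: "singular_relcycle i X (topspace X - S a b) c" for a b
      by (rule singular_relcycle_superset[OF c]) (auto simp: S_def)
    have "singular_relboundary i X (topspace X - S (-2) 2) c"
    proof (rule Bolzano[where P = "\<lambda>a b. singular_relboundary i X (topspace X - S a b) c"])
      fix a b e :: real
      assume 1: "singular_relboundary i X (topspace X - S a b) c"
        and 2: "singular_relboundary i X (topspace X - S b e) c" and "a \<le> b" "b \<le> e"
      have eq: "topspace X - S a e = (topspace X - S a b) \<inter> (topspace X - S b e)"
        "topspace X - S b b = (topspace X - S a b) \<union> (topspace X - S b e)"
        using \<open>a \<le> b\<close> \<open>b \<le> e\<close> by (auto simp: S_def)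
      show "singular_relboundary i X (topspace X - S a e) c"
        unfolding eq
      proof (rule relative_Mayer_Vietoris)
        show "rel_acyclic (Suc i) X (topspace X - S a b \<union> (topspace X - S b e))"
          unfolding eq[symmetric] using Cons.prems(4) by (intro level) auto
      qed (use cl 1 2 in auto)
    next
      fix x :: real
      \<comment> \<open>Off the level \<open>x\<close> the class is killed up to a chain
        \<open>e\<close> that misses the level; by compactness \<open>e\<close> misses a whole slab
        around it.\<close>
      have "rel_acyclic i X (topspace X - S x x)"
        using Cons.prems(4) by (intro level) auto
      then obtain d e where d: "singular_chain (Suc i) X d"
        "singular_chain i (subtopology X (topspace X - S x x)) e" "chain_boundary (Suc i) d + e = c"
        using cS[of x x] unfolding rel_acyclic_def singular_relboundary by blast
      have Sx: "S x x = {y \<in> A. g y = x}"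
        by (auto simp: S_def)
      obtain \<delta> where "\<delta> > 0" and \<delta>: "\<And>a b. a \<le> x ==> x \<le> b ==> b - a < \<delta> ==>
         singular_chain i (subtopology X (topspace X - S a b)) e"
        using singular_chain_avoid_slab[OF X Cons.prems(1) g d(2)[unfolded Sx]]
        unfolding S_def by metis
      have "singular_relboundary i X (topspace X - S a b) c" if "a \<le> x \<and> x \<le> b \<and> b - a < \<delta>" for a b
        using d(1,3) \<delta>[of a b] that unfolding singular_relboundary by metis
      with \<open>\<delta> > 0\<close> show "\<exists>d>0. \<forall>a b. a \<le> x \<and> x \<le> b \<and> b - a < d --> singular_relboundary i X (topspace X - S a b) c"
        by blast
    qed auto
    moreover have "S (-2) 2 = A"
      using gbd by (auto simp: S_def)
    ultimately show "singular_relboundary i X (topspace X - A) c" by simp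
  qed
qed

section \<open>Exponentials and compact subgroups of Banach algebras\<close>

lemma norm_power_diff_le:
  fixes a b :: "'a::real_normed_algebra_1"
  assumes "norm a \<le> M" "norm b \<le> M"
  shows "norm (a ^ k - b ^ k) \<le> real k * norm (a - b) * M ^ (k - 1)"
proof (induction k)
  case (Suc k)
  have M: "0 \<le> M" using assms(1) norm_ge_zero order_trans by blast
  have "a ^ Suc k - b ^ Suc k = a * (a ^ k - b ^ k) + (a - b) * b ^ k"
    by (simp add: algebra_simps)
  also have "norm \<dots> \<le> M * (real k * norm (a - b) * M ^ (k - 1)) + norm (a - b) * M ^ k"
  proof (rule norm_triangle_le, rule add_mono)
    have "norm (a * (a ^ k - b ^ k)) \<le> norm a * norm (a ^ k - b ^ k)"
      by (rule norm_mult_ineq)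
    also have "\<dots> \<le> M * (real k * norm (a - b) * M ^ (k - 1))"
      by (intro mult_mono assms Suc.IH M) auto
    finally show "norm (a * (a ^ k - b ^ k)) \<le> M * (real k * norm (a - b) * M ^ (k - 1))" .
    have "norm ((a - b) * b ^ k) \<le> norm (a - b) * norm (b ^ k)"
      by (rule norm_mult_ineq)
    also have "norm (b ^ k) \<le> M ^ k"
      using norm_power_ineq[of b k] power_mono[OF assms(2), of k] by auto
    finally show "norm ((a - b) * b ^ k) \<le> norm (a - b) * M ^ k"
      by (simp add: mult_left_mono)
  qed
  also have "\<dots> = real (Suc k) * norm (a - b) * M ^ (Suc k - 1)"
    by (cases k) (auto simp: algebra_simps)
  finally show ?case .
qed auto

lemma norm_exp_minus_one_minus_id:
  fixes x :: "'a::{real_normed_algebra_1,banach}"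
  shows "norm (exp x - 1 - x) \<le> exp (norm x) - 1 - norm x"
proof -
  have 1: "(\<lambda>n. x^(n+2) /\<^sub>R fact (n+2)) sums (exp x - (\<Sum>n<2. x^n /\<^sub>R fact n))"
    by (intro sums_split_initial_segment exp_converges)
  have 2: "(\<lambda>n. norm x^(n+2) /\<^sub>R fact (n+2)) sums (exp (norm x) - (\<Sum>n<2. norm x^n /\<^sub>R fact n))"
    by (intro sums_split_initial_segment exp_converges)
  have le: "norm (x ^ m /\<^sub>R fact m) \<le> norm x ^ m /\<^sub>R fact m" for m
    using norm_power_ineq[of x m] by (simp add: field_simps)
  have "norm (suminf (\<lambda>n. x^(n+2) /\<^sub>R fact (n+2))) \<le> suminf (\<lambda>n. norm x^(n+2) /\<^sub>R fact (n+2))"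
    by (rule norm_suminf_le[OF le sums_summable[OF 2]])
  then have "norm (exp x - (\<Sum>n<2. x^n /\<^sub>R fact n)) \<le> exp (norm x) - (\<Sum>n<2. norm x^n /\<^sub>R fact n)"
    using sums_unique[OF 1] sums_unique[OF 2] by simp
  then show ?thesis
    by (simp add: numeral_2_eq_2 algebra_simps)
qed

lemma norm_exp_diff_le:
  fixes a b :: "'a::{real_normed_algebra_1,banach}"
  assumes "norm a \<le> M" "norm b \<le> M"
  shows "norm (exp a - exp b) \<le> norm (a - b) * exp M"
proof -
  have M: "0 \<le> M" using assms(1) norm_ge_zero order_trans by blast
  have 1: "(\<lambda>n. a^n /\<^sub>R fact n - b^n /\<^sub>R fact n) sums (exp a - exp b)"
    by (intro sums_diff exp_converges)
  have 3: "(\<lambda>n. norm (a - b) * (M ^ n /\<^sub>R fact n)) sums (norm (a - b) * exp M)"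
    by (intro sums_mult exp_converges)
  have "(\<lambda>n. norm (a - b) * (real (Suc n) * M ^ (Suc n - 1) /\<^sub>R fact (Suc n))) = (\<lambda>n. norm (a - b) * (M ^ n /\<^sub>R fact n))"
    by (rule ext) (simp add: field_simps del: of_nat_Suc)
  with 3 have "(\<lambda>n. norm (a - b) * (real (Suc n) * M ^ (Suc n - 1) /\<^sub>R fact (Suc n))) sums (norm (a - b) * exp M)"
    by simp
  then have 2: "(\<lambda>n. norm (a - b) * (real n * M ^ (n - 1) /\<^sub>R fact n)) sums (norm (a - b) * exp M)"
    using sums_Suc[where f="\<lambda>n. norm (a - b) * (real n * M ^ (n - 1) /\<^sub>R fact n)"] by fastforce
  have le: "norm (a ^ n /\<^sub>R fact n - b ^ n /\<^sub>R fact n) \<le> norm (a - b) * (real n * M ^ (n - 1) /\<^sub>R fact n)" for n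
  proof -
    have "a ^ n /\<^sub>R fact n - b ^ n /\<^sub>R fact n = (a ^ n - b ^ n) /\<^sub>R fact n"
      by (simp add: scaleR_diff_right)
    then have "norm (a ^ n /\<^sub>R fact n - b ^ n /\<^sub>R fact n) = norm (a ^ n - b ^ n) / fact n"
      by (simp only: norm_scaleR) (simp add: divide_inverse mult.commute)
    also have "\<dots> \<le> (real n * norm (a - b) * M ^ (n - 1)) / fact n"
      by (intro divide_right_mono norm_power_diff_le assms) auto
    finally show ?thesis by (simp add: divide_inverse mult_ac)
  qed
  have "norm (suminf (\<lambda>n. a ^ n /\<^sub>R fact n - b ^ n /\<^sub>R fact n)) \<le> suminf (\<lambda>n. norm (a - b) * (real n * M ^ (n - 1) /\<^sub>R fact n))"
    by (rule norm_suminf_le[OF le sums_summable[OF 2]])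
  then show ?thesis
    unfolding sums_unique[OF 1, symmetric] sums_unique[OF 2, symmetric] .
qed

lemma tendsto_exp_algebra:
  fixes f :: "'b => 'a::{real_normed_algebra_1,banach}"
  assumes "(f \<longlongrightarrow> l) F"
  shows "((\<lambda>x. exp (f x)) \<longlongrightarrow> exp l) F"
proof -
  have bd: "\<forall>\<^sub>F x in F. norm (f x) \<le> norm l + 1"
  proof -
    have "\<forall>\<^sub>F x in F. norm (f x) < norm l + 1"
      by (rule order_tendstoD(2)[OF tendsto_norm[OF assms]]) simp
    then show ?thesis by eventually_elim auto
  qed
  have "((\<lambda>x. exp (f x) - exp l) \<longlongrightarrow> 0) F"
  proof (rule Lim_null_comparison)
    show "\<forall>\<^sub>F x in F. norm (exp (f x) - exp l) \<le> norm (f x - l) * exp (norm l + 1)"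
      using bd by eventually_elim (rule norm_exp_diff_le, auto)
    have "((\<lambda>x. norm (f x - l) * exp (norm l + 1)) \<longlongrightarrow> norm (l - l) * exp (norm l + 1)) F"
      by (intro tendsto_intros assms)
    then show "((\<lambda>x. norm (f x - l) * exp (norm l + 1)) \<longlongrightarrow> 0) F" by simp
  qed
  then show ?thesis by (rule LIM_zero_cancel)
qed

lemma exp_nat_scaleR:
  fixes x :: "'a::{real_normed_algebra_1,banach}"
  shows "exp (real k *\<^sub>R x) = exp x ^ k"
proof (induction k)
  case (Suc k)
  have "exp (real (Suc k) *\<^sub>R x) = exp (x + real k *\<^sub>R x)"
    by (simp add: algebra_simps)
  also have "\<dots> = exp x * exp (real k *\<^sub>R x)"
    by (rule exp_add_commuting) simp
  finally show ?case using Suc by simp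
qed auto

text \<open>The remainder of \<open>exp\<close> is bounded by t times \<phi> t with t the norm of
  \<open>x n\<close>, where \<phi> is the error of the difference quotient of the real exponential
  at 0. The factor \<open>k n\<close> times t stays bounded and \<phi> t tends to 0.\<close>

lemma exp_little_o:
  fixes x :: "nat => 'a::{real_normed_algebra_1,banach}"
  assumes x: "x \<longlonglongrightarrow> 0" and K: "\<forall>\<^sub>F n in sequentially. real (k n) * norm (x n) \<le> C"
  shows "(\<lambda>n. real (k n) *\<^sub>R (exp (x n) - 1 - x n)) \<longlonglongrightarrow> 0"
proof (rule Lim_null_comparison)
  have lim: "((\<lambda>t::real. (exp t - 1) / t - 1) \<longlongrightarrow> 0) (at 0)"
    using DERIV_exp[of 0] by (auto simp: DERIV_def intro: tendsto_eq_intros)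
  define \<phi> where "\<phi> = (\<lambda>t::real. if t = 0 then 0 else (exp t - 1) / t - 1)"
  have "isCont \<phi> 0"
    unfolding continuous_at using lim
    by (auto simp: \<phi>_def cong: Lim_cong_within)
  then have \<phi>: "(\<lambda>n. \<phi> (norm (x n))) \<longlonglongrightarrow> 0"
    using isCont_tendsto_compose[of 0 \<phi> "\<lambda>n. norm (x n)"] x tendsto_norm_zero by (force simp: \<phi>_def)
  have n\<phi>: "exp t - 1 - t = t * \<phi> t" for t
    by (auto simp: \<phi>_def field_simps)
  have \<phi>0: "\<phi> t \<ge> 0" if "t \<ge> 0" for t
    using that exp_ge_add_one_self[of t] by (auto simp: \<phi>_def field_simps)
  show "\<forall>\<^sub>F n in sequentially. norm (real (k n) *\<^sub>R (exp (x n) - 1 - x n)) \<le> C * \<phi> (norm (x n))"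
    using K
  proof eventually_elim
    case (elim n)
    have "norm (real (k n) *\<^sub>R (exp (x n) - 1 - x n)) \<le> real (k n) * (norm (x n) * \<phi> (norm (x n)))"
      using norm_exp_minus_one_minus_id[of "x n"] by (simp add: n\<phi> mult_left_mono)
    also have "\<dots> \<le> C * \<phi> (norm (x n))"
      using mult_right_mono[OF elim \<phi>0[of "norm (x n)"]] by (simp add: mult.assoc)
    finally show ?case .
  qed
  show "(\<lambda>n. C * \<phi> (norm (x n))) \<longlonglongrightarrow> 0"
    using tendsto_mult_left[OF \<phi>, of C] by simp
qed

text \<open>The engine behind both the Trotter product formula and Cartan's closed subgroup theorem.\<close>

lemma tendsto_power_exp:
  fixes g :: "nat => 'a::{real_normed_algebra_1,banach}"
  assumes g: "g \<longlonglongrightarrow> 1" and k: "(\<lambda>n. real (k n) *\<^sub>R (g n - 1)) \<longlonglongrightarrow> Y"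
  shows "(\<lambda>n. g n ^ k n) \<longlonglongrightarrow> exp Y"
proof -
  define x where "x = (\<lambda>n. g n - 1)"
  have x0: "x \<longlonglongrightarrow> 0" unfolding x_def using g by (simp add: LIM_zero_iff)
  define C where "C = norm Y + 1"
  have "\<forall>\<^sub>F n in sequentially. norm (real (k n) *\<^sub>R x n) < C"
    unfolding C_def x_def by (rule order_tendstoD(2)[OF tendsto_norm[OF k]]) simp
  then have K: "\<forall>\<^sub>F n in sequentially. real (k n) * norm (x n) \<le> C"
    by eventually_elim auto
  \<comment> \<open>\<open>g n\<close> and the exponential of \<open>g n - 1\<close> differ by o(1 /
    \<open>k n\<close>), and taking \<open>k n\<close>-th powers magnifies the difference by
    \<open>k n\<close> times a bounded factor.\<close>
  have diff: "(\<lambda>n. g n ^ k n - exp (x n) ^ k n) \<longlonglongrightarrow> 0"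
  proof (rule Lim_null_comparison)
    show "\<forall>\<^sub>F n in sequentially. norm (g n ^ k n - exp (x n) ^ k n)
            \<le> norm (real (k n) *\<^sub>R (exp (x n) - 1 - x n)) * exp C"
      using K
    proof eventually_elim
      case (elim n)
      let ?M = "exp (norm (x n))"
      have 1: "norm (g n) \<le> ?M"
      proof -
        have "norm (g n) \<le> norm (1 :: 'a) + norm (x n)"
          unfolding x_def by (metis add.commute diff_add_cancel norm_triangle_ineq)
        then show ?thesis using exp_ge_add_one_self[of "norm (x n)"] by (simp only: norm_one)
      qed
      have "norm (g n ^ k n - exp (x n) ^ k n) \<le> real (k n) * norm (g n - exp (x n)) * ?M ^ (k n - 1)"
        by (rule norm_power_diff_le[OF 1 norm_exp])
      also have "norm (g n - exp (x n)) = norm (exp (x n) - 1 - x n)"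
        unfolding x_def by (metis diff_diff_eq2 norm_minus_commute add_diff_cancel_left' diff_add_cancel diff_add_eq)
      also have "?M ^ (k n - 1) \<le> exp C"
      proof -
        have "?M ^ (k n - 1) \<le> ?M ^ k n" by (intro power_increasing) auto
        also have "\<dots> = exp (real (k n) * norm (x n))" by (simp add: exp_of_nat_mult)
        also have "\<dots> \<le> exp C" using elim by simp
        finally show ?thesis .
      qed
      finally show ?case by (simp add: mult_left_mono)
    qed
    have "(\<lambda>n. norm (real (k n) *\<^sub>R (exp (x n) - 1 - x n)) * exp C) \<longlonglongrightarrow> norm (0::'a) * exp C"
      by (intro tendsto_intros exp_little_o[OF x0 K])
    then show "(\<lambda>n. norm (real (k n) *\<^sub>R (exp (x n) - 1 - x n)) * exp C) \<longlonglongrightarrow> 0" by simp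
  qed
  have "(\<lambda>n. exp (x n) ^ k n) \<longlonglongrightarrow> exp Y"
    using tendsto_exp_algebra[OF k] by (simp add: exp_nat_scaleR x_def)
  from tendsto_add[OF diff this] show ?thesis by simp
qed

lemma exp_intertwine:
  fixes A B g :: "'a::{real_normed_algebra_1,banach}"
  assumes "g * A = B * g"
  shows "g * exp A = exp B * g"
proof -
  have pw: "g * A ^ n = B ^ n * g" for n
  proof (induction n)
    case (Suc n)
    have "g * A ^ Suc n = B * (g * A ^ n)" using assms by (simp add: mult.assoc[symmetric])
    then show ?case using Suc by (simp add: mult.assoc)
  qed auto
  have "(\<lambda>n. g * (A^n /\<^sub>R fact n)) sums (g * exp A)"
    by (intro sums_mult exp_converges)
  moreover have "(\<lambda>n. (B^n /\<^sub>R fact n) * g) sums (exp B * g)"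
    by (intro sums_mult2 exp_converges)
  moreover have "g * (A^n /\<^sub>R fact n) = (B^n /\<^sub>R fact n) * g" for n
    using pw by simp
  ultimately show ?thesis using sums_unique2 by fastforce
qed

text \<open>The counterpart of \<open>lie_algebra\<close> in a Banach algebra, where the exponential
  series and its calculus are at hand; \<open>lie_of_Endo\<close> identifies the two.\<close>

definition lie_of :: "'a::{real_normed_algebra_1,banach} set => 'a set" where
  "lie_of H = {X. \<forall>t::real. exp (t *\<^sub>R X) \<in> H}"

lemma lie_of_scaleR: "X \<in> lie_of H ==> c *\<^sub>R X \<in> lie_of H"
  by (auto simp: lie_of_def)

lemma power_mem:
  fixes g :: "'a::monoid_mult"
  assumes "1 \<in> H" "\<And>a b. a \<in> H ==> b \<in> H ==> a * b \<in> H" "g \<in> H"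
  shows "g ^ n \<in> H"
  by (induction n) (use assms in auto)

lemma tendsto_exp_inverse_nat:
  fixes A :: "'a::{real_normed_algebra_1,banach}"
  shows "(\<lambda>n. exp (inverse (real (Suc n)) *\<^sub>R A)) \<longlonglongrightarrow> 1"
proof -
  have "(\<lambda>n. exp (inverse (real (Suc n)) *\<^sub>R A)) \<longlonglongrightarrow> exp (0 *\<^sub>R A)"
    by (intro tendsto_exp_algebra tendsto_intros LIMSEQ_inverse_real_of_nat)
  then show ?thesis by simp
qed

lemma tendsto_nat_exp_minus_one:
  fixes A :: "'a::{real_normed_algebra_1,banach}"
  shows "(\<lambda>n. real (Suc n) *\<^sub>R (exp (inverse (real (Suc n)) *\<^sub>R A) - 1)) \<longlonglongrightarrow> A"
proof -
  let ?x = "\<lambda>n. inverse (real (Suc n)) *\<^sub>R A"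
  have "?x \<longlonglongrightarrow> 0 *\<^sub>R A"
    by (intro tendsto_intros LIMSEQ_inverse_real_of_nat)
  then have x0: "?x \<longlonglongrightarrow> 0" by simp
  have "(\<lambda>n. real (Suc n) *\<^sub>R (exp (?x n) - 1 - ?x n)) \<longlonglongrightarrow> 0"
    by (rule exp_little_o[OF x0, where C = "norm A"]) (auto simp: field_simps simp del: of_nat_Suc)
  then have "(\<lambda>n. real (Suc n) *\<^sub>R (exp (?x n) - 1 - ?x n) + A) \<longlonglongrightarrow> 0 + A"
    by (intro tendsto_add tendsto_const)
  then show ?thesis
    by (simp add: scaleR_diff_right del: of_nat_Suc)
qed

text \<open>Trotter product formula: the n-th power of exp (tX/n) exp (tY/n) tends to exp (t(X +
  Y)), and \<open>H\<close> is closed.\<close>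

lemma lie_of_add:
  assumes "closed H" "1 \<in> H" "\<And>a b. a \<in> H ==> b \<in> H ==> a * b \<in> H"
    and X: "X \<in> lie_of H" and Y: "Y \<in> lie_of H"
  shows "X + Y \<in> lie_of H"
  unfolding lie_of_def
proof (intro CollectI allI)
  fix t :: real
  define a where "a = (\<lambda>n. exp (inverse (real (Suc n)) *\<^sub>R (t *\<^sub>R X)))"
  define b where "b = (\<lambda>n. exp (inverse (real (Suc n)) *\<^sub>R (t *\<^sub>R Y)))"
  have ab: "a \<longlonglongrightarrow> 1" "b \<longlonglongrightarrow> 1"
    unfolding a_def b_def by (rule tendsto_exp_inverse_nat)+
  have "(\<lambda>n. real (Suc n) *\<^sub>R (a n - 1) * b n + real (Suc n) *\<^sub>R (b n - 1)) \<longlonglongrightarrow> (t *\<^sub>R X) * 1 + t *\<^sub>R Y"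
    using ab unfolding a_def b_def
    by (intro tendsto_add tendsto_mult tendsto_nat_exp_minus_one)
  then have "(\<lambda>n. real (Suc n) *\<^sub>R (a n * b n - 1)) \<longlonglongrightarrow> t *\<^sub>R (X + Y)"
    by (simp add: algebra_simps del: of_nat_Suc)
  moreover have "(\<lambda>n. a n * b n) \<longlonglongrightarrow> 1"
    using tendsto_mult[OF ab] by simp
  ultimately have lim: "(\<lambda>n. (a n * b n) ^ Suc n) \<longlonglongrightarrow> exp (t *\<^sub>R (X + Y))"
    by (intro tendsto_power_exp)
  have "a n \<in> H" "b n \<in> H" for n
    using X Y by (auto simp: a_def b_def lie_of_def)
  then have "(a n * b n) ^ Suc n \<in> H" for n
    using assms(2,3) by (intro power_mem) auto
  then show "exp (t *\<^sub>R (X + Y)) \<in> H"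
    by (rule closed_sequentially[OF assms(1) _ lim])
qed

lemma closed_lie_of:
  assumes "closed H" shows "closed (lie_of H)"
proof -
  have "closed ((\<lambda>X. exp (t *\<^sub>R X)) -` H)" for t :: real
    by (intro continuous_closed_vimage assms)
      (auto simp: continuous_at intro!: tendsto_exp_algebra tendsto_intros)
  then have "closed (\<Inter>t::real. (\<lambda>X. exp (t *\<^sub>R X)) -` H)"
    by auto
  moreover have "(\<Inter>t::real. (\<lambda>X. exp (t *\<^sub>R X)) -` H) = lie_of H"
    by (auto simp: lie_of_def)
  ultimately show ?thesis by simp
qed

lemma exp_inverse_mult:
  fixes X :: "'a::{real_normed_algebra_1,banach}"
  shows "exp (- X) * exp X = 1" "exp X * exp (- X) = 1"
  using exp_minus_inverse[of X] exp_minus_inverse[of "- X"] by auto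

lemma exp_conjugate:
  fixes A :: "'a::{real_normed_algebra_1,banach}"
  assumes "g' * g = 1" "g * g' = 1"
  shows "exp (g * A * g') = g * exp A * g'"
proof -
  have "g * exp A = exp (g * A * g') * g"
    by (rule exp_intertwine) (simp add: assms mult.assoc)
  then show ?thesis using assms by (simp add: mult.assoc)
qed

lemma lie_of_conjugate:
  assumes "\<And>a b. a \<in> H ==> b \<in> H ==> a * b \<in> H"
    and "g \<in> H" "g' \<in> H" "g' * g = 1" "g * g' = 1" and X: "X \<in> lie_of H"
  shows "g * X * g' \<in> lie_of H"
proof -
  have "exp (t *\<^sub>R (g * X * g')) = g * exp (t *\<^sub>R X) * g'" for t
    using exp_conjugate[OF assms(4,5), of "t *\<^sub>R X"] by simp
  then show ?thesis using assms by (auto simp: lie_of_def)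
qed

text \<open>The bracket is the derivative of conjugation: with a = exp (X/n), the multiples n (a Y
  a^-1 - Y) lie in the Lie algebra and tend to it.\<close>

lemma lie_of_bracket:
  assumes "closed H" "1 \<in> H" and mult: "\<And>a b. a \<in> H ==> b \<in> H ==> a * b \<in> H"
    and X: "X \<in> lie_of H" and Y: "Y \<in> lie_of H"
  shows "X * Y - Y * X \<in> lie_of H"
proof -
  define a where "a = (\<lambda>n. exp (inverse (real (Suc n)) *\<^sub>R X))"
  define b where "b = (\<lambda>n. exp (inverse (real (Suc n)) *\<^sub>R (- X)))"
  have abH: "a n \<in> H" "b n \<in> H" for n
    using X lie_of_scaleR[OF X, of "-1"] by (auto simp: a_def b_def lie_of_def)
  have ab: "a n * b n = 1" "b n * a n = 1" for n
    using exp_inverse_mult[of "inverse (real (Suc n)) *\<^sub>R X"] by (simp_all add: a_def b_def)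
  have lim: "a \<longlonglongrightarrow> 1" "b \<longlonglongrightarrow> 1"
    unfolding a_def b_def by (rule tendsto_exp_inverse_nat)+
  have "(\<lambda>n. (real (Suc n) *\<^sub>R (a n - 1)) * Y * b n + Y * (real (Suc n) *\<^sub>R (b n - 1))) \<longlonglongrightarrow> X * Y * 1 + Y * (- X)"
    unfolding a_def b_def
    by (intro tendsto_add tendsto_mult tendsto_nat_exp_minus_one tendsto_const tendsto_exp_inverse_nat)
  moreover have "(real (Suc n) *\<^sub>R (a n - 1)) * Y * b n + Y * (real (Suc n) *\<^sub>R (b n - 1))
      = real (Suc n) *\<^sub>R (a n * Y * b n - Y)" for n
    by (simp add: algebra_simps del: of_nat_Suc)
  ultimately have "(\<lambda>n. real (Suc n) *\<^sub>R (a n * Y * b n + (-1) *\<^sub>R Y)) \<longlonglongrightarrow> X * Y - Y * X"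
    by simp
  moreover have "real (Suc n) *\<^sub>R (a n * Y * b n + (-1) *\<^sub>R Y) \<in> lie_of H" for n
    by (intro lie_of_scaleR lie_of_add[OF assms(1-3)] lie_of_conjugate[OF mult abH ab(2) ab(1)] Y)
  ultimately show ?thesis
    by - (rule closed_sequentially[OF closed_lie_of[OF assms(1)]])
qed

text \<open>Cartan's argument. Elements of \<open>H\<close> that tend to 1 have directions
  accumulating at some unit vector \<open>Y\<close>; raising them to the power t divided by their
  distance from 1, rounded down, yields exp (tY) in the limit.\<close>

lemma infinite_compact_subgroup_lie:
  fixes H :: "'a::{real_normed_algebra_1,banach,heine_borel} set"
  assumes "compact H" "1 \<in> H" and mult: "\<And>a b. a \<in> H ==> b \<in> H ==> a * b \<in> H"
    and inv: "\<And>a. a \<in> H ==> \<exists>b\<in>H. a * b = 1 \<and> b * a = 1" and "infinite H"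
  obtains X where "X \<noteq> 0" "X \<in> lie_of H"
proof -
  obtain l where l: "l \<in> H" "l islimpt H"
    using assms(1) \<open>infinite H\<close> by (metis compact_eq_Bolzano_Weierstrass order_refl)
  then obtain f where f: "\<And>n. f n \<in> H - {l}" "f \<longlonglongrightarrow> l"
    unfolding islimpt_sequential by auto
  obtain l' where l': "l' \<in> H" "l * l' = 1" "l' * l = 1"
    using inv l(1) by blast
  define g where "g = (\<lambda>n. f n * l')"
  have gH: "g n \<in> H" for n using f l' mult by (auto simp: g_def)
  have g1: "g n \<noteq> 1" for n
  proof
    assume "g n = 1"
    then have "f n * (l' * l) = l" unfolding g_def by (metis mult.assoc mult_1)
    then show False using l' f(1)[of n] by simp
  qed
  have "g \<longlonglongrightarrow> l * l'" unfolding g_def by (intro tendsto_intros f)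
  then have glim: "g \<longlonglongrightarrow> 1" using l' by simp
  define s where "s = (\<lambda>n. norm (g n - 1))"
  have s: "s n > 0" for n using g1 by (simp add: s_def)
  have s0: "s \<longlonglongrightarrow> 0" unfolding s_def using glim by (simp add: LIM_zero tendsto_norm_zero)
  define y where "y = (\<lambda>n. (g n - 1) /\<^sub>R s n)"
  have "y n \<in> sphere 0 1" for n using s[of n] by (simp add: y_def s_def)
  then obtain Y r where Y: "Y \<in> sphere 0 1" "strict_mono (r :: nat => nat)" "(y \<circ> r) \<longlonglongrightarrow> Y"
    using compact_sphere[of "0::'a" 1] unfolding compact_def by metis
  have pos: "exp (t *\<^sub>R Y) \<in> H" if t: "t \<ge> 0" for t
  proof -
    define k where "k = (\<lambda>n. nat \<lfloor>t / s (r n)\<rfloor>)"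
    have sr: "(\<lambda>n. s (r n)) \<longlonglongrightarrow> 0"
      using LIMSEQ_subseq_LIMSEQ[OF s0 Y(2)] by (simp add: o_def)
    have ks: "(\<lambda>n. real (k n) * s (r n)) \<longlonglongrightarrow> t"
    proof (rule tendsto_sandwich)
      have *: "real (k n) = of_int \<lfloor>t / s (r n)\<rfloor>" for n
        unfolding k_def using t s[of "r n"] by simp
      have "t / s (r n) - 1 \<le> real (k n)" "real (k n) \<le> t / s (r n)" for n
        unfolding * by linarith+
      then have "t - s (r n) \<le> real (k n) * s (r n) \<and> real (k n) * s (r n) \<le> t" for n
        using s[of "r n"] pos_divide_le_eq[OF s[of "r n"], of t "1 + real (k n)"]
          pos_le_divide_eq[OF s[of "r n"], of "real (k n)" t]
        by (simp add: algebra_simps)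
      then show "\<forall>\<^sub>F n in sequentially. t - s (r n) \<le> real (k n) * s (r n)"
        "\<forall>\<^sub>F n in sequentially. real (k n) * s (r n) \<le> t" by auto
      show "(\<lambda>n. t - s (r n)) \<longlonglongrightarrow> t" using tendsto_diff[OF tendsto_const sr] by simp
    qed auto
    have "(\<lambda>n. (real (k n) * s (r n)) *\<^sub>R (y \<circ> r) n) \<longlonglongrightarrow> t *\<^sub>R Y"
      by (intro tendsto_scaleR ks Y)
    moreover have "(real (k n) * s (r n)) *\<^sub>R (y \<circ> r) n = real (k n) *\<^sub>R (g (r n) - 1)" for n
      using s[of "r n"] by (simp add: y_def)
    ultimately have "(\<lambda>n. real (k n) *\<^sub>R (g (r n) - 1)) \<longlonglongrightarrow> t *\<^sub>R Y" by simp
    moreover have "(\<lambda>n. g (r n)) \<longlonglongrightarrow> 1"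
      using LIMSEQ_subseq_LIMSEQ[OF glim Y(2)] by (simp add: o_def)
    ultimately have "(\<lambda>n. g (r n) ^ k n) \<longlonglongrightarrow> exp (t *\<^sub>R Y)"
      by (intro tendsto_power_exp)
    moreover have "g (r n) ^ k n \<in> H" for n
      by (intro power_mem assms gH)
    ultimately show ?thesis
      by - (rule closed_sequentially[OF compact_imp_closed[OF assms(1)]])
  qed
  have "exp (t *\<^sub>R Y) \<in> H" for t
  proof (cases "t \<ge> 0")
    case False
    then have "exp ((-t) *\<^sub>R Y) \<in> H" by (intro pos) auto
    then obtain b where b: "b \<in> H" "exp ((-t) *\<^sub>R Y) * b = 1" using inv by blast
    have "exp (t *\<^sub>R Y) = exp (t *\<^sub>R Y) * (exp (- (t *\<^sub>R Y)) * b)" using b by simp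
    also have "\<dots> = b" by (simp add: mult.assoc[symmetric] exp_inverse_mult)
    finally show ?thesis using b by simp
  qed (rule pos)
  then have "Y \<in> lie_of H" by (simp add: lie_of_def)
  moreover have "Y \<noteq> 0" using Y(1) by auto
  ultimately show ?thesis using that by blast
qed

section \<open>Quaternions and rotations\<close>

unbundle cross3_syntax

definition rodrigues :: "real => real^3 => real^3 => real^3" where
  "rodrigues t u y = cos t *\<^sub>R y + sin t *\<^sub>R (u \<times> y) + ((1 - cos t) * (u \<bullet> y)) *\<^sub>R u"

type_synonym quat = "real \<times> (real^3)"

definition qmul :: "quat => quat => quat" where
  "qmul p q = (fst p * fst q - snd p \<bullet> snd q,
     fst p *\<^sub>R snd q + fst q *\<^sub>R snd p + snd p \<times> snd q)"

definition qconj :: "quat => quat" where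
  "qconj p = (fst p, - snd p)"

text \<open>The vector part of p y (conj p), written out. Being defined for all quaternions, it can
  be computed before normalizing, as in \<open>qrot_transitive\<close>.\<close>

definition qrot :: "quat => real^3 => real^3" where
  "qrot p y = (fst p ^ 2 - snd p \<bullet> snd p) *\<^sub>R y + (2 * (snd p \<bullet> y)) *\<^sub>R snd p + (2 * fst p) *\<^sub>R (snd p \<times> y)"

lemmas vec3_simps = vec_eq_iff forall_3 inner_vec_def sum_3 cross3_simps

lemma qmul_assoc: "qmul (qmul p q) r = qmul p (qmul q r)"
  by (simp add: qmul_def vec3_simps prod_eq_iff; algebra)

lemma qconj_qmul: "qconj (qmul p q) = qmul (qconj q) (qconj p)"
  by (simp add: qmul_def qconj_def vec3_simps prod_eq_iff)

lemma qrot_eq_qmul: "(0, qrot p y) = qmul (qmul p (0, y)) (qconj p)"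
  by (simp add: qmul_def qconj_def qrot_def vec3_simps prod_eq_iff power2_eq_square)

lemma qrot_qmul: "qrot (qmul p q) y = qrot p (qrot q y)"
proof -
  have "(0, qrot (qmul p q) y) = (0::real, qrot p (qrot q y))"
    by (simp only: qrot_eq_qmul qconj_qmul qmul_assoc)
  then show ?thesis by simp
qed

lemma norm_quat: "norm p = 1 \<longleftrightarrow> fst p ^ 2 + snd p \<bullet> snd p = 1"
  by (cases p) (simp add: norm_Pair power2_norm_eq_inner)

lemma norm_qmul: "norm p = 1 ==> norm q = 1 ==> norm (qmul p q) = 1"
proof -
  have "fst (qmul p q) ^ 2 + snd (qmul p q) \<bullet> snd (qmul p q) = (fst p ^ 2 + snd p \<bullet> snd p) * (fst q ^ 2 + snd q \<bullet> snd q)"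
    by (simp add: qmul_def vec3_simps power2_eq_square; algebra)
  then show "norm p = 1 ==> norm q = 1 ==> norm (qmul p q) = 1"
    by (simp add: norm_quat)
qed

lemma qmul_one [simp]: "qmul (1, 0) q = q" "qmul q (1, 0) = q"
  by (simp_all add: qmul_def prod_eq_iff cross_zero_left cross_zero_right)

lemma norm_qconj [simp]: "norm (qconj p) = norm p"
  by (cases p) (simp add: qconj_def norm_Pair)

lemma qmul_qconj: "norm p = 1 ==> qmul p (qconj p) = (1, 0)" "norm p = 1 ==> qmul (qconj p) p = (1, 0)"
  by (auto simp: qmul_def qconj_def norm_quat prod_eq_iff power2_eq_square cross_minus_right cross_minus_left cross_refl)

lemma continuous_on_qmul:
  fixes f g :: "'a::t2_space => quat"
  shows
  "continuous_on S f ==> continuous_on S g ==> continuous_on S (\<lambda>x. qmul (f x) (g x))"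
  unfolding qmul_def by (intro continuous_intros continuous_on_cross)

lemma qrot_linear: "qrot p (x + y) = qrot p x + qrot p y" "qrot p (c *\<^sub>R x) = c *\<^sub>R qrot p x"
  by (simp_all add: qrot_def cross_add_right cross_mult_right inner_right_distrib algebra_simps)

lemma qrot_scaleR: "qrot (c *\<^sub>R p) y = c\<^sup>2 *\<^sub>R qrot p y"
  by (simp add: qrot_def cross_mult_left power2_eq_square algebra_simps)

lemma qrot_one [simp]: "qrot (1, 0) y = y"
  by (simp add: qrot_def cross_zero_left)

lemma qrot_half_angle:
  assumes "norm u = 1"
  shows "qrot (cos (t/2), sin (t/2) *\<^sub>R u) y = rodrigues t u y"
proof -
  have "u \<bullet> u = 1" using assms by (simp add: norm_eq_1)
  moreover have "1 - cos t = 2 * sin (t/2) ^ 2" "sin t = 2 * sin (t/2) * cos (t/2)"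
    using cos_double_sin[of "t/2"] sin_double[of "t/2"] by auto
  moreover have "cos t = cos (t/2) ^ 2 - sin (t/2) ^ 2"
    using cos_double[of "t/2"] by simp
  ultimately have a1: "(cos (t/2))\<^sup>2 - (sin (t/2) *\<^sub>R u) \<bullet> (sin (t/2) *\<^sub>R u) = cos t"
    and a2: "(2 * (sin (t/2) *\<^sub>R u \<bullet> y)) *\<^sub>R (sin (t/2) *\<^sub>R u) = ((1 - cos t) * (u \<bullet> y)) *\<^sub>R u"
    and a3: "(2 * cos (t/2)) *\<^sub>R ((sin (t/2) *\<^sub>R u) \<times> y) = sin t *\<^sub>R (u \<times> y)"
    by (simp_all add: cross_mult_left power2_eq_square mult_ac)
  show ?thesis
    unfolding qrot_def rodrigues_def fst_conv snd_conv a1 a2 a3 by simp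
qed

lemma ex_unit_orthogonal3: "\<exists>w::real^3. norm w = 1 \<and> w \<bullet> u = 0"
proof -
  have "2 \<le> DIM(real^3)" by simp
  then obtain y :: "real^3" where "y \<noteq> 0" "orthogonal u y"
    using orthogonal_to_vector_exists[of u] by blast
  then show ?thesis
    by (intro exI[of _ "y /\<^sub>R norm y"]) (auto simp: orthogonal_def inner_commute)
qed

lemma qrot_transitive:
  assumes "norm u = 1" "norm v = 1"
  obtains p where "norm p = 1" "qrot p u = v"
proof (cases "v = - u")
  case True
  obtain w :: "real^3" where w: "norm w = 1" "w \<bullet> u = 0"
    using ex_unit_orthogonal3 by blast
  show thesis
  proof
    show "norm (0::real, w) = 1" using w by (simp add: norm_Pair)
    show "qrot (0, w) u = v" using w True by (simp add: qrot_def norm_eq_1)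
  qed
next
  case False
  \<comment> \<open>By the half-angle formulas this is the wanted unit quaternion scaled by twice
    the cosine of half the angle between \<open>u\<close> and \<open>v\<close>. It vanishes only for
    antipodal vectors, which a half turn about a perpendicular axis exchanges.\<close>
  define p0 :: quat where "p0 = (1 + u \<bullet> v, u \<times> v)"
  have uv: "u \<bullet> u = 1" "v \<bullet> v = 1" using assms by (auto simp: norm_eq_1)
  have lag: "(u \<times> v) \<bullet> (u \<times> v) = 1 - (u \<bullet> v)^2"
    using uv dot_cross[of u v u v] by (simp add: power2_eq_square inner_commute)
  have tri: "(u \<times> v) \<times> u = v - (u \<bullet> v) *\<^sub>R u"
    using uv cross_triple[of u v u] Lagrange[of u u v] by (simp add: cross_skew[of "u \<times> v" u] inner_commute algebra_simps)
  define s where "s = 2 * (1 + u \<bullet> v)"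
  have "u + v \<noteq> 0" using False by (metis add.commute add_eq_0_iff)
  then have "(u + v) \<bullet> (u + v) > 0" by simp
  then have s: "s > 0" using uv by (simp add: s_def inner_add_left inner_add_right inner_commute)
  have np: "fst p0 ^ 2 + snd p0 \<bullet> snd p0 = s"
    using lag by (simp add: p0_def s_def power2_eq_square algebra_simps)
  have r0: "qrot p0 u = s *\<^sub>R v"
    unfolding qrot_def p0_def fst_conv snd_conv lag tri
    by (simp add: dot_cross_self s_def power2_eq_square algebra_simps)
  define p where "p = (1 / sqrt s) *\<^sub>R p0"
  show thesis
  proof
    show "norm p = 1"
      unfolding norm_quat p_def using np s by (simp add: power_divide field_simps)
    show "qrot p u = v"
    proof -
      have "qrot p u = (1 / s) *\<^sub>R qrot p0 u"
        using s unfolding p_def qrot_scaleR by (simp add: power_divide)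
      then show ?thesis using r0 s by simp
    qed
  qed
qed

definition cross_automorphism :: "(real^3 => real^3) => bool" where
  "cross_automorphism A \<longleftrightarrow> linear A \<and> inj A \<and> (\<forall>x y. A (x \<times> y) = A x \<times> A y)"

lemma linear_qrot: "linear (qrot p)"
  by (rule linearI) (simp_all add: qrot_linear)

lemma qrot_qconj: "norm p = 1 ==> qrot p (qrot (qconj p) y) = y" "norm p = 1 ==> qrot (qconj p) (qrot p y) = y"
  by (simp_all add: qrot_qmul[symmetric] qmul_qconj)

text \<open>For the matrix M of an automorphism, the transpose of M times M acts on cross products,
  hence on all vectors, as det M. Taking determinants gives det M squared = det M cubed, so det M =
  1 and M is orthogonal.\<close>

lemma cross_automorphism_inner:
  assumes "cross_automorphism A"
  shows "A x \<bullet> A y = x \<bullet> y"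
proof -
  have lin: "linear A" and inj: "inj A" and cr: "\<And>x y. A (x \<times> y) = A x \<times> A y"
    using assms by (auto simp: cross_automorphism_def)
  define M where "M = matrix A"
  have M: "A x = M *v x" for x using lin by (simp add: M_def matrix_works)
  have detM: "det M \<noteq> 0"
    using inj lin unfolding M_def by (metis det_nz_iff_inj)
  have MM1: "transpose M *v (M *v (x \<times> y)) = det M *\<^sub>R (x \<times> y)" for x y
    using cross_matrix_mult[of M x y] cr M by metis
  have span: "\<exists>x y. z = x \<times> y" for z :: "real^3"
  proof -
    obtain w :: "real^3" where w: "norm w = 1" "w \<bullet> z = 0" using ex_unit_orthogonal3 by blast
    have "w \<times> (z \<times> w) = z"
      using w by (simp add: Lagrange norm_eq_1 inner_commute)
    then show ?thesis by metis
  qed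
  have MM: "transpose M *v (M *v z) = det M *\<^sub>R z" for z
    using span[of z] MM1 by metis
  have "transpose M ** M = det M *\<^sub>R mat 1"
    using MM by (intro matrix_eq[THEN iffD2]) (simp add: matrix_vector_mul_assoc[symmetric] scaleR_matrix_vector_assoc[symmetric])
  then have "det (transpose M ** M) = det (det M *\<^sub>R (mat 1 :: real^3^3))" by simp
  moreover have "det (c *\<^sub>R (mat 1 :: real^3^3)) = c ^ 3" for c
    by (simp add: det_3 mat_def power3_eq_cube)
  ultimately have "det M * det M = det M ^ 3"
    by (simp only: det_mul det_transpose)
  then have "det M = 1" using detM by (simp add: power3_eq_cube)
  then have "A x \<bullet> A y = x \<bullet> (transpose M *v (M *v y))" for x y
    unfolding M by (simp only: transpose_matrix_vector inner_commute[of x] dot_lmul_matrix) (simp add: inner_commute)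
  then show ?thesis using MM \<open>det M = 1\<close> by simp
qed

text \<open>The cross product is the vector part of the product of two imaginary quaternions, and
  conjugation respects products.\<close>

lemma cross_automorphism_qrot: "norm p = 1 ==> cross_automorphism (qrot p)"
proof -
  assume p: "norm p = 1"
  have "qrot p (x \<times> y) = qrot p x \<times> qrot p y" for x y
  proof -
    let ?c = "\<lambda>q. qmul (qmul p q) (qconj p)"
    have "?c (qmul (0, x) (0, y)) = qmul (?c (0, x)) (?c (0, y))"
      by (metis p qmul_assoc qmul_one(1) qmul_qconj(2))
    then have "snd (?c (-(x \<bullet> y), x \<times> y)) = snd (qmul (0, qrot p x) (0, qrot p y))"
      unfolding qrot_eq_qmul[symmetric] by (simp add: qmul_def)
    moreover have "snd (?c (a, z)) = qrot p z" for a z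
      by (simp add: qmul_def qconj_def qrot_def vec3_simps power2_eq_square)
    ultimately have "qrot p (x \<times> y) = snd (qmul (0, qrot p x) (0, qrot p y))"
      by (simp only:)
    then show ?thesis
      by (simp add: qmul_def)
  qed
  moreover have "inj (qrot p)" using qrot_qconj(2)[OF p] by (metis injI)
  ultimately show ?thesis by (simp add: cross_automorphism_def linear_qrot)
qed

lemma cross_automorphism_comp: "cross_automorphism A ==> cross_automorphism B ==> cross_automorphism (A \<circ> B)"
  by (auto simp: cross_automorphism_def linear_compose inj_compose)

abbreviation "e3 \<equiv> axis 3 1 :: real^3"

text \<open>All automorphisms of su(2) are inner; this is what controls the components of a
  disconnected group. After turning the image of \<open>e3\<close> back, the automorphism fixes
  \<open>e3\<close> and turns the plane orthogonal to it by some angle \<open>t\<close>.\<close>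

lemma cross_automorphism_imp_qrot:
  assumes "cross_automorphism A"
  obtains p where "norm p = 1" "A = qrot p"
proof -
  have nA: "norm (A x) = norm x" for x
    using cross_automorphism_inner[OF assms] by (simp add: norm_eq_sqrt_inner)
  obtain p1 where p1: "norm p1 = 1" "qrot p1 (A e3) = e3"
    using qrot_transitive[of "A e3" e3] nA by auto
  define B where "B = qrot p1 \<circ> A"
  have B: "cross_automorphism B" unfolding B_def
    using cross_automorphism_comp cross_automorphism_qrot p1 assms by blast
  have B3: "B e3 = e3" using p1 by (simp add: B_def)
  define c s where "c = B (axis 1 1) $ 1" and "s = B (axis 1 1) $ 2"
  have "B (axis 1 1) \<bullet> B e3 = 0"
    using cross_automorphism_inner[OF B] by (simp add: inner_axis_axis)
  then have z0: "B (axis 1 1) $ 3 = 0" using B3 by (simp add: inner_axis)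
  have "B (axis 1 1) \<bullet> B (axis 1 1) = 1"
    using cross_automorphism_inner[OF B] by (simp add: inner_axis_axis)
  then have "c^2 + s^2 = 1"
    using z0 by (simp add: c_def s_def inner_vec_def sum_3 power2_eq_square)
  then obtain t where t: "c = cos t" "s = sin t"
    using sincos_total_2pi by metis
  define r where "r = (cos (t/2), sin (t/2) *\<^sub>R e3)"
  have r: "qrot r y = rodrigues t e3 y" for y
    unfolding r_def by (rule qrot_half_angle) (simp add: norm_axis_1)
  have nr: "norm r = 1"
    unfolding r_def norm_quat by (simp add: inner_axis_axis power2_eq_square[symmetric])
  have r3: "qrot r e3 = e3" unfolding r by (simp add: rodrigues_def inner_axis_axis algebra_simps)
  have r1: "qrot r (axis 1 1) = B (axis 1 1)"
  proof -
    have "e3 \<bullet> axis 1 1 = 0" by (simp add: inner_axis_axis)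
    then have "qrot r (axis 1 1) = cos t *\<^sub>R axis 1 1 + sin t *\<^sub>R axis 2 1"
      unfolding r rodrigues_def by (simp add: cross_basis)
    then show ?thesis
      using t z0 by (simp add: vec_eq_iff forall_3 c_def s_def axis_def)
  qed
  have crB: "B (x \<times> y) = B x \<times> B y" and crr: "qrot r (x \<times> y) = qrot r x \<times> qrot r y" for x y
    using B cross_automorphism_qrot[OF nr] by (auto simp: cross_automorphism_def)
  have r2: "qrot r (axis 2 1) = B (axis 2 1)"
    using crB[of e3 "axis 1 1"] crr[of e3 "axis 1 1"] r3 r1 B3 by (simp add: cross_basis)
  have "B = qrot r"
  proof (rule linear_eq_stdbasis)
    show "linear B" using B by (simp add: cross_automorphism_def)
    show "linear (qrot r)" by (rule linear_qrot)
    fix b :: "real^3" assume "b \<in> Basis"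
    then show "B b = qrot r b" using r1 r2 r3 B3 by (auto simp: Basis_vec_def axis_eq_axis UNIV_3)
  qed
  then have "A = qrot (qmul (qconj p1) r)"
    using qrot_qconj(2)[OF p1(1)] unfolding B_def by (metis comp_apply ext qrot_qmul)
  moreover have "norm (qmul (qconj p1) r) = 1"
    by (rule norm_qmul) (use p1 nr in auto)
  ultimately show ?thesis using that by blast
qed

unbundle no cross3_syntax

section \<open>Compact groups with Lie algebra su(2)\<close>

unbundle cross3_syntax

locale su2_triple =
  fixes lin :: "real^3 => 'a::{real_normed_algebra_1,banach}"
  assumes linear_lin: "linear lin" and inj_lin: "inj lin"
    and bracket: "lin x * lin y - lin y * lin x = lin (x \<times> y)"
begin

lemma lin_simps: "lin (x + y) = lin x + lin y" "lin (c *\<^sub>R x) = c *\<^sub>R lin x" "lin (- x) = - lin x" "lin 0 = 0"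
  using linear_lin by (auto simp: linear_add linear_scale linear_neg linear_0)

lemma bounded_linear_lin: "bounded_linear lin"
  using linear_lin by (simp add: linear_conv_bounded_linear)

lemma rodrigues_derivative:
  assumes "norm u = 1"
  shows "((\<lambda>s. rodrigues s u y) has_vector_derivative u \<times> rodrigues t u y) (at t)"
proof -
  have u: "u \<bullet> u = 1" using assms by (simp add: norm_eq_1)
  have "((\<lambda>s. rodrigues s u y) has_vector_derivative
     (- sin t) *\<^sub>R y + cos t *\<^sub>R (u \<times> y) + (sin t * (u \<bullet> y)) *\<^sub>R u) (at t)"
    unfolding rodrigues_def
    by (auto intro!: derivative_eq_intros simp: has_vector_derivative_def algebra_simps fun_eq_iff)
  moreover have "u \<times> (u \<times> y) = (u \<bullet> y) *\<^sub>R u - y"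
    using u by (simp add: Lagrange)
  then have "u \<times> rodrigues t u y = (- sin t) *\<^sub>R y + cos t *\<^sub>R (u \<times> y) + (sin t * (u \<bullet> y)) *\<^sub>R u"
    by (simp add: rodrigues_def cross_add_right cross_mult_right scaleR_diff_right)
  ultimately show ?thesis by simp
qed

text \<open>The curve \<open>f\<close> obtained by undoing the conjugation has derivative 0, because
  the rotated vector solves the equation y' = u \<times> y and the bracket of \<open>lin\<close> is
  the cross product.\<close>

lemma exp_lin_conjugate:
  assumes "norm u = 1"
  shows "exp (t *\<^sub>R lin u) * lin y = lin (rodrigues t u y) * exp (t *\<^sub>R lin u)"
proof -
  let ?X = "lin u"
  define f where "f = (\<lambda>s. exp (s *\<^sub>R (- ?X)) * (lin (rodrigues s u y) * exp (s *\<^sub>R ?X)))"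
  have "(f has_vector_derivative 0) (at s)" for s
  proof -
    let ?r = "rodrigues s u y"
    have "((\<lambda>s. lin (rodrigues s u y)) has_vector_derivative lin (u \<times> ?r)) (at s)"
      by (rule bounded_linear.has_vector_derivative[OF bounded_linear_lin rodrigues_derivative[OF assms]])
    then have "(f has_vector_derivative
       exp (s *\<^sub>R (- ?X)) * (lin ?r * (?X * exp (s *\<^sub>R ?X)) + lin (u \<times> ?r) * exp (s *\<^sub>R ?X)) +
       (exp (s *\<^sub>R (- ?X)) * (- ?X)) * (lin ?r * exp (s *\<^sub>R ?X))) (at s)"
      unfolding f_def
      by (intro bounded_bilinear.has_vector_derivative[OF bounded_bilinear_mult]
            exp_scaleR_has_vector_derivative_right exp_scaleR_has_vector_derivative_left)
    then show ?thesis
      unfolding bracket[symmetric] by (simp add: algebra_simps)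
  qed
  then obtain c where "f s = c" for s
    using has_vector_derivative_zero_constant[of UNIV f] by auto
  then have "f t = f 0" by simp
  moreover have "f 0 = lin y" by (simp add: f_def rodrigues_def)
  ultimately have "exp (t *\<^sub>R ?X) * f t = exp (t *\<^sub>R ?X) * lin y" by simp
  moreover have "exp (t *\<^sub>R ?X) * f t = lin (rodrigues t u y) * exp (t *\<^sub>R ?X)"
    using exp_inverse_mult(2)[of "t *\<^sub>R ?X"] by (simp add: f_def mult.assoc[symmetric])
  ultimately show ?thesis by simp
qed

definition full_turn :: 'a where
  "full_turn = exp ((2 * pi) *\<^sub>R lin e3)"

text \<open>The unit quaternion \<open>cos (t/2) + sin (t/2) u\<close> is sent to \<open>exp (t u)\<close>; at \<open>-1\<close> the direction
  \<open>u\<close> is lost, but \<open>exp (2 \<pi> u)\<close> does not depend on it.\<close>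

definition rho :: "quat => 'a" where
  "rho p = (if snd p = 0 then (if fst p > 0 then 1 else full_turn)
     else exp ((2 * arccos (fst p)) *\<^sub>R lin (snd p /\<^sub>R norm (snd p))))"

lemma unit_quat_cases:
  fixes p :: quat
  assumes "norm p = 1"
  obtains (one) "p = (1, 0)" | (minus) "p = (-1, 0)"
  | (gen) u t where "norm u = 1" "p = (cos (t/2), sin (t/2) *\<^sub>R u)" "snd p \<noteq> 0"
      "t = 2 * arccos (fst p)" "u = snd p /\<^sub>R norm (snd p)"
proof (cases "snd p = 0")
  case True
  then have "fst p ^ 2 = 1" using assms unfolding norm_quat by simp
  then have "fst p = 1 \<or> fst p = -1" by (simp add: power2_eq_1_iff)
  with True that(1,2) show ?thesis by (metis prod.collapse)
next
  case False
  let ?t = "2 * arccos (fst p)"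
  have sq: "fst p ^ 2 + norm (snd p) ^ 2 = 1"
    using assms by (simp add: norm_quat power2_norm_eq_inner)
  then have "(fst p)\<^sup>2 \<le> 1" by (metis le_add_same_cancel1 zero_le_power2)
  then have "\<bar>fst p\<bar> \<le> 1" by (simp add: abs_square_le_1)
  then have a: "-1 \<le> fst p" "fst p \<le> 1" by auto
  have "sin (arccos (fst p)) = sqrt (1 - fst p ^ 2)" using a by (rule sin_arccos)
  also have "1 - fst p ^ 2 = norm (snd p) ^ 2" using sq by simp
  finally have "sin (arccos (fst p)) = norm (snd p)" by simp
  then show ?thesis
    using that(3)[of "snd p /\<^sub>R norm (snd p)" ?t] False a by (cases p) auto
qed

lemma rodrigues_2pi: "rodrigues (2 * pi) u y = y"
  by (simp add: rodrigues_def)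

lemma rho_gen:
  assumes "snd p \<noteq> 0" "t = 2 * arccos (fst p)" "u = snd p /\<^sub>R norm (snd p)"
  shows "rho p = exp (t *\<^sub>R lin u)"
  using assms by (simp add: rho_def)

lemma rho_conjugate:
  assumes "norm p = 1"
  shows "rho p * lin y = lin (qrot p y) * rho p"
  using assms
proof (cases p rule: unit_quat_cases)
  case one
  then show ?thesis by (simp add: rho_def)
next
  case minus
  have "full_turn * lin y = lin y * full_turn"
    unfolding full_turn_def by (subst exp_lin_conjugate) (simp_all add: rodrigues_2pi)
  then show ?thesis using minus by (simp add: rho_def qrot_def)
next
  case (gen u t)
  have "qrot p y = rodrigues t u y"
    unfolding gen(2) by (rule qrot_half_angle[OF gen(1)])
  then show ?thesis
    unfolding rho_gen[OF gen(3-5)] using exp_lin_conjugate[OF gen(1)] by simp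
qed

lemma commute_rho:
  assumes c: "\<And>y. c * lin y = lin y * c" and p: "norm p = 1"
  shows "c * rho p = rho p * c"
proof -
  have "c * exp (t *\<^sub>R lin u) = exp (t *\<^sub>R lin u) * c" for t u
    by (rule exp_intertwine) (simp add: c)
  then show ?thesis by (auto simp: rho_def full_turn_def)
qed

lemma full_turn_commute: "norm u = 1 ==> exp ((2 * pi) *\<^sub>R lin u) * lin y = lin y * exp ((2 * pi) *\<^sub>R lin u)"
  by (subst exp_lin_conjugate) (simp_all add: rodrigues_2pi)

lemma rho_unit: "\<exists>b. rho p * b = 1 \<and> b * rho p = 1"
proof -
  have "\<exists>b. exp X * b = 1 \<and> b * exp X = 1" for X :: 'a
    using exp_inverse_mult by blast
  then show ?thesis by (auto simp: rho_def full_turn_def)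
qed

text \<open>A rotation taking \<open>u\<close> to \<open>e3\<close> conjugates one full turn into
  the other. A full turn commutes with every \<open>lin y\<close>, hence with \<open>rho p\<close>,
  so the conjugation changes nothing. Only conjugation by \<open>rho\<close> is used; its
  multiplicativity comes later.\<close>

lemma full_turn_eq:
  assumes "norm u = 1"
  shows "exp ((2 * pi) *\<^sub>R lin u) = full_turn"
proof -
  obtain p where p: "norm p = 1" "qrot p u = e3"
    using qrot_transitive[of u e3] assms by auto
  have "rho p * exp ((2 * pi) *\<^sub>R lin u) = full_turn * rho p"
    unfolding full_turn_def by (rule exp_intertwine) (simp add: rho_conjugate p)
  then have "exp ((2 * pi) *\<^sub>R lin u) * rho p = full_turn * rho p"
    using commute_rho[OF full_turn_commute[OF assms] p(1)] by simp
  then show ?thesis using rho_unit[of p] by (metis mult.assoc mult.right_neutral)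
qed

lemma rho_one [simp]: "rho (1, 0) = 1"
  by (simp add: rho_def)

lemma rho_qconj:
  assumes "norm p = 1"
  shows "rho (qconj p) * rho p = 1"
  using assms
proof (cases p rule: unit_quat_cases)
  case minus
  have "full_turn = exp ((2 * pi) *\<^sub>R lin (- e3))"
    by (rule full_turn_eq[symmetric]) auto
  then have "full_turn * full_turn = 1"
    using exp_inverse_mult(1)[of "(2 * pi) *\<^sub>R lin e3"] by (simp add: lin_simps full_turn_def)
  then show ?thesis using minus by (simp add: rho_def qconj_def)
next
  case (gen u t)
  have "rho (qconj p) = exp (- (t *\<^sub>R lin u))"
    using gen(3-5) by (subst rho_gen[where t=t and u="-u"]) (auto simp: qconj_def lin_simps)
  then show ?thesis unfolding rho_gen[OF gen(3-5)] by (simp add: exp_inverse_mult)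
qed (simp add: qconj_def)

lemma rho_qconj': "norm p = 1 ==> rho p * rho (qconj p) = 1"
proof -
  have "qconj (qconj p) = p" by (simp add: qconj_def)
  then show "norm p = 1 ==> rho p * rho (qconj p) = 1"
    using rho_qconj[of "qconj p"] by simp
qed

text \<open>The axis has no limit at 1 and at -1; at these two points continuity rests on the bound
  \<open>bd1\<close>, which is uniform in the axis.\<close>

lemma continuous_on_rho: "continuous_on (sphere 0 1) rho"
  unfolding continuous_on_eq_continuous_within
proof
  fix p :: quat assume p: "p \<in> sphere 0 1"
  then have np: "norm p = 1" by simp
  obtain K where K: "K > 0" "\<And>x. norm (lin x) \<le> norm x * K"
    using bounded_linear.pos_bounded[OF bounded_linear_lin] by blast
  have bd1: "norm (exp (s *\<^sub>R lin u) - 1) \<le> \<bar>s\<bar> * K * exp (2 * pi * K)"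
    if "\<bar>s\<bar> \<le> 2 * pi" "norm u = 1" for s u
  proof -
    have 1: "norm (s *\<^sub>R lin u) \<le> \<bar>s\<bar> * K" using K(2)[of u] that by (simp add: mult_left_mono)
    also have "\<dots> \<le> 2 * pi * K" using that K(1) by (intro mult_right_mono) auto
    finally have 2: "norm (s *\<^sub>R lin u) \<le> 2 * pi * K" .
    have "norm (exp (s *\<^sub>R lin u) - exp 0) \<le> norm (s *\<^sub>R lin u - 0) * exp (2 * pi * K)"
      by (rule norm_exp_diff_le[OF 2]) (use K(1) in auto)
    also have "\<dots> \<le> \<bar>s\<bar> * K * exp (2 * pi * K)" using 1 by (simp add: mult_right_mono)
    finally show ?thesis by simp
  qed
  have arc: "((\<lambda>q. arccos (fst q)) \<longlongrightarrow> arccos (fst p)) (at p within sphere 0 1)"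
  proof -
    have "continuous_on (sphere 0 1) (\<lambda>q::quat. arccos (fst q))"
    proof (intro continuous_on_compose2[OF continuous_on_arccos'] continuous_intros)
      show "fst ` sphere (0::quat) 1 \<subseteq> {-1..1}"
        using norm_fst_le[of "fst _" "snd _"] by (auto simp: abs_le_iff) (smt (verit) norm_fst_le real_norm_def)+
    qed
    then show ?thesis using p by (simp add: continuous_on_def)
  qed
  have arcb: "0 \<le> arccos (fst q) \<and> arccos (fst q) \<le> pi" if "norm q = 1" for q :: quat
    using norm_fst_le[of "fst q" "snd q"] that by (intro arccos_bounded) (auto simp: abs_le_iff)
  have fstlim: "((\<lambda>q. fst q) \<longlongrightarrow> fst p) (at p within sphere 0 1)"
    by (intro tendsto_intros)
  show "continuous (at p within sphere 0 1) rho"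
    using np
  proof (cases p rule: unit_quat_cases)
    case one
    have "((\<lambda>q. rho q - 1) \<longlongrightarrow> 0) (at p within sphere 0 1)"
    proof (rule Lim_null_comparison)
      have "\<forall>\<^sub>F q in at p within sphere 0 1. fst q > 0"
        using order_tendstoD(1)[OF fstlim, of 0] one by simp
      moreover have "\<forall>\<^sub>F q in at p within sphere 0 1. norm q = 1"
        by (auto simp: eventually_at_filter)
      ultimately show "\<forall>\<^sub>F q in at p within sphere 0 1. norm (rho q - 1) \<le> \<bar>2 * arccos (fst q)\<bar> * K * exp (2 * pi * K)"
      proof eventually_elim
        case (elim q)
        then show ?case
          using bd1[of "2 * arccos (fst q)" "snd q /\<^sub>R norm (snd q)"] arcb[of q] K(1) by (auto simp: rho_def)
      qed
      have "((\<lambda>q. \<bar>2 * arccos (fst q)\<bar> * K * exp (2 * pi * K)) \<longlongrightarrow> \<bar>2 * arccos (fst p)\<bar> * K * exp (2 * pi * K)) (at p within sphere 0 1)"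
        by (intro tendsto_intros arc)
      then show "((\<lambda>q. \<bar>2 * arccos (fst q)\<bar> * K * exp (2 * pi * K)) \<longlongrightarrow> 0) (at p within sphere 0 1)"
        using one by simp
    qed
    then show ?thesis using one by (simp add: continuous_within LIM_zero_iff)
  next
    case minus
    have "((\<lambda>q. rho q - full_turn) \<longlongrightarrow> 0) (at p within sphere 0 1)"
    proof (rule Lim_null_comparison)
      have "\<forall>\<^sub>F q in at p within sphere 0 1. fst q < 0"
        using order_tendstoD(2)[OF fstlim, of 0] minus by simp
      moreover have "\<forall>\<^sub>F q in at p within sphere 0 1. norm q = 1"
        by (auto simp: eventually_at_filter)
      ultimately show "\<forall>\<^sub>F q in at p within sphere 0 1. norm (rho q - full_turn)
          \<le> norm full_turn * (\<bar>2 * arccos (fst q) - 2 * pi\<bar> * K * exp (2 * pi * K))"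
      proof eventually_elim
        case (elim q)
        show ?case
        proof (cases "snd q = 0")
          case True
          then show ?thesis using elim K(1) by (simp add: rho_def)
        next
          case False
          let ?u = "snd q /\<^sub>R norm (snd q)" and ?s = "2 * arccos (fst q)"
          have u: "norm ?u = 1" using False by simp
          \<comment> \<open>Splitting off the full turn, which is the same for all axes, leaves an
            exponent that tends to 0 as \<open>q\<close> approaches -1.\<close>
          have "full_turn * exp ((?s - 2 * pi) *\<^sub>R lin ?u) = exp ((2 * pi) *\<^sub>R lin ?u + (?s - 2 * pi) *\<^sub>R lin ?u)"
            unfolding full_turn_eq[OF u, symmetric] by (rule exp_add_commuting[symmetric]) simp
          also have "\<dots> = rho q" using False by (simp add: rho_def scaleR_left_distrib[symmetric])
          finally have "rho q - full_turn = full_turn * (exp ((?s - 2 * pi) *\<^sub>R lin ?u) - 1)"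
            by (simp add: algebra_simps)
          also have "norm \<dots> \<le> norm full_turn * norm (exp ((?s - 2 * pi) *\<^sub>R lin ?u) - 1)"
            by (rule norm_mult_ineq)
          also have "\<dots> \<le> norm full_turn * (\<bar>?s - 2 * pi\<bar> * K * exp (2 * pi * K))"
            using arcb[of q] elim u by (intro mult_left_mono bd1) auto
          finally show ?thesis .
        qed
      qed
      have "((\<lambda>q. norm full_turn * (\<bar>2 * arccos (fst q) - 2 * pi\<bar> * K * exp (2 * pi * K))) \<longlongrightarrow>
         norm full_turn * (\<bar>2 * arccos (fst p) - 2 * pi\<bar> * K * exp (2 * pi * K))) (at p within sphere 0 1)"
        by (intro tendsto_intros arc)
      then show "((\<lambda>q. norm full_turn * (\<bar>2 * arccos (fst q) - 2 * pi\<bar> * K * exp (2 * pi * K))) \<longlongrightarrow> 0) (at p within sphere 0 1)"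
        using minus by simp
    qed
    moreover have "rho p = full_turn" using minus by (simp add: rho_def)
    ultimately show ?thesis by (simp add: continuous_within LIM_zero_iff)
  next
    case (gen u t)
    have sndlim: "((\<lambda>q. snd q) \<longlongrightarrow> snd p) (at p within sphere 0 1)"
      by (intro tendsto_intros)
    have "((\<lambda>q. exp ((2 * arccos (fst q)) *\<^sub>R lin (snd q /\<^sub>R norm (snd q)))) \<longlongrightarrow> rho p) (at p within sphere 0 1)"
      unfolding rho_gen[OF gen(3-5)] gen(4) gen(5)
      using gen(3) by (intro tendsto_exp_algebra tendsto_scaleR tendsto_mult tendsto_const arc
          bounded_linear.tendsto[OF bounded_linear_lin] tendsto_inverse tendsto_norm sndlim) auto
    moreover have "\<forall>\<^sub>F q in at p within sphere 0 1. exp ((2 * arccos (fst q)) *\<^sub>R lin (snd q /\<^sub>R norm (snd q))) = rho q"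
      using tendsto_imp_eventually_ne[OF sndlim gen(3)] by eventually_elim (simp add: rho_def)
    ultimately show ?thesis
      unfolding continuous_within by (rule Lim_transform_eventually)
  qed
qed

end

locale compact_su2_group = su2_triple lin for lin :: "real^3 => 'a::{real_normed_algebra_1,banach,heine_borel}" +
  fixes H :: "'a set"
  assumes compact_H: "compact H" and one_H: "1 \<in> H"
    and mult_H: "a \<in> H ==> b \<in> H ==> a * b \<in> H"
    and inv_H: "a \<in> H ==> \<exists>b\<in>H. a * b = 1 \<and> b * a = 1"
    and lie_H: "lie_of H = range lin"
begin

definition centralizer :: "'a set" where
  "centralizer = {z \<in> H. \<forall>y. z * lin y = lin y * z}"

lemma rho_in_H: "rho p \<in> H"
proof -
  have "exp (t *\<^sub>R lin u) \<in> H" for t u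
    using lie_H unfolding lie_of_def by blast
  then show ?thesis using one_H by (auto simp: rho_def full_turn_def)
qed

lemma centralizer_H: "z \<in> centralizer ==> z \<in> H"
  by (simp add: centralizer_def)

lemma one_centralizer: "1 \<in> centralizer"
  by (simp add: centralizer_def one_H)

lemma mult_centralizer: "a \<in> centralizer ==> b \<in> centralizer ==> a * b \<in> centralizer"
  unfolding centralizer_def using mult_H by (auto simp: mult.assoc) (simp add: mult.assoc[symmetric])

lemma inv_centralizer:
  assumes "a \<in> centralizer" shows "\<exists>b\<in>centralizer. a * b = 1 \<and> b * a = 1"
proof -
  obtain b where b: "b \<in> H" "a * b = 1" "b * a = 1"
    using inv_H assms by (auto simp: centralizer_def)
  have "b * lin y = lin y * b" for y
  proof -
    have "b * lin y = b * (lin y * a) * b" using b by (simp add: mult.assoc)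
    also have "lin y * a = a * lin y" using assms by (simp add: centralizer_def)
    finally show ?thesis using b by (simp add: mult.assoc[symmetric])
  qed
  then show ?thesis using b by (auto simp: centralizer_def)
qed

lemma centralizer_rho: "z \<in> centralizer ==> norm p = 1 ==> z * rho p = rho p * z"
  by (rule commute_rho) (auto simp: centralizer_def)

text \<open>An infinite centralizer would contain a one-parameter group, whose direction lies in
  \<open>range lin\<close>. But a half turn about \<open>u\<close> negates the vectors orthogonal to
  \<open>u\<close> and so commutes with none of them.\<close>

lemma finite_centralizer: "finite centralizer"
proof (rule ccontr)
  assume inf: "infinite centralizer"
  have "closed {z. \<forall>y. z * lin y = lin y * z}"
    by (intro closed_Collect_all closed_Collect_eq continuous_intros)
  moreover have "centralizer = H \<inter> {z. \<forall>y. z * lin y = lin y * z}"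
    by (auto simp: centralizer_def)
  ultimately have "compact centralizer"
    using compact_H by (simp add: compact_Int_closed)
  then obtain X where X: "X \<noteq> 0" "X \<in> lie_of centralizer"
    using infinite_compact_subgroup_lie[OF _ one_centralizer mult_centralizer inv_centralizer inf] by blast
  have "X \<in> lie_of H" using X(2) centralizer_H by (auto simp: lie_of_def)
  then obtain x where x: "X = lin x" using lie_H by auto
  then have x0: "x \<noteq> 0" using X(1) lin_simps(4) by auto
  define u where "u = x /\<^sub>R norm x"
  have u: "norm u = 1" using x0 by (simp add: u_def)
  obtain w :: "real^3" where w: "norm w = 1" "w \<bullet> u = 0" using ex_unit_orthogonal3 by blast
  have "pi *\<^sub>R lin u = (pi / norm x) *\<^sub>R X" by (simp add: x u_def lin_simps divide_inverse)
  then have c: "exp (pi *\<^sub>R lin u) \<in> centralizer"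
    using X(2) by (auto simp: lie_of_def)
  obtain b where b: "exp (pi *\<^sub>R lin u) * b = 1"
    using inv_centralizer[OF c] by blast
  have "lin w * exp (pi *\<^sub>R lin u) = lin (rodrigues pi u w) * exp (pi *\<^sub>R lin u)"
    using exp_lin_conjugate[OF u, of pi w] c by (simp add: centralizer_def)
  then have "lin w = lin (rodrigues pi u w)"
    using b by (metis mult.assoc mult.right_neutral)
  then have "w = rodrigues pi u w" using inj_lin by (simp add: inj_def)
  also have "\<dots> = - w" using w by (simp add: rodrigues_def inner_commute)
  finally have "w \<bullet> w = (- w) \<bullet> w" by (rule arg_cong)
  then show False using w by (simp add: norm_eq_1)
qed

text \<open>The defect of multiplicativity \<open>k\<close> is continuous on a connected set. It
  commutes with the Lie algebra, so its values lie in the finite centralizer; hence it is constant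
  and equal to its value 1 at the identity.\<close>

lemma rho_qmul:
  assumes "norm p = 1" "norm q = 1"
  shows "rho (qmul p q) = rho p * rho q"
proof -
  let ?S = "sphere (0::quat) 1"
  define k where "k = (\<lambda>x. rho (fst x) * rho (snd x) * rho (qconj (qmul (fst x) (snd x))))"
  have kZ: "k x \<in> centralizer" if "x \<in> Sigma ?S (\<lambda>_. ?S)" for x
  proof -
    obtain a b where x: "x = (a, b)" by (cases x)
    then have ab: "x = (a, b)" "norm a = 1" "norm b = 1" using that by simp_all
    let ?c = "qconj (qmul a b)"
    have nc: "norm (qmul a b) = 1" using ab norm_qmul by blast
    have "k x * lin y = lin y * k x" for y
    proof -
      have "k x * lin y = rho a * (rho b * (rho ?c * lin y))" by (simp add: k_def ab mult.assoc)
      also have "rho ?c * lin y = lin (qrot ?c y) * rho ?c" by (rule rho_conjugate) (simp add: nc)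
      also have "rho b * \<dots> = lin (qrot b (qrot ?c y)) * (rho b * rho ?c)"
        by (simp add: mult.assoc[symmetric] rho_conjugate ab)
      also have "rho a * \<dots> = lin (qrot a (qrot b (qrot ?c y))) * k x"
        by (simp add: mult.assoc[symmetric] rho_conjugate ab k_def)
      also have "qrot a (qrot b (qrot ?c y)) = y"
        unfolding qrot_qmul[symmetric, of a b] by (rule qrot_qconj(1)[OF nc])
      finally show ?thesis .
    qed
    moreover have "k x \<in> H" by (simp add: k_def mult_H rho_in_H)
    ultimately show ?thesis by (simp add: centralizer_def)
  qed
  have cq: "continuous_on T (\<lambda>x. qconj (g x))" if "continuous_on T g" for T and g :: "quat \<times> quat => quat"
    unfolding qconj_def by (intro continuous_intros that)
  have "continuous_on (Sigma ?S (\<lambda>_. ?S)) k"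
    unfolding k_def
    by (intro continuous_on_mult continuous_on_compose2[OF continuous_on_rho] cq continuous_on_qmul
          continuous_on_fst continuous_on_snd continuous_on_id)
      (auto simp: norm_qmul)
  moreover have "connected (Sigma ?S (\<lambda>_. ?S))"
    by (intro connected_Times connected_sphere) auto
  ultimately have "connected (k ` (Sigma ?S (\<lambda>_. ?S)))" by (rule connected_continuous_image)
  moreover have "finite (k ` (Sigma ?S (\<lambda>_. ?S)))"
    using kZ by (intro finite_subset[OF _ finite_centralizer]) auto
  moreover have "k ((1,0), (1,0)) \<in> k ` (Sigma ?S (\<lambda>_. ?S))" "k (p, q) \<in> k ` (Sigma ?S (\<lambda>_. ?S))"
    using assms by (intro imageI; simp add: norm_Pair)+
  ultimately have "k (p, q) = k ((1,0), (1,0))"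
    using connected_finite_iff_sing by (metis empty_iff singletonD)
  also have "\<dots> = 1" by (simp add: k_def qconj_def)
  finally have "rho p * rho q * rho (qconj (qmul p q)) = 1" by (simp add: k_def)
  then have "rho p * rho q * (rho (qconj (qmul p q)) * rho (qmul p q)) = rho (qmul p q)"
    by (simp add: mult.assoc[symmetric])
  then show ?thesis
    unfolding rho_qconj[OF norm_qmul[OF assms]] by simp
qed

text \<open>Conjugation by \<open>h\<close> induces an automorphism of the Lie algebra, hence agrees
  with conjugation by some \<open>rho p\<close>; the quotient of the two elements centralizes the
  Lie algebra.\<close>

lemma H_decomposition:
  assumes "h \<in> H"
  obtains p z where "norm p = 1" "z \<in> centralizer" "h = rho p * z"
proof -
  obtain h' where h': "h' \<in> H" "h * h' = 1" "h' * h = 1" using inv_H assms by blast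
  have "h * lin y * h' \<in> range lin" for y
    using lie_of_conjugate[OF mult_H assms h'(1,3,2), of "lin y"] lie_H by auto
  then have "\<exists>a. h * lin y * h' = lin a" for y by (simp add: image_iff)
  then obtain A where A: "\<And>y. h * lin y * h' = lin (A y)" by metis
  have Ah: "h * lin y = lin (A y) * h" for y
    by (simp add: A[symmetric] mult.assoc h')
  have "cross_automorphism A"
    unfolding cross_automorphism_def
  proof (intro conjI allI)
    have inj: "lin a = lin b ==> a = b" for a b using inj_lin by (simp add: inj_def)
    show "linear A"
    proof (rule linearI)
      show "A (x + y) = A x + A y" for x y
        by (rule inj) (simp add: A[symmetric] lin_simps algebra_simps)
      show "A (c *\<^sub>R x) = c *\<^sub>R A x" for c x
        by (rule inj) (simp add: A[symmetric] lin_simps)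
    qed
    show "inj A"
    proof (rule injI)
      fix x y assume "A x = A y"
      then have "h * lin x = h * lin y" by (simp add: Ah)
      then have "h' * h * lin x = h' * h * lin y" by (simp add: mult.assoc)
      then show "x = y" using h' inj by simp
    qed
    show "A (x \<times> y) = A x \<times> A y" for x y
    proof (rule inj)
      have *: "h * lin a * h' * (h * lin b * h') = h * (lin a * lin b) * h'" for a b
      proof -
        have "h * lin a * h' * (h * lin b * h') = h * lin a * (h' * h) * lin b * h'" by (simp add: mult.assoc)
        then show ?thesis by (simp add: h' mult.assoc)
      qed
      have "lin (A (x \<times> y)) = h * (lin x * lin y - lin y * lin x) * h'"
        by (simp add: A[symmetric] bracket)
      also have "\<dots> = lin (A x) * lin (A y) - lin (A y) * lin (A x)"
        unfolding A[symmetric] * by (simp add: algebra_simps)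
      finally show "lin (A (x \<times> y)) = lin (A x \<times> A y)" by (simp add: bracket)
    qed
  qed
  then obtain p where p: "norm p = 1" "A = qrot p"
    by (rule cross_automorphism_imp_qrot)
  define z where "z = rho (qconj p) * h"
  have "z * lin y = lin y * z" for y
  proof -
    have "z * lin y = (rho (qconj p) * lin (A y)) * h"
      by (simp add: z_def mult.assoc Ah)
    also have "rho (qconj p) * lin (A y) = lin (qrot (qconj p) (A y)) * rho (qconj p)"
      by (rule rho_conjugate) (simp add: p)
    finally show ?thesis using qrot_qconj(2)[OF p(1)] by (simp add: p z_def mult.assoc)
  qed
  then have "z \<in> centralizer" by (simp add: centralizer_def z_def mult_H rho_in_H assms)
  moreover have "h = rho p * z"
    by (simp add: z_def mult.assoc[symmetric] rho_qconj'[OF p(1)])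
  ultimately show ?thesis using that p(1) by blast
qed

end

unbundle no cross3_syntax

section \<open>Singular homology of the 3-sphere\<close>

text \<open>The augmentation. Integers appear as chains on a single point, so that the rules for
  \<open>frag_extend\<close> apply to it.\<close>

abbreviation frag_aug :: "('a \<Rightarrow>\<^sub>0 int) => (unit \<Rightarrow>\<^sub>0 int)" where
  "frag_aug \<equiv> frag_extend (\<lambda>_. frag_of ())"

lemma frag_extend_const: "frag_extend (\<lambda>_. x) c = frag_extend (\<lambda>_. x) (frag_aug c)"
proof -
  have "frag_extend (\<lambda>_. x) c = (frag_extend (\<lambda>_. x) \<circ> frag_extend (\<lambda>_. frag_of ())) c"
    using subset_UNIV by (induction c rule: frag_induction) (auto simp: frag_extend_diff)
  then show ?thesis by simp
qed

text \<open>Every 0-simplex is homologous to a fixed one, so \<open>c\<close> is homologous to its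
  augmentation times that simplex.\<close>

lemma augmentation_zero_bounds:
  assumes X: "path_connected_space X" and c: "singular_chain 0 X c" and 0: "frag_aug c = 0"
  shows "singular_relboundary 0 X {} c"
proof (cases "c = 0")
  case False
  then obtain s where s: "s \<in> Poly_Mapping.keys c" by fastforce
  then have s0: "singular_simplex 0 X s" using c by (auto simp: singular_chain_def)
  have "singular_relboundary 0 X {} (c - frag_extend (\<lambda>_. frag_of s) c)"
    using c unfolding singular_chain_def
  proof (induction c rule: frag_induction)
    case (one f)
    then show ?case
      using iso_integer_zeroth_homology_group_aux[OF X, of f s] s0 by (simp add: homologous_rel_def)
  next
    case (diff a b)
    then show ?case
      using singular_relboundary_diff[OF diff] by (simp add: frag_extend_diff algebra_simps)
  qed auto
  then show ?thesis
    using 0 frag_extend_const[of "frag_of s" c] by simp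
qed auto

abbreviation (input) "S3 \<equiv> sphere (0::quat) 1"
abbreviation (input) "S3_top \<equiv> top_of_set (sphere (0::quat) 1)"

lemma pairwise_orthogonal_Basis': "pairwise orthogonal (Basis :: 'a::euclidean_space set)"
  by (auto simp: pairwise_def orthogonal_def inner_Basis)

lemma nsphere_3_homeomorphic: "nsphere 3 homeomorphic_space S3_top"
proof -
  have "card (Basis :: quat set) = 4" by simp
  then obtain f :: "(nat => real) => quat" and g where
    "homeomorphic_maps (nsphere (4 - 1)) (top_of_set (sphere 0 1 \<inter> span (Basis :: quat set))) f g"
    using homeomorphic_maps_nsphere_euclidean_sphere[of "Basis :: quat set" 4]
    by (metis independent_Basis pairwise_orthogonal_Basis' norm_Basis zero_neq_numeral)
  then show ?thesis
    by (auto simp: homeomorphic_space_def span_Basis)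
qed

lemma homology_S3:
  shows "homology_group 3 S3_top \<cong> integer_group"
    and "i \<in> {1, 2} ==> trivial_group (homology_group i S3_top)"
proof -
  have iso: "reduced_homology_group p S3_top \<cong> reduced_homology_group p (nsphere 3)" for p
    by (rule homeomorphic_space_imp_isomorphic_reduced_homology_groups)
      (metis nsphere_3_homeomorphic homeomorphic_space_sym)
  have "reduced_homology_group 3 S3_top \<cong> integer_group"
    using iso_trans[OF iso[of 3]] reduced_homology_group_nsphere(1)[of 3] by simp
  then show "homology_group 3 S3_top \<cong> integer_group"
    by (simp add: un_reduced_homology_group)
  assume i: "i \<in> {1, 2}"
  then have "trivial_group (reduced_homology_group i (nsphere 3))"
    by (intro reduced_homology_group_nsphere(2)) auto
  then have "trivial_group (reduced_homology_group i S3_top)"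
    using iso[of i] isomorphic_group_triviality group_reduced_homology_group by metis
  then show "trivial_group (homology_group i S3_top)"
    using i by (auto simp: un_reduced_homology_group)
qed

lemma S3_cycle_bounds:
  assumes "i \<in> {1, 2}" "singular_relcycle i S3_top {} c"
  shows "singular_relboundary i S3_top {} c"
  using assms rel_acyclicI[of i S3_top "{}"] homology_S3(2)[of "int i"] by (auto simp: rel_acyclic_def)

text \<open>Turns the isomorphism with the integers into a concrete cycle. Its infinite order, the
  last clause, is what later makes the class of an orbit essential.\<close>

lemma infinite_cyclic_homology_generator:
  assumes "homology_group (int p) X \<cong> integer_group"
  obtains \<mu> where "singular_relcycle p X {} \<mu>"
    "\<And>c. singular_relcycle p X {} c ==> \<exists>m. singular_relboundary p X {} (c - frag_cmul m \<mu>)"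
    "\<And>m. singular_relboundary p X {} (frag_cmul m \<mu>) ==> m = 0"
proof -
  let ?H = "homology_group (int p) X"
  obtain f where f: "f \<in> iso ?H integer_group"
    using assms by (auto simp: is_iso_def)
  then have hom: "f \<in> hom ?H integer_group" and bij: "bij_betw f (carrier ?H) UNIV"
    by (auto simp: iso_def)
  let ?k = "\<lambda>c. homologous_rel_set p X {} c"
  from bij have "f ` carrier ?H = UNIV" by (simp add: bij_betw_def)
  then obtain h where "h \<in> carrier ?H" "f h = 1" by (metis UNIV_I imageE)
  then obtain \<mu> where \<mu>: "singular_relcycle p X {} \<mu>" "f (?k \<mu>) = 1"
    by (auto simp: carrier_relative_homology_group)
  have car: "?k c \<in> carrier ?H" if "singular_relcycle p X {} c" for c
    using that by (auto simp: carrier_relative_homology_group)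
  have ksum: "?k (a + b) = ?k a \<otimes>\<^bsub>?H\<^esub> ?k b" if "singular_relcycle p X {} a" "singular_relcycle p X {} b" for a b
  proof -
    have "\<exists>x y. homologous_rel p X {} a x \<and> homologous_rel p X {} b y \<and> c = x + y"
      if "homologous_rel p X {} (a + b) c" for c
      using that homologous_rel_refl[of p X "{}" b]
      by (intro exI[of _ "c - b"] exI[of _ b]) (auto simp: homologous_rel_def algebra_simps)
    then show ?thesis
      by (auto simp: mult_relative_homology_group homologous_rel_add)
  qed
  have fadd: "f (?k (a + b)) = f (?k a) + f (?k b)"
    if "singular_relcycle p X {} a" "singular_relcycle p X {} b" for a b
    using hom_mult[OF hom car[OF that(1)] car[OF that(2)]] by (simp add: ksum[OF that])
  have f0: "f (?k c) = 0 \<longleftrightarrow> singular_relboundary p X {} c" if "singular_relcycle p X {} c" for c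
  proof -
    have "f (?k 0) = f (?k 0) + f (?k 0)" using fadd[of 0 0] by simp
    then have "f (?k 0) = 0" by simp
    then have "f (?k c) = 0 \<longleftrightarrow> ?k c = ?k 0"
      using inj_on_eq_iff[OF bij_betw_imp_inj_on[OF bij] car[OF that] car[OF singular_relcycle_0]] by simp
    also have "\<dots> \<longleftrightarrow> singular_relboundary p X {} c"
      unfolding homologous_rel_set_eq by (simp add: homologous_rel_def)
    finally show ?thesis .
  qed
  have fneg: "f (?k (- c)) = - f (?k c)" if "singular_relcycle p X {} c" for c
    using fadd[of c "-c"] f0[of 0] that by (simp add: singular_relcycle_minus)
  have fnat: "f (?k (frag_cmul (int n) \<mu>)) = int n" for n
  proof (induction n)
    case 0
    then show ?case using f0[of 0] by simp
  next
    case (Suc n)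
    have "frag_cmul (int (Suc n)) \<mu> = frag_cmul (int n) \<mu> + \<mu>" by (simp add: frag_cmul_distrib)
    then show ?case using fadd[OF singular_relcycle_cmul[OF \<mu>(1)] \<mu>(1)] Suc \<mu>(2) by simp
  qed
  have fm: "f (?k (frag_cmul m \<mu>)) = m" for m
  proof (cases "m \<ge> 0")
    case True
    then show ?thesis using fnat[of "nat m"] by simp
  next
    case False
    have "frag_cmul m \<mu> = - frag_cmul (int (nat (- m))) \<mu>" using False by simp
    then show ?thesis using fneg[OF singular_relcycle_cmul[OF \<mu>(1)], of "int (nat (-m))"] fnat[of "nat (-m)"] False by simp
  qed
  show ?thesis
  proof
    show "singular_relcycle p X {} \<mu>" by (rule \<mu>)
    show "\<exists>m. singular_relboundary p X {} (c - frag_cmul m \<mu>)" if c: "singular_relcycle p X {} c" for c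
    proof
      let ?m = "- f (?k c)"
      have cy: "singular_relcycle p X {} (frag_cmul ?m \<mu>)" by (intro singular_relcycle_cmul \<mu>)
      have "f (?k (c + frag_cmul ?m \<mu>)) = 0" using fadd[OF c cy] fm by simp
      then show "singular_relboundary p X {} (c - frag_cmul (f (?k c)) \<mu>)"
        using f0[OF singular_relcycle_add[OF c cy]] by (simp flip: minus_frag_cmul)
    qed
    show "m = 0" if "singular_relboundary p X {} (frag_cmul m \<mu>)" for m
      using f0[OF singular_relcycle_cmul[OF \<mu>(1)], of m] fm[of m] that by simp
  qed
qed

section \<open>Actions of the unit quaternions and transfer\<close>

text \<open>Moves simplices of dimension at most 4 into a normed space, the setting of the lifting
  theorem for coverings. No simplex of dimension above 4 is ever lifted to the sphere.\<close>

definition emb5 :: "(nat => real) => real \<times> real \<times> real \<times> real \<times> real" where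
  "emb5 x = (x 0, x 1, x 2, x 3, x 4)"

definition unemb5 :: "real \<times> real \<times> real \<times> real \<times> real => (nat => real)" where
  "unemb5 = (\<lambda>(a, b, c, d, e) i. if i = 0 then a else if i = 1 then b else if i = 2 then c
      else if i = 3 then d else if i = 4 then e else 0)"

lemma unemb5_emb5:
  assumes "x \<in> standard_simplex p" "p \<le> 4"
  shows "unemb5 (emb5 x) = x"
  using assms by (auto simp: unemb5_def emb5_def standard_simplex_def fun_eq_iff)

lemma convex_emb5_simplex: "convex (emb5 ` standard_simplex p)"
  unfolding convex_alt
proof (intro ballI allI impI)
  fix X Y and u :: real
  assume XY: "X \<in> emb5 ` standard_simplex p" "Y \<in> emb5 ` standard_simplex p" and u: "0 \<le> u \<and> u \<le> 1"
  then obtain x y where x: "X = emb5 x" "x \<in> standard_simplex p" and y: "Y = emb5 y" "y \<in> standard_simplex p"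
    by blast
  then have "(\<lambda>i. (1 - u) * x i + u * y i) \<in> standard_simplex p"
    using u by (intro convex_standard_simplex) auto
  moreover have "(1 - u) *\<^sub>R X + u *\<^sub>R Y = emb5 (\<lambda>i. (1 - u) * x i + u * y i)"
    by (simp add: emb5_def x y)
  ultimately show "(1 - u) *\<^sub>R X + u *\<^sub>R Y \<in> emb5 ` standard_simplex p"
    by blast
qed

lemma powertop_real_eq: "powertop_real UNIV = (euclidean :: (nat => real) topology)"
  by (simp add: euclidean_product_topology)

lemma singular_simplex_euclidean:
  fixes S :: "'a::topological_space set"
  shows "singular_simplex p (top_of_set S) \<sigma> \<longleftrightarrow>
     continuous_on (standard_simplex p) \<sigma> \<and> \<sigma> ` standard_simplex p \<subseteq> S \<and> \<sigma> \<in> extensional (standard_simplex p)"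
  unfolding singular_simplex_def powertop_real_eq
  by (auto simp: continuous_map_in_subtopology continuous_map_iff_continuous2)

lemma continuous_on_emb5: "continuous_on A emb5"
  unfolding emb5_def by (intro continuous_on_Pair continuous_on_subset[OF continuous_on_product_coordinates] subset_UNIV)

lemma continuous_on_unemb5: "continuous_on A unemb5"
proof (rule continuous_on_coordinatewise_then_product)
  show "continuous_on A (\<lambda>x. unemb5 x i)" for i
  proof -
    consider "i = 0" | "i = 1" | "i = 2" | "i = 3" | "i = 4" | "i > 4" by linarith
    then show ?thesis
      by cases (auto simp: unemb5_def case_prod_unfold intro!: continuous_intros)
  qed
qed

lemma lift_singular_simplex:
  fixes C :: "'c::real_normed_vector set" and B :: "'b::real_normed_vector set"
  assumes cov: "covering_space C q B" and p: "p \<le> 4" and \<sigma>: "singular_simplex p (top_of_set B) \<sigma>"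
  obtains \<tau> where "singular_simplex p (top_of_set C) \<tau>" "simplex_map p q \<tau> = \<sigma>"
proof -
  let ?U = "emb5 ` standard_simplex p"
  have un: "unemb5 ` ?U = standard_simplex p"
    using unemb5_emb5[OF _ p] by force
  have \<sigma>': "continuous_on (standard_simplex p) \<sigma>" "\<sigma> ` standard_simplex p \<subseteq> B" "\<sigma> \<in> extensional (standard_simplex p)"
    using \<sigma> by (auto simp: singular_simplex_euclidean)
  have "continuous_on ?U (\<sigma> \<circ> unemb5)"
    by (rule continuous_on_compose[OF continuous_on_unemb5]) (simp only: un \<sigma>')
  moreover have "\<sigma> \<circ> unemb5 \<in> ?U \<rightarrow> B"
    using \<sigma>'(2) unemb5_emb5[OF _ p] by (auto simp del: split_paired_All)
  ultimately obtain g where g: "continuous_on ?U g" "g \<in> ?U \<rightarrow> C" "\<And>y. y \<in> ?U ==> q (g y) = (\<sigma> \<circ> unemb5) y"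
    using covering_space_lift[OF cov convex_imp_simply_connected convex_imp_locally_path_connected]
      convex_emb5_simplex by metis
  define \<tau> where "\<tau> = restrict (g \<circ> emb5) (standard_simplex p)"
  have "continuous_on (standard_simplex p) (g \<circ> emb5)"
    by (rule continuous_on_compose[OF continuous_on_emb5 g(1)])
  then have "singular_simplex p (top_of_set C) \<tau>"
    using g(2) by (auto simp: singular_simplex_euclidean \<tau>_def cong: continuous_on_cong)
  moreover have "simplex_map p q \<tau> = \<sigma>"
  proof
    fix x show "simplex_map p q \<tau> x = \<sigma> x"
    proof (cases "x \<in> standard_simplex p")
      case True
      then show ?thesis using g(3)[of "emb5 x"] unemb5_emb5[OF True p]
        by (simp add: simplex_map_def \<tau>_def)
    next
      case False
      then show ?thesis using \<sigma>'(3) by (simp add: simplex_map_def extensional_def)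
    qed
  qed
  ultimately show ?thesis using that by blast
qed

lemma connected_standard_simplex: "connected (standard_simplex p)"
  using connectedin_standard_simplex[of p] by (simp add: powertop_real_eq)

lemma lift_singular_simplex_unique:
  fixes C :: "'c::real_normed_vector set" and B :: "'b::real_normed_vector set"
  assumes cov: "covering_space C q B"
    and \<tau>: "singular_simplex p (top_of_set C) \<tau>" and \<tau>': "singular_simplex p (top_of_set C) \<tau>'"
    and eq: "simplex_map p q \<tau> = simplex_map p q \<tau>'"
    and x: "x \<in> standard_simplex p" "\<tau> x = \<tau>' x"
  shows "\<tau> = \<tau>'"
proof
  fix y show "\<tau> y = \<tau>' y"
  proof (cases "y \<in> standard_simplex p")
    case True
    have 1: "continuous_on (standard_simplex p) \<tau>" "\<tau> \<in> standard_simplex p \<rightarrow> C"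
      and 2: "continuous_on (standard_simplex p) \<tau>'" "\<tau>' \<in> standard_simplex p \<rightarrow> C"
      using \<tau> \<tau>' by (auto simp: singular_simplex_euclidean)
    have qC: "continuous_on C q" "q \<in> C \<rightarrow> B" using cov by (auto simp: covering_space_def)
    show ?thesis
    proof (rule covering_space_lift_unique[OF cov x(2) _ _ 1 _ 2 _ connected_standard_simplex x(1) True])
      show "continuous_on (standard_simplex p) (\<lambda>x. q (\<tau> x))"
        by (rule continuous_on_compose2[OF qC(1) 1(1)]) (use 1 in auto)
      show "(\<lambda>x. q (\<tau> x)) \<in> standard_simplex p \<rightarrow> B" using 1 qC by auto
      show "q (\<tau> z) = q (\<tau>' z)" if "z \<in> standard_simplex p" for z
        using fun_cong[OF eq, of z] that by (simp add: simplex_map_def)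
    qed simp
  next
    case False
    then show ?thesis using \<tau> \<tau>' by (auto simp: singular_simplex_def extensional_def)
  qed
qed

lemma norm_qmul_eq: "norm (qmul p q) = norm p * norm q"
proof -
  have "norm (qmul p q) ^ 2 = fst (qmul p q) ^ 2 + snd (qmul p q) \<bullet> snd (qmul p q)"
    by (cases "qmul p q") (simp add: norm_Pair power2_norm_eq_inner)
  also have "\<dots> = (fst p ^ 2 + snd p \<bullet> snd p) * (fst q ^ 2 + snd q \<bullet> snd q)"
    by (simp add: qmul_def vec3_simps power2_eq_square; algebra)
  also have "\<dots> = (norm p * norm q) ^ 2"
    by (cases p; cases q) (simp add: norm_Pair power2_norm_eq_inner power_mult_distrib)
  finally show ?thesis by (simp add: power2_eq_iff_nonneg)
qed

lemma qmul_diff_left: "qmul p r - qmul q r = qmul (p - q) r"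
  by (simp add: qmul_def inner_diff_left algebra_simps prod_eq_iff cross3_simps forall_3)

lemma dist_qmul_right: "norm r = 1 ==> dist (qmul p r) (qmul q r) = dist p q"
  by (simp add: dist_norm qmul_diff_left norm_qmul_eq)

lemma qmul_diff_right: "qmul r p - qmul r q = qmul r (p - q)"
  by (simp add: qmul_def inner_diff_right algebra_simps prod_eq_iff cross3_simps forall_3)

lemma dist_qmul_left: "norm r = 1 ==> dist (qmul r p) (qmul r q) = dist p q"
  by (simp add: dist_norm qmul_diff_right norm_qmul_eq)

text \<open>Right translations by the stabilizer of \<open>v\<close> are the deck transformations of
  the map sending \<open>p\<close> to \<open>act p v\<close>.\<close>

abbreviation rmul :: "quat => quat => quat" where "rmul r p \<equiv> qmul p r"

lemma continuous_on_rmul: "continuous_on A (rmul r)"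
  by (intro continuous_on_qmul continuous_intros)

text \<open>A path from \<open>r\<close> to 1 in the sphere gives the homotopy. Hence deck
  transformations do not change the fundamental class.\<close>

lemma rmul_homotopic_id:
  assumes "norm r = 1"
  shows "homotopic_with (\<lambda>_. True) S3_top S3_top (rmul r) id"
proof -
  have "path_connected S3" by (intro path_connected_sphere) simp
  moreover have "r \<in> S3" "(1, 0) \<in> S3" using assms by (auto simp: norm_Pair)
  ultimately obtain g where g: "path g" "path_image g \<subseteq> S3" "pathstart g = r" "pathfinish g = (1, 0)"
    unfolding path_connected_def by metis
  have gS: "norm (g t) = 1" if "t \<in> {0..1}" for t
    using g(2) that unfolding path_image_def by (metis image_subset_iff mem_sphere_0)
  have "continuous_on {0..1} g" using g(1) by (simp add: path_def)
  then have gc: "continuous_on (Sigma {0..1} (\<lambda>_. S3)) (\<lambda>x. g (fst x))"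
    by (rule continuous_on_compose2[OF _ continuous_on_fst[OF continuous_on_id]]) auto
  have "continuous_on (Sigma {0..1} (\<lambda>_. S3)) (\<lambda>x. qmul (snd x) (g (fst x)))"
    by (rule continuous_on_qmul[OF continuous_on_snd[OF continuous_on_id] gc])
  moreover have "(\<lambda>x. qmul (snd x) (g (fst x))) \<in> Sigma {0..1} (\<lambda>_. S3) \<rightarrow> S3"
    using gS by (auto simp: norm_qmul_eq)
  ultimately have h: "continuous_map (prod_topology (top_of_set {0..1}) S3_top) S3_top (\<lambda>x. qmul (snd x) (g (fst x)))"
    unfolding prod_topology_subtopology_eu continuous_map_subtopology_eu by blast
  show ?thesis
    unfolding homotopic_with_def
  proof (intro exI conjI allI ballI TrueI)
    show "qmul (snd (0, x)) (g (fst (0, x))) = rmul r x" for x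
      using g(3) by (simp add: pathstart_def)
    show "qmul (snd (1, x)) (g (fst (1, x))) = id x" for x
      using g(4) by (simp add: pathfinish_def)
  qed (rule h)
qed

text \<open>The form in which the group enters the topological part: unit quaternions acting by
  isometries and a finite group \<open>Z\<close> of isometries commuting with them. Linearity and
  the infinitesimal action are added in \<open>su2_rep\<close>.\<close>

locale quat_action =
  fixes act :: "quat => 'v::euclidean_space => 'v" and Z :: "('v => 'v) set"
  assumes act_cont: "continuous_on (Sigma S3 (\<lambda>_. UNIV)) (\<lambda>x. act (fst x) (snd x))"
    and act_qmul: "norm p = 1 ==> norm q = 1 ==> act (qmul p q) x = act p (act q x)"
    and act_one [simp]: "act (1, 0) x = x"
    and act_dist: "norm p = 1 ==> dist (act p x) (act p y) = dist x y"
    and finite_Z: "finite Z" and id_Z: "id \<in> Z"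
    and comp_Z: "z \<in> Z ==> w \<in> Z ==> z \<circ> w \<in> Z"
    and inverse_Z: "z \<in> Z ==> \<exists>w\<in>Z. z \<circ> w = id \<and> w \<circ> z = id"
    and dist_Z: "z \<in> Z ==> dist (z x) (z y) = dist x y"
    and Z_act: "z \<in> Z ==> norm p = 1 ==> z (act p x) = act p (z x)"
begin

lemma continuous_on_act: "continuous_on A f ==> continuous_on A g ==> f ` A \<subseteq> S3 ==> continuous_on A (\<lambda>x. act (f x) (g x))"
  using continuous_on_compose2[OF act_cont, of A "\<lambda>x. (f x, g x)"] by (auto intro: continuous_on_Pair)

lemma continuous_on_Z: "z \<in> Z ==> continuous_on A z"
  unfolding continuous_on_iff using dist_Z by metis

lemma act_qconj: "norm p = 1 ==> act p (act (qconj p) x) = x" "norm p = 1 ==> act (qconj p) (act p x) = x"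
  by (simp_all add: act_qmul[symmetric] qmul_qconj)

definition inv_Z :: "('v => 'v) => 'v => 'v" where
  "inv_Z z = (SOME w. w \<in> Z \<and> z \<circ> w = id \<and> w \<circ> z = id)"

lemma inv_Z:
  assumes "z \<in> Z"
  shows "inv_Z z \<in> Z" "z \<circ> inv_Z z = id" "inv_Z z \<circ> z = id" "z (inv_Z z x) = x" "inv_Z z (z x) = x"
proof -
  have "\<exists>w. w \<in> Z \<and> z \<circ> w = id \<and> w \<circ> z = id" using inverse_Z[OF assms] by blast
  then have *: "inv_Z z \<in> Z \<and> z \<circ> inv_Z z = id \<and> inv_Z z \<circ> z = id"
    unfolding inv_Z_def by (rule someI_ex)
  then show "inv_Z z \<in> Z" "z \<circ> inv_Z z = id" "inv_Z z \<circ> z = id" by auto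
  with * show "z (inv_Z z x) = x" "inv_Z z (z x) = x" by (metis comp_apply id_apply)+
qed

text \<open>\<open>stab\<close> and \<open>orbit0\<close> refer to the unit quaternions alone,
  whereas \<open>orb\<close> is the orbit of the whole group, a finite union of translates of
  \<open>orbit0\<close>.\<close>

definition stab :: "'v => quat set" where
  "stab v = {p. norm p = 1 \<and> act p v = v}"

definition orbit0 :: "'v => 'v set" where
  "orbit0 v = (\<lambda>p. act p v) ` S3"

definition orb :: "'v => 'v set" where
  "orb v = {act p (z v) |p z. norm p = 1 \<and> z \<in> Z}"

lemma orb_eq_UN: "orb v = (\<Union>z\<in>Z. orbit0 (z v))"
  unfolding orb_def orbit0_def by fastforce

lemma orbit0_subset_orb: "orbit0 v \<subseteq> orb v"
  using id_Z by (auto simp: orb_eq_UN intro!: bexI[of _ id])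

lemma orbit0_self: "v \<in> orbit0 v"
  unfolding orbit0_def by (rule image_eqI[of _ _ "(1, 0)"]) (auto simp: norm_Pair)

lemma compact_orbit0: "compact (orbit0 v)"
  unfolding orbit0_def by (intro compact_continuous_image continuous_on_act continuous_intros) auto

lemma orbit0_trans: "norm p = 1 ==> x \<in> orbit0 v ==> act p x \<in> orbit0 v"
  unfolding orbit0_def by (auto simp: act_qmul[symmetric] norm_qmul)

lemma orbit0_sym: "x \<in> orbit0 v ==> v \<in> orbit0 x"
  unfolding orbit0_def by (auto simp: image_iff intro!: bexI[of _ "qconj _"] act_qconj(2)[symmetric])

lemma orbit0_eq: "x \<in> orbit0 v ==> orbit0 x = orbit0 v"
proof -
  have sub: "orbit0 x \<subseteq> orbit0 v" if "x \<in> orbit0 v" for x v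
    using orbit0_trans[OF _ that] by (auto simp: orbit0_def)
  show "x \<in> orbit0 v ==> orbit0 x = orbit0 v"
    using sub orbit0_sym by blast
qed

lemma Z_orbit0: "z \<in> Z ==> z ` orbit0 v = orbit0 (z v)"
  unfolding orbit0_def image_image by (intro image_cong) (auto simp: Z_act)

lemma stab_one: "(1, 0) \<in> stab v"
  by (simp add: stab_def norm_Pair)

lemma stab_qmul: "p \<in> stab v ==> q \<in> stab v ==> qmul p q \<in> stab v"
  by (auto simp: stab_def act_qmul norm_qmul)

lemma stab_qconj: "p \<in> stab v ==> qconj p \<in> stab v"
  unfolding stab_def mem_Collect_eq by (metis act_qconj(2) norm_qconj)

lemma act_eq_iff_stab:
  assumes "norm p = 1" "norm q = 1"
  shows "act p v = act q v \<longleftrightarrow> qmul (qconj q) p \<in> stab v"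
  using assms act_qconj[of q] by (simp add: stab_def act_qmul norm_qmul) metis

lemma covering_orbit:
  assumes fin: "finite (stab v)"
  shows "covering_space S3 (\<lambda>p. act p v) (orbit0 v)"
proof
  let ?o = "\<lambda>p. act p v"
  show co: "continuous_on S3 ?o" by (intro continuous_on_act continuous_intros) auto
  show im: "?o ` S3 = orbit0 v" by (simp add: orbit0_def)
  fix x assume "x \<in> orbit0 v"
  then obtain p0 where p0: "norm p0 = 1" "x = act p0 v" by (auto simp: orbit0_def)
  \<comment> \<open>The distance from 1 to the other elements of the finite stabilizer, capped at 1.
    Translations are isometries, so the orbit map is injective on balls of radius r/2, and such
    balls about the right translates of \<open>p0\<close> are the sheets.\<close>
  define r where "r = Min (insert 1 ((\<lambda>\<gamma>. dist (1, 0) \<gamma>) ` (stab v - {(1, 0)})))"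
  have r0: "r > 0" unfolding r_def using fin by (subst Min_gr_iff) auto
  have r1: "\<gamma> = (1, 0)" if "\<gamma> \<in> stab v" "dist (1, 0) \<gamma> < r" for \<gamma>
  proof (rule ccontr)
    assume "\<gamma> \<noteq> (1, 0)"
    then have "r \<le> dist (1, 0) \<gamma>" unfolding r_def using that fin by (intro Min_le) auto
    then show False using that by simp
  qed
  define U where "U = (\<lambda>q. S3 \<inter> ball q (r/2))"
  define T where "T = ?o ` U p0"
  have inj: "p = q" if "p \<in> U s" "q \<in> U s" "?o p = ?o q" for p q s
  proof -
    have n: "norm p = 1" "norm q = 1" using that by (auto simp: U_def)
    have "dist p q < r" using that dist_triangle_half_r[of s p r q] by (auto simp: U_def)
    then have "dist (1, 0) (qmul (qconj q) p) < r"
      using dist_qmul_left[of "qconj q" q p] n by (simp add: qmul_qconj dist_commute)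
    then have "qmul (qconj q) p = (1, 0)"
      using that n by (intro r1) (auto simp: act_eq_iff_stab[symmetric])
    then have "qmul q (qmul (qconj q) p) = q" by simp
    then show ?thesis using n by (simp add: qmul_assoc[symmetric] qmul_qconj)
  qed
  have Ur: "rmul \<gamma> ` U q = U (qmul q \<gamma>)" if \<gamma>: "norm \<gamma> = 1" "norm q = 1" for \<gamma> q
  proof
    show "rmul \<gamma> ` U q \<subseteq> U (qmul q \<gamma>)" using \<gamma> by (auto simp: U_def norm_qmul dist_qmul_right)
    show "U (qmul q \<gamma>) \<subseteq> rmul \<gamma> ` U q"
    proof
      fix p assume p: "p \<in> U (qmul q \<gamma>)"
      have "p = qmul (qmul p (qconj \<gamma>)) \<gamma>" using \<gamma> by (simp add: qmul_assoc qmul_qconj)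
      moreover have "dist q (qmul p (qconj \<gamma>)) = dist (qmul q \<gamma>) p"
        using dist_qmul_right[OF \<gamma>(1), of q "qmul p (qconj \<gamma>)"] calculation by simp
      ultimately show "p \<in> rmul \<gamma> ` U q"
        using p \<gamma> by (auto simp: U_def norm_qmul intro!: image_eqI[of _ _ "qmul p (qconj \<gamma>)"])
    qed
  qed
  have oT: "?o ` U (qmul p0 \<gamma>) = T" if "\<gamma> \<in> stab v" for \<gamma>
  proof -
    have "?o ` U (qmul p0 \<gamma>) = (\<lambda>p. act (qmul p \<gamma>) v) ` U p0"
      using that p0 Ur[of \<gamma> p0] by (auto simp: stab_def image_image simp flip: Ur)
    also have "\<dots> = T"
      unfolding T_def using that by (intro image_cong) (auto simp: U_def stab_def act_qmul)
    finally show ?thesis .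
  qed
  \<comment> \<open>The saturation of \<open>W\<close> under right translation by the stabilizer is
    open, and the orbit map of the compact sphere onto its Hausdorff image is a quotient
    map.\<close>
  have openmap: "openin (top_of_set (orbit0 v)) (?o ` W)" if W: "openin (top_of_set S3) W" for W
  proof -
    define W' where "W' = (\<Union>\<gamma>\<in>stab v. rmul \<gamma> ` W)"
    have WS: "W \<subseteq> S3" using W openin_imp_subset by blast
    have "openin (top_of_set S3) (rmul \<gamma> ` W)" if "\<gamma> \<in> stab v" for \<gamma>
    proof -
      have g: "norm \<gamma> = 1" using that by (simp add: stab_def)
      have "rmul \<gamma> ` W = S3 \<inter> rmul (qconj \<gamma>) -` W"
      proof (rule subset_antisym; rule subsetI)
        fix s assume "s \<in> rmul \<gamma> ` W"
        then show "s \<in> S3 \<inter> rmul (qconj \<gamma>) -` W"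
          using WS g by (auto simp: norm_qmul qmul_assoc qmul_qconj)
      next
        fix p assume "p \<in> S3 \<inter> rmul (qconj \<gamma>) -` W"
        then show "p \<in> rmul \<gamma> ` W"
          using g by (intro image_eqI[of _ _ "qmul p (qconj \<gamma>)"]) (auto simp: qmul_assoc qmul_qconj)
      qed
      moreover have "openin (top_of_set S3) (S3 \<inter> rmul (qconj \<gamma>) -` W)"
        using g by (intro continuous_openin_preimage[OF continuous_on_rmul _ W]) (auto simp: norm_qmul)
      ultimately show ?thesis by simp
    qed
    then have "openin (top_of_set S3) W'" unfolding W'_def by blast
    moreover have "W' = S3 \<inter> ?o -` (?o ` W)"
    proof (rule subset_antisym; rule subsetI)
      fix p assume "p \<in> W'"
      then obtain \<gamma> q where "\<gamma> \<in> stab v" "q \<in> W" "p = qmul q \<gamma>" by (auto simp: W'_def)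
      then show "p \<in> S3 \<inter> ?o -` (?o ` W)" using WS by (auto simp: stab_def norm_qmul act_qmul)
    next
      fix p assume "p \<in> S3 \<inter> ?o -` (?o ` W)"
      then obtain q where pq: "p \<in> S3" "?o p = ?o q" "q \<in> W" by auto
      then have q: "norm q = 1" using WS by auto
      then have "qmul (qconj q) p \<in> stab v" using pq by (simp add: act_eq_iff_stab[symmetric])
      moreover have "p = qmul q (qmul (qconj q) p)" using q by (simp add: qmul_assoc[symmetric] qmul_qconj)
      ultimately show "p \<in> W'" using pq(3) unfolding W'_def by blast
    qed
    ultimately have "openin (top_of_set S3) (S3 \<inter> ?o -` (?o ` W))" by simp
    moreover have "openin (top_of_set S3) (S3 \<inter> ?o -` U) \<longleftrightarrow> openin (top_of_set (orbit0 v)) U"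
      if "U \<subseteq> orbit0 v" for U
    proof -
      have "quotient_map S3_top (top_of_set (orbit0 v)) ?o"
        using co im by (intro continuous_imp_quotient_map) (auto simp: continuous_map_subtopology_eu Hausdorff_space_subtopology compactin_euclidean_iff intro!: compact_space_subtopology)
      then have "openin (top_of_set S3) {x \<in> S3. ?o x \<in> U} \<longleftrightarrow> openin (top_of_set (orbit0 v)) U"
        using that by (auto simp: quotient_map_def)
      moreover have "{x \<in> S3. ?o x \<in> U} = S3 \<inter> ?o -` U" by auto
      ultimately show ?thesis by simp
    qed
    ultimately show ?thesis using image_mono[OF WS, of ?o] im by metis
  qed
  have Uo: "openin (top_of_set S3) (U q)" for q
    unfolding U_def by auto
  show "\<exists>T. x \<in> T \<and> openin (top_of_set (orbit0 v)) T \<and>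
         (\<exists>V. \<Union>V = S3 \<inter> ?o -` T \<and> (\<forall>u\<in>V. openin (top_of_set S3) u) \<and>
            pairwise disjnt V \<and> (\<forall>u\<in>V. \<exists>q. homeomorphism u T ?o q))"
  proof (intro exI[of _ T] conjI exI[of _ "(\<lambda>\<gamma>. U (qmul p0 \<gamma>)) ` stab v"])
    show "x \<in> T" unfolding T_def U_def using p0 r0 by auto
    show "openin (top_of_set (orbit0 v)) T" unfolding T_def by (rule openmap[OF Uo])
    show "\<Union> ((\<lambda>\<gamma>. U (qmul p0 \<gamma>)) ` stab v) = S3 \<inter> ?o -` T"
    proof
      show "\<Union> ((\<lambda>\<gamma>. U (qmul p0 \<gamma>)) ` stab v) \<subseteq> S3 \<inter> ?o -` T"
      proof
        fix p assume "p \<in> \<Union> ((\<lambda>\<gamma>. U (qmul p0 \<gamma>)) ` stab v)"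
        then obtain \<gamma> where g: "\<gamma> \<in> stab v" "p \<in> U (qmul p0 \<gamma>)" by blast
        then have "?o p \<in> T" using oT[OF g(1)] by blast
        then show "p \<in> S3 \<inter> ?o -` T" using g(2) by (simp add: U_def)
      qed
      show "S3 \<inter> ?o -` T \<subseteq> \<Union> ((\<lambda>\<gamma>. U (qmul p0 \<gamma>)) ` stab v)"
      proof
        fix p assume p: "p \<in> S3 \<inter> ?o -` T"
        then obtain q where q: "q \<in> U p0" "act p v = act q v" by (auto simp: T_def)
        let ?\<gamma> = "qmul (qconj q) p"
        have n: "norm p = 1" "norm q = 1" using p q by (auto simp: U_def)
        then have g: "?\<gamma> \<in> stab v" using q(2) by (simp add: act_eq_iff_stab[symmetric])
        have "p = rmul ?\<gamma> q" using n by (simp add: qmul_assoc[symmetric] qmul_qconj)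
        then have "p \<in> U (qmul p0 ?\<gamma>)" using Ur[of ?\<gamma> p0] g p0 q(1) by (auto simp: stab_def)
        then show "p \<in> \<Union> ((\<lambda>\<gamma>. U (qmul p0 \<gamma>)) ` stab v)" using g by blast
      qed
    qed
    show "\<forall>u\<in>(\<lambda>\<gamma>. U (qmul p0 \<gamma>)) ` stab v. openin (top_of_set S3) u" using Uo by auto
    show "pairwise disjnt ((\<lambda>\<gamma>. U (qmul p0 \<gamma>)) ` stab v)"
    proof (clarsimp simp: pairwise_def disjnt_def)
      fix \<gamma> \<gamma>' assume g: "\<gamma> \<in> stab v" "\<gamma>' \<in> stab v" "U (qmul p0 \<gamma>) \<noteq> U (qmul p0 \<gamma>')"
      show "U (qmul p0 \<gamma>) \<inter> U (qmul p0 \<gamma>') = {}"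
      proof (rule ccontr)
        assume "U (qmul p0 \<gamma>) \<inter> U (qmul p0 \<gamma>') \<noteq> {}"
        then obtain p where p: "p \<in> U (qmul p0 \<gamma>)" "p \<in> U (qmul p0 \<gamma>')" by auto
        have n: "norm \<gamma> = 1" "norm \<gamma>' = 1" using g by (auto simp: stab_def)
        have s: "qmul p0 \<gamma> \<in> U p" "qmul p0 \<gamma>' \<in> U p"
          using p n p0 by (auto simp: U_def dist_commute norm_qmul)
        have "?o (qmul p0 \<gamma>) = ?o (qmul p0 \<gamma>')" using g p0 by (simp add: stab_def act_qmul)
        then have "qmul p0 \<gamma> = qmul p0 \<gamma>'" using inj[OF s] by simp
        then show False using g(3) by simp
      qed
    qed
    show "\<forall>u\<in>(\<lambda>\<gamma>. U (qmul p0 \<gamma>)) ` stab v. \<exists>q. homeomorphism u T ?o q"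
    proof
      fix u assume "u \<in> (\<lambda>\<gamma>. U (qmul p0 \<gamma>)) ` stab v"
      then obtain \<gamma> where g: "\<gamma> \<in> stab v" "u = U (qmul p0 \<gamma>)" by auto
      have uS: "u \<subseteq> S3" using g by (auto simp: U_def)
      have "\<exists>q. homeomorphism u T ?o q"
      proof (rule homeomorphism_injective_open_map[where S=u and f="?o" and T=T])
        show "continuous_on u ?o" by (rule continuous_on_subset[OF co uS])
        show "?o ` u = T" using oT g by simp
        show "inj_on ?o u" using inj g by (auto simp: inj_on_def)
        show "openin (top_of_set T) (?o ` W)" if "openin (top_of_set u) W" for W
        proof -
          have "openin (top_of_set S3) W" using that Uo g openin_trans by blast
          then have "openin (top_of_set (orbit0 v)) (?o ` W)" by (rule openmap)
          moreover have "?o ` W \<subseteq> T" using that openin_imp_subset \<open>?o ` u = T\<close> by blast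
          moreover have "T \<subseteq> orbit0 v" unfolding T_def by (auto simp: U_def orbit0_def)
          ultimately show ?thesis by (meson openin_subset_trans)
        qed
      qed blast
      then show "\<exists>q. homeomorphism u T ?o q" .
    qed
  qed
qed

end

section \<open>Averaging chains over the finite group\<close>

context quat_action
begin

definition avg :: "nat => 'v chain => 'v chain" where
  "avg p c = (\<Sum>z\<in>Z. chain_map p z c)"

definition Z_invariant :: "nat => 'v chain => bool" where
  "Z_invariant p c \<longleftrightarrow> (\<forall>z\<in>Z. chain_map p z c = c)"

lemma avg_linear: "avg p (a + b) = avg p a + avg p b" "avg p (a - b) = avg p a - avg p b"
    "avg p 0 = 0" "avg p (frag_cmul k a) = frag_cmul k (avg p a)"
  by (simp_all add: avg_def chain_map_add chain_map_diff sum.distrib sum_subtractf frag_cmul_sum)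

lemma Z_invariant_avg: "Z_invariant p (avg p c)"
  unfolding Z_invariant_def
proof
  fix w assume w: "w \<in> Z"
  have "chain_map p w (avg p c) = (\<Sum>z\<in>Z. chain_map p (w \<circ> z) c)"
    by (simp add: avg_def chain_map_sum finite_Z chain_map_compose)
  also have "\<dots> = avg p c"
    unfolding avg_def
  proof (rule sum.reindex_bij_witness[where i="\<lambda>z. inv_Z w \<circ> z" and j="\<lambda>z. w \<circ> z"])
    fix a assume a: "a \<in> Z"
    show "inv_Z w \<circ> (w \<circ> a) = a" "w \<circ> (inv_Z w \<circ> a) = a"
      using inv_Z[OF w] by (auto simp: fun_eq_iff)
    show "w \<circ> a \<in> Z" "inv_Z w \<circ> a \<in> Z" using comp_Z inv_Z(1)[OF w] w a by auto
  qed simp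
  finally show "chain_map p w (avg p c) = avg p c" .
qed

lemma avg_invariant: "Z_invariant p c ==> avg p c = frag_cmul (int (card Z)) c"
proof -
  have "(\<Sum>z\<in>A. c) = frag_cmul (int (card A)) c" if "finite A" for A :: "('v => 'v) set"
    using that by (induction A rule: finite_induct) (auto simp: frag_cmul_distrib algebra_simps)
  then show "Z_invariant p c ==> avg p c = frag_cmul (int (card Z)) c"
    using finite_Z by (simp add: avg_def Z_invariant_def)
qed

lemma Z_invariant_linear:
  "Z_invariant p a ==> Z_invariant p b ==> Z_invariant p (a + b)"
  "Z_invariant p a ==> Z_invariant p b ==> Z_invariant p (a - b)"
  "Z_invariant p a ==> Z_invariant p (frag_cmul k a)" "Z_invariant p 0"
  by (simp_all add: Z_invariant_def chain_map_add chain_map_diff)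

lemma Z_invariant_extend:
  fixes c :: "'b \<Rightarrow>\<^sub>0 int"
  assumes "\<And>\<sigma>. \<sigma> \<in> Poly_Mapping.keys c ==> Z_invariant p (f \<sigma>)"
  shows "Z_invariant p (frag_extend f c)"
proof -
  have gen: "Z_invariant p (\<Sum>i\<in>I. g i)" if "\<And>i. i \<in> I ==> Z_invariant p (g i)" for I and g :: "'b => 'v chain"
    using that by (induction I rule: infinite_finite_induct) (auto intro: Z_invariant_linear)
  show ?thesis
    unfolding frag_extend_def by (rule gen) (rule Z_invariant_linear(3)[OF assms])
qed

end

section \<open>Transfer from the orbits to the 3-sphere\<close>

context quat_action
begin

abbreviation orbit_map :: "'v => quat => 'v" where
  "orbit_map v \<equiv> \<lambda>p. act p v"

lemma continuous_orbit_map: "continuous_map S3_top (top_of_set (orbit0 v)) (orbit_map v)"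
  by (auto simp: continuous_map_subtopology_eu orbit0_def intro!: continuous_on_act continuous_intros)

lemma continuous_rmul: "norm r = 1 ==> continuous_map S3_top S3_top (rmul r)"
  by (auto simp: continuous_map_subtopology_eu norm_qmul intro!: continuous_on_rmul)

definition lift_of :: "'v => nat => ((nat => real) => 'v) => (nat => real) => quat" where
  "lift_of v p \<sigma> = (SOME \<tau>. singular_simplex p S3_top \<tau> \<and> simplex_map p (orbit_map v) \<tau> = \<sigma>)"

text \<open>The transfer of the finite covering of \<open>orbit0 v\<close> by the sphere: a simplex
  goes to the sum of all its lifts. Simplices elsewhere go to 0, so that the map also applies to
  chains of the full orbit \<open>orb v\<close>.\<close>

definition transfer :: "'v => nat => 'v chain => quat chain" where
  "transfer v p = frag_extend (\<lambda>\<sigma>. if singular_simplex p (top_of_set (orbit0 v)) \<sigma>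
     then \<Sum>\<gamma>\<in>stab v. chain_map p (rmul \<gamma>) (frag_of (lift_of v p \<sigma>)) else 0)"

lemma transfer_linear: "transfer v p (a + b) = transfer v p a + transfer v p b"
    "transfer v p (a - b) = transfer v p a - transfer v p b" "transfer v p 0 = 0"
    "transfer v p (frag_cmul k a) = frag_cmul k (transfer v p a)"
  by (simp_all add: transfer_def frag_extend_add frag_extend_diff frag_extend_cmul)

lemma transfer_sum: "finite I ==> transfer v p (sum f I) = (\<Sum>i\<in>I. transfer v p (f i))"
  by (induction I rule: finite_induct) (auto simp: transfer_linear)

lemma stab_unit: "\<gamma> \<in> stab v ==> norm \<gamma> = 1"
  by (simp add: stab_def)

lemma orbit_map_rmul: "\<gamma> \<in> stab v ==> norm p = 1 ==> orbit_map v (rmul \<gamma> p) = orbit_map v p"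
  by (simp add: stab_def act_qmul)

lemma simplex_map_rmul_lift:
  assumes "\<gamma> \<in> stab v" "singular_simplex p S3_top \<tau>"
  shows "simplex_map p (orbit_map v) (simplex_map p (rmul \<gamma>) \<tau>) = simplex_map p (orbit_map v) \<tau>"
  using assms(2) orbit_map_rmul[OF assms(1)]
  by (auto simp: simplex_map_def singular_simplex_euclidean fun_eq_iff image_subset_iff)

lemma lifts_differ_by_stab:
  assumes fin: "finite (stab v)" and \<tau>: "singular_simplex p S3_top \<tau>" and \<tau>': "singular_simplex p S3_top \<tau>'"
    and eq: "simplex_map p (orbit_map v) \<tau> = simplex_map p (orbit_map v) \<tau>'"
  obtains \<gamma> where "\<gamma> \<in> stab v" "\<tau>' = simplex_map p (rmul \<gamma>) \<tau>"
proof -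
  obtain x where x: "x \<in> standard_simplex p" using nonempty_standard_simplex by blast
  have n: "norm (\<tau> x) = 1" "norm (\<tau>' x) = 1"
    using \<tau> \<tau>' x by (auto simp: singular_simplex_euclidean image_subset_iff)
  define \<gamma> where "\<gamma> = qmul (qconj (\<tau> x)) (\<tau>' x)"
  have "act (\<tau>' x) v = act (\<tau> x) v" using fun_cong[OF eq, of x] x by (simp add: simplex_map_def)
  then have g: "\<gamma> \<in> stab v" unfolding \<gamma>_def using n by (simp add: act_eq_iff_stab[symmetric])
  moreover have "\<tau>' = simplex_map p (rmul \<gamma>) \<tau>"
  proof (rule lift_singular_simplex_unique[OF covering_orbit[OF fin] \<tau>' _ _ x])
    show "singular_simplex p S3_top (simplex_map p (rmul \<gamma>) \<tau>)"
      by (rule singular_simplex_simplex_map[OF \<tau> continuous_rmul[OF stab_unit[OF g]]])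
    show "simplex_map p (orbit_map v) \<tau>' = simplex_map p (orbit_map v) (simplex_map p (rmul \<gamma>) \<tau>)"
      using simplex_map_rmul_lift[OF g \<tau>] eq by simp
    show "\<tau>' x = simplex_map p (rmul \<gamma>) \<tau> x"
      using x n by (simp add: simplex_map_def \<gamma>_def qmul_assoc[symmetric] qmul_qconj)
  qed
  ultimately show ?thesis using that by blast
qed

text \<open>Whichever lift was chosen, it is the translate of \<tau> by some element of the
  stabilizer, and multiplication by that element permutes the stabilizer.\<close>

lemma transfer_orbit_map:
  assumes fin: "finite (stab v)" and c: "singular_chain p S3_top c"
  shows "transfer v p (chain_map p (orbit_map v) c) = (\<Sum>\<gamma>\<in>stab v. chain_map p (rmul \<gamma>) c)"
  using c unfolding singular_chain_def
proof (induction c rule: frag_induction)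
  case (one \<tau>)
  then have \<tau>: "singular_simplex p S3_top \<tau>" by simp
  let ?\<sigma> = "simplex_map p (orbit_map v) \<tau>"
  have \<sigma>: "singular_simplex p (top_of_set (orbit0 v)) ?\<sigma>"
    by (rule singular_simplex_simplex_map[OF \<tau> continuous_orbit_map])
  have "singular_simplex p S3_top (lift_of v p ?\<sigma>) \<and> simplex_map p (orbit_map v) (lift_of v p ?\<sigma>) = ?\<sigma>"
    unfolding lift_of_def by (rule someI[of _ \<tau>]) (simp add: \<tau>)
  then obtain \<gamma>0 where g0: "\<gamma>0 \<in> stab v" "lift_of v p ?\<sigma> = simplex_map p (rmul \<gamma>0) \<tau>"
    using lifts_differ_by_stab[OF fin \<tau>] by metis
  have "(\<Sum>\<gamma>\<in>stab v. chain_map p (rmul \<gamma>) (frag_of (lift_of v p ?\<sigma>))) = (\<Sum>\<gamma>\<in>stab v. chain_map p (rmul (qmul \<gamma>0 \<gamma>)) (frag_of \<tau>))"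
  proof (intro sum.cong refl)
    fix \<gamma>
    have "simplex_map p (rmul \<gamma>) (simplex_map p (rmul \<gamma>0) \<tau>) = simplex_map p (rmul (qmul \<gamma>0 \<gamma>)) \<tau>"
      by (auto simp: simplex_map_def fun_eq_iff qmul_assoc)
    then show "chain_map p (rmul \<gamma>) (frag_of (lift_of v p ?\<sigma>)) = chain_map p (rmul (qmul \<gamma>0 \<gamma>)) (frag_of \<tau>)"
      by (simp add: g0)
  qed
  also have "\<dots> = (\<Sum>\<gamma>\<in>stab v. chain_map p (rmul \<gamma>) (frag_of \<tau>))"
    by (rule sum.reindex_bij_witness[where i="\<lambda>\<gamma>. qmul (qconj \<gamma>0) \<gamma>" and j="\<lambda>\<gamma>. qmul \<gamma>0 \<gamma>"])
      (use g0 in \<open>auto simp: stab_qmul stab_qconj qmul_assoc[symmetric] qmul_qconj stab_unit\<close>)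
  finally show ?case using \<sigma> by (simp add: transfer_def)
next
  case (diff a b)
  then show ?case by (simp add: chain_map_diff transfer_linear sum_subtractf)
qed (simp add: transfer_linear)

text \<open>\<open>orb v\<close> consists of finitely many compact quaternion orbits, any two of
  them equal or disjoint, so a connected subset lies in one of them.\<close>

lemma orbit0_subset_or_disjoint:
  assumes "connected C" "C \<subseteq> orb v" "x \<in> C" "x \<in> orbit0 v"
  shows "C \<subseteq> orbit0 v"
proof -
  define O' where "O' = (\<Union>z\<in>{z\<in>Z. orbit0 (z v) \<noteq> orbit0 v}. orbit0 (z v))"
  have "compact O'" unfolding O'_def using finite_Z by (intro compact_UN) (auto simp: compact_orbit0)
  have "C \<subseteq> orbit0 v \<union> O'" using assms(2) unfolding O'_def orb_eq_UN by blast
  moreover have "orbit0 v \<inter> O' = {}"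
    unfolding O'_def using orbit0_eq by blast
  ultimately show ?thesis
    using connected_closedD[OF assms(1), of "orbit0 v" O'] assms(3,4)
      compact_imp_closed[OF compact_orbit0, of v] compact_imp_closed[OF \<open>compact O'\<close>] by blast
qed

lemma transfer_outside:
  assumes "singular_chain p (top_of_set (orbit0 w)) c" "w \<notin> orbit0 v"
  shows "transfer v p c = 0"
proof -
  have disj: "orbit0 w \<inter> orbit0 v = {}"
    using assms(2) orbit0_eq orbit0_self by blast
  show ?thesis
    unfolding transfer_def
  proof (rule frag_extend_eq_0)
    fix \<sigma> assume "\<sigma> \<in> Poly_Mapping.keys c"
    then have "singular_simplex p (top_of_set (orbit0 w)) \<sigma>"
      using assms(1) unfolding singular_chain_def by blast
    then have "\<sigma> ` standard_simplex p \<subseteq> orbit0 w"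
      by (simp add: singular_simplex_euclidean)
    then have "\<not> singular_simplex p (top_of_set (orbit0 v)) \<sigma>"
      using disj nonempty_standard_simplex[of p] unfolding singular_simplex_euclidean by blast
    then show "(if singular_simplex p (top_of_set (orbit0 v)) \<sigma>
       then \<Sum>\<gamma>\<in>stab v. chain_map p (rmul \<gamma>) (frag_of (lift_of v p \<sigma>)) else 0) = 0" by simp
  qed
qed

lemma singular_simplex_orb_cases:
  assumes "singular_simplex p (top_of_set (orb v)) \<sigma>"
  obtains z where "z \<in> Z" "singular_simplex p (top_of_set (orbit0 (z v))) \<sigma>"
proof -
  have \<sigma>: "continuous_on (standard_simplex p) \<sigma>" "\<sigma> ` standard_simplex p \<subseteq> orb v" "\<sigma> \<in> extensional (standard_simplex p)"
    using assms by (auto simp: singular_simplex_euclidean)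
  obtain x where x: "x \<in> standard_simplex p" using nonempty_standard_simplex by blast
  then obtain z where z: "z \<in> Z" "\<sigma> x \<in> orbit0 (z v)" using \<sigma>(2) by (auto simp: orb_eq_UN)
  have "orb (z v) = orb v"
  proof -
    have "orb (w u) \<subseteq> orb u" if "w \<in> Z" for w u
      unfolding orb_def using comp_Z[OF _ that] by (auto simp: o_def) (metis comp_apply comp_Z that)
    from this[OF z(1), of v] this[OF inv_Z(1)[OF z(1)], of "z v"] show ?thesis
      using inv_Z(5)[OF z(1)] by auto
  qed
  then have "\<sigma> ` standard_simplex p \<subseteq> orbit0 (z v)"
    using orbit0_subset_or_disjoint[OF connected_continuous_image[OF \<sigma>(1) connected_standard_simplex], of "z v" "\<sigma> x"] \<sigma>(2) x z(2)
    by auto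
  then show ?thesis using that z(1) \<sigma> by (auto simp: singular_simplex_euclidean)
qed

lemma orbit_map_lift:
  assumes "finite (stab v)" "p \<le> 4" "singular_chain p (top_of_set (orbit0 v)) c"
  obtains b where "singular_chain p S3_top b" "chain_map p (orbit_map v) b = c"
proof -
  have "\<exists>b. singular_chain p S3_top b \<and> chain_map p (orbit_map v) b = c"
    using assms(3) unfolding singular_chain_def
  proof (induction c rule: frag_induction)
    case (one \<sigma>)
    then obtain \<tau> where "singular_simplex p S3_top \<tau>" "simplex_map p (orbit_map v) \<tau> = \<sigma>"
      using lift_singular_simplex[OF covering_orbit[OF assms(1)] assms(2)] by auto
    then show ?case by (intro exI[of _ "frag_of \<tau>"]) auto
  next
    case (diff a b)
    then obtain a' b' where "Poly_Mapping.keys a' \<subseteq> singular_simplex_set p S3_top" "chain_map p (orbit_map v) a' = a"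
       "Poly_Mapping.keys b' \<subseteq> singular_simplex_set p S3_top" "chain_map p (orbit_map v) b' = b" by auto
    then show ?case
      using keys_diff[of a' b'] by (intro exI[of _ "a' - b'"]) (auto simp: chain_map_diff)
  qed auto
  then show ?thesis using that by blast
qed

text \<open>A simplex of \<open>orbit0 v\<close> is the image of a chain of the sphere, and for such
  images \<open>transfer_orbit_map\<close> reduces the claim to naturality of the boundary. The
  remaining simplices and their faces transfer to 0.\<close>

lemma chain_boundary_transfer:
  assumes fin: "finite (stab v)" and p: "p \<le> 4" and c: "singular_chain p (top_of_set (orb v)) c"
  shows "chain_boundary p (transfer v p c) = transfer v (p - Suc 0) (chain_boundary p c)"
  using c unfolding singular_chain_def
proof (induction c rule: frag_induction)
  case (one \<sigma>)
  then have "singular_simplex p (top_of_set (orb v)) \<sigma>" by simp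
  then obtain z where z: "z \<in> Z" and \<sigma>: "singular_simplex p (top_of_set (orbit0 (z v))) \<sigma>"
    by (rule singular_simplex_orb_cases)
  then have sc: "singular_chain p (top_of_set (orbit0 (z v))) (frag_of \<sigma>)" by (simp add: singular_chain_of)
  show ?case
  proof (cases "z v \<in> orbit0 v")
    case True
    then have "singular_chain p (top_of_set (orbit0 v)) (frag_of \<sigma>)" using sc orbit0_eq by simp
    then obtain b where b: "singular_chain p S3_top b" "chain_map p (orbit_map v) b = frag_of \<sigma>"
      using orbit_map_lift[OF fin p] by blast
    have "chain_boundary p (transfer v p (frag_of \<sigma>)) = (\<Sum>\<gamma>\<in>stab v. chain_map (p - Suc 0) (rmul \<gamma>) (chain_boundary p b))"
      using b by (simp add: b(2)[symmetric] transfer_orbit_map[OF fin] chain_boundary_sum o_def chain_boundary_chain_map)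
    also have "\<dots> = transfer v (p - Suc 0) (chain_map (p - Suc 0) (orbit_map v) (chain_boundary p b))"
      by (rule transfer_orbit_map[OF fin singular_chain_boundary[OF b(1)], symmetric])
    also have "\<dots> = transfer v (p - Suc 0) (chain_boundary p (frag_of \<sigma>))"
      using chain_boundary_chain_map[OF b(1), of "orbit_map v"] b(2) by simp
    finally show ?thesis .
  next
    case False
    then show ?thesis
      using transfer_outside[OF sc False] transfer_outside[OF singular_chain_boundary[OF sc] False] by simp
  qed
next
  case (diff a b)
  then show ?case by (simp add: chain_boundary_diff transfer_linear)
qed (simp add: transfer_linear)

lemma singular_chain_transfer:
  assumes fin: "finite (stab v)" and p: "p \<le> 4" and c: "singular_chain p (top_of_set (orb v)) c"
  shows "singular_chain p S3_top (transfer v p c)"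
  using c unfolding singular_chain_def[of p "top_of_set (orb v)"]
proof (induction c rule: frag_induction)
  case (one \<sigma>)
  then have "singular_simplex p (top_of_set (orb v)) \<sigma>" by simp
  then obtain z where z: "z \<in> Z" and \<sigma>: "singular_simplex p (top_of_set (orbit0 (z v))) \<sigma>"
    by (rule singular_simplex_orb_cases)
  then have sc: "singular_chain p (top_of_set (orbit0 (z v))) (frag_of \<sigma>)" by (simp add: singular_chain_of)
  show ?case
  proof (cases "z v \<in> orbit0 v")
    case True
    then have "singular_chain p (top_of_set (orbit0 v)) (frag_of \<sigma>)" using sc orbit0_eq by simp
    then obtain b where b: "singular_chain p S3_top b" "chain_map p (orbit_map v) b = frag_of \<sigma>"
      using orbit_map_lift[OF fin p] by blast
    show ?thesis
      unfolding b(2)[symmetric] transfer_orbit_map[OF fin b(1)]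
      by (intro singular_chain_sum singular_chain_chain_map[OF b(1)] continuous_rmul stab_unit)
  next
    case False
    then show ?thesis using transfer_outside[OF sc False] by simp
  qed
next
  case (diff a b)
  then show ?case by (simp add: transfer_linear singular_chain_diff)
qed (simp add: transfer_linear)

end

section \<open>Chains near an orbit\<close>

definition S3_class :: "quat chain" where
  "S3_class = (SOME \<mu>. singular_relcycle 3 S3_top {} \<mu> \<and>
     (\<forall>c. singular_relcycle 3 S3_top {} c --> (\<exists>m. singular_relboundary 3 S3_top {} (c - frag_cmul m \<mu>))) \<and>
     (\<forall>m. singular_relboundary 3 S3_top {} (frag_cmul m \<mu>) --> m = 0))"

lemma S3_class:
  shows "singular_relcycle 3 S3_top {} S3_class"
    and "singular_relcycle 3 S3_top {} c ==> \<exists>m. singular_relboundary 3 S3_top {} (c - frag_cmul m S3_class)"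
    and "singular_relboundary 3 S3_top {} (frag_cmul m S3_class) ==> m = 0"
proof -
  have "\<exists>\<mu>. singular_relcycle 3 S3_top {} \<mu> \<and>
     (\<forall>c. singular_relcycle 3 S3_top {} c --> (\<exists>m. singular_relboundary 3 S3_top {} (c - frag_cmul m \<mu>))) \<and>
     (\<forall>m. singular_relboundary 3 S3_top {} (frag_cmul m \<mu>) --> m = 0)"
    using infinite_cyclic_homology_generator[of 3 S3_top] homology_S3(1) by (metis of_nat_numeral)
  note someI_ex[OF this, folded S3_class_def]
  then show "singular_relcycle 3 S3_top {} S3_class"
    "singular_relcycle 3 S3_top {} c ==> \<exists>m. singular_relboundary 3 S3_top {} (c - frag_cmul m S3_class)"
    "singular_relboundary 3 S3_top {} (frag_cmul m S3_class) ==> m = 0" by blast+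
qed

lemma frag_aug_chain_map [simp]: "frag_aug (chain_map p f c) = frag_aug c"
  using subset_UNIV by (induction c rule: frag_induction) (auto simp: frag_extend_diff chain_map_diff)

lemma frag_cmul_diff: "frag_cmul k (a - b) = frag_cmul k a - frag_cmul k b"
  by (rule poly_mapping_eqI) (simp add: lookup_minus algebra_simps)

lemma frag_extend_sum_set: "finite I ==> frag_extend f (sum g I) = (\<Sum>i\<in>I. frag_extend f (g i))"
  by (induction I rule: finite_induct) (auto simp: frag_extend_add)

lemma sum_const_frag: "finite A ==> (\<Sum>x\<in>A. c) = frag_cmul (int (card A)) c"
  by (induction A rule: finite_induct) (auto simp: frag_cmul_distrib algebra_simps)

context quat_action
begin

definition nbhd :: "'v => real => 'v set" where
  "nbhd v eps = {w. \<exists>x\<in>orb v. dist w x < eps}"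

text \<open>The number of pairs of a unit quaternion p and z \<in> Z such that p after z fixes
  \<open>v\<close>; by \<open>avg_transfer\<close> it is the factor gained in passing to the sphere
  and back.\<close>

definition sheets :: "'v => nat" where
  "sheets v = card (stab v) * card {z \<in> Z. z v \<in> orbit0 v}"

definition orbit_class :: "'v => 'v chain" where
  "orbit_class v = avg 3 (chain_map 3 (orbit_map v) S3_class)"

lemma sheets_pos: "finite (stab v) ==> sheets v > 0"
  unfolding sheets_def using stab_one[of v] id_Z finite_Z orbit0_self[of v]
  by (auto simp: card_gt_0_iff intro!: exI[of _ id])

lemma card_Z_pos: "card Z > 0"
  using finite_Z id_Z by (auto simp: card_gt_0_iff)

lemma continuous_Z_orbit0: "z \<in> Z ==> continuous_map (top_of_set (orbit0 v)) (top_of_set (orbit0 (z v))) z"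
  using Z_orbit0[of z v] by (auto simp: continuous_map_subtopology_eu continuous_on_Z)

lemma Z_orb: "z \<in> Z ==> x \<in> orb v ==> z x \<in> orb v"
  unfolding orb_def using Z_act comp_Z by (auto simp: o_def) (metis comp_apply comp_Z)

lemma act_orb: "norm p = 1 ==> x \<in> orb v ==> act p x \<in> orb v"
  unfolding orb_eq_UN using orbit0_trans by blast

lemma orb_self: "v \<in> orb v"
  using orbit0_self orbit0_subset_orb by blast

lemma orb_sym: "x \<in> orb v ==> v \<in> orb x"
proof -
  assume "x \<in> orb v"
  then obtain p z where x: "x = act p (z v)" "norm p = 1" "z \<in> Z" by (auto simp: orb_def)
  have "v = inv_Z z (act (qconj p) x)" using x inv_Z(5) act_qconj(2) by simp
  also have "\<dots> = act (qconj p) (inv_Z z x)" using x inv_Z(1) by (simp add: Z_act)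
  finally show "v \<in> orb x" using x inv_Z(1) unfolding orb_def by (metis (mono_tags, lifting) mem_Collect_eq norm_qconj)
qed

lemma orb_eq: "x \<in> orb v ==> orb x = orb v"
proof -
  have sub: "orb x \<subseteq> orb v" if "x \<in> orb v" for x v
    using that act_orb Z_orb by (auto simp: orb_def[of x])
  show "x \<in> orb v ==> orb x = orb v"
    using sub orb_sym by blast
qed

lemma compact_orb: "compact (orb v)"
  unfolding orb_eq_UN using finite_Z by (intro compact_UN) (auto simp: compact_orbit0)

lemma continuous_Z_nbhd: "z \<in> Z ==> continuous_map (top_of_set (nbhd v eps)) (top_of_set (nbhd v eps)) z"
  unfolding continuous_map_subtopology_eu nbhd_def using Z_orb dist_Z
  by (auto simp: continuous_on_Z) (metis dist_Z)

lemma continuous_Z_orb: "z \<in> Z ==> continuous_map (top_of_set (orb v)) (top_of_set (orb v)) z"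
  unfolding continuous_map_subtopology_eu using Z_orb by (auto simp: continuous_on_Z)

lemma singular_chain_avg_nbhd:
  "singular_chain p (top_of_set (nbhd v eps)) c ==> singular_chain p (top_of_set (nbhd v eps)) (avg p c)"
  unfolding avg_def using continuous_Z_nbhd by (auto intro!: singular_chain_sum singular_chain_chain_map)

lemma singular_chain_avg_orb:
  "singular_chain p (top_of_set (orb v)) c ==> singular_chain p (top_of_set (orb v)) (avg p c)"
  unfolding avg_def using continuous_Z_orb by (auto intro!: singular_chain_sum singular_chain_chain_map)

lemma chain_boundary_avg:
  "singular_chain p X c ==> chain_boundary p (avg p c) = avg (p - Suc 0) (chain_boundary p c)"
  unfolding avg_def by (simp add: chain_boundary_sum o_def chain_boundary_chain_map)

lemma frag_aug_avg: "frag_aug (avg p c) = frag_cmul (int (card Z)) (frag_aug c)"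
  by (simp add: avg_def frag_extend_sum_set finite_Z sum_const_frag)

lemma orb_subset_nbhd: "eps > 0 ==> orb v \<subseteq> nbhd v eps"
  unfolding nbhd_def by auto (metis dist_self)

lemma continuous_orbit_map_orb: "continuous_map S3_top (top_of_set (orb v)) (orbit_map v)"
  using continuous_orbit_map[of v] orbit0_subset_orb[of v] by (auto simp: continuous_map_subtopology_eu)

lemma orbit_map_transfer:
  assumes fin: "finite (stab v)" and p: "p \<le> 4" and c: "singular_chain p (top_of_set (orbit0 v)) c"
  shows "chain_map p (orbit_map v) (transfer v p c) = frag_cmul (int (card (stab v))) c"
proof -
  obtain b where b: "singular_chain p S3_top b" "chain_map p (orbit_map v) b = c"
    using orbit_map_lift[OF fin p c] by blast
  have "chain_map p (orbit_map v) (transfer v p c) = (\<Sum>\<gamma>\<in>stab v. chain_map p (orbit_map v \<circ> rmul \<gamma>) b)"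
    using transfer_orbit_map[OF fin b(1)] b(2) fin by (simp add: chain_map_sum chain_map_compose)
  also have "\<dots> = (\<Sum>\<gamma>\<in>stab v. c)"
    unfolding b(2)[symmetric]
    by (intro sum.cong refl chain_map_eq[OF b(1)]) (auto simp: orbit_map_rmul)
  finally show ?thesis using fin by (simp add: sum_const_frag)
qed

text \<open>The set on the left is a coset of the subgroup of \<open>Z\<close> that maps
  \<open>orbit0 v\<close> to itself.\<close>

lemma card_return:
  assumes "z0 \<in> Z"
  shows "card {z \<in> Z. inv_Z z (z0 v) \<in> orbit0 v} = card {z \<in> Z. z v \<in> orbit0 v}"
proof (rule bij_betw_same_card)
  have inv: "inv_Z (inv_Z z) = z" if "z \<in> Z" for z
    using inv_Z[OF inv_Z(1)[OF that]] inv_Z(4,5)[OF that] by (auto simp: fun_eq_iff) metis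
  have inv2: "inv_Z (z0 \<circ> inv_Z w) = w \<circ> inv_Z z0" if "w \<in> Z" for w
  proof
    fix x
    have Z: "z0 \<circ> inv_Z w \<in> Z" by (intro comp_Z assms inv_Z that)
    have "(z0 \<circ> inv_Z w) ((w \<circ> inv_Z z0) x) = x" using inv_Z(4,5) assms that by simp
    then show "inv_Z (z0 \<circ> inv_Z w) x = (w \<circ> inv_Z z0) x" using inv_Z(5)[OF Z] by metis
  qed
  show "bij_betw (\<lambda>z. inv_Z z \<circ> z0) {z \<in> Z. inv_Z z (z0 v) \<in> orbit0 v} {z \<in> Z. z v \<in> orbit0 v}"
  proof (rule bij_betw_byWitness[where f'="\<lambda>w. z0 \<circ> inv_Z w"])
    show "\<forall>a\<in>{z \<in> Z. inv_Z z (z0 v) \<in> orbit0 v}. z0 \<circ> inv_Z (inv_Z a \<circ> z0) = a"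
    proof
      fix a assume "a \<in> {z \<in> Z. inv_Z z (z0 v) \<in> orbit0 v}"
      then have a: "a \<in> Z" by simp
      have Z: "inv_Z a \<circ> z0 \<in> Z" by (intro comp_Z assms inv_Z a)
      show "z0 \<circ> inv_Z (inv_Z a \<circ> z0) = a"
      proof
        fix x
        have "(inv_Z a \<circ> z0) (inv_Z (inv_Z a \<circ> z0) x) = x" using inv_Z(4)[OF Z] .
        then have "a ((inv_Z a \<circ> z0) (inv_Z (inv_Z a \<circ> z0) x)) = a x" by simp
        then show "(z0 \<circ> inv_Z (inv_Z a \<circ> z0)) x = a x" using inv_Z(4)[OF a] by simp
      qed
    qed
    show "\<forall>a'\<in>{z \<in> Z. z v \<in> orbit0 v}. inv_Z (z0 \<circ> inv_Z a') \<circ> z0 = a'"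
      using inv2 inv_Z(5)[OF assms] by (auto simp: fun_eq_iff)
    show "(\<lambda>z. inv_Z z \<circ> z0) ` {z \<in> Z. inv_Z z (z0 v) \<in> orbit0 v} \<subseteq> {z \<in> Z. z v \<in> orbit0 v}"
      using comp_Z inv_Z(1) assms by auto
    show "(\<lambda>w. z0 \<circ> inv_Z w) ` {z \<in> Z. z v \<in> orbit0 v} \<subseteq> {z \<in> Z. inv_Z z (z0 v) \<in> orbit0 v}"
      using comp_Z inv_Z(1) assms inv2 inv_Z(5)[OF assms] by auto
  qed
qed

lemma avg_transfer:
  assumes fin: "finite (stab v)" and p: "p \<le> 4" and c: "singular_chain p (top_of_set (orb v)) c"
    and inv: "Z_invariant p c"
  shows "avg p (chain_map p (orbit_map v) (transfer v p c)) = frag_cmul (int (sheets v)) c"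
proof -
  \<comment> \<open>The formula is linear in \<open>c\<close> once the inverse of \<open>z\<close>
    is applied first, and can be checked on single simplices, which are not invariant. For the
    invariant chain the inverses disappear again.\<close>
  have "(\<Sum>z\<in>Z. chain_map p z (chain_map p (orbit_map v) (transfer v p (chain_map p (inv_Z z) c))))
      = frag_cmul (int (sheets v)) c"
    using c unfolding singular_chain_def
  proof (induction c rule: frag_induction)
    case (one \<sigma>)
    then have "singular_simplex p (top_of_set (orb v)) \<sigma>" by simp
    then obtain z0 where z0: "z0 \<in> Z" and \<sigma>: "singular_simplex p (top_of_set (orbit0 (z0 v))) \<sigma>"
      by (rule singular_simplex_orb_cases)
    then have sc: "singular_chain p (top_of_set (orbit0 (z0 v))) (frag_of \<sigma>)" by (simp add: singular_chain_of)
    define A where "A = {z \<in> Z. inv_Z z (z0 v) \<in> orbit0 v}"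
    have A: "A \<subseteq> Z" "finite A" using finite_Z by (auto simp: A_def)
    have "chain_map p z (chain_map p (orbit_map v) (transfer v p (chain_map p (inv_Z z) (frag_of \<sigma>))))
        = (if z \<in> A then frag_cmul (int (card (stab v))) (frag_of \<sigma>) else 0)" if z: "z \<in> Z" for z
    proof -
      have sz: "singular_chain p (top_of_set (orbit0 (inv_Z z (z0 v)))) (chain_map p (inv_Z z) (frag_of \<sigma>))"
        by (rule singular_chain_chain_map[OF sc continuous_Z_orbit0[OF inv_Z(1)[OF z]]])
      show ?thesis
      proof (cases "z \<in> A")
        case True
        then have "singular_chain p (top_of_set (orbit0 v)) (chain_map p (inv_Z z) (frag_of \<sigma>))"
          using sz orbit0_eq by (auto simp: A_def)
        then have "chain_map p z (chain_map p (orbit_map v) (transfer v p (chain_map p (inv_Z z) (frag_of \<sigma>))))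
          = frag_cmul (int (card (stab v))) ((chain_map p z \<circ> chain_map p (inv_Z z)) (frag_of \<sigma>))"
          by (simp only: orbit_map_transfer[OF fin p] chain_map_cmul o_apply)
        also have "(chain_map p z \<circ> chain_map p (inv_Z z)) (frag_of \<sigma>) = frag_of \<sigma>"
          unfolding chain_map_compose[symmetric] inv_Z(2)[OF z] by (rule chain_map_ident[OF sc])
        finally show ?thesis using True by simp
      next
        case False
        then show ?thesis using transfer_outside[OF sz] z by (auto simp: A_def)
      qed
    qed
    then have "(\<Sum>z\<in>Z. chain_map p z (chain_map p (orbit_map v) (transfer v p (chain_map p (inv_Z z) (frag_of \<sigma>)))))
        = (\<Sum>z\<in>Z. if z \<in> A then frag_cmul (int (card (stab v))) (frag_of \<sigma>) else 0)"
      by (rule sum.cong[OF refl])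
    also have "\<dots> = (\<Sum>z\<in>A. frag_cmul (int (card (stab v))) (frag_of \<sigma>))"
      using A finite_Z by (simp add: sum.inter_restrict[symmetric] Int_absorb1)
    also have "\<dots> = frag_cmul (int (sheets v)) (frag_of \<sigma>)"
      using A card_return[OF z0, of v] by (simp add: sum_const_frag sheets_def A_def mult.commute)
    finally show ?case .
  next
    case (diff a b)
    then show ?case
      by (simp add: chain_map_diff transfer_linear sum_subtractf frag_cmul_diff)
  qed (simp add: transfer_linear)
  moreover have "chain_map p (inv_Z z) c = c" if "z \<in> Z" for z
    using inv inv_Z(1)[OF that] by (simp add: Z_invariant_def)
  ultimately show ?thesis by (simp add: avg_def)
qed

end

section \<open>Retractions onto an orbit and filling of nearby cycles\<close>

context quat_action
begin

text \<open>Equivariance is recorded for \<open>Z\<close>, because chains pushed along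
  \<open>r\<close> have to stay \<open>Z\<close>-invariant.\<close>

definition equivariant_retraction :: "'v => real => ('v => 'v) => bool" where
  "equivariant_retraction v eta r \<longleftrightarrow> continuous_on (nbhd v eta) r \<and> (\<forall>w\<in>nbhd v eta. r w \<in> orb v) \<and>
     (\<forall>w\<in>orb v. r w = w) \<and> (\<forall>z\<in>Z. \<forall>w\<in>nbhd v eta. r (z w) = z (r w))"

lemma nbhd_mono: "\<delta> \<le> eps ==> nbhd v \<delta> \<subseteq> nbhd v eps"
  unfolding nbhd_def by (auto intro: less_le_trans)

text \<open>Otherwise points displaced by at least \<open>eps\<close> come arbitrarily close to the
  compact orbit and accumulate at one of its points, where \<open>r\<close> is continuous and has a
  fixed point.\<close>

lemma retraction_close:
  assumes r: "equivariant_retraction v eta r" "eta > 0" and "eps > 0"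
  obtains \<delta> where "\<delta> > 0" "\<delta> \<le> eta" "\<And>w. w \<in> nbhd v \<delta> ==> dist (r w) w < eps"
proof -
  have "\<exists>n. \<forall>w\<in>nbhd v (min eta (inverse (real (Suc n)))). dist (r w) w < eps"
  proof (rule ccontr)
    assume "\<not> ?thesis"
    then have "\<forall>n. \<exists>w. w \<in> nbhd v (min eta (inverse (real (Suc n)))) \<and> dist (r w) w \<ge> eps"
      by (simp add: not_less Bex_def)
    then obtain w where w: "\<And>n. w n \<in> nbhd v (min eta (inverse (real (Suc n))))" "\<And>n. dist (r (w n)) (w n) \<ge> eps"
      by metis
    then have "\<forall>n. \<exists>x. x \<in> orb v \<and> dist (w n) x < inverse (real (Suc n))"
      unfolding nbhd_def by fastforce
    then obtain x where x: "\<And>n. x n \<in> orb v" "\<And>n. dist (w n) (x n) < inverse (real (Suc n))"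
      by metis
    obtain l s where l: "l \<in> orb v" "strict_mono (s :: nat => nat)" "(x \<circ> s) \<longlonglongrightarrow> l"
      using compact_orb x(1) unfolding compact_def by metis
    have "(\<lambda>n. dist (w (s n)) (x (s n))) \<longlonglongrightarrow> 0"
    proof (rule Lim_null_comparison)
      show "\<forall>\<^sub>F n in sequentially. norm (dist (w (s n)) (x (s n))) \<le> inverse (real (Suc (s n)))"
      proof (intro always_eventually allI)
        show "norm (dist (w (s n)) (x (s n))) \<le> inverse (real (Suc (s n)))" for n
          using x(2)[of "s n"] by simp
      qed
      show "(\<lambda>n. inverse (real (Suc (s n)))) \<longlonglongrightarrow> 0"
        using LIMSEQ_subseq_LIMSEQ[OF LIMSEQ_inverse_real_of_nat l(2)] by (simp add: o_def)
    qed
    then have wl: "(\<lambda>n. w (s n)) \<longlonglongrightarrow> l"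
      using Lim_transform[OF l(3), of "\<lambda>n. w (s n)"] by (simp add: dist_norm tendsto_norm_zero_iff o_def)
    have "continuous (at l within nbhd v eta) r"
      using r l(1) orb_subset_nbhd[OF r(2), of v] by (auto simp: equivariant_retraction_def continuous_on_eq_continuous_within)
    moreover have "w (s n) \<in> nbhd v eta" for n using w(1)[of "s n"] nbhd_mono[of "min eta _" eta v] by auto
    ultimately have "(\<lambda>n. r (w (s n))) \<longlonglongrightarrow> r l"
      using wl by (auto simp: continuous_within_sequentially o_def)
    then have "(\<lambda>n. dist (r (w (s n))) (w (s n))) \<longlonglongrightarrow> dist (r l) l"
      using wl by (intro tendsto_dist)
    moreover have "r l = l" using r l(1) by (auto simp: equivariant_retraction_def)
    ultimately have "(\<lambda>n. dist (r (w (s n))) (w (s n))) \<longlonglongrightarrow> 0" by simp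
    then have "eps \<le> 0" using w(2) by (intro LIMSEQ_le_const) auto
    then show False using assms by simp
  qed
  then obtain n where "\<forall>w\<in>nbhd v (min eta (inverse (real (Suc n)))). dist (r w) w < eps" by blast
  then show ?thesis using that[of "min eta (inverse (real (Suc n)))"] r(2) by auto
qed

text \<open>Replaces the vanishing of the rational homology of a finite quotient of the 3-sphere in
  degrees 1 and 2 and of its reduced homology in degree 0. The filling must again be invariant to
  serve in the next lifting step.\<close>

definition fills :: "'v => real => real => nat => bool" where
  "fills v \<delta> eps M \<longleftrightarrow> (\<forall>i c. i < 3 --> singular_chain i (top_of_set (nbhd v \<delta>)) c --> chain_boundary i c = 0 -->
     (i = 0 --> frag_aug c = 0) --> Z_invariant i c -->
     (\<exists>d. singular_chain (Suc i) (top_of_set (nbhd v eps)) d \<and> chain_boundary (Suc i) d = frag_cmul (int M) c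
        \<and> Z_invariant (Suc i) d))"

text \<open>The same in degree 3, where a multiple of the orbit class is left over. These multiples
  are the source of the obstruction cochain.\<close>

definition fills3 :: "'v => real => real => nat => bool" where
  "fills3 v \<delta> eps M \<longleftrightarrow> (\<forall>c. singular_chain 3 (top_of_set (nbhd v \<delta>)) c --> chain_boundary 3 c = 0 --> Z_invariant 3 c -->
     (\<exists>d m. singular_chain 4 (top_of_set (nbhd v eps)) d \<and>
        chain_boundary 4 d = frag_cmul (int M) c - frag_cmul m (orbit_class v)))"

definition essential :: "'v => real => bool" where
  "essential v eps \<longleftrightarrow> (\<forall>d m. singular_chain 4 (top_of_set (nbhd v eps)) d -->
      chain_boundary 4 d = frag_cmul m (orbit_class v) --> m = 0)"

lemma straight_line_homologous:
  assumes f: "continuous_map X (top_of_set (nbhd v eps)) f" and g: "continuous_map X (top_of_set (nbhd v eps)) g"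
    and c: "singular_relcycle i X {} c"
    and near: "\<And>x. x \<in> topspace X ==> closed_segment (f x) (g x) \<subseteq> nbhd v eps"
  shows "homologous_rel i (top_of_set (nbhd v eps)) {} (chain_map i f c) (chain_map i g c)"
proof (rule homotopic_imp_homologous_rel_chain_maps[OF _ c])
  let ?h = "\<lambda>x. (1 - fst x) *\<^sub>R f (snd x) + fst x *\<^sub>R g (snd x)"
  have fe: "continuous_map X euclidean f" "continuous_map X euclidean g"
    using f g continuous_map_into_fulltopology by blast+
  have h: "continuous_map (prod_topology (top_of_set {0..1::real}) X) (top_of_set (nbhd v eps)) ?h"
    unfolding continuous_map_in_subtopology
  proof
    have "continuous_map (prod_topology (top_of_set {0..1::real}) X) euclidean fst"
      using continuous_map_fst continuous_map_into_fulltopology by blast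
    moreover have "continuous_map (prod_topology (top_of_set {0..1::real}) X) euclidean (\<lambda>x. f (snd x))"
      "continuous_map (prod_topology (top_of_set {0..1::real}) X) euclidean (\<lambda>x. g (snd x))"
      using continuous_map_compose[OF continuous_map_snd fe(1)] continuous_map_compose[OF continuous_map_snd fe(2)]
      by (auto simp: o_def)
    ultimately show "continuous_map (prod_topology (top_of_set {0..1::real}) X) euclidean ?h"
      unfolding continuous_map_atin
      by (auto intro!: tendsto_intros simp: limitin_canonical_iff)
    show "?h \<in> topspace (prod_topology (top_of_set {0..1::real}) X) \<rightarrow> nbhd v eps"
    proof
      fix x assume x: "x \<in> topspace (prod_topology (top_of_set {0..1::real}) X)"
      then have "?h x \<in> closed_segment (f (snd x)) (g (snd x))" by (auto simp: closed_segment_def)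
      then show "?h x \<in> nbhd v eps" using near[of "snd x"] x by (auto simp: mem_Times_iff)
    qed
  qed
  then show "homotopic_with (\<lambda>h. h \<in> {} \<rightarrow> {}) X (top_of_set (nbhd v eps)) f g"
    unfolding homotopic_with_def by (intro exI[of _ ?h]) auto
qed

lemma retraction_homologous:
  assumes r: "equivariant_retraction v eta r" "eta > 0" and eps: "eps > 0"
  obtains \<delta> where "\<delta> > 0" "\<delta> \<le> eta" "\<delta> \<le> eps"
    "\<And>i c. singular_relcycle i (top_of_set (nbhd v \<delta>)) {} c ==>
        homologous_rel i (top_of_set (nbhd v eps)) {} c (chain_map i r c) \<and>
        singular_relcycle i (top_of_set (orb v)) {} (chain_map i r c)"
proof -
  obtain \<delta>0 where \<delta>0: "\<delta>0 > 0" "\<delta>0 \<le> eta" "\<And>w. w \<in> nbhd v \<delta>0 ==> dist (r w) w < eps"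
    using retraction_close[OF r eps] by blast
  define \<delta> where "\<delta> = min \<delta>0 eps"
  have \<delta>: "\<delta> > 0" "\<delta> \<le> eta" "\<delta> \<le> eps" "\<And>w. w \<in> nbhd v \<delta> ==> dist (r w) w < eps"
    using \<delta>0 eps nbhd_mono[of \<delta> \<delta>0 v] by (auto simp: \<delta>_def)
  have rc: "continuous_map (top_of_set (nbhd v \<delta>)) (top_of_set (orb v)) r"
    using r nbhd_mono[OF \<delta>(2), of v] by (auto simp: continuous_map_subtopology_eu equivariant_retraction_def
        intro: continuous_on_subset)
  have "homologous_rel i (top_of_set (nbhd v eps)) {} c (chain_map i r c) \<and>
        singular_relcycle i (top_of_set (orb v)) {} (chain_map i r c)"
    if c: "singular_relcycle i (top_of_set (nbhd v \<delta>)) {} c" for i c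
  proof
    have "homologous_rel i (top_of_set (nbhd v eps)) {} (chain_map i id c) (chain_map i r c)"
    proof (rule straight_line_homologous[OF _ _ c])
      show "continuous_map (top_of_set (nbhd v \<delta>)) (top_of_set (nbhd v eps)) id"
        using nbhd_mono[OF \<delta>(3), of v] by (auto simp: continuous_map_subtopology_eu)
      show "continuous_map (top_of_set (nbhd v \<delta>)) (top_of_set (nbhd v eps)) r"
        using rc orb_subset_nbhd[OF eps, of v] by (auto simp: continuous_map_subtopology_eu)
      show "closed_segment (id w) (r w) \<subseteq> nbhd v eps" if "w \<in> topspace (top_of_set (nbhd v \<delta>))" for w
      proof
        fix y assume "y \<in> closed_segment (id w) (r w)"
        then have "dist y (r w) \<le> dist w (r w)" using dist_in_closed_segment by fastforce
        also have "\<dots> < eps" using \<delta>(4) that by (simp add: dist_commute)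
        finally show "y \<in> nbhd v eps"
          using rc that by (auto simp: nbhd_def continuous_map_subtopology_eu)
      qed
    qed
    then show "homologous_rel i (top_of_set (nbhd v eps)) {} c (chain_map i r c)"
      using chain_map_ident c by (metis singular_cycle)
    show "singular_relcycle i (top_of_set (orb v)) {} (chain_map i r c)"
      by (rule singular_relcycle_chain_map[OF c rc]) auto
  qed
  then show ?thesis using that \<delta> by blast
qed

text \<open>Retract a cycle to the orbit, transfer it to the 3-sphere, bound it there as far as the
  homology of the sphere permits, map the bounding chain back and average. By
  \<open>avg_transfer\<close> this fills a multiple of the cycle.\<close>

lemma orbit_fills:
  assumes fin: "finite (stab v)" and r: "equivariant_retraction v eta r" "eta > 0" and eps: "eps > 0"
  obtains \<delta> M where "\<delta> > 0" "\<delta> \<le> eps" "M > 0" "fills v \<delta> eps M" "fills3 v \<delta> eps M"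
proof -
  obtain \<delta> where \<delta>: "\<delta> > 0" "\<delta> \<le> eta" "\<delta> \<le> eps" and hom: "\<And>i c. singular_relcycle i (top_of_set (nbhd v \<delta>)) {} c ==>
        homologous_rel i (top_of_set (nbhd v eps)) {} c (chain_map i r c) \<and>
        singular_relcycle i (top_of_set (orb v)) {} (chain_map i r c)"
    using retraction_homologous[OF r eps] by metis
  let ?M0 = "int (sheets v)" and ?k = "int (card Z)"
  have ON: "singular_chain i (top_of_set (nbhd v eps)) c" if "singular_chain i (top_of_set (orb v)) c" for i c
    by (rule singular_chain_mono[OF that orb_subset_nbhd[OF eps]])
  have pushed: "singular_chain i (top_of_set (orb v)) (chain_map i r c)" "chain_boundary i (chain_map i r c) = 0"
    if c: "singular_chain i (top_of_set (nbhd v \<delta>)) c" "chain_boundary i c = 0" for i c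
    using hom[of i c] c by (auto simp: singular_cycle)
  have pushed_inv: "Z_invariant i (chain_map i r c)"
    if c: "singular_chain i (top_of_set (nbhd v \<delta>)) c" "Z_invariant i c" for i c
    unfolding Z_invariant_def
  proof
    fix z assume z: "z \<in> Z"
    have "chain_map i z (chain_map i r c) = chain_map i (z \<circ> r) c" by (simp add: chain_map_compose)
    also have "\<dots> = chain_map i (r \<circ> z) c"
    proof (rule chain_map_eq[OF c(1)])
      fix x assume "x \<in> topspace (top_of_set (nbhd v \<delta>))"
      then have "x \<in> nbhd v eta" using nbhd_mono[OF \<delta>(2), of v] by auto
      then show "(z \<circ> r) x = (r \<circ> z) x" using r(1) z by (auto simp: equivariant_retraction_def)
    qed
    also have "\<dots> = chain_map i r c" using c(2) z by (simp add: chain_map_compose Z_invariant_def)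
    finally show "chain_map i z (chain_map i r c) = chain_map i r c" .
  qed
  have cyc: "singular_relcycle i S3_top {} (transfer v i (chain_map i r c))"
    if i: "i \<le> 3" and c: "singular_chain i (top_of_set (nbhd v \<delta>)) c" "chain_boundary i c = 0" for i c
    using singular_chain_transfer[OF fin _ pushed(1)[OF c]] chain_boundary_transfer[OF fin _ pushed(1)[OF c]]
      pushed(2)[OF c] i by (simp add: singular_cycle transfer_linear)
  \<comment> \<open>\<open>t'\<close> is the part of the transferred cycle that cannot be bounded on
    the sphere: 0 below degree 3, a multiple of \<open>S3_class\<close> in degree 3.\<close>
  have key: "\<exists>d. singular_chain (Suc i) (top_of_set (nbhd v eps)) d \<and> Z_invariant (Suc i) d \<and>
      chain_boundary (Suc i) d = frag_cmul ?k (frag_cmul ?M0 c - avg i (chain_map i (orbit_map v) t'))"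
    if i: "i \<le> 3" and c: "singular_chain i (top_of_set (nbhd v \<delta>)) c" "chain_boundary i c = 0" "Z_invariant i c"
      and b: "singular_chain (Suc i) S3_top b"
         "chain_boundary (Suc i) b = transfer v i (chain_map i r c) - t'" for i c b t'
  proof -
    have cyc: "singular_relcycle i (top_of_set (nbhd v \<delta>)) {} c" using c by (simp add: singular_cycle)
    define c' where "c' = chain_map i r c"
    have c': "singular_chain i (top_of_set (orb v)) c'" "chain_boundary i c' = 0" and inv': "Z_invariant i c'"
      unfolding c'_def using pushed[OF c(1,2)] pushed_inv[OF c(1,3)] by blast+
    obtain d0 where d0: "singular_chain (Suc i) (top_of_set (nbhd v eps)) d0" "chain_boundary (Suc i) d0 = c - c'"
      using hom[OF cyc] by (auto simp: homologous_rel_def singular_boundary c'_def)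
    define e where "e = chain_map (Suc i) (orbit_map v) b"
    have e: "singular_chain (Suc i) (top_of_set (orb v)) e"
      unfolding e_def by (rule singular_chain_chain_map[OF b(1) continuous_orbit_map_orb])
    have be: "chain_boundary (Suc i) e = chain_map i (orbit_map v) (transfer v i c') - chain_map i (orbit_map v) t'"
      using chain_boundary_chain_map[OF b(1)] b(2) by (simp add: e_def c'_def chain_map_diff)
    define d where "d = frag_cmul ?M0 (avg (Suc i) d0) + frag_cmul ?k (avg (Suc i) e)"
    have "singular_chain (Suc i) (top_of_set (nbhd v eps)) d"
      unfolding d_def using d0(1) ON[OF e]
      by (intro singular_chain_add singular_chain_cmul singular_chain_avg_nbhd)
    moreover have "Z_invariant (Suc i) d"
      unfolding d_def by (intro Z_invariant_linear Z_invariant_avg)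
    moreover have "chain_boundary (Suc i) d = frag_cmul ?k (frag_cmul ?M0 c - avg i (chain_map i (orbit_map v) t'))"
    proof -
      have 1: "chain_boundary (Suc i) (avg (Suc i) d0) = frag_cmul ?k (c - c')"
        using chain_boundary_avg[OF d0(1)] d0(2) avg_invariant[OF Z_invariant_linear(2)[OF c(3) inv']] by simp
      have 2: "chain_boundary (Suc i) (avg (Suc i) e) = frag_cmul ?M0 c' - avg i (chain_map i (orbit_map v) t')"
        using chain_boundary_avg[OF e] be avg_transfer[OF fin _ c'(1) inv'] i by (simp add: avg_linear)
      show ?thesis
        unfolding d_def chain_boundary_add chain_boundary_cmul 1 2
        by (simp add: frag_cmul_diff mult.commute)
    qed
    ultimately show ?thesis unfolding c'_def by blast
  qed
  have "fills v \<delta> eps (card Z * sheets v)"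
    unfolding fills_def
  proof (intro allI impI)
    fix i c assume i: "i < 3" and c: "singular_chain i (top_of_set (nbhd v \<delta>)) c" "chain_boundary i c = 0"
      and aug: "i = 0 --> frag_aug c = 0" and inv: "Z_invariant i c"
    let ?t = "transfer v i (chain_map i r c)"
    have "singular_relboundary i S3_top {} ?t"
    proof (cases "i = 0")
      case True
      \<comment> \<open>Comparing augmentations: \<open>card Z\<close> times that of the transfer
        equals \<open>sheets v\<close> times that of \<open>c\<close>, which is 0.\<close>
      have "avg i (chain_map i (orbit_map v) ?t) = frag_cmul ?M0 (chain_map i r c)"
        using i by (intro avg_transfer[OF fin] pushed[OF c] pushed_inv[OF c(1) inv]) auto
      then have "frag_aug (avg i (chain_map i (orbit_map v) ?t)) = frag_aug (frag_cmul ?M0 (chain_map i r c))" by simp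
      then have "frag_aug ?t = 0" using aug True card_Z_pos by (simp add: frag_aug_avg frag_extend_cmul)
      moreover have "path_connected_space S3_top"
        using path_connected_sphere[of "0::quat" 1] path_connectedin_def by fastforce
      ultimately show ?thesis
        using augmentation_zero_bounds[of S3_top ?t] cyc[OF _ c] True by (simp add: singular_cycle)
    next
      case False
      then show ?thesis using cyc[OF _ c] i by (intro S3_cycle_bounds) auto
    qed
    then obtain b where b: "singular_chain (Suc i) S3_top b" "chain_boundary (Suc i) b = ?t - 0"
      by (auto simp: singular_boundary)
    show "\<exists>d. singular_chain (Suc i) (top_of_set (nbhd v eps)) d \<and>
       chain_boundary (Suc i) d = frag_cmul (int (card Z * sheets v)) c \<and> Z_invariant (Suc i) d"
      using key[OF _ c inv b] i by (auto simp: avg_linear)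
  qed
  moreover have "fills3 v \<delta> eps (card Z * sheets v)"
    unfolding fills3_def
  proof (intro allI impI)
    fix c assume c: "singular_chain 3 (top_of_set (nbhd v \<delta>)) c" "chain_boundary 3 c = 0" and inv: "Z_invariant 3 c"
    let ?t = "transfer v 3 (chain_map 3 r c)"
    obtain m where "singular_relboundary 3 S3_top {} (?t - frag_cmul m S3_class)"
      using S3_class(2)[OF cyc[OF _ c]] by auto
    then obtain b where b: "singular_chain (Suc 3) S3_top b" "chain_boundary (Suc 3) b = ?t - frag_cmul m S3_class"
      by (auto simp: singular_boundary)
    show "\<exists>d m. singular_chain 4 (top_of_set (nbhd v eps)) d \<and>
        chain_boundary 4 d = frag_cmul (int (card Z * sheets v)) c - frag_cmul m (orbit_class v)"
      using key[OF _ c inv b] by (auto simp: avg_linear frag_cmul_diff orbit_class_def numeral_eq_Suc)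
  qed
  ultimately show ?thesis
    using that[of \<delta> "card Z * sheets v"] \<delta> card_Z_pos sheets_pos[OF fin] by simp
qed

end

section \<open>The orbit class has infinite order near its orbit\<close>

context quat_action
begin

text \<open>Changing the base point by \<open>q\<close> precomposes the orbit map with right
  translation by \<open>q\<close>, which is homotopic to the identity.\<close>

lemma orbit_map_homologous:
  assumes "norm q = 1"
  shows "homologous_rel 3 (top_of_set (orb v)) {} (chain_map 3 (orbit_map (act q v)) S3_class) (chain_map 3 (orbit_map v) S3_class)"
proof -
  have cyc: "singular_relcycle 3 S3_top {} S3_class" by (rule S3_class(1))
  have "homologous_rel 3 S3_top {} (chain_map 3 (rmul q) S3_class) (chain_map 3 id S3_class)"
    by (rule homotopic_imp_homologous_rel_chain_maps[OF _ cyc])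
       (use rmul_homotopic_id[OF assms] in \<open>simp add: homotopic_with_mono\<close>)
  then have "singular_relboundary 3 S3_top {} (chain_map 3 (rmul q) S3_class - S3_class)"
    using chain_map_ident cyc by (metis homologous_rel_def singular_cycle)
  then have "singular_relboundary 3 (top_of_set (orb v)) {} (chain_map 3 (orbit_map v) (chain_map 3 (rmul q) S3_class - S3_class))"
    by (rule singular_relboundary_chain_map[OF _ continuous_orbit_map_orb]) auto
  moreover have "chain_map 3 (orbit_map v) (chain_map 3 (rmul q) S3_class) = chain_map 3 (orbit_map (act q v)) S3_class"
  proof -
    have "chain_map 3 (orbit_map v) (chain_map 3 (rmul q) S3_class) = chain_map 3 (orbit_map v \<circ> rmul q) S3_class"
      by (simp add: chain_map_compose)
    also have "\<dots> = chain_map 3 (orbit_map (act q v)) S3_class"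
      using cyc assms by (intro chain_map_eq[of 3 S3_top]) (auto simp: singular_cycle act_qmul)
    finally show ?thesis .
  qed
  ultimately show ?thesis by (simp add: homologous_rel_def chain_map_diff)
qed

lemma orbit_class_cycle: "singular_relcycle 3 (top_of_set (orb v)) {} (orbit_class v)"
proof -
  have "singular_relcycle 3 (top_of_set (orb v)) {} (chain_map 3 (orbit_map v) S3_class)"
    by (rule singular_relcycle_chain_map[OF S3_class(1) continuous_orbit_map_orb]) auto
  then show ?thesis
    using singular_chain_avg_orb chain_boundary_avg
    by (auto simp: orbit_class_def singular_cycle avg_linear)
qed

text \<open>Each \<open>z \<in> Z\<close> with \<open>z v\<close> in the same \<open>SU(2)\<close>-orbit as \<open>v\<close> contributes \<open>card (stab v)\<close> copies of the
  fundamental class.\<close>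

lemma transfer_orbit_class:
  assumes fin: "finite (stab v)"
  shows "singular_relboundary 3 S3_top {} (transfer v 3 (orbit_class v) - frag_cmul (int (sheets v)) S3_class)"
proof -
  have cyc: "singular_relcycle 3 S3_top {} S3_class" by (rule S3_class(1))
  then have sc: "singular_chain 3 S3_top S3_class" by (simp add: singular_cycle)
  let ?A = "{z \<in> Z. z v \<in> orbit0 v}"
  have rot: "singular_relboundary 3 S3_top {} (chain_map 3 (rmul q) S3_class - S3_class)" if "norm q = 1" for q
  proof -
    have "homologous_rel 3 S3_top {} (chain_map 3 (rmul q) S3_class) (chain_map 3 id S3_class)"
      by (rule homotopic_imp_homologous_rel_chain_maps[OF _ cyc])
         (use rmul_homotopic_id[OF that] in \<open>simp add: homotopic_with_mono\<close>)
    then show ?thesis using chain_map_ident[OF sc] by (simp add: homologous_rel_def)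
  qed
  have bsum: "singular_relboundary 3 S3_top {} (\<Sum>i\<in>I. f i - g)" if "\<And>i. i \<in> I ==> singular_relboundary 3 S3_top {} (f i - g)"
    for f g and I :: "'i set"
    using that by (induction I rule: infinite_finite_induct) (auto intro: singular_relboundary_add)
  have single: "singular_relboundary 3 S3_top {} (transfer v 3 (chain_map 3 z (chain_map 3 (orbit_map v) S3_class))
      - frag_cmul (int (card (stab v))) S3_class)" if z: "z \<in> ?A" for z
  proof -
    obtain q where q: "norm q = 1" "z v = act q v" using z by (auto simp: orbit0_def)
    have "chain_map 3 z (chain_map 3 (orbit_map v) S3_class) = chain_map 3 (z \<circ> orbit_map v) S3_class"
      by (simp add: chain_map_compose)
    also have "\<dots> = chain_map 3 (orbit_map v \<circ> rmul q) S3_class"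
      using z q by (intro chain_map_eq[OF sc]) (auto simp: Z_act act_qmul)
    also have "\<dots> = chain_map 3 (orbit_map v) (chain_map 3 (rmul q) S3_class)"
      by (simp add: chain_map_compose)
    finally have "transfer v 3 (chain_map 3 z (chain_map 3 (orbit_map v) S3_class))
       = (\<Sum>\<gamma>\<in>stab v. chain_map 3 (rmul \<gamma>) (chain_map 3 (rmul q) S3_class))"
      using transfer_orbit_map[OF fin singular_chain_chain_map[OF sc continuous_rmul[OF q(1)]]] by simp
    also have "\<dots> = (\<Sum>\<gamma>\<in>stab v. chain_map 3 (rmul (qmul q \<gamma>)) S3_class)"
    proof (intro sum.cong refl)
      fix \<gamma>
      have "rmul \<gamma> \<circ> rmul q = rmul (qmul q \<gamma>)" by (auto simp: fun_eq_iff qmul_assoc)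
      then show "chain_map 3 (rmul \<gamma>) (chain_map 3 (rmul q) S3_class) = chain_map 3 (rmul (qmul q \<gamma>)) S3_class"
        by (metis chain_map_compose comp_apply)
    qed
    finally have eq: "transfer v 3 (chain_map 3 z (chain_map 3 (orbit_map v) S3_class)) - frag_cmul (int (card (stab v))) S3_class
       = (\<Sum>\<gamma>\<in>stab v. chain_map 3 (rmul (qmul q \<gamma>)) S3_class - S3_class)"
      using fin by (simp add: sum_subtractf sum_const_frag)
    show ?thesis unfolding eq
      using q by (intro bsum rot) (auto simp: norm_qmul stab_unit)
  qed
  have outside: "transfer v 3 (chain_map 3 z (chain_map 3 (orbit_map v) S3_class)) = 0" if z: "z \<in> Z - ?A" for z
  proof (rule transfer_outside)
    show "singular_chain 3 (top_of_set (orbit0 (z v))) (chain_map 3 z (chain_map 3 (orbit_map v) S3_class))"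
      using z by (intro singular_chain_chain_map[OF singular_chain_chain_map[OF sc continuous_orbit_map] continuous_Z_orbit0]) auto
    show "z v \<notin> orbit0 v" using z by auto
  qed
  have "transfer v 3 (orbit_class v) = (\<Sum>z\<in>Z. transfer v 3 (chain_map 3 z (chain_map 3 (orbit_map v) S3_class)))"
    by (simp add: orbit_class_def avg_def transfer_sum finite_Z)
  also have "\<dots> = (\<Sum>z\<in>?A. transfer v 3 (chain_map 3 z (chain_map 3 (orbit_map v) S3_class)))"
    by (rule sum.mono_neutral_right) (use finite_Z outside in auto)
  finally have "transfer v 3 (orbit_class v) - frag_cmul (int (sheets v)) S3_class
     = (\<Sum>z\<in>?A. transfer v 3 (chain_map 3 z (chain_map 3 (orbit_map v) S3_class)) - frag_cmul (int (card (stab v))) S3_class)"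
    using finite_Z by (simp add: sum_subtractf sum_const_frag sheets_def mult.commute)
  also have "singular_relboundary 3 S3_top {} \<dots>"
    by (intro bsum single)
  finally show ?thesis .
qed

text \<open>Retracting a bounding chain to the orbit and transferring it to the sphere shows that
  \<open>m\<close> times \<open>sheets v\<close> copies of the generator bound, so \<open>m\<close>
  is 0.\<close>

lemma orbit_essential:
  assumes fin: "finite (stab v)" and r: "equivariant_retraction v eta r" "eta > 0"
  shows "essential v eta"
  unfolding essential_def
proof (intro allI impI)
  fix d m assume d: "singular_chain 4 (top_of_set (nbhd v eta)) d" "chain_boundary 4 d = frag_cmul m (orbit_class v)"
  have rc: "continuous_map (top_of_set (nbhd v eta)) (top_of_set (orb v)) r"
    using r by (auto simp: continuous_map_subtopology_eu equivariant_retraction_def)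
  define e where "e = chain_map 4 r d"
  have e: "singular_chain 4 (top_of_set (orb v)) e"
    unfolding e_def by (rule singular_chain_chain_map[OF d(1) rc])
  have "chain_boundary 4 e = chain_map 3 r (frag_cmul m (orbit_class v))"
    using chain_boundary_chain_map[OF d(1), of r] d(2) by (simp add: e_def numeral_eq_Suc)
  also have "\<dots> = frag_cmul m (orbit_class v)"
    using orbit_class_cycle[of v] r(1)
    by (intro chain_map_id_gen[of 3 "top_of_set (orb v)"]) (auto simp: singular_cycle equivariant_retraction_def intro: singular_chain_cmul)
  finally have "chain_boundary 4 (transfer v 4 e) = frag_cmul m (transfer v 3 (orbit_class v))"
    using chain_boundary_transfer[OF fin _ e] by (simp add: transfer_linear numeral_eq_Suc)
  then have "singular_relboundary 3 S3_top {} (frag_cmul m (transfer v 3 (orbit_class v)))"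
    using singular_chain_transfer[OF fin _ e] by (auto simp: singular_boundary numeral_eq_Suc)
  from singular_relboundary_diff[OF this singular_relboundary_cmul[OF transfer_orbit_class[OF fin], of m]]
  have "singular_relboundary 3 S3_top {} (frag_cmul (m * int (sheets v)) S3_class)"
    by (simp add: frag_cmul_diff)
  then have "m * int (sheets v) = 0" by (rule S3_class(3))
  then show "m = 0" using sheets_pos[OF fin] by simp
qed

end

section \<open>Lifting chains from the quotient\<close>

lemma frag_extend_scale: "frag_extend (\<lambda>x. frag_cmul m (f x)) c = frag_cmul m (frag_extend f c)"
  using subset_UNIV
proof (induction c rule: frag_induction)
  case (diff a b)
  then show ?case by (simp add: frag_extend_diff frag_cmul_diff)
qed auto

lemma singular_chain_top_of_set_mono:
  "singular_chain p (top_of_set S) c ==> S \<subseteq> T ==> singular_chain p (top_of_set T) c"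
  by (rule singular_chain_mono)

lemma singular_relboundary_top_of_set_mono:
  "singular_relboundary p (top_of_set S) {} c ==> S \<subseteq> T ==> singular_relboundary p (top_of_set T) {} c"
  by (rule singular_boundary_mono)

section \<open>Constants that are uniform on compact sets\<close>

context quat_action
begin

lemma nbhd_orb: "w \<in> nbhd v eps ==> x \<in> orb w ==> x \<in> nbhd v eps"
proof -
  assume w: "w \<in> nbhd v eps" and x: "x \<in> orb w"
  obtain u where u: "u \<in> orb v" "dist w u < eps" using w by (auto simp: nbhd_def)
  obtain p z where p: "x = act p (z w)" "norm p = 1" "z \<in> Z" using x by (auto simp: orb_def)
  have "dist x (act p (z u)) < eps" using u p by (simp add: act_dist dist_Z)
  moreover have "act p (z u) \<in> orb v" by (rule act_orb[OF p(2) Z_orb[OF p(3) u(1)]])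
  ultimately show ?thesis by (auto simp: nbhd_def)
qed

lemma nbhd_sym: "w \<in> nbhd v eps ==> v \<in> nbhd w eps"
proof -
  assume "w \<in> nbhd v eps"
  then obtain u where u: "u \<in> orb v" "dist w u < eps" by (auto simp: nbhd_def)
  then have "u \<in> nbhd w eps" using orb_self[of w] by (auto simp: nbhd_def dist_commute)
  then show ?thesis using nbhd_orb orb_sym[OF u(1)] by blast
qed

lemma nbhd_triangle: "w \<in> nbhd v \<delta> ==> nbhd w eps \<subseteq> nbhd v (eps + \<delta>)"
proof
  fix x assume w: "w \<in> nbhd v \<delta>" and "x \<in> nbhd w eps"
  then obtain y where y: "y \<in> orb w" "dist x y < eps" by (auto simp: nbhd_def)
  then obtain u where u: "u \<in> orb v" "dist y u < \<delta>" using nbhd_orb[OF w y(1)] by (auto simp: nbhd_def)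
  have "dist x u < eps + \<delta>" using dist_triangle[of x u y] y u by simp
  then show "x \<in> nbhd v (eps + \<delta>)" using u by (auto simp: nbhd_def)
qed

lemma nbhd_dist: "dist w v < eps ==> w \<in> nbhd v eps"
  using orb_self by (auto simp: nbhd_def)

lemma open_nbhd: "open (nbhd v eps)"
proof -
  have "nbhd v eps = (\<Union>x\<in>orb v. ball x eps)" by (auto simp: nbhd_def dist_commute)
  then show ?thesis by auto
qed

lemma avg_chain_map: "z \<in> Z ==> avg p (chain_map p z c) = avg p c"
proof -
  assume z: "z \<in> Z"
  have "avg p (chain_map p z c) = (\<Sum>w\<in>Z. chain_map p (w \<circ> z) c)"
    by (simp add: avg_def chain_map_compose)
  also have "\<dots> = avg p c"
    unfolding avg_def
  proof (rule sum.reindex_bij_witness[where i="\<lambda>w. w \<circ> inv_Z z" and j="\<lambda>w. w \<circ> z"])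
    fix a assume a: "a \<in> Z"
    show "(a \<circ> z) \<circ> inv_Z z = a" "(a \<circ> inv_Z z) \<circ> z = a"
      using inv_Z[OF z] by (auto simp: fun_eq_iff)
    show "a \<circ> z \<in> Z" "a \<circ> inv_Z z \<in> Z" using comp_Z inv_Z(1)[OF z] z a by auto
  qed simp
  finally show ?thesis .
qed

lemma orbit_class_Z: "z \<in> Z ==> orbit_class (z v) = orbit_class v"
proof -
  assume z: "z \<in> Z"
  have "chain_map 3 (orbit_map (z v)) S3_class = chain_map 3 (z \<circ> orbit_map v) S3_class"
    using S3_class(1) z by (intro chain_map_eq[of 3 S3_top]) (auto simp: singular_cycle Z_act)
  also have "\<dots> = chain_map 3 z (chain_map 3 (orbit_map v) S3_class)" by (simp add: chain_map_compose)
  finally show ?thesis using avg_chain_map[OF z] by (simp add: orbit_class_def)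
qed

lemma relboundary_avg:
  assumes "singular_relboundary p (top_of_set (nbhd v eps)) {} c"
  shows "singular_relboundary p (top_of_set (nbhd v eps)) {} (avg p c)"
proof -
  obtain d where d: "singular_chain (Suc p) (top_of_set (nbhd v eps)) d" "chain_boundary (Suc p) d = c"
    using assms by (auto simp: singular_boundary)
  show ?thesis
    unfolding singular_boundary
    using singular_chain_avg_nbhd[OF d(1)] chain_boundary_avg[OF d(1)] d(2) by auto
qed

text \<open>All quaternions act by isometries, so the straight lines between corresponding points of
  two nearby orbits stay in the neighbourhood and form a homotopy of orbit maps.\<close>

lemma orbit_class_near:
  assumes "u \<in> nbhd v eps" "eps > 0"
  shows "singular_relboundary 3 (top_of_set (nbhd v eps)) {} (orbit_class u - orbit_class v)"
proof -
  obtain p z where pz: "norm p = 1" "z \<in> Z" "dist u (act p (z v)) < eps"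
    using assms by (auto simp: nbhd_def orb_def)
  let ?w = "act p (z v)"
  have w: "?w \<in> orb v" using pz unfolding orb_def by blast
  have sub: "orb (z v) \<subseteq> nbhd v eps"
    using orb_eq[of "z v" v] orb_subset_nbhd[OF assms(2), of v] pz Z_orb[OF pz(2) orb_self] by auto
  have cont: "continuous_map S3_top (top_of_set (nbhd v eps)) (orbit_map x)" if "x \<in> nbhd v eps" for x
  proof -
    have "orb x \<subseteq> nbhd v eps" using nbhd_orb[OF that] by blast
    then show ?thesis
      using continuous_orbit_map_orb[of x] by (auto simp: continuous_map_subtopology_eu)
  qed
  have wn: "?w \<in> nbhd v eps" using w orb_subset_nbhd[OF assms(2)] by blast
  have "homologous_rel 3 (top_of_set (nbhd v eps)) {} (chain_map 3 (orbit_map u) S3_class) (chain_map 3 (orbit_map ?w) S3_class)"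
  proof (rule straight_line_homologous[OF cont[OF assms(1)] cont[OF wn] S3_class(1)])
    fix q assume "q \<in> topspace S3_top"
    then have q: "norm q = 1" by simp
    show "closed_segment (act q u) (act q ?w) \<subseteq> nbhd v eps"
    proof
      fix y assume "y \<in> closed_segment (act q u) (act q ?w)"
      then have "dist y (act q ?w) \<le> dist (act q u) (act q ?w)" using dist_in_closed_segment by fastforce
      also have "\<dots> < eps" using pz q by (simp add: act_dist)
      finally show "y \<in> nbhd v eps" using act_orb[OF q w] by (auto simp: nbhd_def)
    qed
  qed
  then have 1: "singular_relboundary 3 (top_of_set (nbhd v eps)) {} (chain_map 3 (orbit_map u) S3_class - chain_map 3 (orbit_map ?w) S3_class)"
    by (simp add: homologous_rel_def)
  have 2: "singular_relboundary 3 (top_of_set (nbhd v eps)) {} (chain_map 3 (orbit_map ?w) S3_class - chain_map 3 (orbit_map (z v)) S3_class)"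
    using orbit_map_homologous[OF pz(1), of "z v"] sub
    by (auto simp: homologous_rel_def intro: singular_relboundary_top_of_set_mono)
  from relboundary_avg[OF singular_relboundary_add[OF 1 2]] show ?thesis
    using orbit_class_Z[OF pz(2), of v] by (simp add: avg_linear orbit_class_def)
qed

text \<open>Constants that work at \<open>u\<close> work at all points near it. The free factor
  \<open>k\<close> makes room for a common multiple over a finite cover.\<close>

lemma fills_near:
  assumes "fills u \<delta> eps M" "v \<in> nbhd u (\<delta>/2)" "0 < \<delta>" "\<delta>' \<le> \<delta>/2" "eps + \<delta>/2 \<le> eps'"
  shows "fills v \<delta>' eps' (k * M)"
  unfolding fills_def
proof (intro allI impI)
  fix i c assume i: "i < 3" and c: "singular_chain i (top_of_set (nbhd v \<delta>')) c" "chain_boundary i c = 0"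
      "i = 0 --> frag_aug c = 0" "Z_invariant i c"
  have "nbhd v \<delta>' \<subseteq> nbhd u \<delta>"
    using nbhd_triangle[OF assms(2), of \<delta>'] nbhd_mono[of "\<delta>' + \<delta>/2" \<delta> u] assms(4) by auto
  then have "singular_chain i (top_of_set (nbhd u \<delta>)) c" using singular_chain_top_of_set_mono[OF c(1)] by blast
  then obtain d where d: "singular_chain (Suc i) (top_of_set (nbhd u eps)) d" "chain_boundary (Suc i) d = frag_cmul (int M) c"
     "Z_invariant (Suc i) d" using assms(1) i c(2-4) unfolding fills_def by blast
  have "nbhd u eps \<subseteq> nbhd v eps'"
    using nbhd_triangle[OF nbhd_sym[OF assms(2)], of eps] nbhd_mono[OF assms(5), of v] by auto
  then have "singular_chain (Suc i) (top_of_set (nbhd v eps')) (frag_cmul (int k) d)"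
    by (intro singular_chain_cmul singular_chain_top_of_set_mono[OF d(1)])
  then show "\<exists>d. singular_chain (Suc i) (top_of_set (nbhd v eps')) d \<and>
       chain_boundary (Suc i) d = frag_cmul (int (k * M)) c \<and> Z_invariant (Suc i) d"
    using d by (intro exI[of _ "frag_cmul (int k) d"]) (simp add: chain_boundary_cmul Z_invariant_linear)
qed

lemma fills3_near:
  assumes "fills3 u \<delta> eps M" "v \<in> nbhd u (\<delta>/2)" "0 < \<delta>" "0 < eps" "\<delta>' \<le> \<delta>/2" "eps + \<delta>/2 \<le> eps'"
  shows "fills3 v \<delta>' eps' (k * M)"
  unfolding fills3_def
proof (intro allI impI)
  fix c assume c: "singular_chain 3 (top_of_set (nbhd v \<delta>')) c" "chain_boundary 3 c = 0" "Z_invariant 3 c"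
  have "nbhd v \<delta>' \<subseteq> nbhd u \<delta>"
    using nbhd_triangle[OF assms(2), of \<delta>'] nbhd_mono[of "\<delta>' + \<delta>/2" \<delta> u] assms(5) by auto
  then have "singular_chain 3 (top_of_set (nbhd u \<delta>)) c" using singular_chain_top_of_set_mono[OF c(1)] by blast
  then obtain d m where d: "singular_chain 4 (top_of_set (nbhd u eps)) d"
      "chain_boundary 4 d = frag_cmul (int M) c - frag_cmul m (orbit_class u)"
    using assms(1) c(2-3) unfolding fills3_def by blast
  have "nbhd u eps \<subseteq> nbhd v eps'"
    using nbhd_triangle[OF nbhd_sym[OF assms(2)], of eps] nbhd_mono[OF assms(6), of v] by auto
  then have d': "singular_chain 4 (top_of_set (nbhd v eps')) d"
    by (intro singular_chain_top_of_set_mono[OF d(1)])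
  have "u \<in> nbhd v eps'" using nbhd_sym[OF assms(2)] nbhd_mono[of "\<delta>/2" eps' v] assms by auto
  then obtain e where e: "singular_chain 4 (top_of_set (nbhd v eps')) e" "chain_boundary 4 e = orbit_class u - orbit_class v"
    using orbit_class_near[of u v eps'] assms by (auto simp: singular_boundary numeral_eq_Suc)
  have "singular_chain 4 (top_of_set (nbhd v eps')) (frag_cmul (int k) (d + frag_cmul m e))"
    by (intro singular_chain_cmul singular_chain_add d' e(1))
  moreover have "chain_boundary 4 (frag_cmul (int k) (d + frag_cmul m e)) =
      frag_cmul (int (k * M)) c - frag_cmul (int k * m) (orbit_class v)"
    by (simp add: chain_boundary_cmul chain_boundary_add d e frag_cmul_diff frag_cmul_distrib2)
  ultimately show "\<exists>d m. singular_chain 4 (top_of_set (nbhd v eps')) d \<and>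
       chain_boundary 4 d = frag_cmul (int (k * M)) c - frag_cmul m (orbit_class v)" by blast
qed

lemma essential_near:
  assumes "essential u eta" "v \<in> nbhd u (eta/2)" "0 < eta" "eta' \<le> eta/2"
  shows "essential v eta'"
  unfolding essential_def
proof (intro allI impI)
  fix d m assume d: "singular_chain 4 (top_of_set (nbhd v eta')) d" "chain_boundary 4 d = frag_cmul m (orbit_class v)"
  have "nbhd v eta' \<subseteq> nbhd u eta"
    using nbhd_triangle[OF assms(2), of eta'] nbhd_mono[of "eta' + eta/2" eta u] assms(4) by auto
  then have d': "singular_chain 4 (top_of_set (nbhd u eta)) d" using singular_chain_top_of_set_mono[OF d(1)] by blast
  have "v \<in> nbhd u eta" using assms(2,3) nbhd_mono[of "eta/2" eta u] by auto
  then obtain e where e: "singular_chain 4 (top_of_set (nbhd u eta)) e" "chain_boundary 4 e = orbit_class v - orbit_class u"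
    using orbit_class_near[of v u eta] assms by (auto simp: singular_boundary numeral_eq_Suc)
  have "singular_chain 4 (top_of_set (nbhd u eta)) (d - frag_cmul m e)"
    by (intro singular_chain_diff singular_chain_cmul d' e(1))
  moreover have "chain_boundary 4 (d - frag_cmul m e) = frag_cmul m (orbit_class u)"
    by (simp add: chain_boundary_cmul chain_boundary_diff d e frag_cmul_diff)
  ultimately show "m = 0" using assms(1) unfolding essential_def by blast
qed

text \<open>Finitely many balls cover \<open>K\<close>; the radius is the least one and the
  multiplier the product of those at the centres.\<close>

lemma uniform_fills:
  assumes K: "compact K" and tame: "\<And>v. v \<in> K ==> finite (stab v) \<and> (\<exists>eta>0. \<exists>r. equivariant_retraction v eta r)"
    and eps: "eps > 0"
  obtains \<delta> M where "\<delta> > 0" "\<delta> \<le> eps" "M > 0" "\<And>v. v \<in> K ==> fills v \<delta> eps M \<and> fills3 v \<delta> eps M"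
proof -
  have "\<exists>\<delta> M. \<delta> > 0 \<and> \<delta> \<le> eps/2 \<and> M > 0 \<and> fills v \<delta> (eps/2) M \<and> fills3 v \<delta> (eps/2) M" if v: "v \<in> K" for v
  proof -
    obtain eta r where "eta > 0" "equivariant_retraction v eta r" "finite (stab v)" using tame[OF v] by blast
    then show ?thesis using orbit_fills[of v eta r "eps/2"] eps by (metis half_gt_zero)
  qed
  then obtain D N where D: "\<And>v. v \<in> K ==> D v > 0 \<and> D v \<le> eps/2 \<and> N v > 0 \<and> fills v (D v) (eps/2) (N v) \<and> fills3 v (D v) (eps/2) (N v)"
    by metis
  obtain F where F: "F \<subseteq> K" "finite F" "K \<subseteq> (\<Union>u\<in>F. ball u (D u / 2))"
  proof (rule compactE_image[OF K, of K "\<lambda>u. ball u (D u / 2)"])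
    show "K \<subseteq> (\<Union>u\<in>K. ball u (D u / 2))" using D by force
  qed auto
  define \<delta> where "\<delta> = Min (insert eps ((\<lambda>u. D u / 2) ` F))"
  define M where "M = (\<Prod>u\<in>F. N u)"
  have "fills v \<delta> eps M \<and> fills3 v \<delta> eps M" if v: "v \<in> K" for v
  proof -
    obtain u where "u \<in> F" "v \<in> ball u (D u / 2)" using F(3) v by blast
    then have u: "u \<in> F" "dist u v < D u / 2" by (simp_all only: mem_ball)
    then have Du: "D u > 0" "D u \<le> eps/2" "fills u (D u) (eps/2) (N u)" "fills3 u (D u) (eps/2) (N u)"
      using D F(1) by auto
    have vn: "v \<in> nbhd u (D u / 2)" using u by (intro nbhd_dist) (simp add: dist_commute)
    have "\<delta> \<le> D u / 2" unfolding \<delta>_def using u F(2) by (intro Min_le) auto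
    moreover have "M = (\<Prod>u\<in>F - {u}. N u) * N u" unfolding M_def using u F(2) by (simp add: prod.remove[of F u] mult.commute)
    ultimately show ?thesis
      using fills_near[OF Du(3) vn] fills3_near[OF Du(4) vn] Du eps by auto
  qed
  moreover have "\<delta> > 0" "\<delta> \<le> eps" unfolding \<delta>_def using F D eps by (auto simp: Min_gr_iff)
  moreover have "M > 0" unfolding M_def using F D by (intro prod_pos) auto
  ultimately show ?thesis using that by blast
qed

lemma uniform_essential:
  assumes K: "compact K" and tame: "\<And>v. v \<in> K ==> finite (stab v) \<and> (\<exists>eta>0. \<exists>r. equivariant_retraction v eta r)"
  obtains eps where "eps > 0" "\<And>v. v \<in> K ==> essential v eps"
proof -
  have "\<exists>eta. eta > 0 \<and> essential v eta" if v: "v \<in> K" for v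
    using tame[OF v] orbit_essential by blast
  then obtain D where D: "\<And>v. v \<in> K ==> D v > 0 \<and> essential v (D v)" by metis
  obtain F where F: "F \<subseteq> K" "finite F" "K \<subseteq> (\<Union>u\<in>F. ball u (D u / 2))"
  proof (rule compactE_image[OF K, of K "\<lambda>u. ball u (D u / 2)"])
    show "K \<subseteq> (\<Union>u\<in>K. ball u (D u / 2))" using D by force
  qed auto
  define \<delta> where "\<delta> = Min (insert 1 ((\<lambda>u. D u / 2) ` F))"
  have "essential v \<delta>" if v: "v \<in> K" for v
  proof -
    obtain u where "u \<in> F" "v \<in> ball u (D u / 2)" using F(3) v by blast
    then have u: "u \<in> F" "dist u v < D u / 2" by (simp_all only: mem_ball)
    have vn: "v \<in> nbhd u (D u / 2)" using u by (intro nbhd_dist) (simp add: dist_commute)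
    have "\<delta> \<le> D u / 2" unfolding \<delta>_def using u F(2) by (intro Min_le) auto
    then show ?thesis using essential_near[OF _ vn] D F(1) u by blast
  qed
  moreover have "\<delta> > 0" unfolding \<delta>_def using F D by (auto simp: Min_gr_iff)
  ultimately show ?thesis using that by blast
qed

end

text \<open>The quotient is kept abstract because in the application it is the complement of the
  singular orbits inside the full orbit space.\<close>

locale quat_quotient = quat_action act Z for act :: "quat => 'v::euclidean_space => 'v" and Z +
  fixes V0 :: "'v set" and \<pi> :: "'v => 'x" and X :: "'x topology"
  assumes open_V0: "open V0"
    and orb_V0: "v \<in> V0 ==> x \<in> orb v ==> x \<in> V0"
    and tame_V0: "v \<in> V0 ==> finite (stab v) \<and> (\<exists>eta>0. \<exists>r. equivariant_retraction v eta r)"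
    and continuous_\<pi>: "continuous_map (top_of_set V0) X \<pi>"
    and open_\<pi>: "open U ==> U \<subseteq> V0 ==> openin X (\<pi> ` U)"
    and topspace_X: "topspace X = \<pi> ` V0"
    and fibre: "v \<in> V0 ==> w \<in> V0 ==> \<pi> v = \<pi> w \<longleftrightarrow> w \<in> orb v"

text \<open>\<open>K\<close> is a compact union of orbits over which all chains of the argument are
  supported; there the radii and multipliers are uniform.\<close>

locale quat_quotient_compact = quat_quotient act Z V0 \<pi> X
  for act :: "quat => 'v::euclidean_space => 'v" and Z V0 and \<pi> :: "'v => 'x" and X +
  fixes K :: "'v set"
  assumes compact_K: "compact K" and K_V0: "K \<subseteq> V0" and K_orb: "v \<in> K ==> x \<in> orb v ==> x \<in> K"
begin

text \<open>Size is measured upstairs, as the quotient carries no metric: seen from any orbit that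
  it meets, the simplex lies within \<open>eta\<close>.\<close>

definition small :: "real => nat => ((nat => real) => 'x) => bool" where
  "small eta p \<sigma> \<longleftrightarrow> singular_simplex p (subtopology X (\<pi> ` K)) \<sigma> \<and>
     (\<forall>w\<in>K. \<pi> w \<in> \<sigma> ` standard_simplex p --> \<sigma> ` standard_simplex p \<subseteq> \<pi> ` (nbhd w eta \<inter> K))"

definition lies_over :: "'v => nat => ((nat => real) => 'x) => bool" where
  "lies_over w p \<sigma> \<longleftrightarrow> w \<in> K \<and> \<pi> w \<in> \<sigma> ` standard_simplex p"

lemma small_mono: "small eta p \<sigma> ==> eta \<le> eta' ==> small eta' p \<sigma>"
  unfolding small_def using nbhd_mono by (meson Int_mono image_mono order_refl order_trans)

lemma small_image: "small eta p \<sigma> ==> \<sigma> ` standard_simplex p \<subseteq> \<pi> ` K"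
  by (auto simp: small_def singular_simplex_subtopology)

lemma ex_lies_over: "small eta p \<sigma> ==> \<exists>w. lies_over w p \<sigma>"
proof -
  assume s: "small eta p \<sigma>"
  obtain x where x: "x \<in> standard_simplex p" using nonempty_standard_simplex by blast
  then have "\<sigma> x \<in> \<pi> ` K" using small_image[OF s] by blast
  then obtain w where "w \<in> K" "\<pi> w = \<sigma> x" by (metis imageE)
  then show ?thesis using x unfolding lies_over_def by (metis imageI)
qed

lemma lies_over_near:
  assumes "small eta p \<sigma>" "lies_over w p \<sigma>" "lies_over w' p \<sigma>"
  shows "w' \<in> nbhd w eta"
proof -
  have "\<pi> w' \<in> \<pi> ` (nbhd w eta \<inter> K)" using assms by (auto simp: small_def lies_over_def)
  then obtain y where y: "y \<in> nbhd w eta" "y \<in> K" "\<pi> w' = \<pi> y" by auto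
  then have "w' \<in> orb y" using fibre[of y w'] assms(3) K_V0 by (auto simp: lies_over_def)
  then show ?thesis using nbhd_orb[OF y(1)] by blast
qed

lemma singular_face_image:
  assumes "p > 0" "k \<le> p"
  shows "singular_face p k f ` standard_simplex (p - Suc 0) \<subseteq> f ` standard_simplex p"
  using assms simplical_face_in_standard_simplex[of p k] by (auto simp: singular_face_def)

lemma keys_chain_boundary_of:
  "f \<in> Poly_Mapping.keys (chain_boundary p (frag_of \<sigma>)) ==> p > 0 \<and> (\<exists>k\<le>p. f = singular_face p k \<sigma>)"
proof -
  assume f: "f \<in> Poly_Mapping.keys (chain_boundary p (frag_of \<sigma>))"
  then have p: "p > 0" by (auto simp: chain_boundary_of split: if_splits)
  then have "f \<in> Poly_Mapping.keys (\<Sum>k\<le>p. frag_cmul ((- 1) ^ k) (frag_of (singular_face p k \<sigma>)))"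
    using f by (simp add: chain_boundary_of)
  then have "f \<in> (\<Union>k\<le>p. Poly_Mapping.keys (frag_cmul ((- 1) ^ k) (frag_of (singular_face p k \<sigma>))))"
    by (rule subsetD[OF keys_sum])
  then show ?thesis using p by auto
qed

lemma small_subset:
  assumes s: "small eta p \<sigma>" and f: "singular_simplex q (subtopology X (\<pi> ` K)) f"
    and im: "f ` standard_simplex q \<subseteq> \<sigma> ` standard_simplex p"
  shows "small eta q f"
  unfolding small_def
proof (intro conjI ballI impI f)
  fix w assume "w \<in> K" "\<pi> w \<in> f ` standard_simplex q"
  then have "\<sigma> ` standard_simplex p \<subseteq> \<pi> ` (nbhd w eta \<inter> K)"
    using s im unfolding small_def by (metis subsetD)
  with im show "f ` standard_simplex q \<subseteq> \<pi> ` (nbhd w eta \<inter> K)" by (rule subset_trans)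
qed

lemma small_face:
  assumes "small eta p \<sigma>" "f \<in> Poly_Mapping.keys (chain_boundary p (frag_of \<sigma>))"
  shows "small eta (p - Suc 0) f" "lies_over w (p - Suc 0) f ==> lies_over w p \<sigma>"
proof -
  obtain k where k: "p > 0" "k \<le> p" "f = singular_face p k \<sigma>" using keys_chain_boundary_of[OF assms(2)] by blast
  have im: "f ` standard_simplex (p - Suc 0) \<subseteq> \<sigma> ` standard_simplex p"
    using singular_face_image[OF k(1,2)] k(3) by simp
  then show "lies_over w (p - Suc 0) f ==> lies_over w p \<sigma>" by (auto simp: lies_over_def)
  have "singular_simplex (p - Suc 0) (subtopology X (\<pi> ` K)) f"
    unfolding k(3) using assms(1) k by (intro singular_simplex_singular_face) (auto simp: small_def)
  then show "small eta (p - Suc 0) f"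
    by (rule small_subset[OF assms(1) _ im])
qed

lemma boundary_extend:
  assumes "\<And>\<sigma>. \<sigma> \<in> Poly_Mapping.keys c ==> chain_boundary p (f \<sigma>) = g (frag_of \<sigma>)"
    and "\<And>a b. g (a - b) = g a - g b" "g 0 = 0"
  shows "chain_boundary p (frag_extend f c) = g c"
proof -
  have "chain_boundary p (frag_extend f c) = g c" if "Poly_Mapping.keys c \<subseteq> {\<sigma>. chain_boundary p (f \<sigma>) = g (frag_of \<sigma>)}"
    using that by (induction c rule: frag_induction) (auto simp: frag_extend_diff chain_boundary_diff assms)
  then show ?thesis using assms(1) by blast
qed

text \<open>The carrier condition. A chain of dimension \<open>q\<close> over a
  \<open>p\<close>-simplex has to be near each orbit that the simplex meets, so fillings and degrees
  can be taken at any of them.\<close>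

definition over :: "real => nat => nat => ((nat => real) => 'x) => 'v chain => bool" where
  "over eps q p \<sigma> c \<longleftrightarrow> Z_invariant q c \<and> (\<forall>w. lies_over w p \<sigma> --> singular_chain q (top_of_set (nbhd w eps)) c)"

definition base_simplex :: "nat => ((nat => real) => 'v) => bool" where
  "base_simplex p \<tau> \<longleftrightarrow> singular_simplex p (top_of_set K) \<tau>"

text \<open>The value that the boundary of \<open>h\<close> must have in degree \<open>p\<close> if
  \<open>h\<close> is to be a chain homotopy from lifting the projected chain to \<open>M\<close>
  times averaging it. The case distinction drops the lower term in degree 0.\<close>

definition homotopy_defect ::
  "(nat => ((nat => real) => 'x) => 'v chain) => (nat => ((nat => real) => 'v) => 'v chain) => nat => nat => 'v chain => 'v chain"
  where "homotopy_defect L h M p c = frag_cmul (int M) (avg p c) - frag_extend (L p) (chain_map p \<pi> c)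
     - (if p = 0 then 0 else frag_extend (h (p - 1)) (chain_boundary p c))"

text \<open>Simultaneous lifts of all small simplices of the quotient, up to dimension \<open>k\<close>, together with a
  homotopy relating them to averaged simplices upstairs.\<close>

definition lifting_system ::
  "nat => real => real => (nat => ((nat => real) => 'x) => 'v chain) => (nat => ((nat => real) => 'v) => 'v chain) => nat => bool"
  where "lifting_system k eps eta L h M \<longleftrightarrow> eta > 0 \<and> M > 0 \<and>
     (\<forall>p \<sigma>. p \<le> k --> small eta p \<sigma> --> over eps p p \<sigma> (L p \<sigma>) \<and>
        (p = 0 --> frag_aug (L 0 \<sigma>) = frag_cmul (int (M * card Z)) (frag_of ())) \<and>
        (p > 0 --> chain_boundary p (L p \<sigma>) = frag_extend (L (p - 1)) (chain_boundary p (frag_of \<sigma>)))) \<and>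
     (\<forall>p \<tau>. p < k --> base_simplex p \<tau> --> small eta p (simplex_map p \<pi> \<tau>) -->
        over eps (Suc p) p (simplex_map p \<pi> \<tau>) (h p \<tau>) \<and>
        chain_boundary (Suc p) (h p \<tau>) = homotopy_defect L h M p (frag_of \<tau>))"

lemma lifting_systemD:
  assumes "lifting_system k eps eta L h M"
  shows "p \<le> k ==> small eta p \<sigma> ==> over eps p p \<sigma> (L p \<sigma>)"
    "small eta 0 \<sigma> ==> frag_aug (L 0 \<sigma>) = frag_cmul (int (M * card Z)) (frag_of ())"
    "0 < p ==> p \<le> k ==> small eta p \<sigma> ==> chain_boundary p (L p \<sigma>) = frag_extend (L (p - 1)) (chain_boundary p (frag_of \<sigma>))"
    "p < k ==> base_simplex p \<tau> ==> small eta p (simplex_map p \<pi> \<tau>) ==> over eps (Suc p) p (simplex_map p \<pi> \<tau>) (h p \<tau>)"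
    "p < k ==> base_simplex p \<tau> ==> small eta p (simplex_map p \<pi> \<tau>) ==> chain_boundary (Suc p) (h p \<tau>) = homotopy_defect L h M p (frag_of \<tau>)"
  using assms unfolding lifting_system_def by blast+

lemma homotopy_defect_linear:
  "homotopy_defect L h M p (a - b) = homotopy_defect L h M p a - homotopy_defect L h M p b"
  "homotopy_defect L h M p 0 = 0"
  by (simp_all add: homotopy_defect_def avg_linear frag_extend_diff chain_map_diff chain_boundary_diff frag_cmul_diff)

lemma over_mono: "over eps q p \<sigma> c ==> eps \<le> eps' ==> over eps' q p \<sigma> c"
  unfolding over_def by (auto intro: singular_chain_top_of_set_mono[OF _ nbhd_mono])

text \<open>A point over a face is also over the whole simplex; passing from one such point to
  another costs at most \<open>eta\<close>.\<close>

lemma over_face: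
  assumes "small eta p \<sigma>" "\<And>f. f \<in> Poly_Mapping.keys (chain_boundary p (frag_of \<sigma>)) ==> over eps q (p - Suc 0) f (F f)"
  shows "over (eps + eta) q p \<sigma> (frag_extend F (chain_boundary p (frag_of \<sigma>)))"
  unfolding over_def
proof (intro conjI allI impI)
  show "Z_invariant q (frag_extend F (chain_boundary p (frag_of \<sigma>)))"
    using assms(2) by (intro Z_invariant_extend) (auto simp: over_def)
  fix w assume w: "lies_over w p \<sigma>"
  show "singular_chain q (top_of_set (nbhd w (eps + eta))) (frag_extend F (chain_boundary p (frag_of \<sigma>)))"
  proof (rule singular_chain_extend)
    fix f assume f: "f \<in> Poly_Mapping.keys (chain_boundary p (frag_of \<sigma>))"
    obtain w' where w': "lies_over w' (p - Suc 0) f"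
      using ex_lies_over[OF small_face(1)[OF assms(1) f]] by blast
    then have "lies_over w' p \<sigma>" by (rule small_face(2)[OF assms(1) f])
    then have "nbhd w' eps \<subseteq> nbhd w (eps + eta)" using lies_over_near[OF assms(1) w] nbhd_triangle by blast
    then show "singular_chain q (top_of_set (nbhd w (eps + eta))) (F f)"
      using assms(2)[OF f] w' unfolding over_def by (auto intro: singular_chain_top_of_set_mono)
  qed
qed

lemma over_linear:
  "over eps q p \<sigma> a ==> over eps q p \<sigma> b ==> over eps q p \<sigma> (a - b)"
  "over eps q p \<sigma> a ==> over eps q p \<sigma> (frag_cmul m a)" "over eps q p \<sigma> 0"
  by (auto simp: over_def Z_invariant_linear intro: singular_chain_diff singular_chain_cmul)

lemma base_simplex_face:
  assumes "base_simplex p \<tau>" "f \<in> Poly_Mapping.keys (chain_boundary p (frag_of \<tau>))"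
  shows "base_simplex (p - Suc 0) f"
proof -
  obtain k where k: "p > 0" "k \<le> p" "f = singular_face p k \<tau>" using keys_chain_boundary_of[OF assms(2)] by blast
  then show "base_simplex (p - Suc 0) f"
    using assms(1) by (auto simp: base_simplex_def intro!: singular_simplex_singular_face)
qed

lemma continuous_\<pi>_K: "continuous_map (top_of_set K) (subtopology X (\<pi> ` K)) \<pi>"
  using continuous_map_from_subtopology_mono[OF continuous_\<pi> K_V0] by (auto simp: continuous_map_in_subtopology)

lemma small_simplex_map_face:
  assumes "base_simplex p \<tau>" "small eta p (simplex_map p \<pi> \<tau>)" "f \<in> Poly_Mapping.keys (chain_boundary p (frag_of \<tau>))"
  shows "small eta (p - Suc 0) (simplex_map (p - Suc 0) \<pi> f)"
    "lies_over w (p - Suc 0) (simplex_map (p - Suc 0) \<pi> f) ==> lies_over w p (simplex_map p \<pi> \<tau>)"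
proof -
  obtain k where k: "p > 0" "k \<le> p" "f = singular_face p k \<tau>" using keys_chain_boundary_of[OF assms(3)] by blast
  have "simplex_map (p - Suc 0) \<pi> f ` standard_simplex (p - Suc 0) = \<pi> ` (f ` standard_simplex (p - Suc 0))"
    by (auto simp: simplex_map_def)
  also have "\<dots> \<subseteq> \<pi> ` (\<tau> ` standard_simplex p)"
    unfolding k(3) by (rule image_mono[OF singular_face_image[OF k(1,2)]])
  also have "\<dots> = simplex_map p \<pi> \<tau> ` standard_simplex p" by (auto simp: simplex_map_def)
  finally have im: "simplex_map (p - Suc 0) \<pi> f ` standard_simplex (p - Suc 0) \<subseteq> simplex_map p \<pi> \<tau> ` standard_simplex p" .
  then show "lies_over w (p - Suc 0) (simplex_map (p - Suc 0) \<pi> f) ==> lies_over w p (simplex_map p \<pi> \<tau>)"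
    by (auto simp: lies_over_def)
  have "singular_simplex (p - Suc 0) (subtopology X (\<pi> ` K)) (simplex_map (p - Suc 0) \<pi> f)"
    using base_simplex_face[OF assms(1,3)] unfolding base_simplex_def
    by (rule singular_simplex_simplex_map[OF _ continuous_\<pi>_K])
  then show "small eta (p - Suc 0) (simplex_map (p - Suc 0) \<pi> f)"
    by (rule small_subset[OF assms(2) _ im])
qed

end

section \<open>Inductive construction of the lifts\<close>

context quat_quotient_compact
begin

text \<open>A point over the 0-simplex is chosen and averaged over \<open>Z\<close>; this explains
  the augmentation \<open>card Z\<close>, and the multiplier is still 1.\<close>

lemma lifting_system_0:
  assumes "eps > 0"
  shows "\<exists>L. lifting_system 0 eps 1 L h 1"
proof -
  have "\<exists>w. small 1 0 \<sigma> --> lies_over w 0 \<sigma>" for \<sigma> using ex_lies_over by blast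
  then obtain W where W: "\<And>\<sigma>. small 1 0 \<sigma> ==> lies_over (W \<sigma>) 0 \<sigma>" by metis
  define L where "L = (\<lambda>(p::nat) \<sigma>. avg 0 (frag_of (restrict (\<lambda>_. W \<sigma>) (standard_simplex 0))))"
  have "over eps 0 0 \<sigma> (L 0 \<sigma>)" if \<sigma>: "small 1 0 \<sigma>" for \<sigma>
    unfolding over_def
  proof (intro conjI allI impI)
    show "Z_invariant 0 (L 0 \<sigma>)" unfolding L_def by (rule Z_invariant_avg)
    fix w assume w: "lies_over w 0 \<sigma>"
    have "\<pi> w = \<pi> (W \<sigma>)" using w W[OF \<sigma>] unfolding lies_over_def standard_simplex_0 by auto
    then have "W \<sigma> \<in> orb w" using fibre[of w "W \<sigma>"] w W[OF \<sigma>] K_V0 by (auto simp: lies_over_def)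
    then have "W \<sigma> \<in> nbhd w eps" using orb_subset_nbhd[OF assms] by blast
    then have "singular_chain 0 (top_of_set (nbhd w eps)) (frag_of (restrict (\<lambda>_. W \<sigma>) (standard_simplex 0)))"
      by (auto simp: singular_chain_of singular_simplex_euclidean cong: continuous_on_cong)
    then show "singular_chain 0 (top_of_set (nbhd w eps)) (L 0 \<sigma>)"
      unfolding L_def by (rule singular_chain_avg_nbhd)
  qed
  moreover have "frag_aug (L 0 \<sigma>) = frag_cmul (int (card Z)) (frag_of ())" for \<sigma>
    by (simp add: L_def frag_aug_avg)
  ultimately show ?thesis by (intro exI[of _ L]) (auto simp: lifting_system_def)
qed

lemma lifting_chain_boundary:
  assumes ls: "lifting_system k eps eta L h M" and p: "p \<le> k" "p > 0"
    and c: "\<And>\<sigma>. \<sigma> \<in> Poly_Mapping.keys c ==> small eta p \<sigma>"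
  shows "chain_boundary p (frag_extend (L p) c) = frag_extend (L (p - 1)) (chain_boundary p c)"
  by (rule boundary_extend) (use assms in \<open>auto simp: lifting_system_def frag_extend_diff chain_boundary_diff\<close>)

lemma homotopy_chain_boundary:
  assumes ls: "lifting_system k eps eta L h M" and p: "p < k"
    and c: "\<And>\<tau>. \<tau> \<in> Poly_Mapping.keys c ==> base_simplex p \<tau> \<and> small eta p (simplex_map p \<pi> \<tau>)"
  shows "chain_boundary (Suc p) (frag_extend (h p) c) = homotopy_defect L h M p c"
  by (rule boundary_extend) (use assms in \<open>auto simp: lifting_system_def homotopy_defect_linear\<close>)

lemma chain_boundary_simplex_map:
  "base_simplex p \<tau> ==> chain_boundary p (frag_of (simplex_map p \<pi> \<tau>)) = chain_map (p - Suc 0) \<pi> (chain_boundary p (frag_of \<tau>))"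
  using chain_boundary_chain_map[of p "top_of_set K" "frag_of \<tau>" \<pi>] by (simp add: base_simplex_def singular_chain_of)

lemma frag_aug_lift:
  assumes "lifting_system k eps eta L h M" "\<And>\<sigma>. \<sigma> \<in> Poly_Mapping.keys c ==> small eta 0 \<sigma>"
  shows "frag_aug (frag_extend (L 0) c) = frag_cmul (int (M * card Z)) (frag_aug c)"
proof -
  have "frag_aug (frag_extend (L 0) c) = frag_cmul (int (M * card Z)) (frag_aug c)"
    if "Poly_Mapping.keys c \<subseteq> {\<sigma>. small eta 0 \<sigma>}"
    using that
  proof (induction c rule: frag_induction)
    case (one \<sigma>)
    then have "frag_aug (L 0 \<sigma>) = frag_cmul (int (M * card Z)) (frag_of ())"
      using assms(1) unfolding lifting_system_def by blast
    then show ?case by simp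
  next
    case (diff a b)
    then show ?case by (simp add: frag_extend_diff frag_cmul_diff)
  qed auto
  then show ?thesis using assms(2) by blast
qed

lemma frag_aug_boundary_1: "frag_aug (chain_boundary (Suc 0) c) = 0"
  using subset_UNIV
proof (induction c rule: frag_induction)
  case (one \<sigma>)
  then show ?case
    by (simp add: chain_boundary_of frag_extend_add frag_extend_diff)
next
  case (diff a b)
  then show ?case by (simp add: chain_boundary_diff frag_extend_diff)
qed simp

lemma chain_boundary_boundary': "chain_boundary (p - Suc 0) (chain_boundary p (frag_of \<sigma>)) = 0"
  if "singular_simplex p Y \<sigma>" for Y
proof (cases "p \<le> 1")
  case True
  then show ?thesis by (cases p) (auto simp: chain_boundary_def)
next
  case False
  then show ?thesis
    using chain_boundary_boundary[of p Y "frag_of \<sigma>"] that by (simp add: singular_chain_of)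
qed

lemma small_singular: "small eta p \<sigma> ==> singular_simplex p (subtopology X (\<pi> ` K)) \<sigma>"
  by (simp add: small_def)

lemma over_avg:
  assumes \<tau>: "base_simplex p \<tau>" and s: "small eta p (simplex_map p \<pi> \<tau>)"
  shows "over eta p p (simplex_map p \<pi> \<tau>) (avg p (frag_of \<tau>))"
  unfolding over_def
proof (intro conjI allI impI)
  show "Z_invariant p (avg p (frag_of \<tau>))" by (rule Z_invariant_avg)
  fix w assume w: "lies_over w p (simplex_map p \<pi> \<tau>)"
  have "\<tau> x \<in> nbhd w eta" if x: "x \<in> standard_simplex p" for x
  proof -
    have tx: "\<tau> x \<in> K" using \<tau> x by (auto simp: base_simplex_def singular_simplex_euclidean)
    then have "lies_over (\<tau> x) p (simplex_map p \<pi> \<tau>)"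
      using x by (auto simp: lies_over_def simplex_map_def image_iff)
    then show ?thesis by (rule lies_over_near[OF s w])
  qed
  then have "singular_chain p (top_of_set (nbhd w eta)) (frag_of \<tau>)"
    using \<tau> by (auto simp: base_simplex_def singular_simplex_euclidean singular_chain_of)
  then show "singular_chain p (top_of_set (nbhd w eta)) (avg p (frag_of \<tau>))"
    by (rule singular_chain_avg_nbhd)
qed

text \<open>The filling is made near one orbit met by the simplex. Every other orbit met is within
  \<open>eta\<close> of it, so the filling is near that orbit as well.\<close>

lemma fill_over:
  assumes K: "\<And>v. v \<in> K ==> fills v \<delta> (eps/2) M1" and s: "small eta p \<sigma>" and "eta \<le> eps/2" and i: "i < 3"
    and c: "over \<delta> i p \<sigma> c" "chain_boundary i c = 0" "i = 0 --> frag_aug c = 0"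
  obtains d where "over eps (Suc i) p \<sigma> d" "chain_boundary (Suc i) d = frag_cmul (int M1) c"
proof -
  obtain w0 where w0: "lies_over w0 p \<sigma>" using ex_lies_over[OF s] by blast
  then obtain d where d: "singular_chain (Suc i) (top_of_set (nbhd w0 (eps/2))) d"
     "chain_boundary (Suc i) d = frag_cmul (int M1) c" "Z_invariant (Suc i) d"
    using K[of w0] c i unfolding fills_def over_def lies_over_def by blast
  have "singular_chain (Suc i) (top_of_set (nbhd w eps)) d" if w: "lies_over w p \<sigma>" for w
  proof -
    have "nbhd w0 (eps/2) \<subseteq> nbhd w (eps/2 + eta)" by (rule nbhd_triangle[OF lies_over_near[OF s w w0]])
    also have "\<dots> \<subseteq> nbhd w eps" using assms(3) by (intro nbhd_mono) auto
    finally show ?thesis by (rule singular_chain_top_of_set_mono[OF d(1)])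
  qed
  then show ?thesis using that d by (auto simp: over_def)
qed

text \<open>Makes the next stage of the homotopy fillable: the boundary of the defect cancels by the
  homotopy identity one degree lower, together with the boundary formulas for averages and
  lifts.\<close>

lemma homotopy_defect_cycle:
  assumes ls: "lifting_system k eps eta0 L h M" and \<tau>: "base_simplex k \<tau>" and s: "small eta k (simplex_map k \<pi> \<tau>)"
    and eta: "eta \<le> eta0" and le: "eps + eta \<le> \<delta>" "0 < eta" "0 < eps"
  shows "over \<delta> k k (simplex_map k \<pi> \<tau>) (homotopy_defect L h M k (frag_of \<tau>))"
    and "chain_boundary k (homotopy_defect L h M k (frag_of \<tau>)) = 0"
proof -
    let ?b = "chain_boundary k (frag_of \<tau>)" and ?D = "homotopy_defect L h M k (frag_of \<tau>)"
    have sm: "small eta p \<sigma> ==> small eta0 p \<sigma>" for p \<sigma> using small_mono eta by blast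
    have fb: "base_simplex (k - 1) f \<and> small eta0 (k - 1) (simplex_map (k - 1) \<pi> f) \<and> k > 0" if "f \<in> Poly_Mapping.keys ?b" for f
      using base_simplex_face[OF \<tau> that] small_simplex_map_face(1)[OF \<tau> s that] sm keys_chain_boundary_of[OF that] by auto
    show "over \<delta> k k (simplex_map k \<pi> \<tau>) ?D"
      unfolding homotopy_defect_def
    proof (intro over_linear)
      show "over \<delta> k k (simplex_map k \<pi> \<tau>) (avg k (frag_of \<tau>))"
        using over_mono[OF over_avg[OF \<tau> s]] le by auto
      show "over \<delta> k k (simplex_map k \<pi> \<tau>) (frag_extend (L k) (chain_map k \<pi> (frag_of \<tau>)))"
        using lifting_systemD(1)[OF ls order_refl sm[OF s]] over_mono[of eps k k "simplex_map k \<pi> \<tau>" "L k (simplex_map k \<pi> \<tau>)" \<delta>] le eta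
        by simp
      show "over \<delta> k k (simplex_map k \<pi> \<tau>) (if k = 0 then 0 else frag_extend (h (k - 1)) ?b)"
      proof (cases "k = 0")
        case False
        have "over \<delta> k k (simplex_map k \<pi> \<tau>) (frag_extend (h (k - 1)) ?b)"
          unfolding over_def
        proof (intro conjI allI impI)
          have hf: "over eps k (k - 1) (simplex_map (k - 1) \<pi> f) (h (k - 1) f)" if "f \<in> Poly_Mapping.keys ?b" for f
            using lifting_systemD(4)[OF ls, of "k - 1" f] fb[OF that] by auto
          then show "Z_invariant k (frag_extend (h (k - 1)) ?b)"
            by (intro Z_invariant_extend) (auto simp: over_def)
          fix w assume w: "lies_over w k (simplex_map k \<pi> \<tau>)"
          show "singular_chain k (top_of_set (nbhd w \<delta>)) (frag_extend (h (k - 1)) ?b)"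
          proof (rule singular_chain_extend)
            fix f assume f: "f \<in> Poly_Mapping.keys ?b"
            obtain w' where w': "lies_over w' (k - 1) (simplex_map (k - 1) \<pi> f)"
              using ex_lies_over fb[OF f] by blast
            then have "lies_over w' k (simplex_map k \<pi> \<tau>)"
              using small_simplex_map_face(2)[OF \<tau> s f] by simp
            then have "nbhd w' eps \<subseteq> nbhd w (eps + eta)" using lies_over_near[OF s w] nbhd_triangle by blast
            also have "\<dots> \<subseteq> nbhd w \<delta>" using le by (intro nbhd_mono) auto
            finally show "singular_chain k (top_of_set (nbhd w \<delta>)) (h (k - 1) f)"
              using hf[OF f] w' unfolding over_def by (auto intro: singular_chain_top_of_set_mono)
          qed
        qed
        then show ?thesis using False by simp
      qed (simp add: over_linear)
    qed
    show "chain_boundary k ?D = 0"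
    proof (cases "k = 0")
      case False
      have kk: "Suc (k - 1) = k" using False by simp
      have 1: "chain_boundary k (avg k (frag_of \<tau>)) = avg (k - 1) ?b"
        using chain_boundary_avg[of k "top_of_set K"] \<tau> by (simp add: base_simplex_def singular_chain_of)
      have 2: "chain_boundary k (frag_extend (L k) (chain_map k \<pi> (frag_of \<tau>))) = frag_extend (L (k - 1)) (chain_map (k - 1) \<pi> ?b)"
        using lifting_chain_boundary[OF ls order_refl, of "frag_of (simplex_map k \<pi> \<tau>)"] sm[OF s] False chain_boundary_simplex_map[OF \<tau>] by simp
      have 3: "chain_boundary k (frag_extend (h (k - 1)) ?b) = homotopy_defect L h M (k - 1) ?b"
        using homotopy_chain_boundary[OF ls, of "k - 1" ?b] fb kk by auto
      have 4: "chain_boundary (k - 1) ?b = 0"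
        using chain_boundary_boundary'[of k "top_of_set K" \<tau>] \<tau> by (simp add: base_simplex_def)
      have "?D = frag_cmul (int M) (avg k (frag_of \<tau>)) - frag_extend (L k) (chain_map k \<pi> (frag_of \<tau>))
          - frag_extend (h (k - 1)) ?b"
        using False by (simp add: homotopy_defect_def)
      then have "chain_boundary k ?D = frag_cmul (int M) (avg (k - 1) ?b)
          - frag_extend (L (k - 1)) (chain_map (k - 1) \<pi> ?b) - homotopy_defect L h M (k - 1) ?b"
        by (simp only: chain_boundary_diff chain_boundary_cmul 1 2 3)
      also have "\<dots> = 0" by (simp add: homotopy_defect_def 4[unfolded One_nat_def])
      finally show ?thesis .
    qed (simp add: chain_boundary_def)
qed

lemma lift_boundary_cycle:
  assumes ls: "lifting_system k eps eta0 L h M" and s: "small eta (Suc k) \<sigma>"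
    and eta: "eta \<le> eta0" and le: "eps + eta \<le> \<delta>"
  shows "over \<delta> k (Suc k) \<sigma> (frag_extend (L k) (chain_boundary (Suc k) (frag_of \<sigma>)))"
    and "chain_boundary k (frag_extend (L k) (chain_boundary (Suc k) (frag_of \<sigma>))) = 0"
proof -
  let ?b = "chain_boundary (Suc k) (frag_of \<sigma>)"
  have sm: "small eta p \<sigma> ==> small eta0 p \<sigma>" for p \<sigma> using small_mono eta by blast
  have fs: "small eta k f" if "f \<in> Poly_Mapping.keys ?b" for f using small_face(1)[OF s that] by simp
  have "over (eps + eta) k (Suc k) \<sigma> (frag_extend (L k) ?b)"
  proof (rule over_face[OF s])
    show "over eps k (Suc k - Suc 0) f (L k f)" if "f \<in> Poly_Mapping.keys ?b" for f
      using lifting_systemD(1)[OF ls order_refl sm[OF fs[OF that]]] by simp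
  qed
  then show "over \<delta> k (Suc k) \<sigma> (frag_extend (L k) ?b)" using le by (rule over_mono)
  show "chain_boundary k (frag_extend (L k) ?b) = 0"
  proof (cases "k = 0")
    case False
    then show ?thesis
      using lifting_chain_boundary[OF ls order_refl, of ?b] fs sm chain_boundary_boundary'[OF small_singular[OF s]] by simp
  qed (simp add: chain_boundary_def)
qed

text \<open>An acyclic carrier argument up to integers. The lifted boundary of a new simplex and the
  new defect of the homotopy are filled after multiplication by \<open>M1\<close>, so all earlier
  stages are multiplied by \<open>M1\<close> too. Since \<open>fills\<close> stops at degree 2,
  lifts exist up to dimension 3.\<close>

lemma lifting_system_step:
  assumes k: "k < 3" and ls: "lifting_system k (\<delta>/2) eta0 L h M" and eps: "eps > 0" "\<delta> > 0" "\<delta> \<le> eps/2"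
    and fills: "\<And>v. v \<in> K ==> fills v \<delta> (eps/2) M1" and M1: "M1 > 0"
  shows "\<exists>eta L' h' M'. lifting_system (Suc k) eps eta L' h' M'"
proof -
  define eta where "eta = min eta0 (\<delta>/2)"
  have eta: "eta > 0" "eta \<le> eta0" "eta \<le> \<delta>/2" "eta \<le> eps/2" using ls eps by (auto simp: eta_def lifting_system_def)
  have sm: "small eta p \<sigma> ==> small eta0 p \<sigma>" for p \<sigma> using small_mono eta by blast
  have "\<exists>d. small eta (Suc k) \<sigma> --> over eps (Suc k) (Suc k) \<sigma> d \<and>
       chain_boundary (Suc k) d = frag_cmul (int M1) (frag_extend (L k) (chain_boundary (Suc k) (frag_of \<sigma>)))" for \<sigma>
  proof (cases "small eta (Suc k) \<sigma>")
    case True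
    let ?b = "chain_boundary (Suc k) (frag_of \<sigma>)"
    have fs: "small eta k f" if "f \<in> Poly_Mapping.keys ?b" for f using small_face(1)[OF True that] by simp
    have "over \<delta> k (Suc k) \<sigma> (frag_extend (L k) ?b)" "chain_boundary k (frag_extend (L k) ?b) = 0"
      using lift_boundary_cycle[OF ls True eta(2), of \<delta>] eta(3) by auto
    moreover have "k = 0 --> frag_aug (frag_extend (L k) ?b) = 0"
      using frag_aug_lift[OF ls, of ?b] fs sm by (auto simp: frag_aug_boundary_1)
    ultimately obtain d where "over eps (Suc k) (Suc k) \<sigma> d" "chain_boundary (Suc k) d = frag_cmul (int M1) (frag_extend (L k) ?b)"
      using fill_over[OF fills True eta(4) k] by blast
    then show ?thesis by blast
  qed auto
  then obtain Ln where Ln: "\<And>\<sigma>. small eta (Suc k) \<sigma> ==> over eps (Suc k) (Suc k) \<sigma> (Ln \<sigma>) \<and>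
       chain_boundary (Suc k) (Ln \<sigma>) = frag_cmul (int M1) (frag_extend (L k) (chain_boundary (Suc k) (frag_of \<sigma>)))"
    by metis
  have "\<exists>d. base_simplex k \<tau> --> small eta k (simplex_map k \<pi> \<tau>) --> over eps (Suc k) k (simplex_map k \<pi> \<tau>) d \<and>
       chain_boundary (Suc k) d = frag_cmul (int M1) (homotopy_defect L h M k (frag_of \<tau>))" for \<tau>
  proof (cases "base_simplex k \<tau> \<and> small eta k (simplex_map k \<pi> \<tau>)")
    case True
    then have \<tau>: "base_simplex k \<tau>" and s: "small eta k (simplex_map k \<pi> \<tau>)" by auto
    let ?D = "homotopy_defect L h M k (frag_of \<tau>)"
    have "over \<delta> k k (simplex_map k \<pi> \<tau>) ?D" "chain_boundary k ?D = 0"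
      using homotopy_defect_cycle[OF ls \<tau> s eta(2), of \<delta>] eta(1,3) eps by auto
    moreover have "k = 0 --> frag_aug ?D = 0"
    proof
      assume "k = 0"
      then show "frag_aug ?D = 0"
        using frag_aug_lift[OF ls, of "frag_of (simplex_map 0 \<pi> \<tau>)"] s sm
        by (simp add: homotopy_defect_def frag_extend_diff frag_extend_cmul frag_aug_avg)
    qed
    ultimately obtain d where "over eps (Suc k) k (simplex_map k \<pi> \<tau>) d" "chain_boundary (Suc k) d = frag_cmul (int M1) ?D"
      using fill_over[OF fills s eta(4) k] by blast
    then show ?thesis by blast
  qed auto
  then obtain hn where hn: "\<And>\<tau>. base_simplex k \<tau> ==> small eta k (simplex_map k \<pi> \<tau>) ==> over eps (Suc k) k (simplex_map k \<pi> \<tau>) (hn \<tau>) \<and>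
       chain_boundary (Suc k) (hn \<tau>) = frag_cmul (int M1) (homotopy_defect L h M k (frag_of \<tau>))"
    by metis
  define L' where "L' = (\<lambda>p \<sigma>. if p = Suc k then Ln \<sigma> else frag_cmul (int M1) (L p \<sigma>))"
  define h' where "h' = (\<lambda>p \<tau>. if p = k then hn \<tau> else frag_cmul (int M1) (h p \<tau>))"
  have L'ext: "frag_extend (L' p) c = frag_cmul (int M1) (frag_extend (L p) c)" if "p \<le> k" for p c
    using that by (simp add: L'_def frag_extend_scale)
  have h'ext: "frag_extend (h' p) c = frag_cmul (int M1) (frag_extend (h p) c)" if "p < k" for p c
    using that by (simp add: h'_def frag_extend_scale)
  have defect: "homotopy_defect L' h' (M1 * M) p c = frag_cmul (int M1) (homotopy_defect L h M p c)" if "p \<le> k" for p c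
    using that by (auto simp: homotopy_defect_def frag_cmul_diff L'ext h'ext)
  have "lifting_system (Suc k) eps eta L' h' (M1 * M)"
    unfolding lifting_system_def
  proof (intro conjI allI impI)
    show "eta > 0" "M1 * M > 0" using eta M1 ls by (auto simp: lifting_system_def)
  next
    fix p \<sigma> assume p: "p \<le> Suc k" and s: "small eta p \<sigma>"
    show "over eps p p \<sigma> (L' p \<sigma>)"
    proof (cases "p = Suc k")
      case True
      then show ?thesis using Ln s by (simp add: L'_def)
    next
      case False
      then have "over (\<delta>/2) p p \<sigma> (L p \<sigma>)" using ls p sm[OF s] by (simp add: lifting_system_def)
      then show ?thesis using False eps over_mono[of "\<delta>/2" p p \<sigma> _ eps] by (simp add: L'_def over_linear)
    qed
  next
    fix p \<sigma> assume p: "p \<le> Suc k" and s: "small eta p \<sigma>" and p0: "p = 0"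
    then show "frag_aug (L' 0 \<sigma>) = frag_cmul (int (M1 * M * card Z)) (frag_of ())"
      using lifting_systemD(2)[OF ls sm] by (simp add: L'_def frag_extend_cmul mult.assoc)
  next
    fix p \<sigma> assume p: "p \<le> Suc k" and s: "small eta p \<sigma>" and p0: "p > 0"
    show "chain_boundary p (L' p \<sigma>) = frag_extend (L' (p - 1)) (chain_boundary p (frag_of \<sigma>))"
    proof (cases "p = Suc k")
      case True
      then show ?thesis using Ln s by (simp add: L'_def frag_extend_scale)
    next
      case False
      then have "p \<le> k" "p - Suc 0 \<noteq> Suc k" using p by auto
      then show ?thesis using lifting_systemD(3)[OF ls p0 _ sm[OF s]] False
        by (simp add: L'_def frag_extend_scale chain_boundary_cmul)
    qed
  next
    fix p \<tau> assume p: "p < Suc k" and \<tau>: "base_simplex p \<tau>" and s: "small eta p (simplex_map p \<pi> \<tau>)"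
    show "over eps (Suc p) p (simplex_map p \<pi> \<tau>) (h' p \<tau>)"
    proof (cases "p = k")
      case True
      then show ?thesis using hn \<tau> s by (simp add: h'_def)
    next
      case False
      then have "over (\<delta>/2) (Suc p) p (simplex_map p \<pi> \<tau>) (h p \<tau>)" using ls p \<tau> sm[OF s] by (simp add: lifting_system_def)
      then show ?thesis using False eps over_mono[of "\<delta>/2" "Suc p" p "simplex_map p \<pi> \<tau>" _ eps] by (simp add: h'_def over_linear)
    qed
    show "chain_boundary (Suc p) (h' p \<tau>) = homotopy_defect L' h' (M1 * M) p (frag_of \<tau>)"
    proof (cases "p = k")
      case True
      then show ?thesis using hn \<tau> s defect by (simp add: h'_def)
    next
      case False
      then show ?thesis using ls p \<tau> sm[OF s] defect[of p]
        by (simp add: h'_def lifting_system_def chain_boundary_cmul)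
    qed
  qed
  then show ?thesis by blast
qed

lemma tame_K: "v \<in> K ==> finite (stab v) \<and> (\<exists>eta>0. \<exists>r. equivariant_retraction v eta r)"
  using tame_V0 K_V0 by blast

text \<open>Radii are fixed from the top dimension downwards: the filling radius \<delta> for the
  last stage determines how close to the orbits the earlier stages must be.\<close>

lemma lifting_system_exists:
  assumes "k \<le> 3" "eps > 0"
  shows "\<exists>eta L h M. lifting_system k eps eta L h M"
  using assms
proof (induction k arbitrary: eps)
  case 0
  then show ?case using lifting_system_0 by blast
next
  case (Suc k)
  obtain \<delta> M1 where \<delta>: "\<delta> > 0" "\<delta> \<le> eps/2" "M1 > 0" "\<And>v. v \<in> K ==> fills v \<delta> (eps/2) M1 \<and> fills3 v \<delta> (eps/2) M1"
    using uniform_fills[OF compact_K tame_K, of "eps/2"] Suc.prems(2) by (metis half_gt_zero)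
  obtain eta0 L h M where "lifting_system k (\<delta>/2) eta0 L h M"
    using Suc.IH[of "\<delta>/2"] Suc.prems \<delta> by auto
  then show ?case
    using lifting_system_step[of k \<delta> eta0 L h M eps M1] Suc.prems \<delta> by auto
qed

end

lemma frag_extend_linear:
  assumes "\<And>a b. G (a - b) = G a - G b" "G 0 = 0"
  shows "frag_extend (\<lambda>x. G (frag_of x)) c = G c"
  using subset_UNIV
proof (induction c rule: frag_induction)
  case (diff a b)
  then show ?case by (simp add: frag_extend_diff assms)
qed (auto simp: assms)

section \<open>Degrees of 3-cycles near an orbit\<close>

context quat_quotient_compact
begin

text \<open>Says that near the orbit of \<open>w\<close> the cycle \<open>c\<close> is x/N times the
  orbit class rationally. The integer \<open>x\<close> is written as a chain on a point, so that
  degrees extend linearly by \<open>frag_extend\<close>.\<close>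

definition has_degree :: "nat => real => 'v => 'v chain => (unit \<Rightarrow>\<^sub>0 int) => bool" where
  "has_degree N eps w c x \<longleftrightarrow> (\<exists>d. singular_chain 4 (top_of_set (nbhd w eps)) d \<and>
     chain_boundary 4 d = frag_cmul (int N) c - frag_extend (\<lambda>_. orbit_class w) x)"

lemma has_degree_diff:
  "has_degree N eps w c x ==> has_degree N eps w c' x' ==> has_degree N eps w (c - c') (x - x')"
  unfolding has_degree_def
proof clarify
  fix d d' assume "singular_chain 4 (top_of_set (nbhd w eps)) d" "singular_chain 4 (top_of_set (nbhd w eps)) d'"
    "chain_boundary 4 d = frag_cmul (int N) c - frag_extend (\<lambda>_. orbit_class w) x"
    "chain_boundary 4 d' = frag_cmul (int N) c' - frag_extend (\<lambda>_. orbit_class w) x'"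
  then show "\<exists>d. singular_chain 4 (top_of_set (nbhd w eps)) d \<and>
       chain_boundary 4 d = frag_cmul (int N) (c - c') - frag_extend (\<lambda>_. orbit_class w) (x - x')"
    by (intro exI[of _ "d - d'"]) (simp add: singular_chain_diff chain_boundary_diff frag_cmul_diff frag_extend_diff)
qed

lemma has_degree_0: "has_degree N eps w 0 0"
  unfolding has_degree_def by (intro exI[of _ 0]) simp

lemma has_degree_boundary:
  "singular_chain 4 (top_of_set (nbhd w eps)) d ==> has_degree N eps w (chain_boundary 4 d) 0"
  unfolding has_degree_def
  by (intro exI[of _ "frag_cmul (int N) d"]) (simp add: singular_chain_cmul chain_boundary_cmul)

lemma has_degree_extend:
  assumes "\<And>\<sigma>. \<sigma> \<in> Poly_Mapping.keys b ==> has_degree N eps w (f \<sigma>) (g \<sigma>)"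
  shows "has_degree N eps w (frag_extend f b) (frag_extend g b)"
proof -
  have "has_degree N eps w (frag_extend f b) (frag_extend g b)"
    if "Poly_Mapping.keys b \<subseteq> {\<sigma>. has_degree N eps w (f \<sigma>) (g \<sigma>)}"
    using that
    by (induction b rule: frag_induction) (auto simp: has_degree_0 frag_extend_diff has_degree_diff)
  then show ?thesis using assms by blast
qed

lemma has_degree_unique_0:
  assumes "essential w eps" "has_degree N eps w 0 x"
  shows "x = 0"
proof -
  obtain d where d: "singular_chain 4 (top_of_set (nbhd w eps)) d"
     "chain_boundary 4 d = frag_cmul (int N) 0 - frag_extend (\<lambda>_. orbit_class w) x"
    using assms(2) unfolding has_degree_def by blast
  define n where "n = poly_mapping.lookup x ()"
  have x: "x = frag_cmul n (frag_of ())"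
    by (rule poly_mapping_eqI) (simp add: n_def)
  have "chain_boundary 4 d = frag_cmul (- n) (orbit_class w)"
    using d(2) by (simp add: x frag_extend_cmul)
  then have "- n = 0" using assms(1) d(1) unfolding essential_def by blast
  then show ?thesis by (simp add: x)
qed

text \<open>Orbit classes of nearby points are homologous, so degrees found at different orbits
  under one simplex can be compared at a common point, at the price of doubling the radius.\<close>

lemma has_degree_move:
  assumes h: "has_degree N eps w' c x" and w: "w' \<in> nbhd w eps" and eps: "eps > 0"
  shows "has_degree N (2 * eps) w c x"
proof -
  obtain d where d: "singular_chain 4 (top_of_set (nbhd w' eps)) d"
     "chain_boundary 4 d = frag_cmul (int N) c - frag_extend (\<lambda>_. orbit_class w') x"
    using h unfolding has_degree_def by blast
  define n where "n = poly_mapping.lookup x ()"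
  have x: "x = frag_cmul n (frag_of ())"
    by (rule poly_mapping_eqI) (simp add: n_def)
  have sub: "nbhd w' eps \<subseteq> nbhd w (2 * eps)" "nbhd w eps \<subseteq> nbhd w (2 * eps)"
    using nbhd_triangle[OF w, of eps] nbhd_mono[of eps "2 * eps" w] eps by auto
  then have "w' \<in> nbhd w (2 * eps)" using w by blast
  then obtain e where e: "singular_chain 4 (top_of_set (nbhd w (2 * eps))) e" "chain_boundary 4 e = orbit_class w' - orbit_class w"
    using orbit_class_near[of w' w "2 * eps"] eps by (auto simp: singular_boundary numeral_eq_Suc)
  have "singular_chain 4 (top_of_set (nbhd w (2 * eps))) (d + frag_cmul n e)"
    by (intro singular_chain_add singular_chain_cmul e(1) singular_chain_top_of_set_mono[OF d(1) sub(1)])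
  moreover have "chain_boundary 4 (d + frag_cmul n e) = frag_cmul (int N) c - frag_extend (\<lambda>_. orbit_class w) x"
    by (simp add: chain_boundary_add chain_boundary_cmul d e x frag_extend_cmul frag_cmul_diff)
  ultimately show ?thesis unfolding has_degree_def by blast
qed

lemma fill_degree:
  assumes K: "\<And>v. v \<in> K ==> fills3 v \<delta> eps N" and s: "small eta p \<sigma>"
    and c: "over \<delta> 3 p \<sigma> c" "chain_boundary 3 c = 0"
  shows "\<exists>x w. lies_over w p \<sigma> \<and> has_degree N eps w c x"
proof -
  obtain w where w: "lies_over w p \<sigma>" using ex_lies_over[OF s] by blast
  then have "fills3 w \<delta> eps N" using K by (simp add: lies_over_def)
  then obtain d m where "singular_chain 4 (top_of_set (nbhd w eps)) d"
     "chain_boundary 4 d = frag_cmul (int N) c - frag_cmul m (orbit_class w)"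
    using c w unfolding fills3_def over_def by blast
  then have "has_degree N eps w c (frag_cmul m (frag_of ()))"
    unfolding has_degree_def by (auto simp: frag_extend_cmul)
  then show ?thesis using w by blast
qed

end

lemma singular_chain_funpow_subdivision:
  "singular_chain p X c ==> singular_chain p X ((singular_subdivision p ^^ n) c)"
  by (induction n) (auto simp: singular_chain_singular_subdivision)

lemma chain_boundary_funpow_subdivision:
  "singular_chain p X c ==> chain_boundary p ((singular_subdivision p ^^ n) c)
     = (singular_subdivision (p - Suc 0) ^^ n) (chain_boundary p c)"
  by (induction n) (auto simp: chain_boundary_singular_subdivision[OF singular_chain_funpow_subdivision])

lemma chain_map_funpow_subdivision:
  "singular_chain p X c ==> chain_map p g ((singular_subdivision p ^^ n) c) = (singular_subdivision p ^^ n) (chain_map p g c)"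
  by (induction n) (auto simp flip: naturality_singular_subdivision[OF singular_chain_funpow_subdivision])

lemma homologous_funpow_subdivision:
  "singular_relcycle p X T c ==> homologous_rel p X T ((singular_subdivision p ^^ n) c) c"
proof (induction n)
  case (Suc n)
  then have "singular_relcycle p X T ((singular_subdivision p ^^ n) c)"
    using homologous_rel_singular_relcycle by blast
  then show ?case
    using homologous_rel_singular_subdivision homologous_rel_trans Suc by fastforce
qed simp

context quat_quotient_compact
begin

lemma small_if_close:
  assumes \<sigma>: "singular_simplex p (subtopology X (\<pi> ` K)) \<sigma>"
    and u: "\<sigma> ` standard_simplex p \<subseteq> \<pi> ` (nbhd u (eta/2) \<inter> V0)"
  shows "small eta p \<sigma>"
  unfolding small_def
proof (intro conjI ballI impI)
  show "singular_simplex p (subtopology X (\<pi> ` K)) \<sigma>" by (rule \<sigma>)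
  fix w assume w: "w \<in> K" "\<pi> w \<in> \<sigma> ` standard_simplex p"
  have near: "y \<in> nbhd u (eta/2)" if y: "y \<in> K" "\<pi> y \<in> \<sigma> ` standard_simplex p" for y
  proof -
    have "\<pi> y \<in> \<pi> ` (nbhd u (eta/2) \<inter> V0)" by (rule subsetD[OF u y(2)])
    then obtain y' where y': "y' \<in> nbhd u (eta/2)" "y' \<in> V0" "\<pi> y = \<pi> y'" by blast
    then have "y \<in> orb y'" using fibre[of y' y] y(1) K_V0 by auto
    then show ?thesis by (rule nbhd_orb[OF y'(1)])
  qed
  have sub: "nbhd u (eta/2) \<subseteq> nbhd w eta"
    using nbhd_triangle[OF nbhd_sym[OF near[OF w]], of "eta/2"] by simp
  show "\<sigma> ` standard_simplex p \<subseteq> \<pi> ` (nbhd w eta \<inter> K)"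
  proof
    fix x assume x: "x \<in> \<sigma> ` standard_simplex p"
    then have "x \<in> \<pi> ` K" using \<sigma> unfolding singular_simplex_subtopology by blast
    then obtain y where y: "y \<in> K" "x = \<pi> y" by blast
    then show "x \<in> \<pi> ` (nbhd w eta \<inter> K)" using near[OF y(1)] x sub by blast
  qed
qed

lemma ex_fine_subdivision:
  assumes eta: "eta > 0" and c: "singular_chain p (subtopology X (\<pi> ` K)) c"
  obtains n where "\<And>m \<sigma>. n \<le> m ==> \<sigma> \<in> Poly_Mapping.keys ((singular_subdivision p ^^ m) c) ==> small eta p \<sigma>"
proof -
  let ?Y = "subtopology X (\<pi> ` K)"
  let ?U = "\<lambda>u. \<pi> ` (nbhd u (eta/2) \<inter> V0) \<inter> \<pi> ` K"
  obtain n where n: "\<And>m f. [|n \<le> m; f \<in> Poly_Mapping.keys ((singular_subdivision p ^^ m) c)|]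
                      ==> \<exists>V \<in> ?U ` K. f \<in> standard_simplex p \<rightarrow> V"
  proof (rule sufficient_iterated_singular_subdivision_exists[of "?U ` K" ?Y])
    show "openin ?Y V" if V: "V \<in> ?U ` K" for V
    proof -
      obtain u where "V = ?U u" using V by blast
      moreover have "openin X (\<pi> ` (nbhd u (eta/2) \<inter> V0))"
        using open_V0 open_nbhd by (intro open_\<pi>) auto
      ultimately show ?thesis by (auto simp: openin_subtopology)
    qed
    show "topspace ?Y \<subseteq> \<Union> (?U ` K)"
    proof
      fix x assume "x \<in> topspace ?Y"
      then obtain u where u: "u \<in> K" "x = \<pi> u" by auto
      then have "u \<in> nbhd u (eta/2) \<inter> V0" using eta K_V0 by (auto intro: nbhd_dist)
      then show "x \<in> \<Union> (?U ` K)" using u by blast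
    qed
  qed (use c in auto)
  have "small eta p \<sigma>" if m: "n \<le> m" and \<sigma>: "\<sigma> \<in> Poly_Mapping.keys ((singular_subdivision p ^^ m) c)" for m \<sigma>
  proof (rule small_if_close)
    show "singular_simplex p ?Y \<sigma>"
      using singular_chain_funpow_subdivision[OF c, of m] \<sigma> by (auto simp: singular_chain_def)
    obtain u where "u \<in> K" "\<sigma> \<in> standard_simplex p \<rightarrow> ?U u" using n[OF m \<sigma>] by blast
    \<comment> \<open>The centre demanded by \<open>small_if_close\<close> is fixed before
      \<open>u\<close> is obtained, so a choice term stands in for it.\<close>
    then show "\<sigma> ` standard_simplex p \<subseteq> \<pi> ` (nbhd (SOME u. \<sigma> ` standard_simplex p \<subseteq> \<pi> ` (nbhd u (eta/2) \<inter> V0)) (eta/2) \<inter> V0)"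
      by (intro someI[of "\<lambda>u. \<sigma> ` standard_simplex p \<subseteq> \<pi> ` (nbhd u (eta/2) \<inter> V0)" u]) auto
  qed
  then show ?thesis using that by blast
qed

end

section \<open>The obstruction cocycle and its value on the 4-cycle\<close>

context quat_quotient_compact
begin

text \<open>The lifts of the boundaries of the small \<open>4\<close>-simplices of the quotient have a degree, an
  integral multiple of a fixed fraction of the orbit class.  This degree is a cocycle on the quotient;
  if the orbit class bounded upstairs, its value on a cycle of the quotient that bounds
  would be the nonzero degree of the orbit class itself.\<close>

lemma orbit_class_obstruction:
  assumes v: "v \<in> K" and a0: "singular_chain 4 (top_of_set K) a0"
    and ba0: "chain_boundary 4 a0 = chain_map 3 (orbit_map v) S3_class"
    and c0: "singular_chain 5 (subtopology X (\<pi> ` K)) c0"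
    and e0: "singular_chain 4 (subtopology X {\<pi> v}) e0"
    and bc0: "chain_boundary 5 c0 = chain_map 4 \<pi> a0 - e0"
  shows False
proof -
  obtain eps0 where eps0: "eps0 > 0" "\<And>w. w \<in> K ==> essential w eps0"
    using uniform_essential[OF compact_K tame_K] by blast
  \<comment> \<open>Half the radius of essentiality, because transporting degrees to a common base
    point doubles \<open>eps\<close>.\<close>
  define eps where "eps = eps0 / 2"
  have eps: "eps > 0" "2 * eps = eps0" using eps0 by (auto simp: eps_def)
  obtain \<delta> N where \<delta>: "\<delta> > 0" "\<delta> \<le> eps" "N > 0" "\<And>w. w \<in> K ==> fills w \<delta> eps N \<and> fills3 w \<delta> eps N"
    using uniform_fills[OF compact_K tame_K eps(1)] by metis
  obtain eta0 L h M where ls: "lifting_system 3 (\<delta>/4) eta0 L h M"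
    using lifting_system_exists[of 3 "\<delta>/4"] \<delta> by auto
  define eta where "eta = min eta0 (\<delta>/4)"
  have eta: "eta > 0" "eta \<le> eta0" "eta \<le> \<delta>/4" "eta \<le> eps" "\<delta>/4 + eta \<le> \<delta>"
    using ls \<delta> by (auto simp: eta_def lifting_system_def)
  have epsle: "eps \<le> eps0" using eps by linarith
  have sm: "small eta p \<sigma> ==> small eta0 p \<sigma>" for p \<sigma> using small_mono eta by blast
  have M: "M > 0" using ls by (simp add: lifting_system_def)
  have near: "w' \<in> nbhd w eps" if "small eta p \<sigma>" "lies_over w p \<sigma>" "lies_over w' p \<sigma>" for p \<sigma> w w'
    using lies_over_near[OF that] nbhd_mono[OF eta(4)] by blast
  \<comment> \<open>The lifts stop at dimension 3: the lifted boundary of a 4-simplex is a 3-cycle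
    whose degree \<open>O4\<close> need not vanish. Likewise the homotopy stops at 2-simplices, and
    \<open>O3\<close> below is the degree of its defect on a 3-simplex upstairs.\<close>
  have "\<exists>x. small eta 4 \<tau> --> (\<exists>w. lies_over w 4 \<tau> \<and> has_degree N eps w (frag_extend (L 3) (chain_boundary 4 (frag_of \<tau>))) x)" for \<tau>
  proof (cases "small eta 4 \<tau>")
    case True
    then have s: "small eta (Suc 3) \<tau>" by (simp add: numeral_eq_Suc)
    have "\<exists>x w. lies_over w (Suc 3) \<tau> \<and> has_degree N eps w (frag_extend (L 3) (chain_boundary (Suc 3) (frag_of \<tau>))) x"
      using fill_degree[OF _ s lift_boundary_cycle[OF ls s eta(2,5)]] \<delta>(4) by blast
    then show ?thesis by (auto simp: numeral_eq_Suc)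
  qed auto
  then obtain O4 where O4: "\<And>\<tau>. small eta 4 \<tau> ==>
     \<exists>w. lies_over w 4 \<tau> \<and> has_degree N eps w (frag_extend (L 3) (chain_boundary 4 (frag_of \<tau>))) (O4 \<tau>)"
    by metis
  have "\<exists>x. base_simplex 3 \<sigma> --> small eta 3 (simplex_map 3 \<pi> \<sigma>) -->
      (\<exists>w. lies_over w 3 (simplex_map 3 \<pi> \<sigma>) \<and> has_degree N eps w (homotopy_defect L h M 3 (frag_of \<sigma>)) x)" for \<sigma>
  proof (cases "base_simplex 3 \<sigma> \<and> small eta 3 (simplex_map 3 \<pi> \<sigma>)")
    case True
    then show ?thesis
      using fill_degree[OF _ _ homotopy_defect_cycle[OF ls _ _ eta(2,5,1)]] \<delta>(1,4) by simp blast
  qed auto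
  then obtain O3 where O3: "\<And>\<sigma>. base_simplex 3 \<sigma> ==> small eta 3 (simplex_map 3 \<pi> \<sigma>) ==>
      \<exists>w. lies_over w 3 (simplex_map 3 \<pi> \<sigma>) \<and> has_degree N eps w (homotopy_defect L h M 3 (frag_of \<sigma>)) (O3 \<sigma>)"
    by metis
  have O4_at: "has_degree N eps0 w (frag_extend (L 3) (chain_boundary 4 (frag_of \<tau>))) (O4 \<tau>)"
    if \<tau>: "small eta 4 \<tau>" and w: "\<And>w'. lies_over w' 4 \<tau> ==> w' \<in> nbhd w eps" for \<tau> w
    using O4[OF \<tau>] has_degree_move[OF _ w eps(1)] eps(2) by auto
  have O3_at: "has_degree N eps0 w (homotopy_defect L h M 3 (frag_of \<sigma>)) (O3 \<sigma>)"
    if \<sigma>: "base_simplex 3 \<sigma>" "small eta 3 (simplex_map 3 \<pi> \<sigma>)"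
      and w: "\<And>w'. lies_over w' 3 (simplex_map 3 \<pi> \<sigma>) ==> w' \<in> nbhd w eps" for \<sigma> w
    using O3[OF \<sigma>] has_degree_move[OF _ w eps(1)] eps(2) by auto
  have lin4: "frag_extend (\<lambda>\<tau>. frag_extend (L 3) (chain_boundary 4 (frag_of \<tau>))) b = frag_extend (L 3) (chain_boundary 4 b)" for b
    by (rule frag_extend_linear) (simp_all add: chain_boundary_diff frag_extend_diff)
  have lin3: "frag_extend (\<lambda>\<sigma>. homotopy_defect L h M 3 (frag_of \<sigma>)) b = homotopy_defect L h M 3 b" for b
    by (rule frag_extend_linear) (simp_all add: homotopy_defect_linear)
  \<comment> \<open>All degrees are moved to one \<open>w\<close>; the cycles add up to the lift of
    a double boundary, which is 0, and 0 has only the degree 0 near an essential orbit.\<close>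
  have cocycle: "frag_extend O4 (chain_boundary 5 (frag_of \<rho>)) = 0" if \<rho>: "small eta 5 \<rho>" for \<rho>
  proof -
    let ?b = "chain_boundary 5 (frag_of \<rho>)"
    obtain w where w: "lies_over w 5 \<rho>" using ex_lies_over[OF \<rho>] by blast
    have "has_degree N eps0 w (frag_extend (\<lambda>\<tau>. frag_extend (L 3) (chain_boundary 4 (frag_of \<tau>))) ?b) (frag_extend O4 ?b)"
    proof (rule has_degree_extend, rule O4_at)
      fix \<tau> assume \<tau>: "\<tau> \<in> Poly_Mapping.keys ?b"
      show "small eta 4 \<tau>" using small_face(1)[OF \<rho> \<tau>] by simp
      show "w' \<in> nbhd w eps" if "lies_over w' 4 \<tau>" for w'
        using small_face(2)[OF \<rho> \<tau>, of w'] that near[OF \<rho> w] by simp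
    qed
    moreover have "chain_boundary 4 ?b = 0"
      using chain_boundary_boundary'[OF small_singular[OF \<rho>]] by simp
    ultimately have "has_degree N eps0 w 0 (frag_extend O4 ?b)"
      unfolding lin4 by simp
    moreover have "w \<in> K" using w by (simp add: lies_over_def)
    ultimately show ?thesis by (intro has_degree_unique_0[OF eps0(2)])
  qed
  \<comment> \<open>Pulled back upstairs the cocycle becomes trivial: the boundary of the averaged
    simplex bounds near the orbit, and the homotopy defect compares it with the lifted
    boundary.\<close>
  have coboundary: "frag_extend O3 (chain_boundary 4 (frag_of \<tau>)) = - O4 (simplex_map 4 \<pi> \<tau>)"
    if \<tau>: "base_simplex 4 \<tau>" and s: "small eta 4 (simplex_map 4 \<pi> \<tau>)" for \<tau>
  proof -
    let ?b = "chain_boundary 4 (frag_of \<tau>)"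
    obtain w where w: "lies_over w 4 (simplex_map 4 \<pi> \<tau>)" using ex_lies_over[OF s] by blast
    have "has_degree N eps0 w (frag_extend (\<lambda>\<sigma>. homotopy_defect L h M 3 (frag_of \<sigma>)) ?b) (frag_extend O3 ?b)"
    proof (rule has_degree_extend, rule O3_at)
      fix \<sigma> assume \<sigma>: "\<sigma> \<in> Poly_Mapping.keys ?b"
      show "base_simplex 3 \<sigma>" using base_simplex_face[OF \<tau> \<sigma>] by simp
      show "small eta 3 (simplex_map 3 \<pi> \<sigma>)" using small_simplex_map_face(1)[OF \<tau> s \<sigma>] by simp
      show "w' \<in> nbhd w eps" if "lies_over w' 3 (simplex_map 3 \<pi> \<sigma>)" for w'
        using small_simplex_map_face(2)[OF \<tau> s \<sigma>, of w'] that near[OF s w] by simp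
    qed
    moreover have "homotopy_defect L h M 3 ?b
       = frag_cmul (int M) (avg 3 ?b) - frag_extend (L 3) (chain_boundary 4 (frag_of (simplex_map 4 \<pi> \<tau>)))"
      using chain_boundary_boundary'[of 4 "top_of_set K" \<tau>] \<tau> chain_boundary_simplex_map[OF \<tau>]
      by (simp add: homotopy_defect_def base_simplex_def)
    ultimately have 1: "has_degree N eps0 w (frag_cmul (int M) (avg 3 ?b)
        - frag_extend (L 3) (chain_boundary 4 (frag_of (simplex_map 4 \<pi> \<tau>)))) (frag_extend O3 ?b)"
      unfolding lin3 by simp
    have 2: "has_degree N eps0 w (frag_extend (L 3) (chain_boundary 4 (frag_of (simplex_map 4 \<pi> \<tau>)))) (O4 (simplex_map 4 \<pi> \<tau>))"
      using near[OF s w] by (intro O4_at[OF s])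
    have "singular_chain 4 (top_of_set (nbhd w eta)) (avg 4 (frag_of \<tau>))"
      using over_avg[OF \<tau> s] w by (simp add: over_def)
    then have "singular_chain 4 (top_of_set (nbhd w eps0)) (frag_cmul (int M) (avg 4 (frag_of \<tau>)))"
      by (rule singular_chain_cmul[OF singular_chain_top_of_set_mono[OF _ order_trans[OF nbhd_mono[OF eta(4)] nbhd_mono[OF epsle]]]])
    from has_degree_boundary[OF this, of N]
    have 3: "has_degree N eps0 w (frag_cmul (int M) (avg 3 ?b)) 0"
      using chain_boundary_avg[of 4 "top_of_set K" "frag_of \<tau>"] \<tau>
      by (simp add: chain_boundary_cmul base_simplex_def singular_chain_of)
    have "has_degree N eps0 w 0 (frag_extend O3 ?b - (0 - O4 (simplex_map 4 \<pi> \<tau>)))"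
      using has_degree_diff[OF 1 has_degree_diff[OF 3 2]] by simp
    moreover have "w \<in> K" using w by (simp add: lies_over_def)
    ultimately have "frag_extend O3 ?b - (0 - O4 (simplex_map 4 \<pi> \<tau>)) = 0"
      using has_degree_unique_0 eps0(2) by blast
    then show ?thesis by (simp add: eq_neg_iff_add_eq_0)
  qed
  obtain n1 where n1: "\<And>m \<sigma>. n1 \<le> m ==> \<sigma> \<in> Poly_Mapping.keys ((singular_subdivision 5 ^^ m) c0) ==> small eta 5 \<sigma>"
    using ex_fine_subdivision[OF eta(1) c0] by blast
  obtain n2 where n2: "\<And>m \<tau>. n2 \<le> m ==> \<tau> \<in> Poly_Mapping.keys ((singular_subdivision 4 ^^ m) a0) ==> small eta 4 (simplex_map 4 \<pi> \<tau>)"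
  proof -
    let ?U = "\<lambda>u. nbhd u (eta/2) \<inter> K"
    obtain m0 where m0: "\<And>m f. [|m0 \<le> m; f \<in> Poly_Mapping.keys ((singular_subdivision 4 ^^ m) a0)|]
                      ==> \<exists>V \<in> ?U ` K. f \<in> standard_simplex 4 \<rightarrow> V"
    proof (rule sufficient_iterated_singular_subdivision_exists[of "?U ` K" "top_of_set K"])
      show "openin (top_of_set K) V" if "V \<in> ?U ` K" for V
        using that open_nbhd by (auto simp: openin_open)
      show "topspace (top_of_set K) \<subseteq> \<Union> (?U ` K)"
      proof
        fix u assume "u \<in> topspace (top_of_set K)"
        then have u: "u \<in> K" by simp
        then have "u \<in> ?U u" using eta(1) by (auto intro: nbhd_dist)
        then show "u \<in> \<Union> (?U ` K)" using u by blast
      qed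
    qed (use a0 in auto)
    have "small eta 4 (simplex_map 4 \<pi> \<tau>)" if m: "m0 \<le> m" and \<tau>: "\<tau> \<in> Poly_Mapping.keys ((singular_subdivision 4 ^^ m) a0)" for m \<tau>
    proof -
      obtain u where "\<tau> \<in> standard_simplex 4 \<rightarrow> ?U u" using m0[OF m \<tau>] by blast
      then have "simplex_map 4 \<pi> \<tau> ` standard_simplex 4 \<subseteq> \<pi> ` (nbhd u (eta/2) \<inter> V0)"
        using K_V0 by (auto simp: simplex_map_def)
      moreover have "singular_simplex 4 (top_of_set K) \<tau>"
        using singular_chain_funpow_subdivision[OF a0, of m] \<tau> by (auto simp: singular_chain_def)
      ultimately show ?thesis
        using singular_simplex_simplex_map[OF _ continuous_\<pi>_K] small_if_close by blast
    qed
    then show ?thesis using that by blast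
  qed
  define n where "n = max n1 n2"
  define c a e where "c = (singular_subdivision 5 ^^ n) c0" and "a = (singular_subdivision 4 ^^ n) a0"
    and "e = (singular_subdivision 4 ^^ n) e0"
  have c: "small eta 5 \<sigma>" if "\<sigma> \<in> Poly_Mapping.keys c" for \<sigma>
    using n1[of n \<sigma>] that by (simp add: n_def c_def)
  have a: "base_simplex 4 \<tau> \<and> small eta 4 (simplex_map 4 \<pi> \<tau>)" if "\<tau> \<in> Poly_Mapping.keys a" for \<tau>
    using n2[of n \<tau>] that singular_chain_funpow_subdivision[OF a0, of n]
    by (auto simp: n_def a_def base_simplex_def singular_chain_def)
  have e_chain: "singular_chain 4 (subtopology X {\<pi> v}) e"
    unfolding e_def by (rule singular_chain_funpow_subdivision[OF e0])
  have e: "small eta 4 \<tau>" "lies_over w 4 \<tau> ==> w \<in> orb v" if "\<tau> \<in> Poly_Mapping.keys e" for \<tau> w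
  proof -
    have \<tau>: "singular_simplex 4 X \<tau>" "\<tau> ` standard_simplex 4 \<subseteq> {\<pi> v}"
      using that e_chain unfolding singular_chain_def
      by (auto dest!: subsetD simp: singular_simplex_subtopology)
    show *: "lies_over w 4 \<tau> ==> w \<in> orb v" for w
    proof -
      assume "lies_over w 4 \<tau>"
      then obtain x where "w \<in> K" "x \<in> standard_simplex 4" "\<pi> w = \<tau> x" by (auto simp: lies_over_def)
      moreover from this have "\<tau> x = \<pi> v" using \<tau>(2) by auto
      ultimately show "w \<in> orb v" using fibre[of v w] v K_V0 by auto
    qed
    show "small eta 4 \<tau>"
      unfolding small_def singular_simplex_subtopology
    proof (intro conjI ballI impI \<tau>(1))
      show "\<tau> ` standard_simplex 4 \<subseteq> \<pi> ` K" using \<tau>(2) v by auto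
      fix w assume "w \<in> K" "\<pi> w \<in> \<tau> ` standard_simplex 4"
      then have "w \<in> orb v" by (intro *) (simp add: lies_over_def)
      then have "v \<in> nbhd w eta" using orb_sym orb_subset_nbhd[OF eta(1)] by blast
      then show "\<tau> ` standard_simplex 4 \<subseteq> \<pi> ` (nbhd w eta \<inter> K)" using \<tau>(2) v by auto
    qed
  qed
  have \<pi>_a: "chain_map 4 \<pi> a = (singular_subdivision 4 ^^ n) (chain_map 4 \<pi> a0)"
    unfolding a_def by (rule chain_map_funpow_subdivision[OF a0])
  have "chain_boundary 5 c = (singular_subdivision 4 ^^ n) (chain_boundary 5 c0)"
    unfolding c_def using chain_boundary_funpow_subdivision[OF c0, of n] by simp
  then have bc: "chain_boundary 5 c = chain_map 4 \<pi> a - e"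
    by (simp add: bc0 singular_subdivision_power_diff \<pi>_a e_def)
  define S where "S = chain_boundary 4 a"
  have S: "S = (singular_subdivision 3 ^^ n) (chain_map 3 (orbit_map v) S3_class)"
    unfolding S_def a_def using chain_boundary_funpow_subdivision[OF a0, of n] ba0 by simp
  have cyc0: "singular_relcycle 3 (top_of_set (orb v)) {} (chain_map 3 (orbit_map v) S3_class)"
    by (rule singular_relcycle_chain_map[OF S3_class(1) continuous_orbit_map_orb]) auto
  have S_chain: "singular_chain 3 (top_of_set (orb v)) S" "chain_boundary 3 S = 0"
  proof -
    let ?c = "chain_map 3 (orbit_map v) S3_class"
    have c: "singular_chain 3 (top_of_set (orb v)) ?c" "chain_boundary 3 ?c = 0"
      using cyc0 by (simp_all add: singular_cycle)
    show "singular_chain 3 (top_of_set (orb v)) S"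
      unfolding S by (rule singular_chain_funpow_subdivision[OF c(1)])
    have "(singular_subdivision k ^^ m) 0 = (0 :: 'v chain)" for k m by (induction m) auto
    then show "chain_boundary 3 S = 0"
      unfolding S by (simp add: chain_boundary_funpow_subdivision[OF c(1)] c(2))
  qed
  have S_face: "base_simplex 3 \<sigma> \<and> small eta 3 (simplex_map 3 \<pi> \<sigma>) \<and> (\<forall>w. lies_over w 3 (simplex_map 3 \<pi> \<sigma>) --> w \<in> orb v)"
    if \<sigma>: "\<sigma> \<in> Poly_Mapping.keys S" for \<sigma>
  proof -
    have s: "singular_simplex 3 (top_of_set (orb v)) \<sigma>" using S_chain(1) \<sigma> by (auto simp: singular_chain_def)
    have orbK: "orb v \<subseteq> K" using K_orb[OF v] by blast
    have \<pi>v: "\<pi> x = \<pi> v" if "x \<in> orb v" for x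
      using fibre[OF subsetD[OF K_V0 v] subsetD[OF K_V0 subsetD[OF orbK that]]] that by simp
    have b: "base_simplex 3 \<sigma>"
      using s orbK unfolding base_simplex_def by (rule singular_simplex_mono)
    have im: "simplex_map 3 \<pi> \<sigma> ` standard_simplex 3 \<subseteq> {\<pi> v}"
      using s \<pi>v by (auto simp: simplex_map_def singular_simplex_euclidean image_subset_iff)
    have "v \<in> nbhd v (eta/2) \<inter> V0" using eta(1) v K_V0 by (auto intro: nbhd_dist)
    then have "small eta 3 (simplex_map 3 \<pi> \<sigma>)"
      using im b by (intro small_if_close[of 3 _ v] singular_simplex_simplex_map[OF _ continuous_\<pi>_K]) (auto simp: base_simplex_def)
    moreover have "w \<in> orb v" if "lies_over w 3 (simplex_map 3 \<pi> \<sigma>)" for w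
    proof -
      have "\<pi> w \<in> {\<pi> v}" using that im by (auto simp: lies_over_def)
      moreover have "w \<in> K" using that by (simp add: lies_over_def)
      ultimately show ?thesis using fibre[OF subsetD[OF K_V0 v] subsetD[OF K_V0], of w] by auto
    qed
    ultimately show ?thesis using b by blast
  qed
  have O4_sum: "frag_extend O4 (chain_map 4 \<pi> a) = - frag_extend O3 S"
  proof -
    have "frag_extend O4 (chain_map 4 \<pi> a) = - frag_extend O3 (chain_boundary 4 a)"
      if "Poly_Mapping.keys a \<subseteq> {\<tau>. base_simplex 4 \<tau> \<and> small eta 4 (simplex_map 4 \<pi> \<tau>)}"
      using that
    proof (induction a rule: frag_induction)
      case (diff a b)
      then show ?case by (simp add: chain_map_diff chain_boundary_diff frag_extend_diff)
    qed (auto simp: coboundary)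
    then show ?thesis using a unfolding S_def by blast
  qed
  have "frag_extend O4 (chain_boundary 5 c) = 0"
  proof -
    have "frag_extend O4 (chain_boundary 5 c) = 0" if "Poly_Mapping.keys c \<subseteq> {\<rho>. small eta 5 \<rho>}"
      using that
    proof (induction c rule: frag_induction)
      case (diff a b)
      then show ?case by (simp add: chain_boundary_diff frag_extend_diff)
    qed (auto simp: cocycle)
    then show ?thesis using c by blast
  qed
  \<comment> \<open>The cocycle vanishes on the boundary of \<open>c\<close>. The part coming from
    upstairs contributes only through its boundary \<open>S\<close>, so both sides concern simplices
    over the single orbit of \<open>v\<close>.\<close>
  then have O43: "frag_extend O4 e = - frag_extend O3 S"
    using O4_sum by (simp add: bc frag_extend_diff)
  have orbn: "w \<in> nbhd v eps" if "w \<in> orb v" for w using orb_subset_nbhd[OF eps(1)] that by blast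
  have 1: "has_degree N eps0 v (homotopy_defect L h M 3 S) (frag_extend O3 S)"
  proof -
    have "has_degree N eps0 v (frag_extend (\<lambda>\<sigma>. homotopy_defect L h M 3 (frag_of \<sigma>)) S) (frag_extend O3 S)"
      by (rule has_degree_extend, rule O3_at) (simp_all add: S_face orbn)
    then show ?thesis unfolding lin3 .
  qed
  have 2: "has_degree N eps0 v (frag_extend (L 3) (chain_boundary 4 e)) (frag_extend O4 e)"
  proof -
    have "has_degree N eps0 v (frag_extend (\<lambda>\<tau>. frag_extend (L 3) (chain_boundary 4 (frag_of \<tau>))) e) (frag_extend O4 e)"
    proof (rule has_degree_extend, rule O4_at)
      show "w' \<in> nbhd v eps" if "\<tau> \<in> Poly_Mapping.keys e" "lies_over w' 4 \<tau>" for w' \<tau>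
        by (rule orbn[OF e(2)[OF that]])
    qed (rule e(1))
    then show ?thesis unfolding lin4 .
  qed
  have be: "chain_boundary 4 e = chain_map 3 \<pi> S"
  proof -
    have "chain_boundary 4 (chain_boundary 5 c) = 0"
      using chain_boundary_boundary_alt[of 4 _ c] singular_chain_funpow_subdivision[OF c0, of n]
      by (simp add: c_def numeral_eq_Suc)
    then have "chain_boundary 4 e = chain_boundary 4 (chain_map 4 \<pi> a)"
      by (simp add: bc chain_boundary_diff)
    also have "\<dots> = chain_map 3 \<pi> S"
      using chain_boundary_chain_map[OF singular_chain_funpow_subdivision[OF a0, of n], of \<pi>]
      by (simp add: S_def a_def)
    finally show ?thesis .
  qed
  \<comment> \<open>By \<open>O43\<close> the degrees of the defect and of the lifted chain cancel,
    so the average of \<open>S\<close> taken \<open>M\<close> times has degree 0. But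
    \<open>S\<close> is a subdivision of the orbit cycle, which gives the same chain the degree N M;
    by uniqueness N M would be 0.\<close>
  have "homotopy_defect L h M 3 S = frag_cmul (int M) (avg 3 S) - frag_extend (L 3) (chain_map 3 \<pi> S)"
    by (simp add: homotopy_defect_def S_chain)
  then have "frag_cmul (int M) (avg 3 S) = homotopy_defect L h M 3 S - (0 - frag_extend (L 3) (chain_boundary 4 e))"
    by (simp add: be)
  then have 3: "has_degree N eps0 v (frag_cmul (int M) (avg 3 S)) 0"
    using has_degree_diff[OF 1 has_degree_diff[OF has_degree_0 2]] O43 by simp
  have "homologous_rel 3 (top_of_set (orb v)) {} S (chain_map 3 (orbit_map v) S3_class)"
    unfolding S by (rule homologous_funpow_subdivision[OF cyc0])
  then obtain g where g: "singular_chain 4 (top_of_set (orb v)) g" "chain_boundary 4 g = S - chain_map 3 (orbit_map v) S3_class"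
    by (auto simp: homologous_rel_def singular_boundary numeral_eq_Suc)
  have "singular_chain 4 (top_of_set (nbhd v eps0)) (frag_cmul (int (N * M)) (avg 4 g))"
    by (intro singular_chain_cmul singular_chain_top_of_set_mono[OF singular_chain_avg_orb[OF g(1)] orb_subset_nbhd[OF eps0(1)]])
  moreover have "chain_boundary 4 (frag_cmul (int (N * M)) (avg 4 g))
     = frag_cmul (int N) (frag_cmul (int M) (avg 3 S)) - frag_extend (\<lambda>_. orbit_class v) (frag_cmul (int (N * M)) (frag_of ()))"
    using chain_boundary_avg[OF g(1)] g(2)
    by (simp add: chain_boundary_cmul avg_linear frag_cmul_diff frag_extend_cmul orbit_class_def)
  ultimately have 4: "has_degree N eps0 v (frag_cmul (int M) (avg 3 S)) (frag_cmul (int (N * M)) (frag_of ()))"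
    unfolding has_degree_def by blast
  have "frag_cmul (int (N * M)) (frag_of ()) - 0 = 0"
    by (rule has_degree_unique_0[OF eps0(2)[OF v] has_degree_diff[OF 4 3, unfolded diff_self]])
  then show False using \<delta>(3) M by simp
qed

end

section \<open>From the obstruction to nonzero homology of the quotient\<close>

context quat_quotient
begin

text \<open>The images of open balls whose closures lie in \<open>V0\<close> cover the compact set;
  finitely many of the closed balls, swept around by the compact group, form
  \<open>K\<close>.\<close>

lemma ex_compact_saturation:
  assumes C: "compactin X C"
  obtains K where "compact K" "K \<subseteq> V0" "\<And>v x. v \<in> K ==> x \<in> orb v ==> x \<in> K" "C \<subseteq> \<pi> ` K"
proof -
  have "\<exists>r>0. cball v r \<subseteq> V0" if "v \<in> V0" for v
    using open_V0 that open_contains_cball by blast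
  then obtain r where r: "\<And>v. v \<in> V0 ==> r v > 0 \<and> cball v (r v) \<subseteq> V0" by metis
  let ?U = "(\<lambda>v. \<pi> ` ball v (r v)) ` V0"
  have bV: "ball v (r v) \<subseteq> V0" if "v \<in> V0" for v using r[OF that] ball_subset_cball by blast
  have "\<exists>FF. finite FF \<and> FF \<subseteq> ?U \<and> C \<subseteq> \<Union> FF"
  proof (rule compactinD[OF C])
    show "openin X U" if "U \<in> ?U" for U using that bV by (auto intro: open_\<pi>)
    have "topspace X \<subseteq> \<Union> ?U"
    proof
      fix x assume "x \<in> topspace X"
      then obtain v where v: "v \<in> V0" "x = \<pi> v" using topspace_X by auto
      then have "v \<in> ball v (r v)" using r by simp
      then show "x \<in> \<Union> ?U" using v by blast
    qed
    then show "C \<subseteq> \<Union> ?U" using C compactin_subset_topspace by blast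
  qed
  then obtain F where F: "finite F" "F \<subseteq> V0" "C \<subseteq> (\<Union>v\<in>F. \<pi> ` ball v (r v))"
    by (metis (no_types, lifting) finite_subset_image)
  define sat where "sat = (\<lambda>A. (\<Union>z\<in>Z. (\<lambda>x. act (fst x) (snd x)) ` (Sigma S3 (\<lambda>_. z ` A))))"
  have sat: "sat A = (\<Union>a\<in>A. orb a)" for A
  proof
    show "sat A \<subseteq> (\<Union>a\<in>A. orb a)" unfolding sat_def by (force simp: orb_eq_UN orbit0_def)
    show "(\<Union>a\<in>A. orb a) \<subseteq> sat A"
    proof
      fix x assume "x \<in> (\<Union>a\<in>A. orb a)"
      then obtain a z p where "a \<in> A" "z \<in> Z" "p \<in> S3" "x = act p (z a)" unfolding orb_eq_UN orbit0_def by blast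
      then have "x = (\<lambda>x. act (fst x) (snd x)) (p, z a)" "(p, z a) \<in> Sigma S3 (\<lambda>_. z ` A)" by auto
      then show "x \<in> sat A" unfolding sat_def using \<open>z \<in> Z\<close> by blast
    qed
  qed
  have csat: "compact (sat A)" if "compact A" for A
    unfolding sat_def
  proof (rule compact_UN[OF finite_Z])
    fix z assume z: "z \<in> Z"
    show "compact ((\<lambda>x. act (fst x) (snd x)) ` (Sigma S3 (\<lambda>_. z ` A)))"
      using that z by (intro compact_continuous_image continuous_on_subset[OF act_cont] compact_Times continuous_on_Z) auto
  qed
  define K where "K = sat (\<Union>v\<in>F. cball v (r v))"
  show ?thesis
  proof
    show "compact K" unfolding K_def using F(1) by (intro csat compact_UN) auto
    show "K \<subseteq> V0" unfolding K_def sat using F(2) r orb_V0 by blast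
    show "x \<in> K" if "v \<in> K" "x \<in> orb v" for v x
      using that orb_eq unfolding K_def sat by blast
    have "(\<Union>v\<in>F. cball v (r v)) \<subseteq> K" unfolding K_def sat using orb_self by blast
    then have "\<pi> ` (\<Union>v\<in>F. ball v (r v)) \<subseteq> \<pi> ` K" using ball_subset_cball by blast
    then show "C \<subseteq> \<pi> ` K" using F(3) by blast
  qed
qed

lemma singular_chain_compact_support:
  assumes "singular_chain p Y c"
  obtains C where "compactin Y C" "singular_chain p (subtopology Y C) c"
proof
  let ?C = "\<Union>f\<in>Poly_Mapping.keys c. f ` standard_simplex p"
  show "compactin Y ?C"
    using assms by (intro compactin_Union) (auto simp: singular_chain_def intro: singular_simplex_compact_image)
  show "singular_chain p (subtopology Y ?C) c"
    using assms by (auto simp: singular_chain_subtopology)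
qed

text \<open>The chain that kills the orbit cycle upstairs projects to a chain whose boundary sits
  over the point \<pi> v. In a one-point space this boundary bounds some \<open>e0\<close>, and
  subtracting \<open>e0\<close> gives a 4-cycle of the quotient.\<close>

theorem quotient_not_acyclic:
  assumes v: "v \<in> V0" and null: "singular_relboundary 3 (top_of_set V0) {} (chain_map 3 (orbit_map v) S3_class)"
  shows "\<not> rel_acyclic 4 X {}"
proof
  assume acyc: "rel_acyclic 4 X {}"
  obtain a0 where a0: "singular_chain 4 (top_of_set V0) a0" "chain_boundary 4 a0 = chain_map 3 (orbit_map v) S3_class"
    using null by (auto simp: singular_boundary numeral_eq_Suc)
  have orbV: "orb v \<subseteq> V0" using orb_V0[OF v] by blast
  have \<pi>v: "\<pi> x = \<pi> v" if "x \<in> orb v" for x using fibre[of v x] orbV v that by auto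
  have cyc0: "singular_relcycle 3 (top_of_set (orb v)) {} (chain_map 3 (orbit_map v) S3_class)"
    by (rule singular_relcycle_chain_map[OF S3_class(1) continuous_orbit_map_orb]) auto
  let ?P = "subtopology X {\<pi> v}"
  have "continuous_map (top_of_set (orb v)) ?P \<pi>"
    using continuous_map_from_subtopology_mono[OF continuous_\<pi> orbV] \<pi>v by (auto simp: continuous_map_in_subtopology)
  from singular_relcycle_chain_map[OF cyc0 this, of "{}"]
  have "singular_relcycle 3 ?P {} (chain_map 3 \<pi> (chain_map 3 (orbit_map v) S3_class))" by auto
  moreover have "topspace ?P = {\<pi> v}" using v topspace_X by auto
  ultimately have "singular_relboundary 3 ?P {} (chain_map 3 \<pi> (chain_map 3 (orbit_map v) S3_class))"
    using singular_boundary_eq_cycle_singleton[of ?P "\<pi> v" 3] by simp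
  then obtain e0 where e0: "singular_chain 4 ?P e0" "chain_boundary 4 e0 = chain_map 3 \<pi> (chain_map 3 (orbit_map v) S3_class)"
    by (auto simp: singular_boundary numeral_eq_Suc)
  have a0X: "singular_chain 4 X (chain_map 4 \<pi> a0)" by (rule singular_chain_chain_map[OF a0(1) continuous_\<pi>])
  have e0X: "singular_chain 4 X e0" using e0(1) by (simp add: singular_chain_subtopology)
  have "singular_relcycle 4 X {} (chain_map 4 \<pi> a0 - e0)"
    using a0X e0X chain_boundary_chain_map[OF a0(1), of \<pi>] a0(2) e0(2)
    by (simp add: singular_cycle singular_chain_diff chain_boundary_diff)
  then obtain c0 where c0: "singular_chain 5 X c0" "chain_boundary 5 c0 = chain_map 4 \<pi> a0 - e0"
    using acyc by (auto simp: rel_acyclic_def singular_boundary numeral_eq_Suc)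
  obtain C1 where C1: "compactin X C1" "singular_chain 5 (subtopology X C1) c0"
    using singular_chain_compact_support[OF c0(1)] by blast
  obtain C2 where C2: "compactin (top_of_set V0) C2" "singular_chain 4 (subtopology (top_of_set V0) C2) a0"
    using singular_chain_compact_support[OF a0(1)] by blast
  have "compactin X (C1 \<union> \<pi> ` C2 \<union> {\<pi> v})"
    using C1(1) image_compactin[OF C2(1) continuous_\<pi>] v topspace_X
    by (intro compactin_Un) (auto simp: compactin_def)
  then obtain K where K: "compact K" "K \<subseteq> V0" "\<And>v x. v \<in> K ==> x \<in> orb v ==> x \<in> K" "C1 \<union> \<pi> ` C2 \<union> {\<pi> v} \<subseteq> \<pi> ` K"
    using ex_compact_saturation by metis
  interpret Q: quat_quotient_compact act Z V0 \<pi> X K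
    using K(1-3) by unfold_locales auto
  have in_K: "x \<in> K" if "x \<in> V0" "\<pi> x \<in> \<pi> ` K" for x
  proof -
    obtain y where y: "y \<in> K" "\<pi> x = \<pi> y" using \<open>\<pi> x \<in> \<pi> ` K\<close> by auto
    then have "y \<in> V0" using K(2) by auto
    then have "x \<in> orb y" using fibre[of y x] y \<open>x \<in> V0\<close> by simp
    then show ?thesis by (rule K(3)[OF y(1)])
  qed
  have "C2 \<subseteq> K"
  proof
    fix x assume x: "x \<in> C2"
    then have "\<pi> x \<in> \<pi> ` K" using K(4) by blast
    then show "x \<in> K" using in_K compactin_subset_topspace[OF C2(1)] x by auto
  qed
  then have "singular_chain 4 (top_of_set K) a0"
    using C2(2) by (metis (no_types, lifting) singular_chain_subtopology subset_trans)
  moreover have "v \<in> K" using in_K[OF v] K(4) by auto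
  moreover have "singular_chain 5 (subtopology X (\<pi> ` K)) c0"
    using C1(2) K(4) by (auto intro: singular_chain_mono)
  ultimately show False
    using Q.orbit_class_obstruction[of v a0 c0 e0] a0(2) e0(1) c0(2) by blast
qed

end

section \<open>Representations of su(2)\<close>

unbundle cross3_syntax

text \<open>The quadratic form of \<open>T\<close> attains its maximum on the unit sphere of
  \<open>S\<close> at an eigenvector: the component \<open>d\<close> of \<open>T x\<close>
  orthogonal to \<open>x\<close> would otherwise be a direction of increase.\<close>

lemma symmetric_eigenvector:
  fixes T :: "'v::euclidean_space => 'v"
  assumes T: "linear T" and S: "subspace S" "S \<noteq> {0}" and inv: "\<And>x. x \<in> S ==> T x \<in> S"
    and sym: "\<And>x y. x \<in> S ==> y \<in> S ==> T x \<bullet> y = x \<bullet> T y"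
  obtains x c where "x \<in> S" "x \<noteq> 0" "T x = c *\<^sub>R x"
proof -
  obtain a where a: "a \<in> S" "a \<noteq> 0" using S subspace_0 by blast
  have ne: "S \<inter> sphere 0 1 \<noteq> {}"
  proof -
    have "a /\<^sub>R norm a \<in> S \<inter> sphere 0 1" using a S(1) by (simp add: subspace_scale)
    then show ?thesis by blast
  qed
  have "compact (S \<inter> sphere 0 1)" by (simp add: S(1) closed_Int_compact closed_subspace)
  moreover have "continuous_on (S \<inter> sphere 0 1) (\<lambda>x. T x \<bullet> x)"
    using T by (intro continuous_on_inner linear_continuous_on continuous_on_id) (simp add: linear_conv_bounded_linear)
  ultimately obtain x where x: "x \<in> S \<inter> sphere 0 1" and mx: "\<And>y. y \<in> S \<inter> sphere 0 1 ==> T y \<bullet> y \<le> T x \<bullet> x"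
    using continuous_attains_sup[OF _ ne, of "\<lambda>x. T x \<bullet> x"] by blast
  define c where "c = T x \<bullet> x"
  have q: "T y \<bullet> y \<le> c * (y \<bullet> y)" if "y \<in> S" for y
  proof (cases "y = 0")
    case False
    have "y /\<^sub>R norm y \<in> S \<inter> sphere 0 1" using False that S(1) by (simp add: subspace_scale)
    from mx[OF this] have "(T y \<bullet> y) / (norm y)^2 \<le> c"
      by (simp add: c_def linear_scale[OF T] power2_eq_square divide_simps)
    then show ?thesis using False by (simp add: divide_simps power2_norm_eq_inner)
  qed (simp add: linear_0[OF T])
  have xx: "x \<bullet> x = 1" "x \<in> S" using x by (auto simp: norm_eq_1)
  define d where "d = T x - c *\<^sub>R x"
  have d: "d \<in> S" unfolding d_def using xx(2) inv S(1) by (intro subspace_diff subspace_scale)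
  have xd: "x \<bullet> d = 0" by (simp add: d_def inner_diff_right c_def xx inner_commute)
  have Txd: "T x \<bullet> d = d \<bullet> d"
  proof -
    have "T x = d + c *\<^sub>R x" by (simp add: d_def)
    then show ?thesis using xd by (simp add: inner_add_left)
  qed
  have *: "2 * t * (d \<bullet> d) \<le> t^2 * (c * (d \<bullet> d) - T d \<bullet> d)" for t
  proof -
    have "x + t *\<^sub>R d \<in> S" using xx(2) d S(1) by (intro subspace_add subspace_scale)
    from q[OF this] have "T x \<bullet> x + 2 * t * (T x \<bullet> d) + t^2 * (T d \<bullet> d) \<le> c * (1 + t^2 * (d \<bullet> d))"
      using xd sym[OF xx(2) d] xx(1)
      by (simp add: linear_add[OF T] linear_scale[OF T] inner_add_left inner_add_right inner_commute power2_eq_square algebra_simps)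
    then show ?thesis unfolding Txd c_def[symmetric] by (simp add: algebra_simps)
  qed
  have "d = 0"
  proof (rule ccontr)
    assume "d \<noteq> 0"
    then have dd: "d \<bullet> d > 0" by simp
    \<comment> \<open>\<open>M\<close> exceeds the coefficient of t^2 in the preceding inequality.
      With t = (d \<bullet> d) / M that inequality becomes 2 <= 1 after division by a positive
      number.\<close>
    define M where "M = \<bar>c * (d \<bullet> d) - T d \<bullet> d\<bar> + 1"
    have M: "M > 0" by (simp add: M_def)
    have "2 * (d \<bullet> d / M) * (d \<bullet> d) \<le> (d \<bullet> d / M)^2 * (c * (d \<bullet> d) - T d \<bullet> d)" by (rule *)
    also have "\<dots> \<le> (d \<bullet> d / M)^2 * M" by (intro mult_left_mono) (auto simp: M_def)
    finally have "2 * (d \<bullet> d)^2 / M \<le> (d \<bullet> d)^2 / M" using M by (simp add: power2_eq_square)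
    then show False using dd M by (simp add: divide_simps)
  qed
  moreover have "x \<noteq> 0" using xx(1) by auto
  ultimately show ?thesis using that[of x c] xx by (auto simp: d_def)
qed

text \<open>An eigenvector x of the symmetric map T^2 spans with T x an invariant plane. Its
  orthogonal complement in \<open>S\<close> is again invariant, and induction removes two dimensions
  at a time.\<close>

lemma skew_inj_even_dim:
  fixes T :: "'v::euclidean_space => 'v"
  assumes T: "linear T" and skew: "\<And>x y. T x \<bullet> y = - (x \<bullet> T y)"
    and "subspace S" "\<And>x. x \<in> S ==> T x \<in> S" "\<And>x. x \<in> S ==> T x = 0 ==> x = 0"
  shows "even (dim S)"
  using assms(3-)
proof (induction "dim S" arbitrary: S rule: less_induct)
  case less
  show ?case
  proof (cases "S = {0}")
    case False
    have "linear (T \<circ> T)" using T by (intro linear_compose)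
    then obtain x c where x: "x \<in> S" "x \<noteq> 0" "T (T x) = c *\<^sub>R x"
    proof (rule symmetric_eigenvector[of "T \<circ> T" S])
      show "(T \<circ> T) a \<bullet> b = a \<bullet> (T \<circ> T) b" for a b
        using skew[of "T a" b] skew[of a "T b"] by simp
    qed (use less.prems False in auto)
    have Tx: "T x \<noteq> 0" "x \<bullet> T x = 0" using less.prems(3) x skew[of x x] by (auto simp: inner_commute[of "T x"])
    have "x \<noteq> T x" using Tx x by auto
    have ind: "independent {x, T x}"
      using Tx x by (intro pairwise_orthogonal_independent) (auto simp: pairwise_def orthogonal_def inner_commute)
    have d2: "dim (span {x, T x}) = 2"
      using dim_eq_card_independent[OF ind] \<open>x \<noteq> T x\<close> by (simp add: dim_span)
    define S' where "S' = {y \<in> S. \<forall>z \<in> span {x, T x}. orthogonal z y}"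
    have sp: "span {x, T x} \<subseteq> S" using x less.prems by (intro span_minimal) auto
    have dS: "dim S' + 2 = dim S"
      using dim_subspace_orthogonal_to_vectors[OF subspace_span less.prems(1) sp] d2 by (simp add: S'_def)
    have S'_iff: "y \<in> S' \<longleftrightarrow> y \<in> S \<and> x \<bullet> y = 0 \<and> T x \<bullet> y = 0" for y
    proof
      assume r: "y \<in> S \<and> x \<bullet> y = 0 \<and> T x \<bullet> y = 0"
      have "orthogonal y z" if "z \<in> span {x, T x}" for z
        by (rule orthogonal_to_span[OF that]) (use r in \<open>auto simp: orthogonal_def inner_commute\<close>)
      then show "y \<in> S'" using r by (auto simp: S'_def orthogonal_commute)
    qed (auto simp: S'_def orthogonal_def span_base)
    have S'_eq: "S' = {y \<in> S. x \<bullet> y = 0 \<and> T x \<bullet> y = 0}" using S'_iff by blast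
    have "even (dim S')"
    proof (rule less.hyps)
      show "subspace S'"
        unfolding S'_eq subspace_def using less.prems(1) by (auto simp: subspace_def inner_add_right)
      show "T y \<in> S'" if "y \<in> S'" for y
        using that less.prems(2) skew[of x y] skew[of "T x" y] x(3) unfolding S'_iff by auto
    qed (use dS less.prems(3) in \<open>auto simp: S'_def\<close>)
    then show ?thesis using dS by (metis even_add even_numeral)
  qed auto
qed

lemma dim_independent_sum:
  fixes S :: "nat => 'v::euclidean_space set"
  assumes sub: "\<And>i. i < L ==> subspace (S i)"
    and ind: "\<And>u. (\<forall>i<L. u i \<in> S i) ==> (\<Sum>i<L. u i) = 0 ==> \<forall>i<L. u i = 0"
  shows "dim {w. \<exists>u. (\<forall>i<L. u i \<in> S i) \<and> w = (\<Sum>i<L. u i)} = (\<Sum>i<L. dim (S i))"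
proof -
  define P where "P = (\<lambda>l. {w. \<exists>u. (\<forall>i<l. u i \<in> S i) \<and> w = (\<Sum>i<l. u i)})"
  have "subspace (P l) \<and> dim (P l) = (\<Sum>i<l. dim (S i))" if "l \<le> L" for l
    using that
  proof (induction l)
    case 0
    then show ?case by (auto simp: P_def subspace_def)
  next
    case (Suc l)
    then have IH: "subspace (P l)" "dim (P l) = (\<Sum>i<l. dim (S i))" and l: "l < L" by auto
    have P_Suc: "P (Suc l) = {x + y |x y. x \<in> P l \<and> y \<in> S l}"
    proof safe
      fix w assume "w \<in> P (Suc l)"
      then obtain u where u: "\<forall>i<Suc l. u i \<in> S i" "w = (\<Sum>i<Suc l. u i)" by (auto simp: P_def)
      then show "\<exists>x y. w = x + y \<and> x \<in> P l \<and> y \<in> S l"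
        unfolding P_def by (intro exI[of _ "\<Sum>i<l. u i"] exI[of _ "u l"]) (auto intro!: exI[of _ u])
    next
      fix x y assume "x \<in> P l" "y \<in> S l"
      then obtain u where u: "\<forall>i<l. u i \<in> S i" "x = (\<Sum>i<l. u i)" by (auto simp: P_def)
      have "x + y = (\<Sum>i<Suc l. (u(l := y)) i)" using u(2) by simp
      moreover have "\<forall>i<Suc l. (u(l := y)) i \<in> S i" using u(1) \<open>y \<in> S l\<close> by (auto simp: less_Suc_eq)
      ultimately show "x + y \<in> P (Suc l)" unfolding P_def by blast
    qed
    have "P l \<inter> S l = {0}"
    proof
      show "P l \<inter> S l \<subseteq> {0}"
      proof
        fix w assume w: "w \<in> P l \<inter> S l"
        then obtain u where u: "\<forall>i<l. u i \<in> S i" "w = (\<Sum>i<l. u i)" by (auto simp: P_def)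
        define u' where "u' = (\<lambda>i. if i < l then u i else if i = l then - w else 0)"
        have "\<forall>i<L. u' i \<in> S i"
          using u(1) w sub l by (auto simp: u'_def intro: subspace_neg subspace_0)
        moreover have "(\<Sum>i<L. u' i) = 0"
        proof -
          have "(\<Sum>i<L. u' i) = (\<Sum>i<Suc l. u' i)"
            using l by (intro sum.mono_neutral_right) (auto simp: u'_def)
          also have "\<dots> = 0" using u(2) by (simp add: u'_def)
          finally show ?thesis .
        qed
        ultimately have "u' l = 0" using ind l by blast
        then show "w \<in> {0}" by (simp add: u'_def)
      qed
      show "{0} \<subseteq> P l \<inter> S l" using subspace_0[OF IH(1)] subspace_0[OF sub[OF l]] by simp
    qed
    then have "dim (P (Suc l)) = dim (P l) + dim (S l)"
      using dim_sums_Int[OF IH(1) sub[OF l]] unfolding P_Suc by simp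
    moreover have "subspace (P (Suc l))"
      unfolding P_Suc using subspace_sums[OF IH(1) sub[OF l]] .
    ultimately show ?case using IH(2) by simp
  qed
  then show ?thesis unfolding P_def by blast
qed

text \<open>The unit quaternion of the rotation by \<open>t\<close> about \<open>u\<close>; half
  angles make its action the flow of \<open>D u\<close> at unit speed.\<close>

definition turn :: "real => real^3 => quat" where
  "turn t u = (cos (t/2), sin (t/2) *\<^sub>R u)"

lemma norm_turn [simp]: "norm u = 1 ==> norm (turn t u) = 1"
  by (simp add: turn_def norm_quat norm_eq_1 power2_eq_square[symmetric])

lemma turn_0 [simp]: "turn 0 u = (1, 0)" by (simp add: turn_def)

lemma qmul_turn: "norm u = 1 ==> qmul (turn s u) (turn t u) = turn (s + t) u"
  by (simp add: turn_def qmul_def cross_mult_left cross_mult_right cross_refl norm_eq_1 add_divide_distrib cos_add sin_add algebra_simps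
      flip: scaleR_add_left)

lemma turn_arccos:
  assumes "norm p = 1"
  obtains u where "norm u = 1" "p = turn (2 * arccos (fst p)) u"
proof -
  have p: "fst p ^ 2 + (norm (snd p))^2 = 1" using assms by (simp add: norm_quat power2_norm_eq_inner)
  then have "\<bar>fst p\<bar> \<le> 1" by (metis abs_square_le_1 le_add_same_cancel1 zero_le_power2)
  moreover have "sqrt (1 - (fst p)^2) = norm (snd p)"
    using p by (intro real_sqrt_unique) auto
  ultimately have t: "fst p = cos (arccos (fst p))" "norm (snd p) = sin (arccos (fst p))"
    by (auto simp: sin_arccos_abs)
  show thesis
  proof (cases "snd p = 0")
    case True
    then show ?thesis using t that[of "e3"] by (auto simp: turn_def prod_eq_iff)
  next
    case False
    have "p = turn (2 * arccos (fst p)) (snd p /\<^sub>R norm (snd p))"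
      using False t(1) by (simp add: turn_def prod_eq_iff flip: t(2))
    then show ?thesis using False by (intro that[of "snd p /\<^sub>R norm (snd p)"]) auto
  qed
qed

lemma ex_turn:
  assumes "norm p = 1"
  obtains t u where "norm u = 1" "p = turn t u"
  using turn_arccos[OF assms] by metis

lemma near_one_turn:
  assumes "\<tau> > 0"
  obtains \<delta> where "\<delta> > 0" "\<And>p. norm p = 1 ==> dist p (1, 0) < \<delta> ==> \<exists>u t. norm u = 1 \<and> \<bar>t\<bar> < \<tau> \<and> p = turn t u"
proof -
  obtain \<delta> where \<delta>: "\<delta> > 0" "\<And>x. x \<in> {-1..1} ==> dist x 1 < \<delta> ==> dist (arccos x) (arccos 1) < \<tau> / 2"
    using continuous_on_arccos' assms unfolding continuous_on_iff by (metis atLeastAtMost_iff half_gt_zero neg_le_iff_le order_refl zero_le_one le_minus_one_simps(2))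
  show thesis
  proof (rule that[OF \<delta>(1)])
    fix p :: quat assume p: "norm p = 1" "dist p (1, 0) < \<delta>"
    obtain u where u: "norm u = 1" "p = turn (2 * arccos (fst p)) u" using turn_arccos[OF p(1)] .
    have "\<bar>fst p\<bar> \<le> 1" using norm_fst_le[of "fst p" "snd p"] p(1) by simp
    moreover have "dist (fst p) 1 < \<delta>" using dist_fst_le[of p "(1,0)"] p(2) by simp
    ultimately have "dist (arccos (fst p)) (arccos 1) < \<tau> / 2" by (intro \<delta>(2)) auto
    then have "\<bar>2 * arccos (fst p)\<bar> < \<tau>" by (simp add: dist_real_def)
    then show "\<exists>u t. norm u = 1 \<and> \<bar>t\<bar> < \<tau> \<and> p = turn t u" using u by blast
  qed
qed

locale su2_rep = quat_action act Z for act :: "quat => 'v::euclidean_space => 'v" and Z +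
  fixes D :: "real^3 => 'v => 'v"
  assumes bilinear_D: "bilinear D"
    and D_skew: "D x v \<bullet> w = - (v \<bullet> D x w)"
    and D_bracket: "D x (D y v) - D y (D x v) = D (x \<times> y) v"
    and act_D: "norm p = 1 ==> act p (D y v) = D (qrot p y) (act p v)"
    and Z_D: "z \<in> Z ==> z (D y v) = D y (z v)"
    and linear_act: "norm p = 1 ==> linear (act p)"
    and linear_Z: "z \<in> Z ==> linear z"
    and flow_0: "norm u = 1 ==> ((\<lambda>t. act (turn t u) v) has_vector_derivative D u v) (at 0)"
begin

lemma linear_D: "linear (D x)" and linear_D_left: "linear (\<lambda>x. D x v)"
  using bilinear_D by (auto simp: bilinear_def)

lemmas D_right = linear_add[OF linear_D] linear_diff[OF linear_D] linear_scale[OF linear_D] linear_0[OF linear_D] linear_neg[OF linear_D]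
lemmas D_left = linear_add[OF linear_D_left] linear_diff[OF linear_D_left] linear_scale[OF linear_D_left] linear_0[OF linear_D_left] linear_neg[OF linear_D_left]

lemma bounded_bilinear_D: "bounded_bilinear D"
  using bilinear_D by (simp add: bilinear_conv_bounded_bilinear)

lemma D_orthogonal: "D x v \<bullet> v = 0"
  using D_skew[of x v v] by (simp add: inner_commute)

lemma flow:
  assumes "norm u = 1"
  shows "((\<lambda>t. act (turn t u) v) has_vector_derivative D u (act (turn t u) v)) (at t)"
proof -
  have "((\<lambda>s. act (turn s u) (act (turn t u) v)) has_vector_derivative D u (act (turn t u) v)) (at (t - t))"
    using flow_0[OF assms] by simp
  then have "((\<lambda>s. act (turn s u) (act (turn t u) v)) \<circ> (\<lambda>s. s - t) has_vector_derivative 1 *\<^sub>R D u (act (turn t u) v)) (at t)"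
    by (intro vector_diff_chain_at) (auto intro!: derivative_eq_intros)
  moreover have "(\<lambda>s. act (turn s u) (act (turn t u) v)) \<circ> (\<lambda>s. s - t) = (\<lambda>s. act (turn s u) v)"
    using assms by (auto simp: fun_eq_iff act_qmul[symmetric] qmul_turn)
  ultimately show ?thesis by simp
qed

lemma act_turn_fixed:
  assumes "norm u = 1" "D u v = 0"
  shows "act (turn t u) v = v"
proof -
  have 0: "D u (act (turn s u) v) = 0" for s
  proof -
    have "qrot (turn s u) u = u"
      using assms(1) by (simp add: turn_def qrot_half_angle rodrigues_def cross_refl norm_eq_1 flip: scaleR_add_left)
    then show ?thesis using act_D[of "turn s u" u v] assms by (simp add: linear_0[OF linear_act])
  qed
  have "((\<lambda>s. act (turn s u) v) has_vector_derivative 0) (at s)" for s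
    using flow[OF assms(1), of v s] by (simp only: 0)
  then obtain c where c: "\<And>s. act (turn s u) v = c"
    using has_vector_derivative_zero_constant[OF convex_UNIV, of "\<lambda>s. act (turn s u) v"] by auto
  have "c = v" using c[of 0] by simp
  then show ?thesis by (simp add: c)
qed

definition E where "E = (\<lambda>i::3. D (axis i 1))"

lemma cross_axes: "axis 1 1 \<times> axis 2 1 = (axis 3 1 :: real^3)" "axis 2 1 \<times> axis 3 1 = (axis 1 1 :: real^3)"
  "axis 3 1 \<times> axis 1 1 = (axis 2 1 :: real^3)"
  by (simp_all add: vec3_simps axis_def)

lemma linear_E: "linear (E i)" unfolding E_def by (rule linear_D)
lemmas E_lin = linear_add[OF linear_E] linear_diff[OF linear_E] linear_scale[OF linear_E] linear_0[OF linear_E] linear_neg[OF linear_E]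

lemma E_skew: "E i v \<bullet> w = - (v \<bullet> E i w)" unfolding E_def by (rule D_skew)

lemma E_bracket: "E 1 (E 2 v) = E 2 (E 1 v) + E 3 v" "E 2 (E 3 v) = E 3 (E 2 v) + E 1 v" "E 3 (E 1 v) = E 1 (E 3 v) + E 2 v"
  using D_bracket[of "axis 1 1" "axis 2 1" v] D_bracket[of "axis 2 1" "axis 3 1" v] D_bracket[of "axis 3 1" "axis 1 1" v]
  unfolding cross_axes E_def by (metis diff_eq_eq add.commute)+

lemma D_E: "D x v = x $ 1 *\<^sub>R E 1 v + x $ 2 *\<^sub>R E 2 v + x $ 3 *\<^sub>R E 3 v"
proof -
  have *: "x = x $ 1 *\<^sub>R axis 1 1 + x $ 2 *\<^sub>R axis 2 1 + x $ 3 *\<^sub>R axis 3 1"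
    by (simp add: vec_eq_iff forall_3 axis_def)
  have "D x v = D (x $ 1 *\<^sub>R axis 1 1 + x $ 2 *\<^sub>R axis 2 1 + x $ 3 *\<^sub>R axis 3 1) v"
    by (rule arg_cong[OF *])
  also have "\<dots> = x $ 1 *\<^sub>R E 1 v + x $ 2 *\<^sub>R E 2 v + x $ 3 *\<^sub>R E 3 v"
    by (simp only: E_def D_left)
  finally show ?thesis .
qed

definition casimir where "casimir v = E 1 (E 1 v) + E 2 (E 2 v) + E 3 (E 3 v)"

lemma linear_casimir: "linear casimir"
  by (rule linearI) (simp_all add: casimir_def E_lin algebra_simps)

lemma casimir_E: "casimir (E i v) = E i (casimir v)"
proof -
  have "casimir (E 1 v) = E 1 (casimir v)" "casimir (E 2 v) = E 2 (casimir v)" "casimir (E 3 v) = E 3 (casimir v)"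
    unfolding casimir_def by (simp_all add: E_lin E_bracket algebra_simps)
  then show ?thesis using exhaust_3[of i] by auto
qed

definition invariant where "invariant W \<longleftrightarrow> subspace W \<and> (\<forall>x. \<forall>w\<in>W. D x w \<in> W)"

lemma invariantI: "subspace W ==> (\<And>i w. w \<in> W ==> E i w \<in> W) ==> invariant W"

proof -
  assume W: "subspace W" and E: "\<And>i w. w \<in> W ==> E i w \<in> W"
  have "D x w \<in> W" if "w \<in> W" for x w
    by (subst D_E) (intro subspace_add subspace_scale W E that)
  then show ?thesis using W by (simp add: invariant_def)
qed

lemma E_invariant: "invariant W ==> w \<in> W ==> E i w \<in> W"
  by (simp add: invariant_def E_def)

text \<open>The Casimir operator is scalar on \<open>W\<close>, so a vector \<open>v\<close> of
  weight 0 and what is raised from it span an invariant subspace, which is all of \<open>W\<close>.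
  Raised vectors lie in the image of \<open>E 3\<close>; hence, up to multiples of \<open>v\<close>,
  a kernel vector lies in that image, and a skew map is injective on its image.\<close>

lemma irreducible_kernel:
  assumes W: "invariant W" "W \<noteq> {0}" and irr: "\<And>U. invariant U ==> U \<subseteq> W ==> U = {0} \<or> U = W"
    and v: "v \<in> W" "v \<noteq> 0" "E 3 v = 0"
  shows "W \<inter> {u. E 3 u = 0} \<subseteq> span {v}"
proof -
  have subW: "subspace W" using W(1) by (simp add: invariant_def)
  have cW: "casimir x \<in> W" if "x \<in> W" for x
    unfolding casimir_def using that subW E_invariant[OF W(1)] by (intro subspace_add) auto
  have "casimir x \<bullet> y = x \<bullet> casimir y" for x y
    by (simp add: casimir_def inner_add_left inner_add_right E_skew)
  then obtain x0 c where x0: "x0 \<in> W" "x0 \<noteq> 0" "casimir x0 = c *\<^sub>R x0"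
    using symmetric_eigenvector[OF linear_casimir subW W(2) cW] by blast
  define U where "U = {x \<in> W. casimir x = c *\<^sub>R x}"
  have "invariant U"
  proof (rule invariantI)
    show "subspace U"
      using subW linear_casimir unfolding U_def subspace_def
      by (auto simp: linear_0 linear_add linear_scale scaleR_add_right)
    show "E i w \<in> U" if "w \<in> U" for i w
      using that E_invariant[OF W(1)] by (auto simp: U_def casimir_E E_lin)
  qed
  then have "U = W" using irr[of U] x0 by (auto simp: U_def)
  then have cas: "casimir x = c *\<^sub>R x" if "x \<in> W" for x using that by (auto simp: U_def)
  (* x_k = a_k + i b_k = (E1 + i E2)^k v is an eigenvector of E3 with eigenvalue -i k. *)
  define ab where "ab = rec_nat (v, 0) (\<lambda>k (a, b). (E 1 a - E 2 b, E 1 b + E 2 a))"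
  define a where "a = (\<lambda>k. fst (ab k))"
  define b where "b = (\<lambda>k. snd (ab k))"
  have a0: "a 0 = v" "b 0 = 0" by (simp_all add: a_def b_def ab_def)
  have aS: "a (Suc k) = E 1 (a k) - E 2 (b k)" "b (Suc k) = E 1 (b k) + E 2 (a k)" for k
    by (simp_all add: a_def b_def ab_def split: prod.split)
  have abW: "a k \<in> W \<and> b k \<in> W" for k
    by (induction k) (auto simp: a0 aS v subspace_0[OF subW] intro!: subspace_add[OF subW] subspace_diff[OF subW] E_invariant[OF W(1)])
  have E3: "E 3 (a k) = real k *\<^sub>R b k \<and> E 3 (b k) = - real k *\<^sub>R a k" for k
  proof (induction k)
    case (Suc k)
    have "E 3 (a (Suc k)) = E 1 (E 3 (a k)) + E 2 (a k) - (E 2 (E 3 (b k)) - E 1 (b k))"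
      by (simp add: aS E_lin E_bracket(2,3))
    also have "\<dots> = real (Suc k) *\<^sub>R b (Suc k)" using Suc by (simp add: aS E_lin algebra_simps)
    finally have 1: "E 3 (a (Suc k)) = real (Suc k) *\<^sub>R b (Suc k)" .
    have "E 3 (b (Suc k)) = E 1 (E 3 (b k)) + E 2 (b k) + (E 2 (E 3 (a k)) - E 1 (a k))"
      by (simp add: aS E_lin E_bracket(2,3))
    also have "\<dots> = - real (Suc k) *\<^sub>R a (Suc k)" using Suc by (simp add: aS E_lin algebra_simps)
    finally show ?case using 1 by blast
  qed (simp add: a0 v E_lin)
  \<comment> \<open>Lowering undoes raising up to this scalar, computed from the Casimir eigenvalue
    \<open>c\<close> and the weight \<open>k\<close>. The two equations of \<open>low\<close> are
    the real and imaginary parts.\<close>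
  define m where "m = (\<lambda>k. c + real k * real k + real k)"
  have low: "E 1 (a (Suc k)) + E 2 (b (Suc k)) = m k *\<^sub>R a k \<and> E 1 (b (Suc k)) - E 2 (a (Suc k)) = m k *\<^sub>R b k" for k
  proof -
    have ca: "E 1 (E 1 (a k)) + E 2 (E 2 (a k)) = (c + real k * real k) *\<^sub>R a k"
      using cas[of "a k"] abW[of k] E3[of k] by (simp add: casimir_def E_lin algebra_simps)
    have cb: "E 1 (E 1 (b k)) + E 2 (E 2 (b k)) = (c + real k * real k) *\<^sub>R b k"
      using cas[of "b k"] abW[of k] E3[of k] by (simp add: casimir_def E_lin algebra_simps)
    have "E 1 (a (Suc k)) + E 2 (b (Suc k)) = (E 1 (E 1 (a k)) + E 2 (E 2 (a k))) - E 3 (b k)"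
      by (simp add: aS E_lin E_bracket(1) algebra_simps)
    moreover have "E 1 (b (Suc k)) - E 2 (a (Suc k)) = (E 1 (E 1 (b k)) + E 2 (E 2 (b k))) + E 3 (a k)"
      by (simp add: aS E_lin E_bracket(1) algebra_simps)
    ultimately show ?thesis using ca cb E3[of k] by (simp add: m_def algebra_simps)
  qed
  define T where "T = span (\<Union>k. {a k, b k})"
  have abT: "a k \<in> T" "b k \<in> T" for k unfolding T_def by (auto intro!: span_base)
  have subT: "subspace T" by (simp add: T_def)
  have gen: "E i (a k) \<in> T \<and> E i (b k) \<in> T" for i k
  proof -
    have 3: "E 3 (a k) \<in> T" "E 3 (b k) \<in> T" using E3[of k] abT subspace_scale[OF subT] subspace_neg[OF subT] by auto
    have 12: "E 1 (a k) \<in> T \<and> E 1 (b k) \<in> T \<and> E 2 (a k) \<in> T \<and> E 2 (b k) \<in> T"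
    proof (cases k)
      case 0
      have "E 1 (a 0) = a 1" "E 2 (a 0) = b 1" using aS[of 0] by (simp_all add: a0 E_lin)
      then show ?thesis using 0 abT[of 1] subspace_0[OF subT] by (simp add: a0 E_lin)
    next
      case (Suc j)
      have half: "x \<in> T" if "x + x \<in> T" for x
        using subspace_scale[OF subT that, of "1/2"] by (simp add: scaleR_2[symmetric])
      have l: "m j *\<^sub>R a j = E 1 (a k) + E 2 (b k)" "m j *\<^sub>R b j = E 1 (b k) - E 2 (a k)"
        using low[of j] unfolding Suc by auto
      have "E 1 (a k) + E 1 (a k) = m j *\<^sub>R a j + a (Suc k)" "E 1 (b k) + E 1 (b k) = m j *\<^sub>R b j + b (Suc k)"
        "E 2 (a k) + E 2 (a k) = b (Suc k) - m j *\<^sub>R b j" "E 2 (b k) + E 2 (b k) = m j *\<^sub>R a j - a (Suc k)"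
        unfolding aS[of k] l by (simp_all only: algebra_simps)
      note eq = this
      show ?thesis
        by (intro conjI; rule half) (simp_all only: eq, simp_all add: abT subT subspace_add subspace_diff subspace_scale)
    qed
    show ?thesis using 3 12 exhaust_3[of i] by auto
  qed
  have "invariant T"
  proof (rule invariantI[OF subT])
    fix i w assume w: "w \<in> T"
    have "T \<subseteq> {w. E i w \<in> T}"
      unfolding T_def
    proof (rule span_minimal)
      show "(\<Union>k. {a k, b k}) \<subseteq> {w. E i w \<in> span (\<Union>k. {a k, b k})}"
        using gen[of i] unfolding T_def by blast
      show "subspace {w. E i w \<in> span (\<Union>k. {a k, b k})}"
        by (auto simp: subspace_def E_lin intro: span_add span_scale span_zero)
    qed
    then show "E i w \<in> T" using w by blast
  qed
  moreover have "T \<subseteq> W" unfolding T_def using abW by (intro span_minimal subW) auto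
  moreover have "v \<in> T" using abT(1)[of 0] a0 by simp
  ultimately have TW: "T = W" using irr v(2) by blast
  \<comment> \<open>For positive \<open>k\<close> the real and imaginary parts are themselves values
    of \<open>E 3\<close>, since the weight can be divided out; only k = 0 contributes
    \<open>v\<close>.\<close>
  have Tim: "T \<subseteq> {s *\<^sub>R v + E 3 y |s y. True}"
    unfolding T_def
  proof (rule span_minimal)
    show "(\<Union>k. {a k, b k}) \<subseteq> {s *\<^sub>R v + E 3 y |s y. True}"
    proof safe
      fix k
      show "\<exists>s y. a k = s *\<^sub>R v + E 3 y \<and> True"
      proof (cases "k = 0")
        case True then show ?thesis using a0 by (intro exI[of _ 1] exI[of _ 0]) (simp add: E_lin)
      next
        case False then show ?thesis using E3[of k] by (intro exI[of _ 0] exI[of _ "(-1 / real k) *\<^sub>R b k"]) (simp add: E_lin)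
      qed
      show "\<exists>s y. b k = s *\<^sub>R v + E 3 y \<and> True"
      proof (cases "k = 0")
        case True then show ?thesis using a0 by (intro exI[of _ 0] exI[of _ 0]) (simp add: E_lin)
      next
        case False then show ?thesis using E3[of k] by (intro exI[of _ 0] exI[of _ "(1 / real k) *\<^sub>R a k"]) (simp add: E_lin)
      qed
    qed
    show "subspace {s *\<^sub>R v + E 3 y |s y. True}"
    proof (rule subspaceI)
      show "0 \<in> {s *\<^sub>R v + E 3 y |s y. True}" by (auto intro!: exI[of _ 0] simp: E_lin)
      show "x + x' \<in> {s *\<^sub>R v + E 3 y |s y. True}" if x: "x \<in> {s *\<^sub>R v + E 3 y |s y. True}" "x' \<in> {s *\<^sub>R v + E 3 y |s y. True}" for x x'
      proof -
        obtain s y s' y' where "x = s *\<^sub>R v + E 3 y" "x' = s' *\<^sub>R v + E 3 y'" using x by blast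
        then have "x + x' = (s + s') *\<^sub>R v + E 3 (y + y')" by (simp add: E_lin algebra_simps)
        then show ?thesis by blast
      qed
      show "r *\<^sub>R x \<in> {s *\<^sub>R v + E 3 y |s y. True}" if x: "x \<in> {s *\<^sub>R v + E 3 y |s y. True}" for x r
      proof -
        obtain s y where "x = s *\<^sub>R v + E 3 y" using x by blast
        then have "r *\<^sub>R x = (r * s) *\<^sub>R v + E 3 (r *\<^sub>R y)" by (simp add: E_lin algebra_simps)
        then show ?thesis by blast
      qed
    qed
  qed
  show ?thesis
  proof
    fix u assume u: "u \<in> W \<inter> {u. E 3 u = 0}"
    then obtain s y where uy: "u = s *\<^sub>R v + E 3 y" using Tim TW by blast
    then have "E 3 (E 3 y) = 0" using u v(3) by (simp add: E_lin)
    then have "E 3 y \<bullet> E 3 y = 0" using E_skew[of 3 y "E 3 y"] by simp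
    then show "u \<in> span {v}" using uy by (simp add: span_base span_scale)
  qed
qed

text \<open>On the orthogonal complement of the kernel \<open>E 3\<close> is skew and injective, so
  that complement has even dimension, while the kernel has dimension at most 1. Parity then decides
  between 0 and 1.\<close>

lemma irreducible_dim_kernel:
  assumes W: "invariant W" "W \<noteq> {0}" and irr: "\<And>U. invariant U ==> U \<subseteq> W ==> U = {0} \<or> U = W"
  shows "dim (W \<inter> {u. E 3 u = 0}) + 2 * (dim W div 2) = dim W"
proof -
  let ?K = "W \<inter> {u. E 3 u = 0}"
  have subW: "subspace W" using W(1) by (simp add: invariant_def)
  have subK: "subspace ?K"
    using subW by (auto simp: subspace_def E_lin)
  define S where "S = {y \<in> W. \<forall>x\<in>?K. orthogonal x y}"
  have dS: "dim S + dim ?K = dim W"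
    unfolding S_def by (rule dim_subspace_orthogonal_to_vectors[OF subK subW]) auto
  have "even (dim S)"
  proof (rule skew_inj_even_dim[OF linear_E E_skew])
    show "subspace S"
      using subW by (auto simp: S_def subspace_def orthogonal_def inner_add_right)
    show "E 3 y \<in> S" if "y \<in> S" for y
      using that E_invariant[OF W(1)] E_skew[of 3 _ y] by (force simp: S_def orthogonal_def)
    show "y = 0" if "y \<in> S" "E 3 y = 0" for y
    proof -
      have "y \<in> ?K" using that by (simp add: S_def)
      then have "orthogonal y y" using that(1) unfolding S_def by blast
      then show ?thesis by (simp add: orthogonal_def)
    qed
  qed
  moreover have "dim ?K \<le> 1"
  proof (cases "?K = {0}")
    case False
    then obtain v where v: "v \<in> W" "v \<noteq> 0" "E 3 v = 0" using subspace_0[OF subK] by blast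
    have "dim ?K \<le> dim {v}"
      using dim_mono[OF irreducible_kernel[OF W irr v]] by simp
    also have "\<dots> \<le> 1" using dim_le_card[of "{v}" "{v}"] by (simp add: span_base)
    finally show ?thesis .
  qed simp
  ultimately show ?thesis using dS by presburger
qed

text \<open>The zero weight space of the torus with axis \<open>e3\<close>. By
  \<open>singular_imp_ker\<close>, every point killed by a nonzero Lie algebra element can be turned
  into it.\<close>

definition ker where "ker = {u. D e3 u = 0}"

lemma ker_E: "ker = {u. E 3 u = 0}" by (simp add: ker_def E_def)

lemma subspace_ker: "subspace ker"
  by (auto simp: ker_def subspace_def D_right)

lemma dim_ker:
  fixes W :: "nat => 'v set"
  assumes sub: "\<And>i. i < L ==> invariant (W i)" "\<And>i. i < L ==> W i \<noteq> {0}"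
    and irr: "\<And>i U. i < L ==> invariant U ==> U \<subseteq> W i ==> U = {0} \<or> U = W i"
    and ind: "\<And>u. (\<forall>i<L. u i \<in> W i) ==> (\<Sum>i<L. u i) = 0 ==> \<forall>i<L. u i = 0"
    and surj: "\<And>w. \<exists>u. (\<forall>i<L. u i \<in> W i) \<and> w = (\<Sum>i<L. u i)"
  shows "dim ker + 2 * (\<Sum>i<L. dim (W i) div 2) = DIM('v)"
proof -
  have subW: "subspace (W i)" if "i < L" for i using sub(1)[OF that] by (simp add: invariant_def)
  have "dim {w. \<exists>u. (\<forall>i<L. u i \<in> W i) \<and> w = (\<Sum>i<L. u i)} = (\<Sum>i<L. dim (W i))"
    by (rule dim_independent_sum) (use subW ind in blast)+
  moreover have "{w. \<exists>u. (\<forall>i<L. u i \<in> W i) \<and> w = (\<Sum>i<L. u i)} = UNIV" using surj by blast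
  ultimately have W: "(\<Sum>i<L. dim (W i)) = DIM('v)" by (simp add: dim_UNIV)
  have E_sum: "E 3 (\<Sum>i<L. u i) = (\<Sum>i<L. E 3 (u i))" for u by (rule linear_sum[OF linear_E])
  have "ker = {w. \<exists>u. (\<forall>i<L. u i \<in> W i \<inter> {u. E 3 u = 0}) \<and> w = (\<Sum>i<L. u i)}"
  proof safe
    fix w assume w: "w \<in> ker"
    obtain u where u: "\<forall>i<L. u i \<in> W i" "w = (\<Sum>i<L. u i)" using surj by blast
    have "\<forall>i<L. E 3 (u i) = 0"
      using w u E_invariant[OF sub(1)] unfolding ker_E u(2)
      by (intro ind) (auto simp: E_sum)
    then show "\<exists>u. (\<forall>i<L. u i \<in> W i \<inter> {u. E 3 u = 0}) \<and> w = (\<Sum>i<L. u i)" using u by auto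
  next
    fix u assume "\<forall>i<L. u i \<in> W i \<inter> {u. E 3 u = 0}"
    then show "(\<Sum>i<L. u i) \<in> ker" by (auto simp: ker_E E_sum)
  qed
  moreover have "dim {w. \<exists>u. (\<forall>i<L. u i \<in> W i \<inter> {u. E 3 u = 0}) \<and> w = (\<Sum>i<L. u i)} = (\<Sum>i<L. dim (W i \<inter> {u. E 3 u = 0}))"
    by (rule dim_independent_sum) (use subW ind in \<open>auto simp: subspace_def E_lin\<close>)
  ultimately have "dim ker + 2 * (\<Sum>i<L. dim (W i) div 2) = (\<Sum>i<L. dim (W i \<inter> {u. E 3 u = 0}) + 2 * (dim (W i) div 2))"
    by (simp add: sum.distrib sum_distrib_left)
  also have "\<dots> = (\<Sum>i<L. dim (W i))"
    by (intro sum.cong refl irreducible_dim_kernel) (use sub irr in auto)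
  finally show ?thesis using W by simp
qed

end

unbundle no cross3_syntax

section \<open>Slices\<close>

unbundle cross3_syntax

context su2_rep begin

lemma act_0 [simp]: "norm p = 1 ==> act p 0 = 0" by (simp add: linear_0[OF linear_act])

lemma orthogonal_act: "norm p = 1 ==> orthogonal_transformation (act p)"
  using linear_act[of p] act_dist[of p _ 0] by (simp add: orthogonal_transformation dist_norm)

lemma orthogonal_Z: "z \<in> Z ==> orthogonal_transformation z"
  using linear_Z[of z] dist_Z[of z _ 0] by (simp add: orthogonal_transformation dist_norm linear_0[OF linear_Z])

definition grp where "grp = {act p \<circ> z |p z. norm p = 1 \<and> z \<in> Z}"

lemma orb_grp: "orb v = (\<lambda>g. g v) ` grp"
  unfolding orb_def grp_def by fastforce

lemma grpI: "norm p = 1 ==> z \<in> Z ==> act p \<circ> z \<in> grp" unfolding grp_def by blast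

lemma act_grp: "norm p = 1 ==> act p \<in> grp" using grpI[OF _ id_Z] by simp

lemma grp_orthogonal: assumes "g \<in> grp" shows "orthogonal_transformation g"
proof -
  obtain p z where "g = act p \<circ> z" "norm p = 1" "z \<in> Z" using assms unfolding grp_def by blast
  then show ?thesis using orthogonal_transformation_compose[OF orthogonal_act orthogonal_Z] by simp
qed

lemma grp_linear: "g \<in> grp ==> linear g"
  using grp_orthogonal orthogonal_transformation_linear by blast

lemma grp_norm: "g \<in> grp ==> norm (g x) = norm x"
  using grp_orthogonal by (simp add: orthogonal_transformation)

lemma grp_inner: "g \<in> grp ==> g x \<bullet> g y = x \<bullet> y"
  using grp_orthogonal by (simp add: orthogonal_transformation_def)

lemma grp_comp: assumes "g \<in> grp" "h \<in> grp" shows "g \<circ> h \<in> grp"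
proof -
  obtain p z q w where g: "g = act p \<circ> z" "norm p = 1" "z \<in> Z" and h: "h = act q \<circ> w" "norm q = 1" "w \<in> Z"
    using assms unfolding grp_def by blast
  have "g \<circ> h = act (qmul p q) \<circ> (z \<circ> w)"
    using g h by (auto simp: fun_eq_iff act_qmul Z_act)
  then show ?thesis using grpI[of "qmul p q" "z \<circ> w"] g h by (simp add: norm_qmul comp_Z)
qed

lemma grp_inverse: assumes "g \<in> grp" obtains h where "h \<in> grp" "\<And>x. h (g x) = x" "\<And>x. g (h x) = x"
proof -
  obtain p z where g: "g = act p \<circ> z" "norm p = 1" "z \<in> Z"
    using assms unfolding grp_def by blast
  obtain w where w: "w \<in> Z" "z \<circ> w = id" "w \<circ> z = id" using inverse_Z[OF g(3)] by blast
  have zw: "z (w x) = x" "w (z x) = x" for x using w(2,3) by (auto dest: fun_cong[of _ _ x])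
  show ?thesis
  proof (rule that)
    show "act (qconj p) \<circ> w \<in> grp" using g w by (intro grpI) auto
    show "(act (qconj p) \<circ> w) (g x) = x" for x using g w(1) zw by (simp add: Z_act act_qconj)
    show "g ((act (qconj p) \<circ> w) x) = x" for x using g w(1) zw by (simp add: Z_act act_qconj)
  qed
qed

lemma grp_D: assumes "g \<in> grp" obtains p where "norm p = 1" "\<And>x y. g (D x y) = D (qrot p x) (g y)"
  using assms unfolding grp_def by (auto simp: act_D Z_D)

lemma orb_act: "norm p = 1 ==> act p v \<in> orb v"
  using act_grp unfolding orb_grp by blast

lemma grp_orb: "g \<in> grp ==> g v \<in> orb v" unfolding orb_grp by blast

text \<open>The normal space of the orbit at \<open>v\<close>, as a linear subspace; the affine
  slice is its translate through \<open>v\<close>.\<close>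

definition slice where "slice v = {y. \<forall>x. y \<bullet> D x v = 0}"

lemma sliceI: assumes "\<And>u. norm u = 1 ==> y \<bullet> D u v = 0" shows "y \<in> slice v"
  unfolding slice_def
proof safe
  fix x
  show "y \<bullet> D x v = 0"
  proof (cases "x = 0")
    case False
    then have "x = norm x *\<^sub>R (x /\<^sub>R norm x)" by simp
    then have "y \<bullet> D x v = norm x * (y \<bullet> D (x /\<^sub>R norm x) v)" by (metis D_left(3) inner_scaleR_right)
    then show ?thesis using assms[of "x /\<^sub>R norm x"] False by simp
  qed (simp add: D_left)
qed

lemma subspace_slice: "subspace (slice v)"
  by (auto simp: slice_def subspace_def inner_add_left)

lemma slice_grp: assumes g: "g \<in> grp" and y: "y \<in> slice v" shows "g y \<in> slice (g v)"
proof -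
  obtain p where p: "norm p = 1" "\<And>x y. g (D x y) = D (qrot p x) (g y)" using grp_D[OF g] by blast
  have "g y \<bullet> D x (g v) = 0" for x
  proof -
    have "D x (g v) = g (D (qrot (qconj p) x) v)" by (simp add: p qrot_qconj)
    then show ?thesis using y grp_inner[OF g] by (simp add: slice_def)
  qed
  then show ?thesis by (simp add: slice_def)
qed

text \<open>The set V0: the infinitesimal action at \<open>v\<close> is injective, so stabilizers
  are finite and orbits have dimension 3.\<close>

definition reg where "reg = {v. \<forall>x. x \<noteq> 0 --> D x v \<noteq> 0}"

lemma reg_bound: assumes "v \<in> reg" obtains c where "c > 0" "\<And>x. c * norm x \<le> norm (D x v)"
proof (rule linear_inj_bounded_below_pos[OF linear_D_left])
  show "inj (\<lambda>x. D x v)"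
    using assms by (auto simp: linear_injective_0[OF linear_D_left] reg_def)
qed (use that in blast)

lemma D_bound: obtains B where "B > 0" "\<And>x v. norm (D x v) \<le> B * norm x * norm v"
  using bounded_bilinear.pos_bounded[OF bounded_bilinear_D] by (metis mult.assoc mult.commute)

lemma open_reg: "open reg"
  unfolding open_contains_ball
proof
  fix v assume v: "v \<in> reg"
  obtain c where c: "c > 0" "\<And>x. c * norm x \<le> norm (D x v)" using reg_bound[OF v] by blast
  obtain B where B: "B > 0" "\<And>x v. norm (D x v) \<le> B * norm x * norm v" using D_bound by blast
  have "w \<in> reg" if w: "dist v w < c / B" for w
  proof -
    have "D x w \<noteq> 0" if "x \<noteq> 0" for x
    proof
      assume "D x w = 0"
      then have "D x v = D x (v - w)" by (simp add: D_right)
      then have "c * norm x \<le> B * norm x * norm (v - w)" using c(2)[of x] B(2)[of x "v - w"] by simp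
      then have "c \<le> B * norm (v - w)" using that by (simp add: mult.assoc mult.left_commute)
      then show False using w B(1) by (simp add: dist_norm pos_less_divide_eq mult.commute)
    qed
    then show ?thesis by (simp add: reg_def)
  qed
  then have "ball v (c / B) \<subseteq> reg" by auto
  moreover have "c / B > 0" using c B by simp
  ultimately show "\<exists>e>0. ball v e \<subseteq> reg" by blast
qed

lemma reg_grp: assumes g: "g \<in> grp" and v: "v \<in> reg" shows "g v \<in> reg"
proof -
  obtain p where p: "norm p = 1" "\<And>x y. g (D x y) = D (qrot p x) (g y)" using grp_D[OF g] by blast
  have "D x (g v) \<noteq> 0" if "x \<noteq> 0" for x
  proof
    assume "D x (g v) = 0"
    then have "g (D (qrot (qconj p) x) v) = 0" by (simp add: p qrot_qconj)
    then have "norm (D (qrot (qconj p) x) v) = 0" using grp_norm[OF g] by (metis norm_zero)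
    then have "qrot (qconj p) x = 0" using v by (auto simp: reg_def)
    then have "x = 0" using qrot_qconj(1)[OF p(1), of x] linear_0[OF linear_qrot] by metis
    then show False using that by simp
  qed
  then show ?thesis by (simp add: reg_def)
qed

lemma reg_orb: "v \<in> reg ==> x \<in> orb v ==> x \<in> reg"
  using reg_grp unfolding orb_grp by blast

lemma flow_inner:
  assumes "norm u = 1"
  shows "((\<lambda>t. w \<bullet> act (turn t u) v) has_real_derivative w \<bullet> D u (act (turn t u) v)) (at t)"
  using bounded_linear.has_vector_derivative[OF bounded_linear_inner_right flow[OF assms], of w v t]
  by (simp add: has_real_derivative_iff_has_vector_derivative)

lemma flow_mvt:
  assumes u: "norm u = 1"
  obtains s where "\<bar>s\<bar> \<le> \<bar>t\<bar>" "w \<bullet> act (turn t u) v - w \<bullet> v = t * (w \<bullet> D u (act (turn s u) v))"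
proof -
  let ?f = "\<lambda>t. w \<bullet> act (turn t u) v" and ?f' = "\<lambda>t. w \<bullet> D u (act (turn t u) v)"
  consider "t = 0" | "t > 0" | "t < 0" by linarith
  then show thesis
  proof cases
    case 1 then show ?thesis using that[of 0] by simp
  next
    case 2
    obtain s where "0 < s" "s < t" "?f t - ?f 0 = (t - 0) * ?f' s"
      using MVT2[OF 2, of ?f ?f'] flow_inner[OF u] by blast
    then show ?thesis using that[of s] by simp
  next
    case 3
    obtain s where "t < s" "s < 0" "?f 0 - ?f t = (0 - t) * ?f' s"
      using MVT2[OF 3, of ?f ?f'] flow_inner[OF u] by blast
    then show ?thesis using that[of s] by (simp add: algebra_simps)
  qed
qed

text \<open>The nearest point of the compact orbit has this property: along each one-parameter group
  the distance is least at time 0, so its derivative vanishes there.\<close>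

lemma nbhd_slice:
  assumes "w \<in> nbhd v eta"
  obtains x where "x \<in> orb v" "dist w x < eta" "w - x \<in> slice x"
proof -
  have "orb v \<noteq> {}" using orb_self by blast
  moreover have "continuous_on (orb v) (dist w)" by (intro continuous_intros)
  ultimately obtain x where x: "x \<in> orb v" "\<And>y. y \<in> orb v ==> dist w x \<le> dist w y"
    using continuous_attains_inf[OF compact_orb, of v "dist w"] by blast
  have "(w - x) \<bullet> D u x = 0" if u: "norm u = 1" for u
  proof -
    have "w \<bullet> act (turn t u) x \<le> w \<bullet> x" for t
    proof -
      have p: "norm (turn t u) = 1" using u by simp
      have "act (turn t u) x \<in> orb v" using orb_act[OF p, of x] orb_eq[OF x(1)] by simp
      from x(2)[OF this] have "(norm (w - x))^2 \<le> (norm (w - act (turn t u) x))^2"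
        by (simp add: dist_norm)
      moreover have "norm (act (turn t u) x) = norm x" using grp_norm[OF act_grp[OF p]] .
      then have "act (turn t u) x \<bullet> act (turn t u) x = x \<bullet> x" by (simp flip: power2_norm_eq_inner)
      ultimately show ?thesis by (simp add: power2_norm_eq_inner inner_diff_left inner_diff_right inner_commute)
    qed
    then have "w \<bullet> D u x = 0"
      using DERIV_local_max[OF flow_inner[OF u, of w x 0], of 1] by simp
    then show ?thesis using D_orthogonal[of u x] inner_commute[of x "D u x"] by (simp add: inner_diff_left)
  qed
  then have "w - x \<in> slice x" by (rule sliceI)
  moreover have "dist w x < eta"
    using assms x(2) unfolding nbhd_def by (auto intro: le_less_trans)
  ultimately show thesis using that x(1) by blast
qed

text \<open>Start and end of the motion have the same component along \<open>w = D u v\<close>, as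
  \<open>a\<close> and \<open>b\<close> are normal to the orbit. By the mean value theorem the
  velocity is orthogonal to \<open>w\<close> at some moment unless \<open>t\<close> is 0, but near
  \<open>v\<close> the velocity is close to \<open>w\<close>.\<close>

lemma slice_unique_turn:
  assumes v: "v \<in> reg"
  obtains eta \<tau> where "eta > 0" "\<tau> > 0"
    "\<And>u t a b. norm u = 1 ==> \<bar>t\<bar> < \<tau> ==> a \<in> slice v ==> b \<in> slice v ==> norm a < eta ==> act (turn t u) (v + a) = v + b ==> t = 0"
proof -
  obtain c where c: "c > 0" "\<And>x. c * norm x \<le> norm (D x v)" using reg_bound[OF v] by blast
  obtain B where B: "B > 0" "\<And>x v. norm (D x v) \<le> B * norm x * norm v" using D_bound by blast
  \<comment> \<open>Within distance 2 eta of \<open>v\<close> the vector field \<open>D u\<close>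
    changes by less than the lower bound \<open>c\<close> of its length at \<open>v\<close>; \<tau>
    is so small that the flow keeps \<open>v\<close> within eta.\<close>
  define eta where "eta = c / (2 * B)"
  define \<tau> where "\<tau> = eta^2 / (2 * B * ((norm v)^2 + 1))"
  have eta: "eta > 0" using c B by (simp add: eta_def)
  have pos: "2 * B * ((norm v)^2 + 1) > 0" using B by (simp add: add_nonneg_pos)
  have \<tau>: "\<tau> > 0" using eta pos by (simp add: \<tau>_def)
  show thesis
  proof (rule that[OF eta \<tau>], rule ccontr)
    fix u t a b
    assume u: "norm u = 1" and t: "\<bar>t\<bar> < \<tau>" and ab: "a \<in> slice v" "b \<in> slice v" "norm a < eta"
      and eq: "act (turn t u) (v + a) = v + b" and "t \<noteq> 0"
    define w where "w = D u v"
    have w: "c \<le> norm w" using c(2)[of u] u by (simp add: w_def)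
    obtain s where s: "\<bar>s\<bar> \<le> \<bar>t\<bar>" "w \<bullet> act (turn t u) (v + a) - w \<bullet> (v + a) = t * (w \<bullet> D u (act (turn s u) (v + a)))"
      using flow_mvt[OF u] by blast
    have p: "norm (turn r u) = 1" for r using u by simp
    have nv: "norm (act (turn r u) x) = norm x" for r x using grp_norm[OF act_grp[OF p]] .
    have close: "norm (act (turn s u) v - v) \<le> eta"
    proof -
      obtain r where r: "v \<bullet> act (turn s u) v - v \<bullet> v = s * (v \<bullet> D u (act (turn r u) v))"
        using flow_mvt[OF u] by blast
      have "norm (D u (act (turn r u) v)) \<le> B * norm v"
        using B(2)[of u "act (turn r u) v"] u nv by simp
      then have "\<bar>v \<bullet> D u (act (turn r u) v)\<bar> \<le> norm v * (B * norm v)"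
        by (rule order_trans[OF Cauchy_Schwarz_ineq2 mult_left_mono]) simp
      then have "\<bar>s * (v \<bullet> D u (act (turn r u) v))\<bar> \<le> \<tau> * (norm v * (B * norm v))"
        unfolding abs_mult using s(1) t B by (intro mult_mono) auto
      moreover have "(norm (act (turn s u) v - v))^2 = 2 * (v \<bullet> v - v \<bullet> act (turn s u) v)"
        using nv[of s v] by (simp add: power2_norm_eq_inner inner_diff_left inner_diff_right inner_commute norm_eq)
      moreover have "v \<bullet> v - v \<bullet> act (turn s u) v = - (s * (v \<bullet> D u (act (turn r u) v)))" using r by simp
      ultimately have "(norm (act (turn s u) v - v))^2 \<le> 2 * (\<tau> * (norm v * (B * norm v)))"
        by (metis abs_le_D2 mult_le_cancel_left_pos zero_less_numeral)
      also have "\<dots> = \<tau> * (2 * B * (norm v)^2)" by (simp add: power2_eq_square)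
      also have "\<dots> \<le> \<tau> * (2 * B * ((norm v)^2 + 1))" using \<tau> B by (intro mult_left_mono) auto
      also have "\<dots> = eta^2" using less_imp_neq[OF pos] by (simp only: \<tau>_def) simp
      finally show ?thesis using eta by (simp add: power2_le_iff_abs_le)
    qed
    have "norm (D u (act (turn s u) (v + a)) - w) < c"
    proof -
      have "act (turn s u) (v + a) - v = (act (turn s u) v - v) + act (turn s u) a"
        by (simp add: linear_add[OF linear_act[OF p]])
      then have "norm (act (turn s u) (v + a) - v) \<le> norm (act (turn s u) v - v) + norm (act (turn s u) a)"
        by (simp only: norm_triangle_ineq)
      also have "\<dots> \<le> eta + norm a" using close nv[of s a] by simp
      also have "\<dots> < 2 * eta" using ab by simp
      finally have 1: "norm (act (turn s u) (v + a) - v) < 2 * eta" .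
      have "norm (D u (act (turn s u) (v + a)) - w) \<le> B * norm (act (turn s u) (v + a) - v)"
        using B(2)[of u "act (turn s u) (v + a) - v"] u by (simp add: w_def D_right)
      also have "\<dots> < B * (2 * eta)" using 1 B by simp
      finally show ?thesis using B by (simp add: eta_def)
    qed
    moreover have "\<bar>w \<bullet> (D u (act (turn s u) (v + a)) - w)\<bar> \<le> norm w * norm (D u (act (turn s u) (v + a)) - w)"
      by (rule Cauchy_Schwarz_ineq2)
    ultimately have "\<bar>w \<bullet> (D u (act (turn s u) (v + a)) - w)\<bar> < norm w * c"
      using w c(1) by (smt (verit) mult_strict_left_mono)
    also have "\<dots> \<le> norm w * norm w" using w by (simp add: mult_left_mono)
    finally have "w \<bullet> D u (act (turn s u) (v + a)) > 0"
      by (simp add: inner_diff_right power2_norm_eq_inner[symmetric] power2_eq_square)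
    moreover have "w \<bullet> act (turn t u) (v + a) - w \<bullet> (v + a) = 0"
      using ab eq by (simp add: inner_add_right slice_def w_def inner_commute)
    ultimately show False using s(2) \<open>t \<noteq> 0\<close> by simp
  qed
qed

lemma slice_unique_near_one:
  assumes v: "v \<in> reg"
  obtains eta \<delta> where "eta > 0" "\<delta> > 0"
    "\<And>p a b. norm p = 1 ==> dist p (1, 0) < \<delta> ==> a \<in> slice v ==> b \<in> slice v ==> norm a < eta ==> act p (v + a) = v + b ==> p = (1, 0)"
proof -
  obtain eta \<tau> where eta\<tau>: "eta > 0" "\<tau> > 0"
    "\<And>u t a b. norm u = 1 ==> \<bar>t\<bar> < \<tau> ==> a \<in> slice v ==> b \<in> slice v ==> norm a < eta ==> act (turn t u) (v + a) = v + b ==> t = 0"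
    using slice_unique_turn[OF v] by blast
  obtain \<delta> where \<delta>: "\<delta> > 0" "\<And>p. norm p = 1 ==> dist p (1, 0) < \<delta> ==> \<exists>u t. norm u = 1 \<and> \<bar>t\<bar> < \<tau> \<and> p = turn t u"
    using near_one_turn[OF eta\<tau>(2)] by blast
  show thesis
    by (rule that[OF eta\<tau>(1) \<delta>(1)]) (metis \<delta>(2) eta\<tau>(3) turn_0)
qed

text \<open>Two distinct nearby elements carrying \<open>x\<close> to \<open>v\<close> would differ
  by an element close to 1 that fixes \<open>v\<close>, against \<open>slice_unique_near_one\<close>
  with both normal vectors 0.\<close>

lemma finite_transporter:
  assumes v: "v \<in> reg"
  shows "finite {p. norm p = 1 \<and> act p x = v}"
proof (rule ccontr)
  let ?T = "{p. norm p = 1 \<and> act p x = v}"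
  obtain eta \<delta> where eta\<delta>: "eta > 0" "\<delta> > 0"
    "\<And>p a b. norm p = 1 ==> dist p (1, 0) < \<delta> ==> a \<in> slice v ==> b \<in> slice v ==> norm a < eta ==> act p (v + a) = v + b ==> p = (1, 0)"
    using slice_unique_near_one[OF v] by blast
  assume "infinite ?T"
  moreover have "?T \<subseteq> S3" by auto
  ultimately obtain l where "l islimpt ?T"
    using Heine_Borel_imp_Bolzano_Weierstrass[OF compact_sphere[of 0 1]] by blast
  then have inf: "infinite (?T \<inter> ball l (\<delta>/2))" using eta\<delta>(2) by (simp add: islimpt_eq_infinite_ball)
  then obtain p where p: "p \<in> ?T \<inter> ball l (\<delta>/2)" using infinite_imp_nonempty by blast
  have "infinite (?T \<inter> ball l (\<delta>/2) - {p})" using inf by simp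
  then obtain q where q: "q \<in> ?T \<inter> ball l (\<delta>/2) - {p}" using infinite_imp_nonempty by blast
  have n: "norm p = 1" "norm q = 1" "norm (qconj p) = 1" using p q by auto
  have d: "dist (qmul q (qconj p)) (1, 0) < \<delta>"
  proof -
    have "dist (qmul q (qconj p)) (1, 0) = dist q p"
      using dist_qmul_right[OF n(3), of q p] n by (simp add: qmul_qconj)
    also have "\<dots> < \<delta>" using p q dist_triangle_half_r[of l q \<delta> p] by auto
    finally show ?thesis .
  qed
  have "act (qmul q (qconj p)) (v + 0) = v + 0"
    using p q n by (auto simp: act_qmul act_qconj)
  then have "qmul q (qconj p) = (1, 0)"
    using eta\<delta>(3)[OF _ d, of 0 0] eta\<delta>(1) n by (simp add: norm_qmul subspace_0[OF subspace_slice])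
  then have "q = p" using n by (metis dist_qmul_right dist_eq_0_iff qmul_qconj(1))
  then show False using q by simp
qed

text \<open>Extends uniqueness from elements near 1 to the whole group. Elements near one that fixes
  \<open>v\<close> are treated by \<open>slice_unique_near_one\<close>, which forces equality; all
  others move \<open>v\<close> too far.\<close>

lemma slice_unique:
  assumes v: "v \<in> reg"
  obtains eta where "eta > 0"
    "\<And>g y y'. g \<in> grp ==> y \<in> slice v ==> y' \<in> slice v ==> norm y < eta ==> norm y' < eta ==> g (v + y) = v + y' ==> g v = v"
proof -
  obtain eta1 \<delta> where eta\<delta>: "eta1 > 0" "\<delta> > 0"
    "\<And>p a b. norm p = 1 ==> dist p (1, 0) < \<delta> ==> a \<in> slice v ==> b \<in> slice v ==> norm a < eta1 ==> act p (v + a) = v + b ==> p = (1, 0)"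
    using slice_unique_near_one[OF v] by blast
  have "\<exists>eta>0. \<forall>p y y'. norm p = 1 --> y \<in> slice v --> y' \<in> slice v --> norm y < eta --> norm y' < eta --> act p (z (v + y)) = v + y' --> act p (z v) = v"
    if z: "z \<in> Z" for z
  proof -
    let ?K = "{q. norm q = 1 \<and> act q (z v) = v}"
    \<comment> \<open>A compact set of quaternions \<open>p\<close> for which p after z does not fix
      \<open>v\<close>; the displacement of \<open>v\<close> therefore has a positive minimum
      \<open>m\<close> on it.\<close>
    define C where "C = S3 \<inter> (\<Inter>q\<in>?K. {p. \<delta> \<le> dist p q})"
    have "compact C" unfolding C_def
      by (intro compact_Int_closed compact_sphere closed_INT ballI closed_Collect_le continuous_intros)
    have pos: "dist (act p (z v)) v > 0" if "p \<in> C" for p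
    proof -
      have "p \<notin> ?K"
      proof
        assume "p \<in> ?K"
        then have "\<delta> \<le> dist p p" using that unfolding C_def by blast
        then show False using eta\<delta>(2) by simp
      qed
      moreover have "norm p = 1" using that by (simp add: C_def)
      ultimately show ?thesis by simp
    qed
    have cont: "continuous_on C (\<lambda>p. dist (act p (z v)) v)"
      by (intro continuous_intros continuous_on_act) (auto simp: C_def)
    have "\<exists>m>0. \<forall>p\<in>C. m \<le> dist (act p (z v)) v"
    proof (cases "C = {}")
      case False
      then show ?thesis using continuous_attains_inf[OF \<open>compact C\<close> _ cont] pos by blast
    qed (auto intro: exI[of _ 1])
    then obtain m where m: "m > 0" "\<And>p. p \<in> C ==> m \<le> dist (act p (z v)) v" by blast
    show ?thesis
    proof (intro exI[of _ "min eta1 (m/2)"] conjI allI impI)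
      show "min eta1 (m/2) > 0" using m(1) eta\<delta>(1) by simp
      fix p y y' assume p: "norm p = 1" and y: "y \<in> slice v" "y' \<in> slice v" "norm y < min eta1 (m/2)" "norm y' < min eta1 (m/2)"
        and eq: "act p (z (v + y)) = v + y'"
      have pz: "act p \<circ> z \<in> grp" by (rule grpI[OF p z])
      have "act p (z v) + act p (z y) = v + y'"
        using eq linear_add[OF grp_linear[OF pz], of v y] by simp
      then have "act p (z v) - v = y' - act p (z y)" by (simp add: algebra_simps)
      then have "dist (act p (z v)) v \<le> norm y' + norm y"
        using norm_triangle_ineq4[of y' "act p (z y)"] grp_norm[OF pz, of y] by (simp add: dist_norm)
      then have "dist (act p (z v)) v < m" using y by simp
      then have "p \<notin> C" using m(2)[of p] by linarith
      then obtain q where q: "norm q = 1" "act q (z v) = v" "dist p q < \<delta>"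
        using p by (auto simp: C_def not_le)
      have nq: "norm (qconj q) = 1" using q by simp
      have d: "dist (qmul p (qconj q)) (1, 0) < \<delta>"
        using dist_qmul_right[OF nq, of p q] q by (simp add: qmul_qconj)
      have qz: "act q \<circ> z \<in> grp" by (rule grpI[OF q(1) z])
      have "act q (z (v + y)) = v + act q (z y)"
        using linear_add[OF grp_linear[OF qz], of v y] q by simp
      then have "act (qmul p (qconj q)) (v + act q (z y)) = v + y'"
        using eq p q nq by (metis act_qconj(2) act_qmul)
      moreover have "act q (z y) \<in> slice v" using slice_grp[OF qz y(1)] q(2) by simp
      moreover have "norm (act q (z y)) < eta1" using grp_norm[OF qz, of y] y(3) by simp
      ultimately have "qmul p (qconj q) = (1, 0)"
        using eta\<delta>(3)[OF norm_qmul[OF p nq] d] y(2) by blast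
      then have "p = q" using q by (metis dist_qmul_right[OF nq] dist_eq_0_iff qmul_qconj(1))
      then show "act p (z v) = v" using q by simp
    qed
  qed
  then obtain eta where eta: "\<And>z. z \<in> Z ==> eta z > 0 \<and> (\<forall>p y y'. norm p = 1 --> y \<in> slice v --> y' \<in> slice v --> norm y < eta z --> norm y' < eta z --> act p (z (v + y)) = v + y' --> act p (z v) = v)"
    by metis
  have Zne: "Z \<noteq> {}" using id_Z by blast
  show thesis
  proof (rule that[of "Min (eta ` Z)"])
    show "Min (eta ` Z) > 0" using finite_Z Zne eta by (subst Min_gr_iff) auto
    fix g y y' assume g: "g \<in> grp" and y: "y \<in> slice v" "y' \<in> slice v" "norm y < Min (eta ` Z)" "norm y' < Min (eta ` Z)" "g (v + y) = v + y'"
    obtain p z where pz: "g = act p \<circ> z" "norm p = 1" "z \<in> Z" using g unfolding grp_def by blast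
    have le: "Min (eta ` Z) \<le> eta z" using pz(3) finite_Z by simp
    have "act p (z v) = v"
      using eta[OF pz(3)] pz y(1,2,5) less_le_trans[OF y(3) le] less_le_trans[OF y(4) le] by (metis comp_apply)
    then show "g v = v" using pz by simp
  qed
qed

text \<open>The retraction sends \<open>w\<close> to the foot of its normal to the orbit. A nearest
  point is a foot, \<open>slice_unique\<close> makes it the only one, uniqueness yields
  equivariance, and continuity follows because the graph is closed and the orbit compact.\<close>

lemma equivariant_retraction_exists:
  assumes v: "v \<in> reg"
  obtains eta r where "eta > 0" "equivariant_retraction v eta r"
proof -
  obtain eta where eta: "eta > 0"
    "\<And>g y y'. g \<in> grp ==> y \<in> slice v ==> y' \<in> slice v ==> norm y < eta ==> norm y' < eta ==> g (v + y) = v + y' ==> g v = v"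
    using slice_unique[OF v] by blast
  define R where "R = (\<lambda>w x. x \<in> orb v \<and> dist w x \<le> eta / 2 \<and> w - x \<in> slice x)"
  have uniq: "x = x'" if "R w x" "R w x'" for w x x'
  proof -
    obtain g g' where g: "g \<in> grp" "x = g v" "g' \<in> grp" "x' = g' v" using \<open>R w x\<close> \<open>R w x'\<close> unfolding R_def orb_grp by blast
    obtain h where h: "h \<in> grp" "\<And>x. h (g x) = x" "\<And>x. g (h x) = x" using grp_inverse[OF g(1)] by blast
    obtain h' where h': "h' \<in> grp" "\<And>x. h' (g' x) = x" "\<And>x. g' (h' x) = x" using grp_inverse[OF g(3)] by blast
    define y where "y = h (w - x)"
    define y' where "y' = h' (w - x')"
    have y: "y \<in> slice v" "norm y < eta"
      using slice_grp[OF h(1), of "w - x" x] that(1) h(2)[of v] g(2) eta(1) grp_norm[OF h(1)]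
      by (auto simp: y_def R_def dist_norm)
    have y': "y' \<in> slice v" "norm y' < eta"
      using slice_grp[OF h'(1), of "w - x'" x'] that(2) h'(2)[of v] g(4) eta(1) grp_norm[OF h'(1)]
      by (auto simp: y'_def R_def dist_norm)
    have "g (v + y) = w" using h(3)[of "w - x"] g(2) by (simp add: linear_add[OF grp_linear[OF g(1)]] y_def)
    moreover have "h' w = v + y'"
      using linear_add[OF grp_linear[OF h'(1)], of x' "w - x'"] h'(2)[of v] g(4) by (simp add: y'_def)
    ultimately have "(h' \<circ> g) (v + y) = v + y'" by simp
    then have "(h' \<circ> g) v = v" using eta(2)[OF grp_comp[OF h'(1) g(1)] y(1) y'(1) y(2) y'(2)] by blast
    then show ?thesis using g h'(3)[of "g v"] by simp
  qed
  have ex: "\<exists>x. R w x" if "w \<in> nbhd v (eta / 2)" for w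
    using nbhd_slice[OF that] unfolding R_def by (metis less_imp_le)
  define r where "r = (\<lambda>w. THE x. R w x)"
  have r: "R w (r w)" if "w \<in> nbhd v (eta / 2)" for w
    unfolding r_def using ex[OF that] uniq by (metis theI)
  have r_eq: "r w = x" if "R w x" for w x
    unfolding r_def using that uniq by blast
  have closed: "closed {a :: 'v \<times> 'v. dist (fst a) (snd a) \<le> eta / 2 \<and> fst a - snd a \<in> slice (snd a)}"
  proof -
    have "{a :: 'v \<times> 'v. dist (fst a) (snd a) \<le> eta / 2 \<and> fst a - snd a \<in> slice (snd a)}
      = {a. dist (fst a) (snd a) \<le> eta / 2} \<inter> (\<Inter>x. {a. (fst a - snd a) \<bullet> D x (snd a) = 0})"
      by (auto simp: slice_def)
    moreover have "closed {a :: 'v \<times> 'v. (fst a - snd a) \<bullet> D x (snd a) = 0}" for x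
      by (intro closed_Collect_eq continuous_intros linear_continuous_on_compose[OF _ linear_D])
    moreover have "closed {a :: 'v \<times> 'v. dist (fst a) (snd a) \<le> eta / 2}"
      by (intro closed_Collect_le continuous_intros)
    ultimately show ?thesis by (simp add: closed_INT closed_Int)
  qed
  have "continuous_on (nbhd v (eta/2)) r"
  proof -
    have rf: "r \<in> nbhd v (eta/2) \<rightarrow> orb v" using r by (auto simp: R_def)
    have "(\<lambda>x. (x, r x)) ` nbhd v (eta/2) = (Sigma (nbhd v (eta/2)) (\<lambda>_. orb v)) \<inter> {a. dist (fst a) (snd a) \<le> eta / 2 \<and> fst a - snd a \<in> slice (snd a)}"
      using r r_eq by (fastforce simp: R_def)
    then have "closedin (top_of_set (Sigma (nbhd v (eta/2)) (\<lambda>_. orb v))) ((\<lambda>x. (x, r x)) ` nbhd v (eta/2))"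
      using closed by (simp add: closedin_closed_Int)
    then show ?thesis using continuous_closed_graph_eq[OF compact_orb rf] by blast
  qed
  moreover have "r w = w" if "w \<in> orb v" for w
    by (rule r_eq) (use that eta(1) subspace_0[OF subspace_slice] in \<open>auto simp: R_def\<close>)
  moreover have "r (z w) = z (r w)" if "z \<in> Z" "w \<in> nbhd v (eta/2)" for z w
  proof (rule r_eq)
    have z: "z \<in> grp" using grpI[OF _ that(1), of "(1, 0)"] by (simp add: norm_Pair comp_def)
    have Rw: "R w (r w)" by (rule r[OF that(2)])
    then have "z (r w) \<in> orb v" using grp_orb[OF z] orb_eq unfolding R_def by blast
    moreover have "z w - z (r w) = z (w - r w)" by (simp add: linear_diff[OF grp_linear[OF z]])
    ultimately show "R (z w) (z (r w))"
      using Rw slice_grp[OF z, of "w - r w" "r w"] dist_Z[OF that(1)] by (auto simp: R_def)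
  qed
  moreover have "r w \<in> orb v" if "w \<in> nbhd v (eta/2)" for w using r[OF that] by (simp add: R_def)
  ultimately have "equivariant_retraction v (eta/2) r" by (auto simp: equivariant_retraction_def)
  then show thesis using that[of "eta/2" r] eta(1) by simp
qed

end

unbundle no cross3_syntax

section \<open>Generic points and the local structure of the orbit space\<close>

unbundle cross3_syntax

lemma const_cycle_bounds:
  assumes c: "singular_relcycle p X {} c" and "p > 0" and w: "w \<in> topspace Y"
  shows "singular_relboundary p Y {} (chain_map p (\<lambda>_. w) c)"
proof -
  have "singular_relcycle p (subtopology Y {w}) {} (chain_map p (\<lambda>_. w) c)"
    by (rule singular_relcycle_chain_map[OF c]) (use w in auto)
  moreover have "topspace (subtopology Y {w}) = {w}" using w by auto
  ultimately have "singular_relboundary p (subtopology Y {w}) {} (chain_map p (\<lambda>_. w) c)"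
    using singular_boundary_eq_cycle_singleton[of "subtopology Y {w}" w p] \<open>p > 0\<close> by simp
  then obtain d where "singular_chain (Suc p) (subtopology Y {w}) d" "chain_boundary (Suc p) d = chain_map p (\<lambda>_. w) c"
    unfolding singular_boundary by (elim exE conjE)
  then show ?thesis
    unfolding singular_boundary by (intro exI[of _ d] conjI) (simp_all add: singular_chain_subtopology)
qed

lemma star_shaped_cycle_bounds:
  fixes f :: "'a::topological_space => 'b::real_normed_vector"
  assumes f: "continuous_on S f" and w: "w \<in> T" and seg: "\<And>x. x \<in> S ==> closed_segment (f x) w \<subseteq> T"
    and c: "singular_relcycle p (top_of_set S) {} c" and "p > 0"
  shows "singular_relboundary p (top_of_set T) {} (chain_map p f c)"
proof -
  have "homotopic_with_canon (\<lambda>z. True) S T f (\<lambda>_. w)"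
    by (rule homotopic_with_linear) (use f seg in auto)
  then have "homotopic_with (\<lambda>h. h \<in> {} \<rightarrow> {}) (top_of_set S) (top_of_set T) f (\<lambda>_. w)"
    by (rule homotopic_with_mono) auto
  then have "homologous_rel p (top_of_set T) {} (chain_map p f c) (chain_map p (\<lambda>_. w) c)"
    by (rule homotopic_imp_homologous_rel_chain_maps[OF _ c])
  then show ?thesis
    using const_cycle_bounds[OF c \<open>p > 0\<close>, of w "top_of_set T"] w singular_relboundary_add unfolding homologous_rel_def by fastforce
qed

text \<open>Part of the long exact sequence of a pair: vanishing of H_{j+1}(X, S) makes H_j(S) ->
  H_j(X) injective.\<close>

lemma rel_acyclic_boundary:
  assumes ac: "rel_acyclic (Suc j) X S" and e: "singular_chain (Suc j) X e"
    and be: "singular_chain j (subtopology X S) (chain_boundary (Suc j) e)"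
  shows "singular_relboundary j (subtopology X S) {} (chain_boundary (Suc j) e)"
proof -
  have "singular_relcycle (Suc j) X S e" using e be by (simp add: singular_relcycle)
  then have "singular_relboundary (Suc j) X S e" using ac by (simp add: rel_acyclic_def)
  then obtain d g where dg: "singular_chain (Suc (Suc j)) X d" "singular_chain (Suc j) (subtopology X S) g"
    "chain_boundary (Suc (Suc j)) d = e + g"
    unfolding singular_relboundary_alt by metis
  have "chain_boundary (Suc j) (e + g) = 0"
    using chain_boundary_boundary_alt[OF dg(1)] dg(3) by simp
  then have "chain_boundary (Suc j) e = chain_boundary (Suc j) (- g)"
    by (simp add: chain_boundary_add chain_boundary_minus eq_neg_iff_add_eq_0)
  then have a: "chain_boundary (Suc j) e = chain_boundary (Suc j) (- g)" .
  have "singular_chain (Suc j) (subtopology X S) (- g)" using dg(2) by (simp add: singular_chain_minus)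
  then show ?thesis unfolding a singular_boundary by (intro exI[of _ "- g"] conjI refl)
qed

lemma sphere_section_cycle:
  fixes T :: "'v::euclidean_space set"
  assumes T: "subspace T" "dim T = Suc j" "j > 0"
  obtains c where "singular_relcycle j (top_of_set (sphere 0 1 \<inter> T)) {} c"
    "\<not> singular_relboundary j (top_of_set (sphere 0 1 \<inter> T)) {} c"
proof -
  obtain B where B: "B \<subseteq> T" "pairwise orthogonal B" "\<And>x. x \<in> B ==> norm x = 1" "independent B" "card B = dim T" "span B = T"
    using orthonormal_basis_subspace[OF T(1)] by metis
  obtain f :: "(nat => real) => 'v" and g where "homeomorphic_maps (nsphere (Suc j - 1)) (top_of_set (sphere 0 1 \<inter> span B)) f g"
    by (rule homeomorphic_maps_nsphere_euclidean_sphere[OF B(4,2), of "Suc j"]) (use B(3,5) T(2) in auto)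
  then have "top_of_set (sphere 0 1 \<inter> T) homeomorphic_space nsphere j"
    using B(6) homeomorphic_space_def homeomorphic_space_sym by fastforce
  from homeomorphic_space_imp_isomorphic_reduced_homology_groups[OF this, of "int j"]
  have "reduced_homology_group (int j) (top_of_set (sphere 0 1 \<inter> T)) \<cong> integer_group"
    using iso_trans reduced_homology_group_nsphere(1)[of j] by blast
  then have "homology_group (int j) (top_of_set (sphere 0 1 \<inter> T)) \<cong> integer_group"
    using T(3) by (simp add: un_reduced_homology_group)
  then obtain \<mu> where "singular_relcycle j (top_of_set (sphere 0 1 \<inter> T)) {} \<mu>"
    "\<And>m. singular_relboundary j (top_of_set (sphere 0 1 \<inter> T)) {} (frag_cmul m \<mu>) ==> m = 0"
    using infinite_cyclic_homology_generator by metis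
  then show thesis using that[of \<mu>] by (metis frag_cmul_one zero_neq_one)
qed

text \<open>A generator for the sphere bounds in the disc by coning. Acyclicity would make it bound
  in the punctured disc, and radial projection would then kill it on the sphere.\<close>

lemma disc_section_not_acyclic:
  fixes T :: "'v::euclidean_space set"
  assumes T: "subspace T" "dim T = Suc j" "j > 0" and r: "r > 0"
  shows "\<not> rel_acyclic (Suc j) (top_of_set (cball 0 r \<inter> T)) (cball 0 r \<inter> T - {0})"
proof
  let ?C = "cball 0 r \<inter> T" and ?S = "sphere 0 1 \<inter> T"
  assume ac: "rel_acyclic (Suc j) (top_of_set ?C) (?C - {0})"
  obtain c where c: "singular_relcycle j (top_of_set ?S) {} c" "\<not> singular_relboundary j (top_of_set ?S) {} c"
    using sphere_section_cycle[OF T] by blast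
  have im: "scaleR r ` ?S \<subseteq> ?C - {0}" using r T(1) by (auto simp: subspace_scale)
  have "singular_relboundary j (top_of_set ?C) {} (chain_map j (scaleR r) c)"
  proof (rule star_shaped_cycle_bounds[OF _ _ _ c(1) T(3), where w = 0])
    show "closed_segment (r *\<^sub>R x) 0 \<subseteq> ?C" if "x \<in> ?S" for x
      using that im r subspace_0[OF T(1)] subspace_scale[OF T(1)]
      by (intro closed_segment_subset convex_Int convex_cball subspace_imp_convex T(1)) auto
  qed (use r subspace_0[OF T(1)] in \<open>auto intro: continuous_intros\<close>)
  then obtain e where e: "singular_chain (Suc j) (top_of_set ?C) e" "chain_boundary (Suc j) e = chain_map j (scaleR r) c"
    unfolding singular_boundary by blast
  have sub: "subtopology (top_of_set ?C) (?C - {0}) = top_of_set (?C - {0})"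
    unfolding subtopology_subtopology by (rule arg_cong[where f = top_of_set]) blast
  have cont: "continuous_map (top_of_set ?S) (top_of_set (?C - {0})) (scaleR r)"
    using im by (auto intro: continuous_intros)
  have "singular_relcycle j (top_of_set (?C - {0})) {} (chain_map j (scaleR r) c)"
    by (rule singular_relcycle_chain_map[OF c(1) cont]) auto
  then have "singular_relboundary j (top_of_set (?C - {0})) {} (chain_map j (scaleR r) c)"
    using rel_acyclic_boundary[OF ac e(1)] by (simp add: e(2) sub singular_cycle)
  moreover have "continuous_map (top_of_set (?C - {0})) (top_of_set ?S) (\<lambda>y. y /\<^sub>R norm y)"
    using T(1) by (auto intro!: continuous_intros simp: subspace_scale)
  ultimately have "singular_relboundary j (top_of_set ?S) {} (chain_map j (\<lambda>y. y /\<^sub>R norm y) (chain_map j (scaleR r) c))"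
    by (rule singular_relboundary_chain_map[where T = "{}" and S = "{}", simplified])
  moreover have "chain_map j (\<lambda>y. y /\<^sub>R norm y) (chain_map j (scaleR r) c) = chain_map j ((\<lambda>y. y /\<^sub>R norm y) \<circ> scaleR r) c"
    by (simp add: chain_map_compose)
  moreover have "\<dots> = chain_map j id c"
  proof (rule chain_map_eq)
    show "singular_chain j (top_of_set ?S) c" using c(1) by (simp add: singular_cycle)
    show "((\<lambda>y. y /\<^sub>R norm y) \<circ> scaleR r) x = id x" if "x \<in> topspace (top_of_set ?S)" for x
      using that r by simp
  qed
  moreover have "chain_map j id c = c"
    by (rule chain_map_id_gen[of j "top_of_set ?S"]) (use c(1) in \<open>auto simp: singular_cycle\<close>)
  ultimately show False using c(2) by simp
qed

text \<open>Parametrizes all unit quaternions by three real angles through flows, so that the bad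
  cone vertices form a differentiable image of a set of low dimension.\<close>

lemma euler_angles:
  assumes "norm p = 1"
  obtains a b c where "p = qmul (qmul (turn a e3) (turn b (axis 1 1))) (turn c e3)"
proof -
  have n: "(fst p)^2 + (snd p $ 1)^2 + (snd p $ 2)^2 + (snd p $ 3)^2 = 1"
    using assms by (simp add: norm_quat inner_vec_def sum_3 power2_eq_square)
  obtain r1 \<alpha> where 1: "fst p = r1 * cos \<alpha>" "snd p $ 3 = r1 * sin \<alpha>" using polar_Ex by blast
  obtain r2 \<beta> where 2: "snd p $ 1 = r2 * cos \<beta>" "snd p $ 2 = r2 * sin \<beta>" using polar_Ex by blast
  have "r1^2 + r2^2 = r1^2 * ((cos \<alpha>)^2 + (sin \<alpha>)^2) + r2^2 * ((cos \<beta>)^2 + (sin \<beta>)^2)" by simp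
  also have "\<dots> = 1"
    using n unfolding 1 2 power_mult_distrib distrib_left by linarith
  finally have "r1^2 + r2^2 = 1" .
  \<comment> \<open>The two polar radii are the cosine and sine of half the middle angle; half the
    sum and half the difference of the polar angles give the outer ones.\<close>
  then obtain \<gamma> where \<gamma>: "r1 = cos \<gamma>" "r2 = sin \<gamma>" using sincos_total_2pi by metis
  define A where "A = (\<alpha> + \<beta>) / 2"
  define C where "C = (\<alpha> - \<beta>) / 2"
  have AC: "\<alpha> = A + C" "\<beta> = A - C" by (simp_all add: A_def C_def field_simps)
  have "p = qmul (qmul (turn (2 * A) e3) (turn (2 * \<gamma>) (axis 1 1))) (turn (2 * C) e3)"
    by (simp add: prod_eq_iff vec3_simps qmul_def turn_def axis_def 1 2 \<gamma> AC cos_add sin_add cos_diff sin_diff algebra_simps)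
  then show thesis by (rule that)
qed

context su2_rep begin

lemma act_turn_differentiable:
  fixes \<alpha> :: "'v => real" and \<xi> :: "'v => 'v"
  assumes u: "norm u = 1" and \<alpha>: "\<alpha> differentiable (at x)" and \<xi>: "\<xi> differentiable (at x)"
  shows "(\<lambda>x. act (turn (\<alpha> x) u) (\<xi> x)) differentiable (at x)"
proof -
  have "(\<lambda>x. act (turn (\<alpha> x) u) b) differentiable (at x)" for b
  proof -
    have "(\<lambda>t. act (turn t u) b) differentiable (at (\<alpha> x))"
      using flow[OF u] unfolding has_vector_derivative_def by (rule differentiableI)
    from differentiable_chain_at[OF \<alpha> this] show ?thesis by (simp add: comp_def)
  qed
  moreover have "(\<lambda>x. \<xi> x \<bullet> b) differentiable (at x)" for b
    using \<xi> unfolding differentiable_def by (blast intro: has_derivative_inner_left)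
  ultimately have d: "(\<lambda>x. \<Sum>b\<in>Basis. (\<xi> x \<bullet> b) *\<^sub>R act (turn (\<alpha> x) u) b) differentiable (at x)"
    by (intro differentiable_sum differentiable_scaleR) auto
  have e: "act (turn s u) y = (\<Sum>b\<in>Basis. (y \<bullet> b) *\<^sub>R act (turn s u) b)" for s y
  proof -
    have l: "linear (act (turn s u))" using u by (intro linear_act) simp
    have "act (turn s u) y = act (turn s u) (\<Sum>b\<in>Basis. (y \<bullet> b) *\<^sub>R b)" by (simp add: euclidean_representation)
    then show ?thesis by (simp add: linear_sum[OF l] linear_scale[OF l])
  qed
  show ?thesis by (subst e) (rule d)
qed

lemma act_euler:
  assumes "norm p = 1"
  obtains a b c where "\<And>y. act p y = act (turn a e3) (act (turn b (axis 1 1)) (act (turn c e3) y))"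
proof -
  obtain a b c where "p = qmul (qmul (turn a e3) (turn b (axis 1 1))) (turn c e3)" using euler_angles[OF assms] .
  then show thesis using that[of a b c] by (simp add: act_qmul norm_qmul)
qed

lemma singular_imp_ker:
  assumes "x \<noteq> 0" "D x y = 0"
  obtains q where "norm q = 1" "act q y \<in> ker"
proof -
  obtain q where q: "norm q = 1" "qrot q (x /\<^sub>R norm x) = e3"
    using qrot_transitive[of "x /\<^sub>R norm x" e3] assms(1) by auto
  have "D e3 (act q y) = act q (D (x /\<^sub>R norm x) y)" by (simp add: act_D q)
  also have "\<dots> = 0" using assms q by (simp add: D_left)
  finally show thesis using that q by (simp add: ker_def)
qed

text \<open>A vertex \<open>w\<close> for which the claim fails is determined by a vector of
  \<open>ker\<close>, two unit quaternions and a point of the segment. Hence the bad vertices lie in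
  a differentiable image of a proper subspace, which is negligible. The end t = 0 is left out since
  solving for \<open>w\<close> divides by t.\<close>

lemma generic_half_open_segment:
  assumes dim: "dim ker + 7 < DIM('v)"
  obtains w where "\<And>p t. norm p = 1 ==> 0 < t ==> t \<le> 1 ==> (1 - t) *\<^sub>R act p v + t *\<^sub>R w \<in> reg"
proof -
  \<comment> \<open>Seven orthonormal vectors orthogonal to \<open>ker\<close> turn the seven real
    parameters into coordinates inside the space itself.\<close>
  define K' where "K' = {y \<in> UNIV. \<forall>x\<in>ker. orthogonal x y}"
  have K': "subspace K'" by (auto simp: K'_def subspace_def orthogonal_clauses)
  have dK: "dim K' + dim ker = DIM('v)"
    using dim_subspace_orthogonal_to_vectors[OF subspace_ker subspace_UNIV] by (simp add: K'_def)
  obtain B where B: "B \<subseteq> K'" "pairwise orthogonal B" "\<And>x. x \<in> B ==> norm x = 1" "independent B" "card B = dim K'" "span B = K'"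
    using orthonormal_basis_subspace[OF K'] by metis
  obtain h where h: "bij_betw h {0..<card B} B"
    using ex_bij_betw_nat_finite[OF finiteI_independent[OF B(4)]] by blast
  have c7: "card B \<ge> 7" using dK dim B(5) by linarith
  have bB: "h i \<in> B" if "i < 7" for i using h that c7 by (auto simp: bij_betw_def)
  have bb: "h i \<bullet> h j = (if i = j then 1 else 0)" if "i < 7" "j < 7" for i j
  proof (cases "i = j")
    case True then show ?thesis using B(3)[OF bB[OF that(1)]] by (simp add: norm_eq_1)
  next
    case False
    then have "h i \<noteq> h j" using h that c7 by (auto simp: bij_betw_def inj_on_def)
    then show ?thesis using False B(2) bB that by (auto simp: pairwise_def orthogonal_def)
  qed
  have bk: "u \<bullet> h i = 0" if "u \<in> ker" "i < 7" for u i
    using B(1) bB[OF that(2)] that(1) by (auto simp: K'_def orthogonal_def)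
  let ?e1 = "axis 1 1 :: real^3"
  define P where "P = (\<lambda>x. x - (\<Sum>i<7. (x \<bullet> h i) *\<^sub>R h i))"
  \<comment> \<open>Solves the equation t u = q ((1 - t) p v + t w) for \<open>w\<close>.
    \<open>P x\<close> is the kernel vector u, coordinates 0 to 2 are Euler angles of the inverse of
    q, 3 to 5 those of p, and coordinate 6 is -(1 - t)/t.\<close>
  define F where "F = (\<lambda>x. act (turn (x \<bullet> h 0) e3) (act (turn (x \<bullet> h 1) ?e1) (act (turn (x \<bullet> h 2) e3) (P x)))
     + (x \<bullet> h 6) *\<^sub>R act (turn (x \<bullet> h 3) e3) (act (turn (x \<bullet> h 4) ?e1) (act (turn (x \<bullet> h 5) e3) v)))"
  define S where "S = {x + y |x y. x \<in> ker \<and> y \<in> span (h ` {..<7})}"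
  have "dim S < DIM('v)"
  proof -
    have "dim S \<le> dim ker + dim (span (h ` {..<7}))"
      using dim_sums_Int[OF subspace_ker subspace_span, of "h ` {..<7}"] unfolding S_def by linarith
    moreover have "dim (span (h ` {..<7})) \<le> 7"
      using dim_le_card[of "span (h ` {..<7})" "h ` {..<7}"] card_image_le[of "{..<7}" h] by simp
    ultimately show ?thesis using dim by linarith
  qed
  then have "negligible S" by (rule negligible_lowdim)
  moreover have "F differentiable_on S"
  proof -
    have inn: "(\<lambda>x. x \<bullet> b) differentiable (at x)" for x b :: 'v
      by (simp add: bounded_linear_imp_differentiable bounded_linear_inner_left)
    have "P differentiable (at x)" for x
      unfolding P_def by (intro differentiable_diff differentiable_sum differentiable_scaleR inn) auto
    then have "F differentiable (at x)" for x
      unfolding F_def by (intro differentiable_add differentiable_scaleR act_turn_differentiable inn) auto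
    then show ?thesis by (simp add: differentiable_on_def differentiable_at_withinI)
  qed
  ultimately have "negligible (F ` S)" by (intro negligible_differentiable_image_negligible) auto
  then obtain w where w: "w \<notin> F ` S" using non_negligible_UNIV by (metis UNIV_eq_I)
  show thesis
  proof (rule that)
    fix p :: quat and t :: real assume p: "norm p = 1" and t01: "0 < t" "t \<le> 1"
    define y where "y = (1 - t) *\<^sub>R act p v + t *\<^sub>R w"
    have t: "t \<noteq> 0" "y = (1 - t) *\<^sub>R act p v + t *\<^sub>R w" using t01 by (auto simp: y_def)
    have "y \<in> reg"
      proof (rule ccontr)
        assume "y \<notin> reg"
        then obtain x0 where "x0 \<noteq> 0" "D x0 y = 0" by (auto simp: reg_def)
        then obtain q where q: "norm q = 1" "act q y \<in> ker" using singular_imp_ker by blast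
        obtain a1 b1 c1 where e1: "\<And>y. act (qconj q) y = act (turn a1 e3) (act (turn b1 ?e1) (act (turn c1 e3) y))"
          using act_euler[of "qconj q"] q by auto
        obtain a2 b2 c2 where e2: "\<And>y. act p y = act (turn a2 e3) (act (turn b2 ?e1) (act (turn c2 e3) y))"
          using act_euler[OF p] by blast
        define u where "u = (1/t) *\<^sub>R act q y"
        have u: "u \<in> ker" unfolding u_def using q subspace_scale[OF subspace_ker] by blast
        define k where "k = [a1, b1, c1, a2, b2, c2, - ((1 - t) / t)]"
        define x where "x = u + (\<Sum>i<7. k ! i *\<^sub>R h i)"
        have xS: "x \<in> S"
        proof -
          have "(\<Sum>i<7. k ! i *\<^sub>R h i) \<in> span (h ` {..<7})" by (intro span_sum span_scale span_base) simp
          then show ?thesis unfolding S_def x_def using u by blast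
        qed
        have xh: "x \<bullet> h j = k ! j" if "j < 7" for j
        proof -
          have "x \<bullet> h j = (\<Sum>i<7. k ! i * (h i \<bullet> h j))" using bk[OF u that] by (simp add: x_def inner_add_left inner_sum_left)
          also have "\<dots> = (\<Sum>i<7. if i = j then k ! i else 0)" by (intro sum.cong) (auto simp: bb that)
          finally show ?thesis using that by simp
        qed
        have Px: "P x = u"
        proof -
          have "(\<Sum>i<7. (x \<bullet> h i) *\<^sub>R h i) = (\<Sum>i<7. k ! i *\<^sub>R h i)" by (intro sum.cong) (auto simp: xh)
          then show ?thesis by (simp add: P_def x_def)
        qed
        have l: "linear (act (qconj q))" using q by (intro linear_act) simp
        have "F x = act (qconj q) u - ((1 - t) / t) *\<^sub>R act p v"
          unfolding F_def Px by (simp add: xh k_def e1 e2 numeral_eq_Suc)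
        also have "act (qconj q) u = (1/t) *\<^sub>R y"
          using q by (simp add: u_def linear_scale[OF l] act_qconj)
        also have "\<dots> = ((1 - t) / t) *\<^sub>R act p v + w"
          using t(1) unfolding t(2) by (simp add: scaleR_add_right)
        finally have "F x = w" by simp
        then show False using w xS by blast
      qed
    then show "(1 - t) *\<^sub>R act p v + t *\<^sub>R w \<in> reg" by (simp add: y_def)
  qed
qed

lemma reg_nonempty: "dim ker + 7 < DIM('v) ==> reg \<noteq> {}"
proof -
  assume "dim ker + 7 < DIM('v)"
  then obtain w where w: "\<And>p t. norm p = 1 ==> 0 < t ==> t \<le> 1 ==> (1 - t) *\<^sub>R act p 0 + t *\<^sub>R w \<in> reg"
    using generic_half_open_segment[of 0] by blast
  have "norm (1 :: real, 0 :: real^3) = 1" by (simp add: norm_Pair)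
  from w[OF this, of 1] show ?thesis by auto
qed

lemma generic_point:
  assumes v: "v \<in> reg" and dim: "dim ker + 7 < DIM('v)"
  obtains w where "\<And>p. norm p = 1 ==> closed_segment (act p v) w \<subseteq> reg"
proof -
  obtain w where w: "\<And>p t. norm p = 1 ==> 0 < t ==> t \<le> 1 ==> (1 - t) *\<^sub>R act p v + t *\<^sub>R w \<in> reg"
    using generic_half_open_segment[OF dim, of v] by blast
  have "(1 - t) *\<^sub>R act p v + t *\<^sub>R w \<in> reg" if "norm p = 1" "0 \<le> t" "t \<le> 1" for p :: quat and t :: real
    using w[OF that(1), of t] reg_orb[OF v orb_act[OF that(1)]] that by (cases "t = 0") auto
  then show thesis by (intro that) (auto simp: closed_segment_def)
qed

lemma orbit_class_null:
  assumes v: "v \<in> reg" and dim: "dim ker + 7 < DIM('v)"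
  shows "singular_relboundary 3 (top_of_set reg) {} (chain_map 3 (orbit_map v) S3_class)"
proof -
  obtain w where w: "\<And>p. norm p = 1 ==> closed_segment (act p v) w \<subseteq> reg" using generic_point[OF assms] by blast
  show ?thesis
  proof (rule star_shaped_cycle_bounds[OF _ _ _ S3_class(1)])
    show "continuous_on S3 (orbit_map v)" by (intro continuous_on_act continuous_intros) auto
    show "w \<in> reg" using w[of "(1, 0)"] by (auto simp: norm_Pair)
    show "closed_segment (act p v) w \<subseteq> reg" if "p \<in> S3" for p using that w[of p] by simp
  qed simp
qed

lemma dim_slice: assumes "v \<in> reg" shows "dim (slice v) + 3 = DIM('v)"
proof -
  have inj: "inj (\<lambda>x. D x v)"
    using assms by (auto simp: linear_injective_0[OF linear_D_left] reg_def)
  have s: "subspace (range (\<lambda>x. D x v))" by (rule linear_subspace_image[OF linear_D_left subspace_UNIV])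
  have "dim (range (\<lambda>x. D x v)) = 3"
    using dim_image_eq[OF linear_D_left, of v UNIV] inj by (simp add: dim_UNIV)
  moreover have "slice v = {y \<in> UNIV. \<forall>x\<in>range (\<lambda>x. D x v). orthogonal x y}"
    by (auto simp: slice_def orthogonal_def inner_commute)
  ultimately show ?thesis using dim_subspace_orthogonal_to_vectors[OF s subspace_UNIV] by simp
qed

text \<open>At a point with fewest stabilizing pairs, nearby points of the slice have the same
  stabilizer, being contained in that of \<open>v\<close>. An element identifying two slice points
  fixes \<open>v\<close>, hence fixes the first of them too.\<close>

lemma principal_slice:
  assumes "reg \<noteq> {}"
  obtains v eta where "v \<in> reg" "eta > 0"
    "\<And>y y'. y \<in> slice v ==> y' \<in> slice v ==> norm y < eta ==> norm y' < eta ==> orb (v + y) = orb (v + y') ==> y = y'"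
proof -
  define st where "st = (\<lambda>v. {(p, z). norm p = 1 \<and> z \<in> Z \<and> act p (z v) = v})"
  have fin: "finite (st v)" if "v \<in> reg" for v
  proof -
    have "st v \<subseteq> (\<Union>z\<in>Z. Sigma {p. norm p = 1 \<and> act p (z v) = v} (\<lambda>_. {z}))" by (auto simp: st_def)
    then show ?thesis using finite_transporter[OF that] finite_Z by (auto intro: finite_subset)
  qed
  obtain v where v: "v \<in> reg" "\<And>w. w \<in> reg ==> card (st v) \<le> card (st w)"
    using ex_has_least_nat[of "\<lambda>v. v \<in> reg" _ "\<lambda>v. card (st v)"] assms by blast
  obtain eta1 where eta1: "eta1 > 0"
    "\<And>g y y'. g \<in> grp ==> y \<in> slice v ==> y' \<in> slice v ==> norm y < eta1 ==> norm y' < eta1 ==> g (v + y) = v + y' ==> g v = v"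
    using slice_unique[OF v(1)] by blast
  obtain eta2 where eta2: "eta2 > 0" "ball v eta2 \<subseteq> reg" using open_reg v(1) open_contains_ball by blast
  show thesis
  proof (rule that[OF v(1), of "min eta1 eta2"])
    show "min eta1 eta2 > 0" using eta1 eta2 by simp
    fix y y' assume y: "y \<in> slice v" "y' \<in> slice v" "norm y < min eta1 eta2" "norm y' < min eta1 eta2" and eq: "orb (v + y) = orb (v + y')"
    have reg: "v + y \<in> reg" using y eta2 by (auto simp: dist_norm)
    have "st (v + y) \<subseteq> st v"
    proof
      fix a assume "a \<in> st (v + y)"
      then obtain p z where a: "a = (p, z)" "norm p = 1" "z \<in> Z" "act p (z (v + y)) = v + y" by (auto simp: st_def)
      then have "(act p \<circ> z) v = v" using y by (intro eta1(2)[OF grpI, of p z y y]) auto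
      then show "a \<in> st v" using a by (simp add: st_def)
    qed
    then have st: "st (v + y) = st v" using fin[OF v(1)] v(2)[OF reg] by (simp add: card_seteq)
    have "v + y' \<in> orb (v + y)" using eq orb_self by simp
    then obtain g where g: "g \<in> grp" "v + y' = g (v + y)" unfolding orb_grp by blast
    then obtain p z where pz: "g = act p \<circ> z" "norm p = 1" "z \<in> Z" unfolding grp_def by blast
    have "g v = v" using eta1(2)[OF g(1) y(1,2)] y g(2) by simp
    then have "(p, z) \<in> st v" using pz by (simp add: st_def)
    then have "g (v + y) = v + y" using pz unfolding st[symmetric] by (simp add: st_def)
    then show "y = y'" using g(2) by simp
  qed
qed

definition orbtop where "orbtop = topology (\<lambda>U. U \<subseteq> range orb \<and> open (orb -` U))"

lemma openin_orbtop: "openin orbtop U \<longleftrightarrow> U \<subseteq> range orb \<and> open (orb -` U)"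
proof -
  have "istopology (\<lambda>U. U \<subseteq> range orb \<and> open (orb -` U))"
    unfolding istopology_def by (auto simp: vimage_Union)
  then show ?thesis by (simp add: orbtop_def topology_inverse')
qed

lemma topspace_orbtop: "topspace orbtop = range orb"
proof
  show "topspace orbtop \<subseteq> range orb" using openin_orbtop openin_topspace by blast
  have "openin orbtop (range orb)" by (simp add: openin_orbtop vimage_def)
  then show "range orb \<subseteq> topspace orbtop" by (rule openin_subset)
qed

lemma quotient_map_orb: "quotient_map euclidean orbtop orb"
  by (simp add: quotient_map_def topspace_orbtop openin_orbtop vimage_def)

lemma continuous_map_orb: "continuous_map euclidean orbtop orb"
  by (rule quotient_imp_continuous_map[OF quotient_map_orb])

lemma orb_eq_iff: "orb v = orb w \<longleftrightarrow> w \<in> orb v"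
  using orb_eq orb_self by blast

lemma orb_vimage: "orb -` orb ` U = (\<Union>g\<in>grp. g ` U)"
proof
  show "orb -` orb ` U \<subseteq> (\<Union>g\<in>grp. g ` U)"
  proof
    fix x assume "x \<in> orb -` orb ` U"
    then obtain u where "u \<in> U" "orb u = orb x" by auto
    then have "x \<in> orb u" by (simp add: orb_eq_iff)
    then show "x \<in> (\<Union>g\<in>grp. g ` U)" unfolding orb_grp using \<open>u \<in> U\<close> by blast
  qed
  show "(\<Union>g\<in>grp. g ` U) \<subseteq> orb -` orb ` U"
    using orb_eq[OF grp_orb] by blast
qed

lemma open_orb: assumes "open U" shows "openin orbtop (orb ` U)"
  unfolding openin_orbtop orb_vimage
proof
  show "open (\<Union>g\<in>grp. g ` U)"
  proof (intro open_UN ballI)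
    fix g assume g: "g \<in> grp"
    show "open (g ` U)"
      by (rule open_surjective_linear_image[OF assms grp_linear[OF g]]) (metis grp_inverse[OF g] surjI)
  qed
qed blast

text \<open>Determines the dimension of the orbit space. A disc in a principal slice maps
  homeomorphically onto a neighbourhood in the quotient, and excision compares local homology with
  that of the disc.\<close>

lemma local_homology_nontrivial:
  assumes H: "Hausdorff_space orbtop" and ne: "reg \<noteq> {}" and dim: "DIM('v) \<ge> 5"
  obtains x where "x \<in> topspace orbtop" "\<not> trivial_group (relative_homology_group (int (DIM('v) - 3)) orbtop (topspace orbtop - {x}))"
proof -
  let ?X = orbtop
  obtain v eta where v: "v \<in> reg" and eta: "eta > 0"
    "\<And>y y'. y \<in> slice v ==> y' \<in> slice v ==> norm y < eta ==> norm y' < eta ==> orb (v + y) = orb (v + y') ==> y = y'"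
    using principal_slice[OF ne] by metis
  define C where "C = cball 0 (eta/2) \<inter> slice v"
  define f where "f = (\<lambda>y. orb (v + y))"
  have inj: "inj_on f C" unfolding inj_on_def f_def C_def using eta by auto
  have "continuous_map euclidean euclidean (\<lambda>y. v + y)" by (auto intro: continuous_intros)
  from continuous_map_compose[OF this continuous_map_orb]
  have cf: "continuous_map (top_of_set C) ?X f" by (simp add: f_def comp_def continuous_map_from_subtopology)
  have compC: "compact C" unfolding C_def by (simp add: compact_Int_closed closed_subspace subspace_slice)
  have homeo: "homeomorphic_map (top_of_set C) (subtopology ?X (f ` C)) f"
  proof (rule continuous_imp_homeomorphic_map)
    show "compact_space (top_of_set C)" using compC by (simp add: compact_space_subtopology compactin_euclidean_iff)
    show "Hausdorff_space (subtopology ?X (f ` C))" by (rule Hausdorff_space_subtopology[OF H])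
    show "continuous_map (top_of_set C) (subtopology ?X (f ` C)) f" using cf by (simp add: continuous_map_in_subtopology)
    show "f ` topspace (top_of_set C) = topspace (subtopology ?X (f ` C))"
      by (auto simp: topspace_orbtop f_def)
  qed (use inj in simp)
  have x: "f 0 \<in> topspace ?X" by (simp add: f_def topspace_orbtop)
  have 0: "0 \<in> C" using eta(1) by (simp add: C_def subspace_0 subspace_slice)
  have iso1: "relative_homology_group p (top_of_set C) (C - {0}) \<cong> relative_homology_group p (subtopology ?X (f ` C)) (f ` C - {f 0})" for p
    unfolding is_iso_def
    using homeomorphic_map_relative_homology_iso[OF homeo, of "C - {0}" "f ` C - {f 0}" p] inj_on_image_set_diff[OF inj, of C "{0}"] 0
    by auto
  have open_nb: "openin ?X (orb ` nbhd v (eta/2))" by (rule open_orb) (simp add: open_nbhd)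
  \<comment> \<open>Every orbit near that of \<open>v\<close> meets the slice: the normal through
    the foot on the orbit is carried back to \<open>v\<close> by a group element.\<close>
  have nb: "orb ` nbhd v (eta/2) \<subseteq> f ` C"
  proof
    fix s assume "s \<in> orb ` nbhd v (eta/2)"
    then obtain w where w: "w \<in> nbhd v (eta/2)" "s = orb w" by blast
    obtain a where a: "a \<in> orb v" "dist w a < eta/2" "w - a \<in> slice a" using nbhd_slice[OF w(1)] by blast
    obtain g where g: "g \<in> grp" "a = g v" using a(1) unfolding orb_grp by blast
    obtain h where h: "h \<in> grp" "\<And>x. h (g x) = x" "\<And>x. g (h x) = x" using grp_inverse[OF g(1)] by blast
    have "h (w - a) \<in> C"
      using slice_grp[OF h(1) a(3)] a(2) g(2) h(2) grp_norm[OF h(1)] by (simp add: C_def dist_norm)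
    moreover have "orb (v + h (w - a)) = s"
    proof -
      have "v + h (w - a) = h w" using h(2)[of v] g(2) by (simp add: linear_diff[OF grp_linear[OF h(1)]])
      then show ?thesis using orb_eq[OF grp_orb[OF h(1)]] w(2) by simp
    qed
    ultimately show "s \<in> f ` C" by (auto simp: f_def)
  qed
  have fv: "f 0 \<in> orb ` nbhd v (eta/2)" using eta(1) orb_subset_nbhd[of "eta/2" v] orb_self by (auto simp: f_def)
  let ?T = "topspace ?X - {f 0}" and ?U = "topspace ?X - f ` C"
  have "?X closure_of ?U \<subseteq> ?X interior_of ?T"
  proof -
    have "?X closure_of ?U \<subseteq> topspace ?X - orb ` nbhd v (eta/2)"
      by (intro closure_of_minimal closedin_diff open_nb) (use nb in auto)
    also have "\<dots> \<subseteq> ?T" using fv by blast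
    also have "?T = ?X interior_of ?T"
      using H x by (simp add: interior_of_openin openin_diff closedin_Hausdorff_singleton)
    finally show ?thesis .
  qed
  from homology_excision_axiom[OF this, of "topspace ?X"]
  have "relative_homology_group p (subtopology ?X (topspace ?X - ?U)) (?T - ?U) \<cong> relative_homology_group p ?X ?T" for p
    unfolding is_iso_def by auto
  moreover have "topspace ?X - ?U = f ` C" "?T - ?U = f ` C - {f 0}" by (auto simp: topspace_orbtop f_def)
  ultimately have iso2: "relative_homology_group p (subtopology ?X (f ` C)) (f ` C - {f 0}) \<cong> relative_homology_group p ?X ?T" for p
    by simp
  define j where "j = DIM('v) - 4"
  have j: "dim (slice v) = Suc j" "j > 0" "DIM('v) - 3 = Suc j" using dim_slice[OF v] dim by (auto simp: j_def)
  have "\<not> rel_acyclic (Suc j) (top_of_set C) (C - {0})"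
    unfolding C_def using disc_section_not_acyclic[OF subspace_slice j(1,2), of "eta/2"] eta(1) by simp
  then have "\<not> trivial_group (relative_homology_group (int (Suc j)) (top_of_set C) (C - {0}))"
    using rel_acyclicI by blast
  then have "\<not> trivial_group (relative_homology_group (int (Suc j)) ?X ?T)"
    using isomorphic_group_triviality[OF iso_trans[OF iso1 iso2]] by (metis group_relative_homology_group)
  then show thesis using that[OF x] j(3) by simp
qed

end

unbundle no cross3_syntax

section \<open>The orbit space is not a homological manifold\<close>

unbundle cross3_syntax

lemma continuous_on_Max_image:
  fixes f :: "'i => 'a::topological_space => real"
  assumes "finite I" "I \<noteq> {}" "\<And>i. i \<in> I ==> continuous_on S (f i)"
  shows "continuous_on S (\<lambda>x. Max ((\<lambda>i. f i x) ` I))"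
  using assms
proof (induction rule: finite_ne_induct)
  case (insert i I)
  then have "(\<lambda>x. Max ((\<lambda>i. f i x) ` insert i I)) = (\<lambda>x. max (f i x) (Max ((\<lambda>i. f i x) ` I)))"
    by (intro ext) (simp add: Max_insert)
  then show ?case using insert by (auto intro: continuous_on_max)
qed simp

lemma ex_generic_form:
  fixes F :: "'v::euclidean_space set"
  assumes "finite F" "0 \<notin> F"
  obtains l where "\<And>f. f \<in> F ==> l \<bullet> f \<noteq> 0"
proof -
  have "negligible (\<Union>f\<in>F. {l. f \<bullet> l = 0})"
  proof (rule negligible_Union)
    show "negligible S" if "S \<in> (\<lambda>f. {l. f \<bullet> l = 0}) ` F" for S
      using that assms(2) by (auto intro!: negligible_hyperplane)
  qed (use assms(1) in simp)
  then have "(\<Union>f\<in>F. {l. f \<bullet> l = 0}) \<noteq> UNIV" using non_negligible_UNIV by metis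
  then obtain l where "l \<notin> (\<Union>f\<in>F. {l. f \<bullet> l = 0})" by blast
  then show thesis using that[of l] by (auto simp: inner_commute)
qed

text \<open>A generic form, composed with any of the finitely many maps in \<open>W\<close>, cuts
  every nonzero subspace of the finite family properly, so one form lowers all dimensions at once.
  The maps may differ from form to form because the maxima in \<open>height\<close> can be attained
  at different elements.\<close>

lemma ex_separating_forms:
  fixes KK :: "'v::euclidean_space set set" and W :: "('v => 'v) set"
  assumes W: "finite W" "\<And>\<tau>. \<tau> \<in> W ==> linear \<tau>" "\<And>\<tau> x. \<tau> \<in> W ==> \<tau> x = 0 ==> x = 0"
    and "finite KK" "\<And>K. K \<in> KK ==> subspace K \<and> dim K \<le> m"
  shows "\<exists>ls. length ls = m \<and> (\<forall>K\<in>KK. \<forall>k\<in>K. \<forall>ts. (\<forall>i<m. ts i \<in> W) --> (\<forall>i<m. ls ! i \<bullet> ts i k = 0) --> k = 0)"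
  using assms(4-)
proof (induction m arbitrary: KK)
  case 0
  then show ?case by (auto simp: dim_eq_0)
next
  case (Suc m)
  define c where "c = (\<lambda>K. SOME k. k \<in> K \<and> k \<noteq> (0 :: 'v))"
  have c: "c K \<in> K \<and> c K \<noteq> 0" if "K \<in> KK" "K \<noteq> {0}" for K
  proof -
    have "\<exists>k. k \<in> K \<and> k \<noteq> 0" using that Suc.prems(2) subspace_0 by blast
    then show ?thesis unfolding c_def by (rule someI_ex)
  qed
  define F where "F = {\<tau> (c K) |\<tau> K. \<tau> \<in> W \<and> K \<in> KK \<and> K \<noteq> {0}}"
  have "F \<subseteq> (\<Union>\<tau>\<in>W. (\<lambda>K. \<tau> (c K)) ` KK)" unfolding F_def by blast
  then have "finite F" using W(1) Suc.prems(1) by (simp add: finite_subset)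
  moreover have "0 \<notin> F"
  proof
    assume "0 \<in> F"
    then obtain \<tau> K where "\<tau> \<in> W" "K \<in> KK" "K \<noteq> {0}" "\<tau> (c K) = 0" unfolding F_def by force
    then show False using W(3) c by blast
  qed
  ultimately obtain l where l: "\<And>f. f \<in> F ==> l \<bullet> f \<noteq> 0" using ex_generic_form by blast
  define cut where "cut = (\<lambda>(\<tau> :: 'v => 'v) K. {k \<in> K. l \<bullet> \<tau> k = 0})"
  define KK' where "KK' = (\<lambda>(\<tau>, K). cut \<tau> K) ` Sigma W (\<lambda>_. KK)"
  have "finite KK'" unfolding KK'_def using W(1) Suc.prems(1) by simp
  moreover have "subspace K' \<and> dim K' \<le> m" if K': "K' \<in> KK'" for K'
  proof -
    obtain \<tau> K where K: "\<tau> \<in> W" "K \<in> KK" "K' = cut \<tau> K" using K' unfolding KK'_def by auto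
    have sK: "subspace K" "dim K \<le> Suc m" using Suc.prems(2) K by auto
    have s: "subspace K'"
      using sK(1) unfolding K(3) cut_def subspace_def
      by (auto simp: linear_0[OF W(2)[OF K(1)]] linear_add[OF W(2)[OF K(1)]] linear_scale[OF W(2)[OF K(1)]] inner_add_right)
    show ?thesis
    proof (cases "K = {0}")
      case True
      then have "dim K' = 0" using K(3) by (auto simp: cut_def)
      then show ?thesis using s by linarith
    next
      case False
      have "l \<bullet> \<tau> (c K) \<noteq> 0" using False K by (intro l) (unfold F_def, blast)
      then have "K' \<subset> K" using c[OF K(2) False] K(3) by (auto simp: cut_def)
      then have "dim K' < dim K" using s sK(1) by (intro dim_psubset) (simp add: span_eq_iff[THEN iffD2])
      then show ?thesis using s sK(2) by simp
    qed
  qed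
  ultimately obtain ls where ls: "length ls = m" "\<forall>K\<in>KK'. \<forall>k\<in>K. \<forall>ts. (\<forall>i<m. ts i \<in> W) --> (\<forall>i<m. ls ! i \<bullet> ts i k = 0) --> k = 0"
    using Suc.IH[of KK'] by blast
  show ?case
  proof (intro exI[of _ "l # ls"] conjI ballI allI impI)
    show "length (l # ls) = Suc m" using ls(1) by simp
    fix K k ts assume K: "K \<in> KK" "k \<in> K" and ts: "\<forall>i<Suc m. ts i \<in> W" and eq: "\<forall>i<Suc m. (l # ls) ! i \<bullet> ts i k = 0"
    have "k \<in> cut (ts 0) K" using K(2) eq by (auto simp: cut_def)
    moreover have "cut (ts 0) K \<in> KK'" unfolding KK'_def using ts K(1) by (intro image_eqI[of _ _ "(ts 0, K)"]) auto
    moreover have "\<forall>i<m. ts (Suc i) \<in> W" using ts by simp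
    moreover have "\<forall>i<m. ls ! i \<bullet> ts (Suc i) k = 0"
    proof (intro allI impI)
      fix i assume "i < m"
      then show "ls ! i \<bullet> ts (Suc i) k = 0" using eq[rule_format, of "Suc i"] by simp
    qed
    ultimately show "k = 0" using ls(2)[rule_format, of "cut (ts 0) K" k "\<lambda>i. ts (Suc i)"] by blast
  qed
qed

lemma qrot_fixes_e3:
  assumes p: "norm p = 1" "qrot p e3 = e3"
  obtains t where "p = turn t e3"
proof -
  have n: "(fst p)^2 + (snd p $ 1)^2 + (snd p $ 2)^2 + (snd p $ 3)^2 = 1"
    using p(1) by (simp add: norm_quat inner_vec_def sum_3 power2_eq_square)
  have "qrot p e3 $ 3 = 1" using p(2) by simp
  then have "(fst p)^2 - (snd p $ 1)^2 - (snd p $ 2)^2 + (snd p $ 3)^2 = 1"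
    by (simp add: qrot_def inner_vec_def sum_3 axis_def cross3_simps power2_eq_square)
  then have "(snd p $ 1)^2 + (snd p $ 2)^2 = 0" using n by linarith
  then have z: "snd p $ 1 = 0" "snd p $ 2 = 0" by (simp_all add: sum_power2_eq_zero_iff)
  then have "(fst p)^2 + (snd p $ 3)^2 = 1" using n by simp
  then obtain t where "fst p = cos t" "snd p $ 3 = sin t" using sincos_total_2pi by metis
  then have "p = turn (2 * t) e3" using z by (simp add: turn_def prod_eq_iff vec_eq_iff forall_3 axis_def)
  then show thesis by (rule that)
qed

context su2_rep begin

text \<open>Represents the nontrivial element of the Weyl group: it reverses the axis of the
  torus.\<close>

definition flip :: quat where "flip = turn pi (axis 1 1)"

lemma norm_flip [simp]: "norm flip = 1" by (simp add: flip_def)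

lemma qrot_flip: "qrot flip e3 = - e3"
  unfolding flip_def turn_def by (subst qrot_half_angle) (simp_all add: rodrigues_def inner_axis_axis)

definition weyl where "weyl = Z \<union> (\<lambda>z. act flip \<circ> z) ` Z"

lemma finite_weyl: "finite weyl" and weyl_ne: "weyl \<noteq> {}"
  using finite_Z id_Z by (auto simp: weyl_def)

lemma Z_grp: "z \<in> Z ==> z \<in> grp"
  using grpI[of "(1, 0)" z] by (simp add: norm_Pair comp_def)

lemma weyl_grp: "\<tau> \<in> weyl ==> \<tau> \<in> grp"
  unfolding weyl_def using Z_grp grpI[OF norm_flip] by blast

lemma ker_weyl:
  assumes u: "u \<in> ker" and \<tau>: "\<tau> \<in> weyl"
  shows "\<tau> u \<in> ker"
proof -
  have z: "z u \<in> ker" if "z \<in> Z" for z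
    using u Z_D[OF that, of e3 u] linear_0[OF linear_Z[OF that]] by (simp add: ker_def)
  have "act flip y \<in> ker" if "y \<in> ker" for y
  proof -
    have "D e3 (act flip y) = - D (qrot flip e3) (act flip y)" by (simp add: qrot_flip D_left)
    also have "\<dots> = - act flip (D e3 y)" by (simp add: act_D)
    finally show ?thesis using that by (simp add: ker_def)
  qed
  then show ?thesis using \<tau> z unfolding weyl_def by auto
qed

lemma act_fixed_if_killed:
  assumes "\<And>c. D c x = 0" "norm p = 1"
  shows "act p x = x"
proof -
  obtain t u where "norm u = 1" "p = turn t u" using ex_turn[OF assms(2)] by metis
  then show ?thesis using act_turn_fixed assms(1) by metis
qed

text \<open>A point of the orbit lying in \<open>ker\<close> is killed by \<open>e3\<close> and by
  the rotated axis \<open>f\<close>. Either \<open>f\<close> is plus or minus \<open>e3\<close>, and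
  the quaternion lies in the torus or in \<open>flip\<close> times the torus, or the two axes
  generate the Lie algebra and every quaternion fixes the point.\<close>

lemma orb_ker:
  assumes u: "u \<in> ker"
  shows "orb u \<inter> ker = (\<lambda>\<tau>. \<tau> u) ` weyl"
proof
  show "(\<lambda>\<tau>. \<tau> u) ` weyl \<subseteq> orb u \<inter> ker" using ker_weyl[OF u] grp_orb[OF weyl_grp] by blast
  show "orb u \<inter> ker \<subseteq> (\<lambda>\<tau>. \<tau> u) ` weyl"
  proof
    fix x assume x: "x \<in> orb u \<inter> ker"
    then obtain p z where pz: "norm p = 1" "z \<in> Z" "x = act p (z u)" unfolding orb_def by blast
    define y where "y = z u"
    have y: "D e3 y = 0" using ker_weyl[OF u, of z] pz(2) by (simp add: weyl_def ker_def y_def)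
    have xe: "D e3 x = 0" using x by (simp add: ker_def)
    define f where "f = qrot p e3"
    have xf: "D f x = 0" using act_D[OF pz(1), of e3 y] y pz(1) by (simp add: f_def pz(3) y_def)
    have nf: "norm f = 1"
      unfolding f_def using cross_automorphism_inner[OF cross_automorphism_qrot[OF pz(1)], of e3 e3] by (simp add: norm_eq_1 inner_axis_axis)
    have zW: "z \<in> weyl" and fW: "act flip \<circ> z \<in> weyl" using pz(2) by (auto simp: weyl_def)
    show "x \<in> (\<lambda>\<tau>. \<tau> u) ` weyl"
    proof (cases "f $ 1 = 0 \<and> f $ 2 = 0")
      case False
      define n where "n = (f $ 1)^2 + (f $ 2)^2"
      have n: "n \<noteq> 0" using False by (simp add: n_def sum_power2_eq_zero_iff)
      have xg: "D (e3 \<times> f) x = 0" using D_bracket[of e3 f x] xe xf by (simp add: D_right)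
      then have xh: "D (e3 \<times> (e3 \<times> f)) x = 0" using D_bracket[of e3 "e3 \<times> f" x] xe by (simp add: D_right)
      \<comment> \<open>The vectors \<open>e3\<close>, e3 \<times> f and e3 \<times> (e3 \<times> f)
        form an orthogonal basis; the display expands \<open>c\<close> in it with the denominator
        \<open>n\<close> cleared.\<close>
      have "D c x = 0" for c
      proof -
        have "n *\<^sub>R c = (n * c $ 3) *\<^sub>R e3 - (c $ 1 * f $ 1 + c $ 2 * f $ 2) *\<^sub>R (e3 \<times> (e3 \<times> f)) + (c $ 2 * f $ 1 - c $ 1 * f $ 2) *\<^sub>R (e3 \<times> f)"
          by (simp add: vec3_simps axis_def n_def power2_eq_square algebra_simps)
        then have "n *\<^sub>R D c x = 0" using xe xg xh by (metis (no_types, lifting) D_left(1-3) add.right_neutral diff_zero scaleR_zero_right)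
        then show ?thesis using n by simp
      qed
      from act_fixed_if_killed[OF this, of "qconj p"] have "y = x"
        using act_qconj(2)[OF pz(1), of y] pz by (simp add: y_def)
      then show ?thesis using zW by (auto simp: y_def)
    next
      case True
      then have "(f $ 3)^2 = 1" using nf by (simp add: norm_eq_1 inner_vec_def sum_3 power2_eq_square)
      then consider "f $ 3 = 1" | "f $ 3 = - 1" by (auto simp: power2_eq_1_iff)
      then show ?thesis
      proof cases
        case 1
        then have "f = e3" using True by (simp add: vec_eq_iff forall_3 axis_def)
        then obtain t where "p = turn t e3" using qrot_fixes_e3[OF pz(1)] by (auto simp: f_def)
        then have "x = y" using act_turn_fixed[of e3 y t] y pz(3) by (simp add: y_def)
        then show ?thesis using zW by (auto simp: y_def)
      next
        case 2
        then have f: "f = - e3" using True by (simp add: vec_eq_iff forall_3 axis_def)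
        let ?r = "qmul (qconj flip) p"
        have nr: "norm ?r = 1" using pz(1) by (simp add: norm_qmul)
        have "qrot ?r e3 = qrot (qconj flip) (qrot flip e3)" using f by (simp add: qrot_qmul qrot_flip f_def)
        then have "qrot ?r e3 = e3" by (simp add: qrot_qconj)
        then obtain t where "?r = turn t e3" using qrot_fixes_e3[OF nr] by auto
        then have "act ?r y = y" using act_turn_fixed[of e3 y t] y by simp
        then have "act flip (act (qconj flip) x) = act flip y" using pz by (simp add: act_qmul y_def)
        then have "x = act flip y" by (simp add: act_qconj)
        then show ?thesis by (intro image_eqI[OF _ fW]) (simp add: y_def)
      qed
    qed
  qed
qed

text \<open>A compact orbit disjoint from a closed set has positive distance from it, and the group
  acts by isometries, so neighbouring orbits are disjoint from it as well.\<close>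

lemma closed_orb_image:
  assumes F: "closed F"
  shows "closedin orbtop (orb ` F)"
  unfolding closedin_def
proof
  show "orb ` F \<subseteq> topspace orbtop" by (auto simp: topspace_orbtop)
  have "orb -` (topspace orbtop - orb ` F) = {x. orb x \<inter> F = {}}"
    using orb_eq_iff by (fastforce simp: topspace_orbtop)
  moreover have "open {x. orb x \<inter> F = {}}"
    unfolding open_contains_ball
  proof safe
    fix x assume x: "orb x \<inter> F = {}"
    obtain d where d: "d > 0" "\<And>a b. a \<in> orb x ==> b \<in> F ==> d \<le> dist a b"
      using separate_compact_closed[OF compact_orb F x] by blast
    have "orb y \<inter> F = {}" if y: "dist x y < d" for y
    proof (rule ccontr)
      assume "orb y \<inter> F \<noteq> {}"
      then obtain g where g: "g \<in> grp" "g y \<in> F" unfolding orb_grp by blast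
      have "d \<le> dist (g x) (g y)" by (rule d(2)[OF grp_orb[OF g(1)] g(2)])
      also have "\<dots> = dist x y" using grp_norm[OF g(1), of "x - y"] by (simp add: dist_norm linear_diff[OF grp_linear[OF g(1)]])
      finally show False using y by simp
    qed
    then have "ball x d \<subseteq> {x. orb x \<inter> F = {}}" by (simp add: subset_iff)
    then show "\<exists>e>0. ball x e \<subseteq> {x. orb x \<inter> F = {}}" using d(1) by blast
  qed
  ultimately show "openin orbtop (topspace orbtop - orb ` F)"
    by (simp add: openin_orbtop topspace_orbtop)
qed

lemma closed_ker: "closed ker" by (rule closed_subspace[OF subspace_ker])

text \<open>A linear form made into a function on orbits: \<open>orb_ker\<close> shows that an orbit
  through \<open>ker\<close> meets it in a finite set, over which the maximum is taken.\<close>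

definition height where "height l s = Max ((\<bullet>) l ` (s \<inter> ker))"

lemma height_orb: "u \<in> ker ==> height l (orb u) = Max ((\<lambda>\<tau>. l \<bullet> \<tau> u) ` weyl)"
  by (simp add: height_def orb_ker image_image)

lemma continuous_height: "continuous_map (subtopology orbtop (orb ` ker)) euclideanreal (height l)"
  unfolding continuous_map_closedin
proof (intro conjI allI impI)
  fix C :: "real set" assume "closedin euclideanreal C"
  then have C: "closed C" by simp
  let ?g = "\<lambda>u. Max ((\<lambda>\<tau>. l \<bullet> \<tau> u) ` weyl)"
  have "continuous_on ker ?g"
    by (intro continuous_on_Max_image finite_weyl weyl_ne continuous_on_inner continuous_on_const
        linear_continuous_on linear_conv_bounded_linear[THEN iffD1] grp_linear weyl_grp)
  then have "closed (ker \<inter> ?g -` C)" using closed_ker C by (simp add: continuous_on_closed_vimage Int_commute)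
  then have "closedin orbtop (orb ` (ker \<inter> ?g -` C))" by (rule closed_orb_image)
  moreover have "{x \<in> topspace (subtopology orbtop (orb ` ker)). height l x \<in> C} = orb ` (ker \<inter> ?g -` C)"
    by (auto simp: topspace_orbtop height_orb)
  ultimately show "closedin (subtopology orbtop (orb ` ker)) {x \<in> topspace (subtopology orbtop (orb ` ker)). height l x \<in> C}"
    using closed_orb_image[OF closed_ker] by (auto simp: closedin_closed_subtopology)
qed simp

text \<open>Given all heights, each form attains its maximum at some element of \<open>weyl\<close>.
  There are finitely many ways to assign elements to forms, and each assignment leaves at most one
  vector of \<open>ker\<close>.\<close>

lemma ex_separating_heights:
  obtains ls where "length ls = dim ker" "\<And>s. s \<in> orb ` ker ==> finite {t \<in> orb ` ker. \<forall>l\<in>set ls. height l t = height l s}"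
proof -
  have "\<exists>ls. length ls = dim ker \<and> (\<forall>K\<in>{ker}. \<forall>k\<in>K. \<forall>ts. (\<forall>i<dim ker. ts i \<in> weyl) --> (\<forall>i<dim ker. ls ! i \<bullet> ts i k = 0) --> k = 0)"
  proof (rule ex_separating_forms[OF finite_weyl])
    show "x = 0" if "\<tau> \<in> weyl" "\<tau> x = 0" for \<tau> x
      using grp_norm[OF weyl_grp[OF that(1)], of x] that(2) by simp
  qed (use subspace_ker grp_linear weyl_grp in auto)
  then obtain ls where ls: "length ls = dim ker" "\<And>k ts. k \<in> ker ==> (\<forall>i<dim ker. ts i \<in> weyl) ==> (\<forall>i<dim ker. ls ! i \<bullet> ts i k = 0) ==> k = 0"
    by blast
  show thesis
  proof (rule that[OF ls(1)])
    fix s assume "s \<in> orb ` ker"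
    let ?m = "dim ker"
    define fib where "fib = (\<lambda>ts. {u \<in> ker. \<forall>i<?m. ls ! i \<bullet> ts i u = height (ls ! i) s})"
    have sub: "{t \<in> orb ` ker. \<forall>l\<in>set ls. height l t = height l s} \<subseteq> (\<Union>ts\<in>{..<?m} \<rightarrow>\<^sub>E weyl. orb ` fib ts)"
    proof
      fix t assume t: "t \<in> {t \<in> orb ` ker. \<forall>l\<in>set ls. height l t = height l s}"
      then obtain u where u: "u \<in> ker" "t = orb u" by blast
      have "\<exists>\<tau>\<in>weyl. ls ! i \<bullet> \<tau> u = height (ls ! i) s" if "i < ?m" for i
      proof -
        have "ls ! i \<in> set ls" using that ls(1) by simp
        then have "height (ls ! i) t = height (ls ! i) s" using t by blast
        then have "height (ls ! i) s = Max ((\<lambda>\<tau>. ls ! i \<bullet> \<tau> u) ` weyl)"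
          using u(2) height_orb[OF u(1), of "ls ! i"] by simp
        also have "\<dots> \<in> (\<lambda>\<tau>. ls ! i \<bullet> \<tau> u) ` weyl" using finite_weyl weyl_ne by (intro Max_in) auto
        finally show ?thesis by auto
      qed
      then obtain ts where ts: "\<And>i. i < ?m ==> ts i \<in> weyl \<and> ls ! i \<bullet> ts i u = height (ls ! i) s" by metis
      have "restrict ts {..<?m} \<in> {..<?m} \<rightarrow>\<^sub>E weyl" using ts by auto
      moreover have "u \<in> fib (restrict ts {..<?m})" using ts u(1) by (auto simp: fib_def)
      ultimately show "t \<in> (\<Union>ts\<in>{..<?m} \<rightarrow>\<^sub>E weyl. orb ` fib ts)" using u(2) by blast
    qed
    have one: "u = u'" if "u \<in> fib ts" "u' \<in> fib ts" "ts \<in> {..<?m} \<rightarrow>\<^sub>E weyl" for u u' ts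
    proof -
      have "u - u' = 0"
      proof (rule ls(2))
        show "u - u' \<in> ker" using that by (auto simp: fib_def intro: subspace_diff[OF subspace_ker])
        show "\<forall>i<?m. ts i \<in> weyl" using that(3) by auto
        then show "\<forall>i<?m. ls ! i \<bullet> ts i (u - u') = 0"
          using that(1,2) by (auto simp: fib_def linear_diff[OF grp_linear[OF weyl_grp]] inner_diff_right)
      qed
      then show ?thesis by simp
    qed
    have "finite (fib ts)" if "ts \<in> {..<?m} \<rightarrow>\<^sub>E weyl" for ts
    proof (cases "fib ts = {}")
      case False
      then obtain u where "u \<in> fib ts" by blast
      then have "fib ts \<subseteq> {u}" using one[OF _ _ that] by blast
      then show ?thesis using finite_subset by blast
    qed simp
    then have "finite (\<Union>ts\<in>{..<?m} \<rightarrow>\<^sub>E weyl. orb ` fib ts)"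
      using finite_weyl by (intro finite_UN_I finite_PiE) auto
    then show "finite {t \<in> orb ` ker. \<forall>l\<in>set ls. height l t = height l s}"
      using sub by (rule finite_subset[rotated])
  qed
qed

lemma orb_scaleR: "scaleR c ` orb v = orb (c *\<^sub>R v)"
  unfolding orb_grp by (auto simp: image_image linear_scale[OF grp_linear])

text \<open>Scaling to 0 commutes with the group and descends to a contraction of the orbit space;
  it is continuous there because the product of a quotient map with a compact interval is again a
  quotient map.\<close>

lemma orbtop_cycle_bounds:
  assumes c: "singular_relcycle p orbtop {} c" and "p > 0"
  shows "singular_relboundary p orbtop {} c"
proof -
  let ?I = "top_of_set {0..1::real}"
  define h where "h = (\<lambda>(t::real, s). scaleR (1 - t) ` (s :: 'v set))"
  have q: "quotient_map (prod_topology ?I euclidean) (prod_topology ?I orbtop) (\<lambda>(t, v). (t, orb v))"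
    by (rule quotient_map_prod_right[OF _ _ quotient_map_orb])
      (auto simp: locally_compact_space_euclidean Hausdorff_space_subtopology compact_imp_locally_compact_space compact_space_subtopology compactin_euclidean_iff)
  have "continuous_map (prod_topology ?I (top_of_set UNIV)) euclidean (\<lambda>(t, v). (1 - t) *\<^sub>R (v :: 'v))"
    unfolding prod_topology_subtopology_eu continuous_map_iff_continuous
    by (auto simp: case_prod_unfold intro!: continuous_intros)
  then have "continuous_map (prod_topology ?I euclidean) orbtop (orb \<circ> (\<lambda>(t, v). (1 - t) *\<^sub>R (v :: 'v)))"
    using continuous_map_compose[OF _ continuous_map_orb] by simp
  moreover have "orb \<circ> (\<lambda>(t, v). (1 - t) *\<^sub>R v) = h \<circ> (\<lambda>(t, v). (t, orb v))"
    by (auto simp: h_def orb_scaleR fun_eq_iff)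
  ultimately have ch: "continuous_map (prod_topology ?I orbtop) orbtop h"
    using continuous_compose_quotient_map[OF q] by metis
  have orb0: "orb 0 = {0}" using orb_self[of 0] by (auto simp: orb_grp linear_0[OF grp_linear])
  have "homotopic_with (\<lambda>h. h \<in> {} \<rightarrow> {}) orbtop orbtop id (\<lambda>_. orb 0)"
  proof (subst homotopic_with)
    show "\<exists>h. continuous_map (prod_topology ?I orbtop) orbtop h \<and> (\<forall>x\<in>topspace orbtop. h (0, x) = id x) \<and>
      (\<forall>x\<in>topspace orbtop. h (1, x) = orb 0) \<and> (\<forall>t\<in>{0..1}. (\<lambda>x. h (t, x)) \<in> {} \<rightarrow> {})"
    proof (intro exI[of _ h] conjI ch)
      show "\<forall>x\<in>topspace orbtop. h (1, x) = orb 0" using orb_self by (auto simp: h_def topspace_orbtop orb0)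
    qed (auto simp: h_def)
  qed auto
  then have "homologous_rel p orbtop {} (chain_map p id c) (chain_map p (\<lambda>_. orb 0) c)"
    by (rule homotopic_imp_homologous_rel_chain_maps[OF _ c])
  moreover have "chain_map p id c = c"
    by (rule chain_map_id_gen[of p orbtop]) (use c in \<open>auto simp: singular_cycle\<close>)
  moreover have "singular_relboundary p orbtop {} (chain_map p (\<lambda>_. orb 0) c)"
    by (rule const_cycle_bounds[OF c \<open>p > 0\<close>]) (simp add: topspace_orbtop)
  ultimately show ?thesis
    using singular_relboundary_add unfolding homologous_rel_def by fastforce
qed

theorem orbit_space_not_manifold:
  assumes H: "Hausdorff_space orbtop"
    and loc: "\<And>x i. x \<in> topspace orbtop ==> i \<noteq> n ==> trivial_group (relative_homology_group (int i) orbtop (topspace orbtop - {x}))"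
    and dim: "dim ker + 10 \<le> DIM('v)"
  shows False
proof -
  have ne: "reg \<noteq> {}" using dim by (intro reg_nonempty) simp
  obtain x where "x \<in> topspace orbtop" "\<not> trivial_group (relative_homology_group (int (DIM('v) - 3)) orbtop (topspace orbtop - {x}))"
    using local_homology_nontrivial[OF H ne] dim by auto
  then have n: "n = DIM('v) - 3" using loc by metis
  let ?A = "orb ` ker"
  obtain ls where ls: "length ls = dim ker" "\<And>s. s \<in> ?A ==> finite {t \<in> ?A. \<forall>l\<in>set ls. height l t = height l s}"
    using ex_separating_heights by blast
  \<comment> \<open>Degree 5 of the pair gives degree 4 of the complement. With n = DIM - 3 the
    dimension hypothesis yields 5 + dim ker < n, as the bisection needs with dim ker many
    heights.\<close>
  have ac5: "rel_acyclic 5 orbtop (topspace orbtop - ?A)"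
  proof (rule rel_acyclic_complement[OF H, of n _ "map height ls"])
    show "rel_acyclic i orbtop (topspace orbtop - {x})" if "x \<in> topspace orbtop" "i < n" for x i
      using loc[OF that(1)] that(2) by (intro rel_acyclicI) auto
    show "closedin orbtop ?A" by (rule closed_orb_image[OF closed_ker])
    show "continuous_map (subtopology orbtop ?A) euclideanreal h" if "h \<in> set (map height ls)" for h
      using that continuous_height by auto
    show "finite {y \<in> ?A. \<forall>h\<in>set (map height ls). h y = h x}" if "x \<in> ?A" for x
      using ls(2)[OF that] by simp
    show "5 + length (map height ls) < n" using ls(1) n dim by simp
  qed
  let ?X = "subtopology orbtop (topspace orbtop - ?A)"
  have ac4: "rel_acyclic 4 ?X {}"
    unfolding rel_acyclic_def
  proof (intro allI impI)
    fix c assume c: "singular_relcycle 4 ?X {} c"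
    then have "singular_relcycle 4 orbtop {} c" by (simp add: singular_cycle singular_chain_subtopology)
    then have "singular_relboundary 4 orbtop {} c" by (rule orbtop_cycle_bounds) simp
    then obtain e where e: "singular_chain (Suc 4) orbtop e" "chain_boundary (Suc 4) e = c"
      unfolding singular_boundary by blast
    have "rel_acyclic (Suc 4) orbtop (topspace orbtop - ?A)" using ac5 by simp
    from rel_acyclic_boundary[OF this e(1)] show "singular_relboundary 4 ?X {} c"
      using c e(2) by (simp add: singular_cycle)
  qed
  have regA: "orb v \<in> ?A \<longleftrightarrow> v \<notin> reg" for v
  proof
    assume "orb v \<in> ?A"
    then obtain u where u: "u \<in> ker" "orb v = orb u" by blast
    show "v \<notin> reg"
    proof
      assume "v \<in> reg"
      then have "u \<in> reg" using reg_orb u(2) orb_self by blast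
      then show False using u(1) by (auto simp: reg_def ker_def)
    qed
  next
    assume "v \<notin> reg"
    then obtain x where "x \<noteq> 0" "D x v = 0" by (auto simp: reg_def)
    then obtain q where "norm q = 1" "act q v \<in> ker" using singular_imp_ker by blast
    then show "orb v \<in> ?A" using orb_eq[OF orb_act] by (metis imageI)
  qed
  interpret Q: quat_quotient act Z reg orb ?X
  proof
    show "open reg" by (rule open_reg)
    show "x \<in> reg" if "v \<in> reg" "x \<in> orb v" for v x by (rule reg_orb[OF that])
    show "finite (stab v) \<and> (\<exists>eta>0. \<exists>r. equivariant_retraction v eta r)" if "v \<in> reg" for v
    proof -
      obtain eta r where "eta > 0" "equivariant_retraction v eta r" using equivariant_retraction_exists[OF \<open>v \<in> reg\<close>] .
      then show ?thesis using finite_transporter[OF \<open>v \<in> reg\<close>, of v] by (auto simp: stab_def)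
    qed
    show "continuous_map (top_of_set reg) ?X orb"
      using regA by (auto simp: continuous_map_in_subtopology topspace_orbtop intro: continuous_map_from_subtopology[OF continuous_map_orb])
    show "openin ?X (orb ` U)" if "open U" "U \<subseteq> reg" for U
      using open_orb[OF that(1)] that(2) regA unfolding openin_subtopology
      by (intro exI[of _ "orb ` U"]) (auto simp: topspace_orbtop)
    show "topspace ?X = orb ` reg" using regA by (auto simp: topspace_orbtop)
    show "orb v = orb w \<longleftrightarrow> w \<in> orb v" for v w by (rule orb_eq_iff)
  qed
  obtain v where v: "v \<in> reg" using ne by blast
  have "singular_relboundary 3 (top_of_set reg) {} (chain_map 3 (orbit_map v) S3_class)"
    using dim by (intro orbit_class_null[OF v]) simp
  then show False using Q.quotient_not_acyclic[OF v] ac4 by blast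
qed

end

unbundle no cross3_syntax

section \<open>Subgroups of the orthogonal group\<close>

unbundle cross3_syntax

text \<open>A copy of the operator space whose multiplication is composition, which makes it a
  Banach algebra, so that the results on exponentials and compact subgroups apply.\<close>

typedef (overloaded) 'v endo = "UNIV :: ('v::euclidean_space \<Rightarrow>\<^sub>L 'v) set" morphisms op_of Endo ..

lemma op_of_Endo [simp]: "op_of (Endo X) = X" by (rule Endo_inverse) simp

lemma Endo_op_of [simp]: "Endo (op_of a) = a" by (rule op_of_inverse)

lemma endo_eqI: "op_of a = op_of b ==> a = b" by (simp add: op_of_inject)

instantiation endo :: (euclidean_space) real_normed_algebra_1
begin

definition zero_endo :: "'a endo" where "zero_endo = Endo 0"
definition plus_endo :: "'a endo => 'a endo => 'a endo" where "plus_endo a b = Endo (op_of a + op_of b)"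
definition minus_endo :: "'a endo => 'a endo => 'a endo" where "minus_endo a b = Endo (op_of a - op_of b)"
definition uminus_endo :: "'a endo => 'a endo" where "uminus_endo a = Endo (- op_of a)"
definition scaleR_endo :: "real => 'a endo => 'a endo" where "scaleR_endo c a = Endo (c *\<^sub>R op_of a)"
definition times_endo :: "'a endo => 'a endo => 'a endo" where "times_endo a b = Endo (op_of a o\<^sub>L op_of b)"
definition one_endo :: "'a endo" where "one_endo = Endo id_blinfun"
definition norm_endo :: "'a endo => real" where "norm_endo a = norm (op_of a)"
definition sgn_endo :: "'a endo => 'a endo" where "sgn_endo a = inverse (norm a) *\<^sub>R a"
definition dist_endo :: "'a endo => 'a endo => real" where "dist_endo a b = norm (a - b)"
definition uniformity_endo :: "('a endo \<times> 'a endo) filter" where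
  "uniformity_endo = (INF e\<in>{0<..}. principal {(x, y). dist x y < e})"
definition open_endo :: "'a endo set => bool" where
  "open_endo U = (\<forall>x\<in>U. eventually (\<lambda>(x', y). x' = x --> y \<in> U) uniformity)"

lemmas endo_defs = zero_endo_def plus_endo_def minus_endo_def uminus_endo_def scaleR_endo_def times_endo_def one_endo_def

instance
proof
  fix a b c :: "'a endo" and r s :: real
  show "dist a b = norm (a - b)" by (rule dist_endo_def)
  show "a + b + c = a + (b + c)" "a + b = b + a" "0 + a = a" "- a + a = 0" "a - b = a + - b"
    "r *\<^sub>R (a + b) = r *\<^sub>R a + r *\<^sub>R b" "(r + s) *\<^sub>R a = r *\<^sub>R a + s *\<^sub>R a" "r *\<^sub>R s *\<^sub>R a = (r * s) *\<^sub>R a" "1 *\<^sub>R a = a"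
    by (simp_all add: endo_defs algebra_simps)
  show "a * b * c = a * (b * c)" "1 * a = a" "a * 1 = a"
    by (simp_all only: endo_defs op_of_Endo) (auto intro!: endo_eqI blinfun_eqI)
  show "(a + b) * c = a * c + b * c" "a * (b + c) = a * b + a * c" "r *\<^sub>R a * b = r *\<^sub>R (a * b)" "a * r *\<^sub>R b = r *\<^sub>R (a * b)"
    by (simp_all add: endo_defs bounded_bilinear.add_left[OF bounded_bilinear_blinfun_compose] bounded_bilinear.add_right[OF bounded_bilinear_blinfun_compose]
        bounded_bilinear.scaleR_left[OF bounded_bilinear_blinfun_compose] bounded_bilinear.scaleR_right[OF bounded_bilinear_blinfun_compose])
  show "(0 :: 'a endo) \<noteq> 1"
  proof
    assume "(0 :: 'a endo) = 1"
    then have "(0 :: 'a \<Rightarrow>\<^sub>L 'a) = id_blinfun" by (metis one_endo_def op_of_Endo zero_endo_def)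
    then have "norm (id_blinfun :: 'a \<Rightarrow>\<^sub>L 'a) = 0" by simp
    then show False by simp
  qed
  show "sgn a = inverse (norm a) *\<^sub>R a" by (rule sgn_endo_def)
  show "uniformity = (INF e\<in>{0<..}. principal {(x :: 'a endo, y). dist x y < e})" by (rule uniformity_endo_def)
  show "open U = (\<forall>x\<in>U. \<forall>\<^sub>F (x', y) in uniformity. x' = x --> y \<in> U)" for U :: "'a endo set" by (rule open_endo_def)
  show "norm a = 0 \<longleftrightarrow> a = 0" by (auto simp: norm_endo_def zero_endo_def intro: endo_eqI)
  show "norm (a + b) \<le> norm a + norm b" by (simp add: norm_endo_def plus_endo_def norm_triangle_ineq)
  show "norm (r *\<^sub>R a) = \<bar>r\<bar> * norm a" by (simp add: norm_endo_def scaleR_endo_def)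
  show "norm (a * b) \<le> norm a * norm b" by (simp add: norm_endo_def times_endo_def norm_blinfun_compose)
  show "norm (1 :: 'a endo) = 1" by (simp add: norm_endo_def one_endo_def)
qed

end

lemma op_of_simps [simp]: "op_of 0 = 0" "op_of (a + b) = op_of a + op_of b" "op_of (a - b) = op_of a - op_of b" "op_of (- a) = - op_of a"
  "op_of (c *\<^sub>R a) = c *\<^sub>R op_of a" "op_of (a * b) = op_of a o\<^sub>L op_of b" "op_of 1 = id_blinfun"
  by (simp_all add: endo_defs)

lemma dist_op_of [simp]: "dist (op_of a) (op_of b) = dist a b"
  by (simp add: dist_norm norm_endo_def)

lemma bounded_linear_op_of: "bounded_linear op_of"
  by (rule bounded_linear_intro[of _ 1]) (simp_all add: norm_endo_def)

lemma dist_Endo [simp]: "dist (Endo a) (Endo b) = dist a b"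
  using dist_op_of[of "Endo a" "Endo b"] by simp

lemma continuous_on_Endo: "continuous_on S Endo"
  unfolding continuous_on_iff by auto

lemma tendsto_op_of_iff: "((\<lambda>x. op_of (f x)) \<longlongrightarrow> op_of l) F \<longleftrightarrow> (f \<longlongrightarrow> l) F"
  by (simp add: tendsto_iff)

instance endo :: (euclidean_space) "{banach, heine_borel}"
proof
  fix X :: "nat => 'a endo"
  assume "Cauchy X"
  then have "Cauchy (\<lambda>n. op_of (X n))" by (simp add: Cauchy_def)
  then obtain l where "(\<lambda>n. op_of (X n)) \<longlonglongrightarrow> l" using Cauchy_convergent convergent_def by blast
  then have "X \<longlonglongrightarrow> Endo l" using tendsto_op_of_iff[of X "Endo l"] by simp
  then show "convergent X" by (auto simp: convergent_def)
next
  fix f :: "nat => 'a endo"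
  assume "bounded (range f)"
  then have "bounded (range (\<lambda>n. op_of (f n)))" by (simp add: bounded_iff norm_endo_def)
  then obtain l r where r: "strict_mono r" "((\<lambda>n. op_of (f n)) \<circ> r) \<longlonglongrightarrow> l"
    using bounded_imp_convergent_subsequence by blast
  then have "(f \<circ> r) \<longlonglongrightarrow> Endo l" using tendsto_op_of_iff[of "f \<circ> r" "Endo l"] by (simp add: comp_def)
  then show "\<exists>l r. strict_mono r \<and> (f \<circ> r) \<longlonglongrightarrow> l" using r(1) by blast
qed

lemma op_of_exp: "op_of (exp a) = op_exp (op_of a)"
proof -
  have "op_of (a ^ n /\<^sub>R fact n) = (((\<lambda>Y. op_of a o\<^sub>L Y) ^^ n) id_blinfun) /\<^sub>R fact n" for n
  proof -
    have "op_of (a ^ n) = ((\<lambda>Y. op_of a o\<^sub>L Y) ^^ n) id_blinfun" by (induction n) auto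
    then show ?thesis by simp
  qed
  then show ?thesis
    using bounded_linear.suminf[OF bounded_linear_op_of summable_exp_generic[of a]] by (simp add: exp_def op_exp_def)
qed

lemma lie_of_Endo: "lie_of (Endo ` G) = Endo ` lie_algebra G"
proof -
  have Gi: "b \<in> Endo ` G \<longleftrightarrow> op_of b \<in> G" for b by (metis Endo_op_of image_iff op_of_Endo)
  have "a \<in> lie_of (Endo ` G) \<longleftrightarrow> op_of a \<in> lie_algebra G" for a
    by (simp add: lie_of_def lie_algebra_def Gi op_of_exp)
  moreover have "a \<in> Endo ` lie_algebra G \<longleftrightarrow> op_of a \<in> lie_algebra G" for a by (metis Endo_op_of image_iff op_of_Endo)
  ultimately show ?thesis by blast
qed

text \<open>The Pauli matrices times -i/2 as basis of su(2); with this factor the bracket is exactly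
  the cross product.\<close>

definition su2_mat :: "real^3 => complex^2^2" where
  "su2_mat x = (\<chi> i j. if i = 1 then (if j = 1 then Complex 0 (- x$3 / 2) else Complex (- x$2 / 2) (- x$1 / 2))
     else (if j = 1 then Complex (x$2 / 2) (- x$1 / 2) else Complex 0 (x$3 / 2)))"

lemma su2_mat_entries: "su2_mat x $ 1 $ 1 = Complex 0 (- x$3 / 2)" "su2_mat x $ 1 $ 2 = Complex (- x$2 / 2) (- x$1 / 2)"
  "su2_mat x $ 2 $ 1 = Complex (x$2 / 2) (- x$1 / 2)" "su2_mat x $ 2 $ 2 = Complex 0 (x$3 / 2)"
  by (simp_all add: su2_mat_def)

lemmas mat2_simps = vec_eq_iff forall_2 su2_mat_entries

lemma su2_mat_linear: "su2_mat (x + y) = su2_mat x + su2_mat y" "su2_mat (c *\<^sub>R x) = c *\<^sub>R su2_mat x"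
  by (simp_all add: mat2_simps complex_eq_iff add_divide_distrib)

lemma su2_mat_inj: "su2_mat x = su2_mat y ==> x = y"
  by (simp add: mat2_simps forall_3 complex_eq_iff)

lemma su2_mat_bracket: "mat_bracket (su2_mat x) (su2_mat y) = su2_mat (x \<times> y)"
  by (simp add: mat_bracket_def mat2_simps matrix_matrix_mult_def sum_2 complex_eq_iff cross3_simps field_simps)

lemma range_su2_mat: "range su2_mat = su2"
proof
  show "range su2_mat \<subseteq> su2"
    by (auto simp: su2_def trace_def sum_2 forall_2 su2_mat_entries complex_eq_iff)
  show "su2 \<subseteq> range su2_mat"
  proof
    fix A assume "A \<in> su2"
    then have A: "\<And>i j. cnj (A $ j $ i) = - (A $ i $ j)" "A $ 1 $ 1 + A $ 2 $ 2 = 0" by (auto simp: su2_def trace_def sum_2)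
    have "A = su2_mat (vector [- 2 * Im (A $ 1 $ 2), - 2 * Re (A $ 1 $ 2), - 2 * Im (A $ 1 $ 1)])"
      using A(1)[of 1 1] A(1)[of 1 2] A(1)[of 2 2] A(2) by (simp add: mat2_simps complex_eq_iff)
    then show "A \<in> range su2_mat" by blast
  qed
qed

lemma su2_coordinates:
  fixes G :: "('v::euclidean_space \<Rightarrow>\<^sub>L 'v) set"
  assumes H: "compact (Endo ` G)" "1 \<in> Endo ` G" "\<And>a b. a \<in> Endo ` G ==> b \<in> Endo ` G ==> a * b \<in> Endo ` G"
    and iso: "lie_isomorphic (lie_algebra G) op_bracket su2 mat_bracket"
  obtains lin :: "real^3 => 'v endo" where "su2_triple lin" "lie_of (Endo ` G) = range lin"
proof -
  let ?L = "lie_algebra G"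
  obtain f where f: "bij_betw f ?L su2" "\<And>x y. x \<in> ?L ==> y \<in> ?L ==> f (x + y) = f x + f y"
    "\<And>c x. x \<in> ?L ==> f (c *\<^sub>R x) = c *\<^sub>R f x" "\<And>x y. x \<in> ?L ==> y \<in> ?L ==> f (op_bracket x y) = mat_bracket (f x) (f y)"
    using iso unfolding lie_isomorphic_def by blast
  have cl: "closed (Endo ` G)" using H(1) by (rule compact_imp_closed)
  have L: "x \<in> ?L \<longleftrightarrow> Endo x \<in> lie_of (Endo ` G)" for x
    unfolding lie_of_Endo by (metis image_iff op_of_Endo)
  have add: "x + y \<in> ?L" if "x \<in> ?L" "y \<in> ?L" for x y
    using lie_of_add[OF cl H(2,3), of "Endo x" "Endo y"] that unfolding L by (simp add: plus_endo_def)
  have scale: "c *\<^sub>R x \<in> ?L" if "x \<in> ?L" for x c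
    using lie_of_scaleR[of "Endo x" "Endo ` G" c] that unfolding L by (simp add: scaleR_endo_def)
  have br: "op_bracket x y \<in> ?L" if "x \<in> ?L" "y \<in> ?L" for x y
    using lie_of_bracket[OF cl H(2,3), of "Endo x" "Endo y"] that unfolding L
    by (simp add: op_bracket_def times_endo_def minus_endo_def)
  define g where "g = (\<lambda>x. inv_into ?L f (su2_mat x))"
  have M: "su2_mat x \<in> su2" for x using range_su2_mat by blast
  have im: "f ` ?L = su2" using f(1) by (simp add: bij_betw_def)
  have g: "g x \<in> ?L" "f (g x) = su2_mat x" for x
    unfolding g_def using M[of x] im by (auto intro: inv_into_into f_inv_into_f)
  have inj: "x = y" if "x \<in> ?L" "y \<in> ?L" "f x = f y" for x y
    using f(1) that by (auto simp: bij_betw_def inj_on_def)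
  have g1: "g (x + y) = g x + g y" for x y
    by (rule inj) (simp_all add: g add f su2_mat_linear)
  have g2: "g (c *\<^sub>R x) = c *\<^sub>R g x" for c x
    by (rule inj) (simp_all add: g scale f su2_mat_linear)
  have g3: "op_bracket (g x) (g y) = g (x \<times> y)" for x y
    by (rule inj) (simp_all add: g br f su2_mat_bracket)
  have "su2_triple (\<lambda>x. Endo (g x))"
  proof (rule su2_triple.intro)
    show "linear (\<lambda>x. Endo (g x))" by (rule linearI) (simp_all add: g1 g2 plus_endo_def scaleR_endo_def)
    show "inj (\<lambda>x. Endo (g x))" by (rule injI) (metis g(2) op_of_Endo su2_mat_inj)
    show "Endo (g x) * Endo (g y) - Endo (g y) * Endo (g x) = Endo (g (x \<times> y))" for x y
      by (simp add: g3[symmetric] op_bracket_def times_endo_def minus_endo_def)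
  qed
  moreover have "lie_of (Endo ` G) = range (\<lambda>x. Endo (g x))"
  proof -
    have "?L = range g"
    proof
      show "?L \<subseteq> range g"
      proof
        fix x assume x: "x \<in> ?L"
        then have "f x \<in> range su2_mat" using im range_su2_mat by blast
        then obtain y where "f x = su2_mat y" by blast
        then have "x = g y" using inj[OF x g(1)] g(2) by simp
        then show "x \<in> range g" by blast
      qed
    qed (use g in blast)
    then show ?thesis unfolding lie_of_Endo by auto
  qed
  ultimately show thesis by (rule that)
qed

lemma exp_flow:
  fixes a :: "'v::euclidean_space endo"
  shows "((\<lambda>t. blinfun_apply (op_of (exp (t *\<^sub>R a))) v) has_vector_derivative blinfun_apply (op_of a) v) (at 0)"
proof -
  have "bounded_linear (\<lambda>a. blinfun_apply (op_of a) v)"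
    by (rule bounded_linear_compose[OF blinfun.bounded_linear_left bounded_linear_op_of])
  from bounded_linear.has_vector_derivative[OF this exp_scaleR_has_vector_derivative_right[of a 0 UNIV]]
  show ?thesis by simp
qed

locale orthogonal_su2_group = compact_su2_group lin H for lin :: "real^3 => 'v::euclidean_space endo" and H +
  assumes orthogonal_H: "h \<in> H ==> orthogonal_transformation (blinfun_apply (op_of h))"
begin

definition act where "act p v = blinfun_apply (op_of (rho p)) v"
definition Z where "Z = (\<lambda>z. blinfun_apply (op_of z)) ` centralizer"
definition D where "D x v = blinfun_apply (op_of (lin x)) v"

lemma H_dist: "h \<in> H ==> dist (blinfun_apply (op_of h) x) (blinfun_apply (op_of h) y) = dist x y"
  using orthogonal_H[of h] by (simp add: orthogonal_transformation dist_norm flip: blinfun.diff_right)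

lemma op_mult: "a * b = c ==> blinfun_apply (op_of a) (blinfun_apply (op_of b) v) = blinfun_apply (op_of c) v"
  by auto

text \<open>\<open>rho\<close> is defined by cases through \<open>arccos\<close>. Here it is
  recognized as a one-parameter group on an interval around 0, which gives its derivative; negative
  angles are handled by reversing the axis.\<close>

lemma rho_turn:
  assumes u: "norm u = 1" and t: "\<bar>t\<bar> < 2 * pi"
  shows "rho (turn t u) = exp (t *\<^sub>R lin u)"
proof -
  have pos: "rho (turn t u) = exp (t *\<^sub>R lin u)" if "norm u = 1" "0 < t" "t < 2 * pi" for t u
  proof -
    have s: "sin (t/2) > 0" using that by (intro sin_gt_zero) auto
    then have "rho (turn t u) = exp ((2 * arccos (cos (t/2))) *\<^sub>R lin ((sin (t/2) *\<^sub>R u) /\<^sub>R norm (sin (t/2) *\<^sub>R u)))"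
      using that by (auto simp: rho_def turn_def)
    also have "arccos (cos (t/2)) = t/2" using that by (intro arccos_cos) auto
    finally show ?thesis using s that by simp
  qed
  consider "t = 0" | "t > 0" | "t < 0" by linarith
  then show ?thesis
  proof cases
    case 3
    have "turn t u = turn (- t) (- u)" by (simp add: turn_def)
    then show ?thesis using pos[of "- u" "- t"] u t 3 by (simp add: lin_simps)
  qed (use pos u t in auto)
qed

sublocale su2_rep act Z D
proof (intro su2_rep.intro su2_rep_axioms.intro quat_action.intro)
  have cr: "continuous_on S3 (\<lambda>p. op_of (rho p))"
    by (rule bounded_linear.continuous_on[OF bounded_linear_op_of continuous_on_rho])
  show "continuous_on (Sigma S3 (\<lambda>_. UNIV)) (\<lambda>x. act (fst x) (snd x))"
    unfolding act_def
    by (intro bounded_bilinear.continuous_on[OF bounded_bilinear_blinfun_apply] continuous_on_compose2[OF cr] continuous_intros) auto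
  show "act (qmul p q) x = act p (act q x)" if "norm p = 1" "norm q = 1" for p q x
    using that by (simp add: act_def rho_qmul)
  show "act (1, 0) x = x" for x by (simp add: act_def)
  show "dist (act p x) (act p y) = dist x y" for p x y unfolding act_def by (rule H_dist[OF rho_in_H])
  show "finite Z" unfolding Z_def using finite_centralizer by simp
  show "id \<in> Z" unfolding Z_def by (rule image_eqI[OF _ one_centralizer]) (simp add: fun_eq_iff)
  show "z \<circ> w \<in> Z" if "z \<in> Z" "w \<in> Z" for z w
  proof -
    obtain a b where "a \<in> centralizer" "b \<in> centralizer" "z = blinfun_apply (op_of a)" "w = blinfun_apply (op_of b)"
      using \<open>z \<in> Z\<close> \<open>w \<in> Z\<close> unfolding Z_def by blast
    then show ?thesis unfolding Z_def by (intro image_eqI[OF _ mult_centralizer[of a b]]) (auto simp: fun_eq_iff)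
  qed
  show "\<exists>w\<in>Z. z \<circ> w = id \<and> w \<circ> z = id" if "z \<in> Z" for z
  proof -
    obtain a where a: "a \<in> centralizer" "z = blinfun_apply (op_of a)" using \<open>z \<in> Z\<close> unfolding Z_def by blast
    obtain b where b: "b \<in> centralizer" "a * b = 1" "b * a = 1" using inv_centralizer[OF a(1)] by blast
    have "blinfun_apply (op_of b) \<in> Z" unfolding Z_def using b by blast
    moreover have "z \<circ> blinfun_apply (op_of b) = id" "blinfun_apply (op_of b) \<circ> z = id"
      using op_mult[OF b(2)] op_mult[OF b(3)] a(2) by (auto simp: fun_eq_iff)
    ultimately show ?thesis by blast
  qed
  show "dist (z x) (z y) = dist x y" if "z \<in> Z" for z x y
    using that centralizer_H H_dist unfolding Z_def by blast
  show "z (act p x) = act p (z x)" if "z \<in> Z" "norm p = 1" for z p x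
  proof -
    obtain a where a: "a \<in> centralizer" "z = blinfun_apply (op_of a)" using \<open>z \<in> Z\<close> unfolding Z_def by blast
    then show ?thesis using op_mult[OF centralizer_rho[OF a(1) that(2)], of x] by (simp add: act_def)
  qed
  show "bilinear D"
    unfolding bilinear_def D_def
    by (auto intro!: linearI simp: lin_simps blinfun.add_right blinfun.scaleR_right blinfun.add_left blinfun.scaleR_left)
  show "D x v \<bullet> w = - (v \<bullet> D x w)" for x v w
  proof -
    \<comment> \<open>The operators are orthogonal, so the inner product of two moving vectors is
      constant; its derivative at 0 is the skew symmetry.\<close>
    let ?f = "\<lambda>v t. blinfun_apply (op_of (exp (t *\<^sub>R lin x))) v"
    have H: "exp (t *\<^sub>R lin x) \<in> H" for t using lie_H by (auto simp: lie_of_def)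
    have "((\<lambda>t. ?f v t \<bullet> ?f w t) has_vector_derivative (?f v 0 \<bullet> D x w + D x v \<bullet> ?f w 0)) (at 0)"
      unfolding D_def by (rule bounded_bilinear.has_vector_derivative[OF bounded_bilinear_inner exp_flow exp_flow])
    moreover have "(\<lambda>t. ?f v t \<bullet> ?f w t) = (\<lambda>t. v \<bullet> w)"
      using orthogonal_H[OF H] by (simp add: orthogonal_transformation_def fun_eq_iff)
    ultimately have "((\<lambda>t. v \<bullet> w) has_vector_derivative (v \<bullet> D x w + D x v \<bullet> w)) (at (0::real))" by simp
    then have "v \<bullet> D x w + D x v \<bullet> w = 0"
      by (rule vector_derivative_unique_at[OF _ has_vector_derivative_const])
    then show ?thesis by simp
  qed
  show "D x (D y v) - D y (D x v) = D (x \<times> y) v" for x y v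
  proof -
    have "op_of (lin (x \<times> y)) = (op_of (lin x) o\<^sub>L op_of (lin y)) - (op_of (lin y) o\<^sub>L op_of (lin x))"
      using arg_cong[OF bracket[of x y], of op_of] by simp
    then show ?thesis by (simp add: D_def blinfun.diff_left)
  qed
  show "act p (D y v) = D (qrot p y) (act p v)" if "norm p = 1" for p y v
    using op_mult[OF rho_conjugate[OF that, of y], of v] by (simp add: D_def act_def)
  show "z (D y v) = D y (z v)" if "z \<in> Z" for z y v
  proof -
    obtain a where a: "a \<in> centralizer" "z = blinfun_apply (op_of a)" using \<open>z \<in> Z\<close> unfolding Z_def by blast
    then have "a * lin y = lin y * a" by (simp add: centralizer_def)
    from op_mult[OF this, of v] show ?thesis using a(2) by (simp add: D_def)
  qed
  show "linear (act p)" for p unfolding act_def by (intro bounded_linear.linear blinfun.bounded_linear_right)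
  show "linear z" if "z \<in> Z" for z
    using that unfolding Z_def by (auto intro: bounded_linear.linear blinfun.bounded_linear_right)
  show "((\<lambda>t. act (turn t u) v) has_vector_derivative D u v) (at 0)" if "norm u = 1" for u v
  proof (rule has_vector_derivative_transform_within_open[OF exp_flow[of "lin u" v, folded D_def]])
    show "open {- 2 * pi <..< 2 * pi}" by simp
    show "blinfun_apply (op_of (exp (t *\<^sub>R lin u))) v = act (turn t u) v" if "t \<in> {- 2 * pi <..< 2 * pi}" for t
      using that \<open>norm u = 1\<close> by (subst act_def) (simp add: rho_turn abs_less_iff)
  qed simp
qed

text \<open>By \<open>H_decomposition\<close> the pairs of a unit quaternion and a centralizing
  element exhaust the group, so both descriptions of an orbit agree.\<close>

lemma orb_H: "orb v = (\<lambda>h. blinfun_apply (op_of h) v) ` H"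
proof
  show "orb v \<subseteq> (\<lambda>h. blinfun_apply (op_of h) v) ` H"
  proof
    fix x assume "x \<in> orb v"
    then obtain p z' where p: "norm p = 1" "z' \<in> Z" "x = act p (z' v)"
      unfolding orb_def by (elim CollectE exE conjE)
    then obtain z where z: "z \<in> centralizer" "z' = blinfun_apply (op_of z)" unfolding Z_def by (elim imageE)
    have pz: "x = act p (blinfun_apply (op_of z) v)" "z \<in> centralizer" using p z by simp_all
    then show "x \<in> (\<lambda>h. blinfun_apply (op_of h) v) ` H"
      by (intro image_eqI[of _ _ "rho p * z"] mult_H rho_in_H centralizer_H) (auto simp: act_def)
  qed
  show "(\<lambda>h. blinfun_apply (op_of h) v) ` H \<subseteq> orb v"
  proof
    fix x assume "x \<in> (\<lambda>h. blinfun_apply (op_of h) v) ` H"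
    then obtain h where h: "h \<in> H" "x = blinfun_apply (op_of h) v" by blast
    obtain p z where pz: "norm p = 1" "z \<in> centralizer" "h = rho p * z" using H_decomposition[OF h(1)] by blast
    then have "x = act p (blinfun_apply (op_of z) v)" using h(2) by (simp add: act_def)
    moreover have "blinfun_apply (op_of z) \<in> Z" unfolding Z_def using pz(2) by (rule imageI)
    ultimately show "x \<in> orb v" unfolding orb_def using pz(1) by (intro CollectI exI[of _ p] exI[of _ "blinfun_apply (op_of z)"] conjI)
  qed
qed

end

lemma orthogonal_subgroup_su2:
  fixes G :: "('v::euclidean_space \<Rightarrow>\<^sub>L 'v) set"
  assumes G: "subgroup G orthogonal_group" and comp: "compact G"
    and iso: "lie_isomorphic (lie_algebra G) op_bracket su2 mat_bracket"
  obtains lin :: "real^3 => 'v endo" where "orthogonal_su2_group lin (Endo ` G)" "lie_of (Endo ` G) = range lin"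
proof -
  let ?H = "Endo ` G"
  have Gi: "b \<in> ?H \<longleftrightarrow> op_of b \<in> G" for b by (metis Endo_op_of image_iff op_of_Endo)
  have sub: "G \<subseteq> carrier orthogonal_group" using G by (rule subgroup.subset)
  have one: "1 \<in> ?H" unfolding Gi using subgroup.one_closed[OF G] by (simp add: orthogonal_group_def)
  have mult: "a * b \<in> ?H" if "a \<in> ?H" "b \<in> ?H" for a b
    using that subgroup.m_closed[OF G, of "op_of a" "op_of b"] unfolding Gi by (simp add: orthogonal_group_def)
  have inv: "\<exists>b\<in>?H. a * b = 1 \<and> b * a = 1" if "a \<in> ?H" for a
  proof -
    interpret O: group "orthogonal_group :: ('v \<Rightarrow>\<^sub>L 'v) monoid" by (rule group_orthogonal_group)
    let ?b = "inv\<^bsub>orthogonal_group\<^esub> op_of a"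
    have aG: "op_of a \<in> G" using that unfolding Gi .
    then have "?b \<in> G" by (rule subgroup.m_inv_closed[OF G])
    moreover have "op_of a \<in> carrier orthogonal_group" using aG sub by blast
    then have "op_of a o\<^sub>L ?b = id_blinfun" "?b o\<^sub>L op_of a = id_blinfun"
      using O.r_inv[of "op_of a"] O.l_inv[of "op_of a"] by (simp_all add: orthogonal_group_def)
    ultimately show ?thesis by (intro bexI[of _ "Endo ?b"]) (auto intro: endo_eqI)
  qed
  have cH: "compact ?H" by (rule compact_continuous_image[OF continuous_on_Endo comp])
  obtain lin :: "real^3 => 'v endo" where lin: "su2_triple lin" "lie_of ?H = range lin"
    using su2_coordinates[OF cH one mult iso] by blast
  interpret su2_triple lin by (rule lin(1))
  have "orthogonal_su2_group lin ?H"
  proof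
    show "orthogonal_transformation (blinfun_apply (op_of h))" if "h \<in> ?H" for h
      using that sub unfolding Gi by (auto simp: orthogonal_group_def)
  qed (use cH one mult inv lin(2) in auto)
  then show thesis using that lin(2) by blast
qed

unbundle no cross3_syntax

lemma direct_sum_decomposition:
  assumes "is_direct_sum L W"
  shows "(\<forall>i<L. u i \<in> W i) ==> (\<Sum>i<L. u i) = 0 ==> \<forall>i<L. u i = 0"
    and "\<exists>u. (\<forall>i<L. u i \<in> W i) \<and> w = (\<Sum>i<L. u i)"
proof -
  have sub: "\<And>i. i < L ==> subspace (W i)" and bij: "bij_betw (\<lambda>u. \<Sum>i<L. u i) (Pi\<^sub>E {..<L} W) UNIV"
    using assms by (auto simp: is_direct_sum_def)
  show "\<exists>u. (\<forall>i<L. u i \<in> W i) \<and> w = (\<Sum>i<L. u i)"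
  proof -
    have "w \<in> (\<lambda>u. \<Sum>i<L. u i) ` Pi\<^sub>E {..<L} W" using bij by (simp add: bij_betw_def)
    then obtain u where "u \<in> Pi\<^sub>E {..<L} W" "w = (\<Sum>i<L. u i)" by blast
    then show ?thesis by (intro exI[of _ u]) auto
  qed
  assume u: "\<forall>i<L. u i \<in> W i" "(\<Sum>i<L. u i) = 0"
  have "restrict u {..<L} = restrict (\<lambda>_. 0) {..<L}"
  proof (rule inj_onD[OF bij_betw_imp_inj_on[OF bij]])
    show "restrict u {..<L} \<in> Pi\<^sub>E {..<L} W" using u(1) by auto
    show "restrict (\<lambda>_. 0) {..<L} \<in> Pi\<^sub>E {..<L} W" using sub subspace_0 by auto
  qed (use u(2) in simp)
  then show "\<forall>i<L. u i = 0" by (metis lessThan_iff restrict_apply')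
qed

theorem theorem1:
  fixes G :: "('v::euclidean_space \<Rightarrow>\<^sub>L 'v) set" and ns :: "nat list"
  assumes "subgroup G orthogonal_group"
    and "compact G"
    and "irreducible_component_dims (lie_algebra G) ns"
    and "lie_isomorphic (lie_algebra G) op_bracket su2 mat_bracket"
    and "homological_manifold (orbit_space G)"
  shows "q_of_dims ns \<le> 4"
proof (rule ccontr)
  assume q: "\<not> q_of_dims ns \<le> 4"
  obtain lin :: "real^3 \<Rightarrow> 'v endo" where lin: "orthogonal_su2_group lin (Endo ` G)" "lie_of (Endo ` G) = range lin"
    using orthogonal_subgroup_su2[OF assms(1,2,4)] by metis
  interpret O: orthogonal_su2_group lin "Endo ` G" by (rule lin(1))
  have orb: "O.orb = orbit_of G"
    by (rule ext) (simp add: O.orb_H orbit_of_def image_image)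
  have X: "O.orbtop = orbit_space G"
    unfolding O.orbtop_def orbit_space_def orb ..
  have lie: "lie_algebra G = range (\<lambda>x. op_of (lin x))"
  proof -
    have "lie_algebra G = op_of ` Endo ` lie_algebra G" by (simp add: image_image)
    also have "Endo ` lie_algebra G = range lin" using lin(2) by (simp add: lie_of_Endo)
    finally show ?thesis by (simp add: image_image)
  qed
  have inv: "invariant_subspace (lie_algebra G) U \<longleftrightarrow> O.invariant U" for U
    by (auto simp: invariant_subspace_def O.invariant_def lie O.D_def)
  let ?L = "length ns"
  obtain W where W: "is_direct_sum ?L W" "\<And>i. i < ?L \<Longrightarrow> irreducible_subrep (lie_algebra G) (W i) \<and> dim (W i) = ns ! i"
    using assms(3) unfolding irreducible_component_dims_def by blast
  have "dim O.ker + 2 * (\<Sum>i<?L. dim (W i) div 2) = DIM('v)"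
  proof (rule O.dim_ker)
    show "O.invariant (W i)" "W i \<noteq> {0}" if "i < ?L" for i
      using W(2)[OF that] by (auto simp: irreducible_subrep_def inv)
    show "U = {0} \<or> U = W i" if "i < ?L" "O.invariant U" "U \<subseteq> W i" for i U
      using W(2)[OF that(1)] that(2,3) by (auto simp: irreducible_subrep_def inv)
  qed (use direct_sum_decomposition[OF W(1)] in blast)+
  moreover have "(\<Sum>i<?L. dim (W i) div 2) = q_of_dims ns"
    using W(2) by (simp add: q_of_dims_def sum_list_sum_nth atLeast0LessThan)
  \<comment> \<open>Here dim ker = DIM - 2 q, and failure of the bound means q is at least
    5.\<close>
  ultimately have dim: "dim O.ker + 10 \<le> DIM('v)" using q by linarith
  obtain n where n: "homological_n_manifold n (orbit_space G)"
    using assms(5) unfolding homological_manifold_def by blast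
  show False
  proof (rule O.orbit_space_not_manifold[OF _ _ dim, unfolded X])
    show "Hausdorff_space (orbit_space G)" using n by (simp add: homological_n_manifold_def)
    fix x and i :: nat assume "x \<in> topspace (orbit_space G)" "i \<noteq> n"
    then show "trivial_group (relative_homology_group (int i) (orbit_space G) (topspace (orbit_space G) - {x}))"
      using n[unfolded homological_n_manifold_def, THEN conjunct2, rule_format, of x "int i"] by simp
  qed
qed

end
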